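(* Let $q\in(0,1)$ and let $n\ge 1$, $m\ge 2$ be integers, $N=n+m$. Let $Q:\mathscr{H}\to\mathscr{H}$ be the linear operator $$Qe(i_1,\dots,i_{N-1})=\mathrm{const}\cdot q^{2\sum_{j=1}^{N-1}(N-j)i_j}\,e(i_1,\dots,i_{N-1}),\qquad \mathrm{const}>0.$$ Then the linear functional $$\nu_q:\mathscr{D}(\mathscr{H}_{n,m})_q\to\mathbb{C},\qquad \nu_q(f)=\operatorname{Tr}(T(f)\cdot Q)$$ is well defined, positive (i.e. $\nu_q(f^*f)>0$ for all $f\ne 0$), and $U_q\mathfrak{su}_{n,m}$-invariant (i.e. $\nu_q(af)=\varepsilon(a)\nu_q(f)$ for all $a\in U_q\mathfrak{su}_{n,m}$ and $f\in\mathscr{D}(\mathscr{H}_{n,m})_q$).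
   Context: Notation: $\mathbb{Z}_+=\{0,1,2,\dots\}$, $\mathbb{N}=\{1,2,\dots\}$; algebras are over $\mathbb{C}$. **Algebras.** $\mathrm{Pol}(\widehat{\mathscr{H}}_{n,m})_q$ is the unital $*$-algebra with generators $t_1,\dots,t_N$ and relations $t_it_j=qt_jt_i$ for $i<j$; $t_it_j^*=qt_j^*t_i$ for $i\ne j$; $t_it_i^*=t_i^*t_i+(q^{-2}-1)\sum_{k=i+1}^N t_kt_k^*$ for $i>n$; $t_it_i^*=t_i^*t_i+(q^{-2}-1)\sum_{k=i+1}^n t_kt_k^*-(q^{-2}-1)\sum_{k=n+1}^N t_kt_k^*$ for $i\le n$. The element $c=-\sum_{j=1}^n t_jt_j^*+\sum_{j=n+1}^N t_jt_j^*$ is central. $\mathrm{Pol}(\widetilde{\mathscr{H}}_{n,m})_q$ is the $*$-algebra obtained by adding the relation $c=1$. Put $x_{n+1}=\sum_{k=n+1}^N t_kt_k^*$. $\mathrm{Fun}(\widetilde{\mathscr{H}}_{n,m})$ is obtained from $\mathrm{Pol}(\widetilde{\mathscr{H}}_{n,m})_q$ by adding a generator $f_0$ and the relations $t_j^*f_0=f_0t_j=0$ for $j\le n$; $x_{n+1}f_0=f_0x_{n+1}=f_0$; $f_0^2=f_0^*=f_0$; $t_jf_0=f_0t_j$, $t_j^*f_0=f_0t_j^*$ for $j\ge n+1$. For $\varphi\in\mathbb{R}/2\pi\mathbb{Z}$, $I_\varphi$ is its $*$-automorphism with $I_\varphi(t_j)=e^{i\varphi}t_j$, $I_\varphi(f_0)=f_0$;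 $\mathrm{Fun}(\mathscr{H}_{n,m})=\{f: I_\varphi f=f\ \forall\varphi\}$; $\mathscr{D}(\mathscr{H}_{n,m})_q$ is the two-sided ideal of $\mathrm{Fun}(\mathscr{H}_{n,m})$ generated by $f_0$. **Representation.** $\mathscr{H}$ is the pre-Hilbert space that is the linear span of an orthonormal basis $\{e(i_1,\dots,i_{N-1}) : i_1,\dots,i_n\in-\mathbb{Z}_+,\ i_{n+1},\dots,i_{N-1}\in\mathbb{N}\}$. The $*$-representation $T$ is given by, with $e=e(i_1,\dots,i_{N-1})$ and $S_j=\sum_{k=1}^{j-1}i_k$: for $j\le n$: $T(t_j)e=q^{S_j}(q^{2(i_j-1)}-1)^{1/2}e(\dots,i_j-1,\dots)$, $T(t_j^* )e=q^{S_j}(q^{2i_j}-1)^{1/2}e(\dots,i_j+1,\dots)$; for $n<j<N$: $T(t_j)e=q^{S_j}(1-q^{2(i_j-1)})^{1/2}e(\dots,i_j-1,\dots)$, $T(t_j^* )e=q^{S_j}(1-q^{2i_j})^{1/2}e(\dots,i_j+1,\dots)$; $T(t_N)e=T(t_N^* )e=q^{S_N}e$; $T(f_0)=P$, the orthogonal projection onto the span of the $e(0,\dots,0,i_{n+1},\dots,i_{N-1})$. (A term with zero coefficient is $0$.) The trace is the sum of the diagonal matrix elements in the basis $e(i_1,\dots,i_{N-1})$; well-definedness of $\nu_q$ means that this series converges absolutely. **Quantum group.** $U_q\mathfrak{su}_{n,m}$ is the Hopf algebra $U_q\mathfrak{sl}_N$ with standard Drinfeld–Jimbo generators $E_j,F_j,K_j^{\pm1}$,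 $1\le j\le N-1$ ($K_iE_j=q^{a_{ij}}E_jK_i$, $K_iF_j=q^{-a_{ij}}F_jK_i$ with $(a_{ij})$ the Cartan matrix, $[E_i,F_j]=\delta_{ij}(K_i-K_i^{-1})/(q-q^{-1})$, $q$-Serre relations), comultiplication $\Delta E_j=E_j\otimes1+K_j\otimes E_j$, $\Delta F_j=F_j\otimes K_j^{-1}+1\otimes F_j$, $\Delta K_j=K_j\otimes K_j$, counit $\varepsilon(E_j)=\varepsilon(F_j)=0$, $\varepsilon(K_j)=1$, antipode $S(E_j)=-K_j^{-1}E_j$, $S(F_j)=-F_jK_j$, $S(K_j)=K_j^{-1}$, and involution $K_j^*=K_j$, $E_j^*=K_jF_j$, $F_j^*=E_jK_j^{-1}$ for $j\ne n$, $E_n^*=-K_nF_n$, $F_n^*=-E_nK_n^{-1}$. **Action.** $\mathscr{D}(\mathscr{H}_{n,m})_q$ is a $U_q\mathfrak{su}_{n,m}$-module algebra; the action on products is determined by $a(fg)=\sum(a_{(1)}f)(a_{(2)}g)$ and the following formulas (unlisted values of $E_j,F_j$ are $0$): $E_jt_{j+1}=q^{-1/2}t_j$; $F_jt_j=q^{1/2}t_{j+1}$; $K_jt_j=qt_j$, $K_jt_{j+1}=q^{-1}t_{j+1}$, $K_jt_i=t_i$ otherwise; $E_jt_j^*=-q^{-3/2}t_{j+1}^*$ for $j\ne n$, $E_nt_n^*=q^{-3/2}t_{n+1}^*$; $F_jt_{j+1}^*=-q^{3/2}t_j^*$ for $j\ne n$, $F_nt_{n+1}^*=q^{3/2}t_n^*$;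 $K_jt_j^*=q^{-1}t_j^*$, $K_jt_{j+1}^*=qt_{j+1}^*$, $K_jt_i^*=t_i^*$ otherwise; $E_nf_0=-\frac{q^{-1/2}}{q^{-2}-1}t_nf_0t_{n+1}^*$, $F_nf_0=-\frac{q^{3/2}}{q^{-2}-1}t_{n+1}f_0t_n^*$, $K_nf_0=f_0$, and $E_jf_0=F_jf_0=(K_j-1)f_0=0$ for $j\ne n$. *)

theory Defs
  imports
    "HOL-Library.Poly_Mapping"
    "HOL-Algebra.QuotRing"
    "HOL-Analysis.Infinite_Sum"
begin

section \<open>Free unital algebras over the complex numbers\<close>

text \<open>
  The free algebra on a type of letters is the monoid algebra of the monoid of words. Words are a
  copy of lists, so that lists themselves do not get an additive structure; the monoid operation is
  written additively, as the convolution product of \<^typ>\<open>'a \<Rightarrow>\<^sub>0 complex\<close> expects.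
\<close>

datatype 'g word = Word (letters: "'g list")

instantiation word :: (type) monoid_add
begin
definition zero_word :: "'a word" where "zero_word = Word []"
definition plus_word :: "'a word \<Rightarrow> 'a word \<Rightarrow> 'a word"
  where "plus_word v w = Word (letters v @ letters w)"
instance by standard (simp_all add: zero_word_def plus_word_def)
end

type_synonym 'g free = "'g word \<Rightarrow>\<^sub>0 complex"

definition mon :: "'g list \<Rightarrow> 'g free"
  where "mon gs = Poly_Mapping.single (Word gs) 1"

definition const :: "complex \<Rightarrow> 'g free"
  where "const z = Poly_Mapping.single 0 z"

abbreviation rconst :: "real \<Rightarrow> 'g free"
  where "rconst r \<equiv> const (complex_of_real r)"

definition free_algebra :: "'g set \<Rightarrow> 'g free ring" where
  "free_algebra G =
     \<lparr>carrier = {p. \<forall>w\<in>Poly_Mapping.keys p. set (letters w) \<subseteq> G},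
      monoid.mult = (*), one = 1, zero = 0, add = (+)\<rparr>"

definition lin_ext ::
    "('a \<Rightarrow> ('b \<Rightarrow>\<^sub>0 complex)) \<Rightarrow> ('a \<Rightarrow>\<^sub>0 complex) \<Rightarrow> ('b \<Rightarrow>\<^sub>0 complex)" where
  "lin_ext h v =
     (\<Sum>a\<in>Poly_Mapping.keys v. Poly_Mapping.map ((*) (Poly_Mapping.lookup v a)) (h a))"


section \<open>The function algebras\<close>

datatype fgen = Gen_t nat | Gen_ts nat | Gen_f0

definition fgens :: "nat \<Rightarrow> fgen set"
  where "fgens N = Gen_t ` {1..N} \<union> Gen_ts ` {1..N} \<union> {Gen_f0}"

abbreviation t :: "nat \<Rightarrow> fgen free" where "t j \<equiv> mon [Gen_t j]"
abbreviation ts :: "nat \<Rightarrow> fgen free" where "ts j \<equiv> mon [Gen_ts j]"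
abbreviation f0 :: "fgen free" where "f0 \<equiv> mon [Gen_f0]"

fun star_letter :: "fgen \<Rightarrow> fgen" where
  "star_letter (Gen_t j) = Gen_ts j"
| "star_letter (Gen_ts j) = Gen_t j"
| "star_letter Gen_f0 = Gen_f0"

definition free_star :: "fgen free \<Rightarrow> fgen free" where
  "free_star p = (\<Sum>w\<in>Poly_Mapping.keys p.
     Poly_Mapping.single (Word (rev (map star_letter (letters w)))) (cnj (Poly_Mapping.lookup p w)))"

text \<open>
  A relation \<open>a = b\<close> is represented by the element \<open>a - b\<close>; everything below uses \<open>N = n + m\<close>.
  The relation \<open>f0\<^sup>* = f0\<close> is built into the involution of the free algebra.
\<close>

definition hat_rels :: "real \<Rightarrow> nat \<Rightarrow> nat \<Rightarrow> fgen free set" where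
  "hat_rels q n m = (let N = n + m in
      {t i * t j - rconst q * t j * t i | i j. i \<in> {1..N} \<and> j \<in> {1..N} \<and> i < j}
    \<union> {t i * ts j - rconst q * ts j * t i | i j. i \<in> {1..N} \<and> j \<in> {1..N} \<and> i \<noteq> j}
    \<union> {t i * ts i - (ts i * t i
          + rconst (q powi (-2) - 1) * (\<Sum>k\<in>{i+1..N}. t k * ts k)) | i. i \<in> {n+1..N}}
    \<union> {t i * ts i - (ts i * t i
          + rconst (q powi (-2) - 1) * (\<Sum>k\<in>{i+1..n}. t k * ts k)
          - rconst (q powi (-2) - 1) * (\<Sum>k\<in>{n+1..N}. t k * ts k)) | i. i \<in> {1..n}})"

definition central_c :: "nat \<Rightarrow> nat \<Rightarrow> fgen free" where
  "central_c n m = - (\<Sum>j\<in>{1..n}. t j * ts j) + (\<Sum>j\<in>{n+1..n+m}. t j * ts j)"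

definition tilde_rels :: "real \<Rightarrow> nat \<Rightarrow> nat \<Rightarrow> fgen free set" where
  "tilde_rels q n m = hat_rels q n m \<union> {central_c n m - 1}"

definition x_elt :: "nat \<Rightarrow> nat \<Rightarrow> fgen free" where
  "x_elt n m = (\<Sum>k\<in>{n+1..n+m}. t k * ts k)"

definition fun_rels :: "real \<Rightarrow> nat \<Rightarrow> nat \<Rightarrow> fgen free set" where
  "fun_rels q n m = tilde_rels q n m
    \<union> {ts j * f0 | j. j \<in> {1..n}} \<union> {f0 * t j | j. j \<in> {1..n}}
    \<union> {x_elt n m * f0 - f0, f0 * x_elt n m - f0, f0 * f0 - f0}
    \<union> {t j * f0 - f0 * t j | j. j \<in> {n+1..n+m}}
    \<union> {ts j * f0 - f0 * ts j | j. j \<in> {n+1..n+m}}"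

text \<open>The defining relations are those of a \<open>*\<close>-algebra, hence their adjoints are imposed as well.\<close>

definition fun_ideal :: "real \<Rightarrow> nat \<Rightarrow> nat \<Rightarrow> fgen free set" where
  "fun_ideal q n m =
     genideal (free_algebra (fgens (n + m))) (fun_rels q n m \<union> free_star ` fun_rels q n m)"

text \<open>\<open>Fun_tilde\<close> is \<open>Fun(H~)\<close>, \<open>Fun_H\<close> is \<open>Fun(H)\<close> and \<open>D_H\<close> is \<open>D(H)\<^sub>q\<close>.\<close>

definition Fun_tilde :: "real \<Rightarrow> nat \<Rightarrow> nat \<Rightarrow> fgen free set ring" where
  "Fun_tilde q n m = free_algebra (fgens (n + m)) Quot fun_ideal q n m"

definition fun_class :: "real \<Rightarrow> nat \<Rightarrow> nat \<Rightarrow> fgen free \<Rightarrow> fgen free set" where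
  "fun_class q n m p = fun_ideal q n m +>\<^bsub>free_algebra (fgens (n + m))\<^esub> p"

definition fun_scale ::
    "real \<Rightarrow> nat \<Rightarrow> nat \<Rightarrow> complex \<Rightarrow> fgen free set \<Rightarrow> fgen free set" where
  "fun_scale q n m z f = fun_class q n m (const z) \<otimes>\<^bsub>Fun_tilde q n m\<^esub> f"

text \<open>
  \<open>free_star\<close> and \<open>gauge \<phi>\<close> permute the cosets of \<open>fun_ideal\<close>, so the induced maps on the quotient
  are the image maps \<open>(`) free_star\<close> and \<open>(`) (gauge \<phi>)\<close>.
\<close>

definition fun_star :: "fgen free set \<Rightarrow> fgen free set"
  where "fun_star f = free_star ` f"

fun gauge_letter :: "real \<Rightarrow> fgen \<Rightarrow> complex" where
  "gauge_letter \<phi> (Gen_t j) = cis \<phi>"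
| "gauge_letter \<phi> (Gen_ts j) = cis (- \<phi>)"
| "gauge_letter \<phi> Gen_f0 = 1"

definition gauge :: "real \<Rightarrow> fgen free \<Rightarrow> fgen free" where
  "gauge \<phi> =
     lin_ext (\<lambda>w. Poly_Mapping.single w (prod_list (map (gauge_letter \<phi>) (letters w))))"

definition Fun_H :: "real \<Rightarrow> nat \<Rightarrow> nat \<Rightarrow> fgen free set ring" where
  "Fun_H q n m = (Fun_tilde q n m)
     \<lparr>carrier := {f \<in> carrier (Fun_tilde q n m). \<forall>\<phi>. gauge \<phi> ` f = f}\<rparr>"

definition D_H :: "real \<Rightarrow> nat \<Rightarrow> nat \<Rightarrow> fgen free set set" where
  "D_H q n m = genideal (Fun_H q n m) {fun_class q n m f0}"


section \<open>The representation\<close>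

text \<open>
  A multi-index \<open>(i\<^sub>1, \<dots>, i\<^sub>N\<^sub>-\<^sub>1)\<close> is a function \<^typ>\<open>nat \<Rightarrow> int\<close> that vanishes outside \<open>{1..N-1}\<close>.
  The pre-Hilbert space consists of the finitely supported functions on the multi-indices; the
  matrix element \<open>\<langle>A e(i), e(i)\<rangle>\<close> is the coefficient of \<open>e(i)\<close> in \<open>A e(i)\<close>.
\<close>

definition idx :: "nat \<Rightarrow> nat \<Rightarrow> (nat \<Rightarrow> int) set" where
  "idx n m = {i. (\<forall>j\<in>{1..n}. i j \<le> 0) \<and> (\<forall>j\<in>{n+1..n+m-1}. 1 \<le> i j) \<and>
                 (\<forall>j. j \<notin> {1..n+m-1} \<longrightarrow> i j = 0)}"

type_synonym vec = "(nat \<Rightarrow> int) \<Rightarrow>\<^sub>0 complex"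

abbreviation e :: "(nat \<Rightarrow> int) \<Rightarrow> vec" where "e i \<equiv> Poly_Mapping.single i 1"

definition Ssum :: "nat \<Rightarrow> (nat \<Rightarrow> int) \<Rightarrow> int" where "Ssum j i = (\<Sum>k\<in>{1..<j}. i k)"

fun T_letter :: "real \<Rightarrow> nat \<Rightarrow> nat \<Rightarrow> fgen \<Rightarrow> (nat \<Rightarrow> int) \<Rightarrow> vec" where
  "T_letter q n m (Gen_t j) i =
    (if j \<le> n then
       Poly_Mapping.single (i(j := i j - 1))
         (complex_of_real (q powi Ssum j i * sqrt (q powi (2 * (i j - 1)) - 1)))
     else if j < n + m then
       Poly_Mapping.single (i(j := i j - 1))
         (complex_of_real (q powi Ssum j i * sqrt (1 - q powi (2 * (i j - 1)))))
     else Poly_Mapping.single i (complex_of_real (q powi Ssum j i)))"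
| "T_letter q n m (Gen_ts j) i =
    (if j \<le> n then
       Poly_Mapping.single (i(j := i j + 1))
         (complex_of_real (q powi Ssum j i * sqrt (q powi (2 * i j) - 1)))
     else if j < n + m then
       Poly_Mapping.single (i(j := i j + 1))
         (complex_of_real (q powi Ssum j i * sqrt (1 - q powi (2 * i j))))
     else Poly_Mapping.single i (complex_of_real (q powi Ssum j i)))"
| "T_letter q n m Gen_f0 i = (if \<forall>j\<in>{1..n}. i j = 0 then e i else 0)"

primrec T_word :: "real \<Rightarrow> nat \<Rightarrow> nat \<Rightarrow> fgen list \<Rightarrow> vec \<Rightarrow> vec" where
  "T_word q n m [] v = v"
| "T_word q n m (g # w) v = lin_ext (T_letter q n m g) (T_word q n m w v)"

definition T_free :: "real \<Rightarrow> nat \<Rightarrow> nat \<Rightarrow> fgen free \<Rightarrow> vec \<Rightarrow> vec" where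
  "T_free q n m p v = lin_ext (\<lambda>w. T_word q n m (letters w) v) p"

text \<open>
  The vector \<open>T(f) v\<close> for a coset \<open>f\<close> is the common value of \<open>T_free p v\<close> for \<open>p \<in> f\<close>. It is meant
  for vectors \<open>v\<close> supported on \<open>idx n m\<close>, where \<open>T_free\<close> respects the relations.
\<close>

definition T :: "real \<Rightarrow> nat \<Rightarrow> nat \<Rightarrow> fgen free set \<Rightarrow> vec \<Rightarrow> vec" where
  "T q n m f v = the_elem ((\<lambda>p. T_free q n m p v) ` f)"

definition Q :: "real \<Rightarrow> nat \<Rightarrow> nat \<Rightarrow> real \<Rightarrow> vec \<Rightarrow> vec" where
  "Q q n m \<kappa> = lin_ext (\<lambda>i. Poly_Mapping.single i
     (complex_of_real (\<kappa> * q powi (2 * (\<Sum>j\<in>{1..n+m-1}. (int (n + m) - int j) * i j)))))"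

definition diag_elt :: "(vec \<Rightarrow> vec) \<Rightarrow> (nat \<Rightarrow> int) \<Rightarrow> complex"
  where "diag_elt A i = Poly_Mapping.lookup (A (e i)) i"

definition trace_converges :: "nat \<Rightarrow> nat \<Rightarrow> (vec \<Rightarrow> vec) \<Rightarrow> bool"
  where "trace_converges n m A \<longleftrightarrow> diag_elt A abs_summable_on idx n m"

definition Tr :: "nat \<Rightarrow> nat \<Rightarrow> (vec \<Rightarrow> vec) \<Rightarrow> complex"
  where "Tr n m A = infsum (diag_elt A) (idx n m)"

definition nu :: "real \<Rightarrow> nat \<Rightarrow> nat \<Rightarrow> real \<Rightarrow> fgen free set \<Rightarrow> complex"
  where "nu q n m \<kappa> f = Tr n m (T q n m f \<circ> Q q n m \<kappa>)"


section \<open>The quantum group and its action\<close>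

datatype ugen = Gen_E nat | Gen_F nat | Gen_K nat | Gen_Kinv nat

definition ugens :: "nat \<Rightarrow> ugen set" where
  "ugens N = (\<Union>j\<in>{1..N-1}. {Gen_E j, Gen_F j, Gen_K j, Gen_Kinv j})"

abbreviation E :: "nat \<Rightarrow> ugen free" where "E j \<equiv> mon [Gen_E j]"
abbreviation F :: "nat \<Rightarrow> ugen free" where "F j \<equiv> mon [Gen_F j]"
abbreviation K :: "nat \<Rightarrow> ugen free" where "K j \<equiv> mon [Gen_K j]"
abbreviation Kinv :: "nat \<Rightarrow> ugen free" where "Kinv j \<equiv> mon [Gen_Kinv j]"

definition cartan :: "nat \<Rightarrow> nat \<Rightarrow> int" where
  "cartan i j = (if i = j then 2 else if i = j + 1 \<or> j = i + 1 then -1 else 0)"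

definition serre :: "real \<Rightarrow> ugen free \<Rightarrow> ugen free \<Rightarrow> ugen free" where
  "serre q x y = x * x * y - rconst (q + inverse q) * x * y * x + y * x * x"

definition uq_rels :: "real \<Rightarrow> nat \<Rightarrow> ugen free set" where
  "uq_rels q N = (let J = {1..N-1} in
      {K i * K j - K j * K i | i j. i \<in> J \<and> j \<in> J}
    \<union> {K i * Kinv i - 1 | i. i \<in> J} \<union> {Kinv i * K i - 1 | i. i \<in> J}
    \<union> {K i * E j - rconst (q powi cartan i j) * E j * K i | i j. i \<in> J \<and> j \<in> J}
    \<union> {K i * F j - rconst (q powi (- cartan i j)) * F j * K i | i j. i \<in> J \<and> j \<in> J}
    \<union> {E i * F j - F j * E i - (if i = j then rconst (1 / (q - inverse q)) * (K i - Kinv i) else 0)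
        | i j. i \<in> J \<and> j \<in> J}
    \<union> {serre q (E i) (E j) | i j. i \<in> J \<and> j \<in> J \<and> cartan i j = -1}
    \<union> {serre q (F i) (F j) | i j. i \<in> J \<and> j \<in> J \<and> cartan i j = -1}
    \<union> {E i * E j - E j * E i | i j. i \<in> J \<and> j \<in> J \<and> cartan i j = 0}
    \<union> {F i * F j - F j * F i | i j. i \<in> J \<and> j \<in> J \<and> cartan i j = 0})"

definition Uq :: "real \<Rightarrow> nat \<Rightarrow> ugen free set ring" where
  "Uq q N = free_algebra (ugens N) Quot genideal (free_algebra (ugens N)) (uq_rels q N)"

fun counit_letter :: "ugen \<Rightarrow> complex" where
  "counit_letter (Gen_E j) = 0"
| "counit_letter (Gen_F j) = 0"
| "counit_letter (Gen_K j) = 1"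
| "counit_letter (Gen_Kinv j) = 1"

definition counit_free :: "ugen free \<Rightarrow> complex" where
  "counit_free p = (\<Sum>w\<in>Poly_Mapping.keys p.
     Poly_Mapping.lookup p w * prod_list (map counit_letter (letters w)))"

definition counit :: "ugen free set \<Rightarrow> complex"
  where "counit a = the_elem (counit_free ` a)"

text \<open>
  The comultiplication of a generator as a list of pure tensors; \<^const>\<open>None\<close> stands for the unit.
  The antipode and the involution of the Hopf algebra enter neither the action nor invariance.
\<close>

fun comult :: "ugen \<Rightarrow> (ugen option \<times> ugen option) list" where
  "comult (Gen_E j) = [(Some (Gen_E j), None), (Some (Gen_K j), Some (Gen_E j))]"
| "comult (Gen_F j) = [(Some (Gen_F j), Some (Gen_Kinv j)), (None, Some (Gen_F j))]"
| "comult (Gen_K j) = [(Some (Gen_K j), Some (Gen_K j))]"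
| "comult (Gen_Kinv j) = [(Some (Gen_Kinv j), Some (Gen_Kinv j))]"

text \<open>The exponent \<open>d\<close> in \<open>K\<^sub>j g = q\<^sup>d g\<close>.\<close>

fun K_weight :: "nat \<Rightarrow> fgen \<Rightarrow> int" where
  "K_weight j (Gen_t i) = (if i = j then 1 else if i = j + 1 then -1 else 0)"
| "K_weight j (Gen_ts i) = (if i = j then -1 else if i = j + 1 then 1 else 0)"
| "K_weight j Gen_f0 = 0"

fun act_letter :: "real \<Rightarrow> nat \<Rightarrow> ugen \<Rightarrow> fgen \<Rightarrow> fgen free" where
  "act_letter q n (Gen_K j) g = rconst (q powi K_weight j g) * mon [g]"
| "act_letter q n (Gen_Kinv j) g = rconst (q powi (- K_weight j g)) * mon [g]"
| "act_letter q n (Gen_E j) (Gen_t i) =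
    (if i = j + 1 then rconst (q powr (-1/2)) * t j else 0)"
| "act_letter q n (Gen_E j) (Gen_ts i) =
    (if i = j then rconst ((if j = n then 1 else -1) * q powr (-3/2)) * ts (j + 1) else 0)"
| "act_letter q n (Gen_E j) Gen_f0 =
    (if j = n then rconst (- (q powr (-1/2) / (q powi (-2) - 1))) * t n * f0 * ts (n + 1) else 0)"
| "act_letter q n (Gen_F j) (Gen_t i) =
    (if i = j then rconst (q powr (1/2)) * t (j + 1) else 0)"
| "act_letter q n (Gen_F j) (Gen_ts i) =
    (if i = j + 1 then rconst ((if j = n then 1 else -1) * q powr (3/2)) * ts j else 0)"
| "act_letter q n (Gen_F j) Gen_f0 =
    (if j = n then rconst (- (q powr (3/2) / (q powi (-2) - 1))) * t (n + 1) * f0 * ts n else 0)"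

text \<open>
  The action of a generator \<open>u\<close> on a word: \<open>u 1 = \<epsilon>(u) 1\<close> and \<open>u (g w) = \<Sum> (u\<^sub>(\<^sub>1\<^sub>) g) (u\<^sub>(\<^sub>2\<^sub>) w)\<close>.
\<close>

primrec act_word :: "real \<Rightarrow> nat \<Rightarrow> fgen list \<Rightarrow> ugen \<Rightarrow> fgen free" where
  "act_word q n [] u = const (counit_letter u)"
| "act_word q n (g # w) u = sum_list (map (\<lambda>(a, b).
      (case a of None \<Rightarrow> mon [g] | Some a' \<Rightarrow> act_letter q n a' g) *
      (case b of None \<Rightarrow> mon w | Some b' \<Rightarrow> act_word q n w b')) (comult u))"

primrec act_uword :: "real \<Rightarrow> nat \<Rightarrow> ugen list \<Rightarrow> fgen free \<Rightarrow> fgen free" where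
  "act_uword q n [] p = p"
| "act_uword q n (u # us) p = lin_ext (\<lambda>w. act_word q n (letters w) u) (act_uword q n us p)"

definition act_free :: "real \<Rightarrow> nat \<Rightarrow> ugen free \<Rightarrow> fgen free \<Rightarrow> fgen free" where
  "act_free q n a p = lin_ext (\<lambda>us. act_uword q n (letters us) p) a"

text \<open>The action on the quotients: the coset of \<open>act_free a p\<close>, independently of the
  representatives \<open>a\<close> and \<open>p\<close>.\<close>

definition act ::
    "real \<Rightarrow> nat \<Rightarrow> nat \<Rightarrow> ugen free set \<Rightarrow> fgen free set \<Rightarrow> fgen free set" where
  "act q n m a f = the_elem ((\<lambda>(a', p). fun_class q n m (act_free q n a' p)) ` (a \<times> f))"

end

theory Submission
  imports Defs "HOL-Computational_Algebra.Polynomial" "HOL-Algebra.Subrings"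
begin

text \<open>
  Normal ordering: every element of \<open>D(H)\<close> is a combination of products of powers of the \<open>t j\<close> and
  \<open>ts j\<close>, of powers of commuting elements \<open>X j\<close>, of \<open>f0\<close>, and of powers of the \<open>ts j\<close> with \<open>j \<le> n\<close>. The
  \<open>X j\<close> act diagonally with eigenvalues \<open>q ^ (2 * Ssum j i)\<close>, and on sparse multi-indices these separate
  the normal forms, so the representation \<open>T\<close> is faithful on \<open>D(H)\<close>. Hence \<open>\<nu>(f\<^sup>* f)\<close>, a sum of squared
  matrix elements of \<open>T f\<close> with positive weights, vanishes only for \<open>f = 0\<close>. The factor \<open>f0\<close> confines
  \<open>i\<^sub>1, \<dots>, i\<^sub>n\<close> to a finite box, and in the other indices the weights decay geometrically; therefore the
  trace converges.

  Invariance: \<open>E j\<close> acts on \<open>D(H)\<close> as a twisted commutator, \<open>T(E j f) = EE T(f) - T(K j f) EE\<close> with an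
  unbounded weighted shift \<open>EE\<close>. The operator \<open>Q\<close> absorbs the twist by \<open>K j\<close>, so the trace of the
  right-hand side telescopes to zero. The involution carries the result over to \<open>F j\<close>.
\<close>

section \<open>Linear algebra on finitely supported functions\<close>

text \<open>Rewriting shows only that the normal forms span; their independence is read off from
  \<open>T\<close>, with no confluence argument. The obstacle is the letter
  \<open>t (n + m)\<close>: it acts diagonally and shifts no entry, so its exponent is not visible
  as a shift of indices. Gauge invariance supplies the missing exponent, and for this reason the
  normal forms are graded by gauge weight.

  The action is defined on cosets through \<open>the_elem\<close>, so independence of
  representatives is a substantial obligation: the generators must preserve the ideal of the
  function algebra, and the relations of the quantum group must act by zero modulo it. Both reduce
  to single relations and letters, because the operators involved are twisted derivations.

  \<open>EE\<close> comes from \<open>t j * ts (j + 1)\<close> by dividing by eigenvalues of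
  \<open>X (j + 1)\<close>, which is done only inside the representation. It moves one unit between
  neighbouring entries, where the exponents 2(N - j) of \<open>Q\<close> differ by 2; this is
  exactly the \<open>K j\<close>-weight of the move. Telescoping requires each half of the
  commutator to be summable by itself. That holds because \<open>Q\<close> decays twice as fast as
  \<open>EE\<close> grows.\<close>

abbreviation "lookup \<equiv> Poly_Mapping.lookup"
abbreviation "single \<equiv> Poly_Mapping.single"
abbreviation "keys \<equiv> Poly_Mapping.keys"

definition scl :: "complex \<Rightarrow> ('a \<Rightarrow>\<^sub>0 complex) \<Rightarrow> ('a \<Rightarrow>\<^sub>0 complex)" where
  "scl c p = Poly_Mapping.map ((*) c) p"

lemma lookup_scl [simp]: "lookup (scl c p) a = c * lookup p a"
  by (simp add: scl_def map.rep_eq when_def)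

interpretation scl: vector_space scl
  by unfold_locales (auto intro!: poly_mapping_eqI simp: lookup_add algebra_simps)

lemma scl_single [simp]: "scl c (single a x) = single a (c * x)"
  by (rule poly_mapping_eqI) (simp add: lookup_single when_def)

lemma const_mult: "const z * p = scl z p"
  by (simp add: const_def scl_def mult_map_scale_conv_mult)

lemma scl_mult_left [simp]: "scl c p * r = scl c (p * r)" for p r :: "'g free"
  by (metis const_mult mult.assoc)

lemma const_simps [simp]: "const 0 = 0" "const 1 = 1"
  by (simp_all add: const_def)

text \<open>The basis step is restricted to the keys of \<open>p\<close>, so that a condition on the
  support of \<open>p\<close> is available there.\<close>

lemma poly_mapping_linear_induct [consumes 0, case_names zero single add scl]:
  assumes "P 0" "\<And>a. a \<in> keys p \<Longrightarrow> P (single a 1)"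
    "\<And>x y. P x \<Longrightarrow> P y \<Longrightarrow> P (x + y)" "\<And>c x. P x \<Longrightarrow> P (scl c x)"
  shows "P p"
proof -
  have "p = (\<Sum>a\<in>keys p. scl (lookup p a) (single a 1))"
    by (rule poly_mapping_eqI)
      (auto simp: lookup_sum lookup_single when_def in_keys_iff sum.delta)
  moreover have "P (\<Sum>a\<in>A. scl (lookup p a) (single a 1))"
    if "A \<subseteq> keys p" for A
    using finite_subset [OF that finite_keys] that
    by (induction A rule: finite_induct) (auto intro: assms simp del: scl_single)
  ultimately show ?thesis by force
qed

lemma mult_const: "p * const z = scl z p" for p :: "'g free"
  by (induction p rule: poly_mapping_linear_induct)
    (simp_all add: const_def mult_single distrib_right scl.scale_right_distrib)

lemma scl_mult_right [simp]: "p * scl c r = scl c (p * r)" for p r :: "'g free"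
  by (metis const_mult mult_const mult.assoc)

lemma const_scl: "const z = scl z 1"
  by (metis const_mult mult.right_neutral)

definition lin :: "(('a \<Rightarrow>\<^sub>0 complex) \<Rightarrow> ('b \<Rightarrow>\<^sub>0 complex)) \<Rightarrow> bool" where
  "lin f \<longleftrightarrow> (\<forall>x y. f (x + y) = f x + f y) \<and> (\<forall>c x. f (scl c x) = scl c (f x))"

lemma linI: "(\<And>x y. f (x + y) = f x + f y) \<Longrightarrow> (\<And>c x. f (scl c x) = scl c (f x)) \<Longrightarrow> lin f"
  by (simp add: lin_def)

context
  fixes f :: "('a \<Rightarrow>\<^sub>0 complex) \<Rightarrow> ('b \<Rightarrow>\<^sub>0 complex)"
  assumes f: "lin f"
begin

lemma lin_add: "f (x + y) = f x + f y" and lin_scl: "f (scl c x) = scl c (f x)"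
  using f by (auto simp: lin_def)

lemma lin_zero: "f 0 = 0"
  using lin_scl [of 0 0] by simp

lemma lin_minus: "f (- x) = - f x"
  using lin_scl [of "- 1" x] by simp

lemma lin_diff: "f (x - y) = f x - f y"
  using lin_add [of x "- y"] by (simp add: lin_minus)

lemma lin_sum: "f (sum g A) = (\<Sum>a\<in>A. f (g a))"
  by (induction A rule: infinite_finite_induct) (auto simp: lin_zero lin_add)

end

lemma lin_eqI:
  assumes "lin f" "lin g"
    "\<And>a. a \<in> keys p \<Longrightarrow> f (single a 1) = g (single a 1)"
  shows "f p = g p"
  by (induction p rule: poly_mapping_linear_induct)
    (use assms in \<open>auto simp: lin_zero lin_add lin_scl simp del: scl_single\<close>)

lemma lin_comp: "lin f \<Longrightarrow> lin g \<Longrightarrow> lin (\<lambda>x. f (g x))"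
  by (auto simp: lin_def)

lemma lin_plus: "lin f \<Longrightarrow> lin g \<Longrightarrow> lin (\<lambda>x. f x + g x)"
  by (auto simp: lin_def scl.scale_right_distrib)

lemma lin_minus': "lin f \<Longrightarrow> lin g \<Longrightarrow> lin (\<lambda>x. f x - g x)"
  by (auto simp: lin_def scl.scale_right_diff_distrib)

lemma lin_scaled: "lin f \<Longrightarrow> lin (\<lambda>x. scl c (f x))"
  by (auto simp: lin_def scl.scale_right_distrib mult.commute)

lemma lin_ident: "lin (\<lambda>x. x)"
  by (simp add: lin_def)

lemma lin_mult_left:
  fixes f :: "('a \<Rightarrow>\<^sub>0 complex) \<Rightarrow> ('g word \<Rightarrow>\<^sub>0 complex)"
  shows "lin f \<Longrightarrow> lin (\<lambda>x. b * f x)"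
  by (auto simp: lin_def algebra_simps)

lemma lin_mult_right:
  fixes f :: "('a \<Rightarrow>\<^sub>0 complex) \<Rightarrow> ('g word \<Rightarrow>\<^sub>0 complex)"
  shows "lin f \<Longrightarrow> lin (\<lambda>x. f x * b)"
  by (auto simp: lin_def algebra_simps)

text \<open>The finite set \<open>A\<close> may exceed the support, so that several vectors can be
  summed over one common range.\<close>

lemma lookup_lin_ext:
  assumes "keys v \<subseteq> A" "finite A"
  shows "lookup (lin_ext h v) b =
    (\<Sum>a\<in>A. lookup v a * lookup (h a) b)"
proof -
  have "lookup (lin_ext h v) b =
      (\<Sum>a\<in>keys v. lookup v a * lookup (h a) b)"
    by (simp add: lin_ext_def lookup_sum flip: scl_def)
  also have "\<dots> = (\<Sum>a\<in>A. lookup v a * lookup (h a) b)"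
    using assms by (intro sum.mono_neutral_left) (auto simp: in_keys_iff)
  finally show ?thesis .
qed

lemma lin_ext_lin: "lin (lin_ext h)"
proof (rule linI)
  fix x y :: "'a \<Rightarrow>\<^sub>0 complex" and c
  let ?A = "keys x \<union> keys y"
  have "keys (x + y) \<subseteq> ?A" by (rule keys_add)
  then show "lin_ext h (x + y) = lin_ext h x + lin_ext h y"
    by (intro poly_mapping_eqI)
      (simp add: lookup_lin_ext [of _ ?A] lookup_add sum.distrib distrib_right)
  have "keys (scl c x) \<subseteq> keys x"
    by (auto simp: in_keys_iff)
  then show "lin_ext h (scl c x) = scl c (lin_ext h x)"
    by (intro poly_mapping_eqI)
      (simp add: lookup_lin_ext [of _ "keys x"] sum_distrib_left mult.assoc)
qed

lemma lin_ext_single [simp]: "lin_ext h (single a c) = scl c (h a)"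
  by (cases "c = 0") (auto simp: lin_ext_def scl_def [symmetric])

lemma lin_ext_unique: "lin f \<Longrightarrow> lin_ext (\<lambda>a. f (single a 1)) p = f p"
  by (rule lin_eqI) (auto intro: lin_ext_lin)


section \<open>Free algebras and their ideals\<close>

lemma mon_Nil [simp]: "mon [] = 1"
  by (simp add: mon_def flip: zero_word_def)

lemma mon_append: "mon (v @ w) = mon v * mon w"
  by (simp add: mon_def mult_single plus_word_def)

lemma mon_Cons: "mon (g # w) = mon [g] * mon w"
  using mon_append [of "[g]" w] by simp

lemma single_mon: "single w 1 = mon (letters w)"
  by (simp add: mon_def)

lemma keys_mon [simp]: "keys (mon w) = {Word w}"
  by (simp add: mon_def)

lemma free_linear_induct [case_names zero mon add scl]:
  assumes "P 0" "\<And>w. Word w \<in> keys p \<Longrightarrow> P (mon w)"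
    "\<And>x y. P x \<Longrightarrow> P y \<Longrightarrow> P (x + y)" "\<And>c x. P x \<Longrightarrow> P (scl c x)"
  shows "P p"
  by (induction p rule: poly_mapping_linear_induct) (auto simp: single_mon intro: assms)

lemma free_lin_eqI:
  fixes f g :: "'g free \<Rightarrow> ('b \<Rightarrow>\<^sub>0 complex)"
  assumes "lin f" "lin g" "\<And>w. Word w \<in> keys p \<Longrightarrow> f (mon w) = g (mon w)"
  shows "f p = g p"
  by (rule lin_eqI) (use assms in \<open>auto simp: single_mon\<close>)

lemma lin_ext_mon [simp]: "lin_ext h (mon w) = h (Word w)"
  by (simp add: mon_def)

text \<open>The ideal generated in the free algebra on all letters of the type. It involves no
  carrier conditions, so congruences can be rewritten freely; \<open>genideal_free_algebra\<close>
  compares it with the ideal of the algebra on the letters \<open>G\<close>.\<close>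

inductive_set tsi :: "'g free set \<Rightarrow> 'g free set" for R where
  zero: "0 \<in> tsi R"
| gen: "x \<in> R \<Longrightarrow> x \<in> tsi R"
| add: "x \<in> tsi R \<Longrightarrow> y \<in> tsi R \<Longrightarrow> x + y \<in> tsi R"
| lmult: "x \<in> tsi R \<Longrightarrow> a * x \<in> tsi R"
| rmult: "x \<in> tsi R \<Longrightarrow> x * a \<in> tsi R"

lemma tsi_scl: "x \<in> tsi R \<Longrightarrow> scl c x \<in> tsi R"
  by (metis const_mult tsi.lmult)

lemma tsi_uminus: "x \<in> tsi R \<Longrightarrow> - x \<in> tsi R"
  using tsi_scl [of x R "- 1"] by simp

lemma tsi_diff: "x \<in> tsi R \<Longrightarrow> y \<in> tsi R \<Longrightarrow> x - y \<in> tsi R"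
  using tsi.add [OF _ tsi_uminus, of x R y] by simp

definition carr :: "'g set \<Rightarrow> 'g free set" where
  "carr G = {p. \<forall>w\<in>keys p. set (letters w) \<subseteq> G}"

lemma carrier_free_algebra: "carrier (free_algebra G) = carr G"
  by (simp add: free_algebra_def carr_def)

lemma carr_zero [simp]: "0 \<in> carr G"
  by (simp add: carr_def)

lemma carr_mon [simp]: "mon w \<in> carr G \<longleftrightarrow> set w \<subseteq> G"
  by (simp add: carr_def)

lemma carr_one [simp]: "1 \<in> carr G"
  using carr_mon [of "[]"] by simp

lemma carr_add [intro]: "x \<in> carr G \<Longrightarrow> y \<in> carr G \<Longrightarrow> x + y \<in> carr G"
  using keys_add [of x y] by (auto simp: carr_def)

lemma carr_scl [intro]: "x \<in> carr G \<Longrightarrow> scl c x \<in> carr G"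
  by (auto simp: carr_def in_keys_iff)

lemma carr_const [simp]: "const c \<in> carr G"
  by (auto simp: const_scl)

lemma carr_uminus [intro]: "x \<in> carr G \<Longrightarrow> - x \<in> carr G"
  using carr_scl [of x G "- 1"] by simp

lemma carr_diff [intro]: "x \<in> carr G \<Longrightarrow> y \<in> carr G \<Longrightarrow> x - y \<in> carr G"
  using carr_add [OF _ carr_uminus, of x G y] by simp

lemma carr_sum [intro]: "(\<And>a. a \<in> A \<Longrightarrow> f a \<in> carr G) \<Longrightarrow> sum f A \<in> carr G"
  by (induction A rule: infinite_finite_induct) auto

lemma carr_mult [intro]:
  assumes "x \<in> carr G" "y \<in> carr G"
  shows "x * y \<in> carr G"
proof -
  have mon: "mon w * y \<in> carr G" if "Word w \<in> keys x" for w
  proof (induction y rule: free_linear_induct)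
    case (mon v)
    then show ?case
      using that assms unfolding mon_append [symmetric] carr_mon by (fastforce simp: carr_def)
  qed (auto simp: algebra_simps)
  show ?thesis
    by (rule free_linear_induct [where p = x and P = "\<lambda>x. x * y \<in> carr G"])
      (use mon in \<open>auto simp: distrib_right\<close>)
qed

lemma free_algebra_ring: "ring (free_algebra G)"
proof (rule ringI)
  have "\<exists>y\<in>carr G. y + x = 0" if "x \<in> carr G" for x
    using that by (intro bexI [of _ "- x"]) auto
  then show "abelian_group (free_algebra G)"
    by (intro abelian_groupI) (auto simp: free_algebra_def carr_def [symmetric] algebra_simps)
  show "Group.monoid (free_algebra G)"
    by (rule monoidI) (auto simp: free_algebra_def carr_def [symmetric] algebra_simps)
qed (auto simp: free_algebra_def algebra_simps)

lemma free_algebra_simps [simp]: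
  "\<zero>\<^bsub>free_algebra G\<^esub> = 0" "\<one>\<^bsub>free_algebra G\<^esub> = 1"
  "x \<otimes>\<^bsub>free_algebra G\<^esub> y = x * y" "x \<oplus>\<^bsub>free_algebra G\<^esub> y = x + y"
  by (simp_all add: free_algebra_def)

lemma free_algebra_a_inv:
  assumes "x \<in> carr G"
  shows "\<ominus>\<^bsub>free_algebra G\<^esub> x = - x"
proof -
  interpret ring "free_algebra G" by (rule free_algebra_ring)
  show ?thesis
    using minus_equality [of "- x" x] assms by (auto simp: carrier_free_algebra)
qed

definition restr :: "'g set \<Rightarrow> 'g free \<Rightarrow> 'g free" where
  "restr G = lin_ext (\<lambda>w. if set (letters w) \<subseteq> G then mon (letters w) else 0)"

lemma restr_lin: "lin (restr G)"
  by (simp add: restr_def lin_ext_lin)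

lemma restr_mon: "restr G (mon w) = (if set w \<subseteq> G then mon w else 0)"
  by (simp add: restr_def)

lemma restr_in_carr: "restr G p \<in> carr G"
proof (induction p rule: free_linear_induct)
  case (mon w)
  then show ?case by (simp add: restr_def)
qed (auto simp: lin_zero [OF restr_lin] lin_add [OF restr_lin] lin_scl [OF restr_lin])

lemma restr_carr:
  assumes "p \<in> carr G"
  shows "restr G p = p"
  by (rule free_lin_eqI [OF restr_lin lin_ident])
    (use assms in \<open>fastforce simp: restr_def carr_def\<close>)

text \<open>A concatenation has all its letters in \<open>G\<close> exactly if both parts do, so
  discarding words is multiplicative.\<close>

lemma restr_mult: "restr G (x * y) = restr G x * restr G y"
proof -
  have 1: "restr G (mon v * mon w) = restr G (mon v) * restr G (mon w)" for v w
  proof -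
    have "restr G (mon v * mon w) = restr G (mon (v @ w))" by (simp add: mon_append)
    also have "\<dots> = restr G (mon v) * restr G (mon w)"
      unfolding restr_mon by (auto simp: mon_append)
    finally show ?thesis .
  qed
  have "restr G (mon v * y) = restr G (mon v) * restr G y" for v
    by (rule free_lin_eqI [OF lin_comp [OF restr_lin lin_mult_left [OF lin_ident]]
          lin_mult_left [OF restr_lin] 1])
  then show ?thesis
    by (rule free_lin_eqI [OF lin_comp [OF restr_lin lin_mult_right [OF lin_ident]]
          lin_mult_right [OF restr_lin]])
qed

text \<open>Discarding the words with letters outside \<open>G\<close> maps the ideal of the big free algebra
  into the ideal of the small one.\<close>

lemma genideal_free_algebra:
  assumes R: "R \<subseteq> carr G"
  shows "genideal (free_algebra G) R = tsi R \<inter> carr G"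
proof
  interpret ring "free_algebra G" by (rule free_algebra_ring)
  have "ideal (tsi R \<inter> carr G) (free_algebra G)"
  proof (rule idealI)
    show "subgroup (tsi R \<inter> carr G) (add_monoid (free_algebra G))"
      by (rule add.subgroupI)
        (auto simp: carrier_free_algebra free_algebra_a_inv a_inv_def [symmetric]
          intro: tsi.zero tsi.add tsi_uminus)
  qed (auto intro: tsi.lmult tsi.rmult simp: carrier_free_algebra free_algebra_ring)
  then show "genideal (free_algebra G) R \<subseteq> tsi R \<inter> carr G"
    by (rule genideal_minimal) (use R in \<open>auto intro: tsi.gen\<close>)
  have "ideal (genideal (free_algebra G) R) (free_algebra G)"
    by (rule genideal_ideal) (use R in \<open>auto simp: carrier_free_algebra\<close>)
  then interpret I: ideal "genideal (free_algebra G) R" "free_algebra G" .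
  have "restr G x \<in> genideal (free_algebra G) R" if "x \<in> tsi R" for x
    using that
  proof induction
    case zero
    then show ?case using I.zero_closed by (simp add: lin_zero [OF restr_lin])
  next
    case (gen x)
    then have "x \<in> carr G" using R by auto
    then show ?case
      using gen genideal_self R by (auto simp: restr_carr carrier_free_algebra)
  next
    case (add x y)
    then show ?case using I.a_closed by (simp add: lin_add [OF restr_lin])
  next
    case (lmult x a)
    then show ?case using I.I_l_closed [of "restr G x" "restr G a"] restr_in_carr [of G a]
      by (simp add: restr_mult carrier_free_algebra)
  next
    case (rmult x a)
    then show ?case using I.I_r_closed [of "restr G x" "restr G a"] restr_in_carr [of G a]
      by (simp add: restr_mult carrier_free_algebra)
  qed
  then show "tsi R \<inter> carr G \<subseteq> genideal (free_algebra G) R"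
    by (metis IntE restr_carr subsetI)
qed


section \<open>The involution\<close>

fun star_word :: "fgen word \<Rightarrow> fgen word" where
  "star_word (Word w) = Word (rev (map star_letter w))"

lemma star_letter_star_letter [simp]: "star_letter (star_letter g) = g"
  by (cases g) auto

lemma star_letter_comp [simp]: "star_letter \<circ> star_letter = id"
  by (rule ext) simp

lemma star_word_star_word [simp]: "star_word (star_word w) = w"
  by (cases w) (simp add: rev_map)

text \<open>Since \<open>star_word\<close> is its own inverse, a single summand of
  \<open>free_star\<close> contributes to each coefficient; conjugate linearity and involutivity are
  then checked coefficientwise.\<close>

lemma lookup_free_star: "lookup (free_star p) w = cnj (lookup p (star_word w))"
proof -
  have eq: "Word (rev (map star_letter (letters v))) = w \<longleftrightarrow> v = star_word w" for v
    by (cases v) (metis star_word.simps star_word_star_word word.sel)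
  show ?thesis
    by (auto simp: free_star_def lookup_sum lookup_single when_def eq in_keys_iff sum.delta)
qed

lemma free_star_add: "free_star (x + y) = free_star x + free_star y"
  by (rule poly_mapping_eqI) (simp add: lookup_free_star lookup_add)

lemma free_star_scl: "free_star (scl c x) = scl (cnj c) (free_star x)"
  by (rule poly_mapping_eqI) (simp add: lookup_free_star)

lemma free_star_zero [simp]: "free_star 0 = 0"
  by (rule poly_mapping_eqI) (simp add: lookup_free_star)

lemma free_star_uminus: "free_star (- x) = - free_star x"
  by (rule poly_mapping_eqI) (simp add: lookup_free_star)

lemma free_star_diff: "free_star (x - y) = free_star x - free_star y"
  by (rule poly_mapping_eqI) (simp add: lookup_free_star lookup_minus)

lemma free_star_sum: "free_star (sum f A) = (\<Sum>a\<in>A. free_star (f a))"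
  by (induction A rule: infinite_finite_induct) (auto simp: free_star_add)

lemma free_star_free_star [simp]: "free_star (free_star p) = p"
  by (rule poly_mapping_eqI) (simp add: lookup_free_star)

lemma free_star_mon: "free_star (mon w) = mon (rev (map star_letter w))"
  by (simp add: free_star_def) (simp add: mon_def)

lemma free_star_one [simp]: "free_star 1 = 1"
  using free_star_mon [of "[]"] by simp

lemma free_star_letters [simp]:
  "free_star (t j) = ts j" "free_star (ts j) = t j" "free_star f0 = f0"
  by (simp_all add: free_star_mon)

lemma free_star_mult: "free_star (x * y) = free_star y * free_star x"
proof -
  have 1: "free_star (mon v * mon w) = free_star (mon w) * free_star (mon v)" for v w
    by (metis free_star_mon map_append mon_append rev_append)
  have 2: "free_star (mon v * y) = free_star y * free_star (mon v)" for v
    by (rule free_linear_induct [where p = y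
          and P = "\<lambda>y. free_star (mon v * y) = free_star y * free_star (mon v)"])
      (auto simp: 1 distrib_left distrib_right free_star_add free_star_scl)
  show ?thesis
    by (rule free_linear_induct [where p = x
          and P = "\<lambda>x. free_star (x * y) = free_star y * free_star x"])
      (auto simp: 2 distrib_left distrib_right free_star_add free_star_scl)
qed

lemmas free_star_simps =
  free_star_mult free_star_add free_star_diff free_star_uminus free_star_scl free_star_sum

lemma tsi_free_star:
  assumes "x \<in> tsi R" "free_star ` R \<subseteq> R"
  shows "free_star x \<in> tsi R"
  using assms(1)
  by induction (use assms(2) in \<open>auto simp: free_star_simps intro: tsi.intros\<close>)


section \<open>Relations\<close>

locale hyperboloid =
  fixes q :: real and n m :: nat
  assumes q_pos: "0 < q" and q_less_1: "q < 1" and n_ge: "1 \<le> n" and m_ge: "2 \<le> m"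
begin

definition rels :: "fgen free set" where
  "rels = fun_rels q n m \<union> free_star ` fun_rels q n m"

definition cong :: "fgen free \<Rightarrow> fgen free \<Rightarrow> bool" (infix "\<approx>" 50) where
  "p \<approx> r \<longleftrightarrow> p - r \<in> tsi rels"

definition h :: complex where "h = complex_of_real (sqrt q)"

abbreviation qc :: complex where "qc \<equiv> complex_of_real q"

lemma h_simps [simp]: "h \<noteq> 0" "h * h = qc" "h\<^sup>2 = qc"
  using q_pos by (auto simp: h_def power2_eq_square simp flip: of_real_mult)

lemma q_simps [simp]: "q \<noteq> 0" "q\<^sup>2 \<noteq> 1" "qc\<^sup>2 \<noteq> 1"
proof -
  show q2: "q\<^sup>2 \<noteq> 1"
    using q_pos q_less_1 power_strict_mono [of q 1 2] by auto
  then show "qc\<^sup>2 \<noteq> 1"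
    by (metis of_real_eq_1_iff of_real_power)
qed (use q_pos in auto)

text \<open>The signs \<open>eps\<close> merge the cases \<open>i \<le> n\<close> and \<open>i > n\<close> of the relations for \<open>t i * ts i\<close>; the elements \<open>X j\<close>
  interpolate between the central element \<open>X 1\<close> and \<open>x_elt = X (n + 1)\<close>.\<close>

definition eps :: "nat \<Rightarrow> complex" where "eps k = (if k \<le> n then - 1 else 1)"

lemma eps_simps [simp]: "eps k * eps k = 1" "eps k \<noteq> 0" "eps k * (eps k * z) = z" "cnj (eps k) = eps k"
  by (auto simp: eps_def)

definition X :: "nat \<Rightarrow> fgen free" where
  "X j = (\<Sum>k\<in>{j..n+m}. scl (eps k) (t k * ts k))"

section \<open>Congruence modulo the relations\<close>

lemma cong_refl [simp, intro]: "p \<approx> p"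
  by (simp add: cong_def tsi.zero)

lemma cong_sym: "p \<approx> r \<Longrightarrow> r \<approx> p"
  using tsi_uminus [of "p - r" rels] by (simp add: cong_def)

lemma cong_trans [trans]: "p \<approx> r \<Longrightarrow> r \<approx> s \<Longrightarrow> p \<approx> s"
  using tsi.add [of "p - r" rels "r - s"] by (simp add: cong_def)

lemma eq_cong_trans [trans]: "p = r \<Longrightarrow> r \<approx> s \<Longrightarrow> p \<approx> s"
  and cong_eq_trans [trans]: "p \<approx> r \<Longrightarrow> r = s \<Longrightarrow> p \<approx> s"
  by simp_all

lemma cong_add: "p \<approx> r \<Longrightarrow> p' \<approx> r' \<Longrightarrow> p + p' \<approx> r + r'"
  using tsi.add [of "p - r" rels "p' - r'"] by (simp add: cong_def algebra_simps)

lemma cong_diff: "p \<approx> r \<Longrightarrow> p' \<approx> r' \<Longrightarrow> p - p' \<approx> r - r'"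
  using tsi_diff [of "p - r" rels "p' - r'"] by (simp add: cong_def algebra_simps)

lemma cong_scl: "p \<approx> r \<Longrightarrow> scl c p \<approx> scl c r"
  using tsi_scl [of "p - r" rels c] by (simp add: cong_def scl.scale_right_diff_distrib)

lemma cong_uminus: "p \<approx> r \<Longrightarrow> - p \<approx> - r"
  using cong_scl [of p r "- 1"] by simp

lemma cong_mult_left: "p \<approx> r \<Longrightarrow> a * p \<approx> a * r"
  using tsi.lmult [of "p - r" rels a] by (simp add: cong_def algebra_simps)

lemma cong_mult_right: "p \<approx> r \<Longrightarrow> p * a \<approx> r * a"
  using tsi.rmult [of "p - r" rels a] by (simp add: cong_def algebra_simps)

lemma cong_mult: "p \<approx> r \<Longrightarrow> p' \<approx> r' \<Longrightarrow> p * p' \<approx> r * r'"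
  by (metis cong_mult_left cong_mult_right cong_trans)

lemma cong_sum: "(\<And>a. a \<in> A \<Longrightarrow> f a \<approx> g a) \<Longrightarrow> sum f A \<approx> sum g A"
  by (induction A rule: infinite_finite_induct) (auto intro: cong_add)

lemma cong_0_iff: "p \<approx> 0 \<longleftrightarrow> p \<in> tsi rels"
  by (simp add: cong_def)

lemma cong_diff_0_iff: "p - r \<approx> 0 \<longleftrightarrow> p \<approx> r"
  by (simp add: cong_def)

lemma cong_free_star: "p \<approx> r \<Longrightarrow> free_star p \<approx> free_star r"
  using tsi_free_star [of "p - r" rels]
  by (force simp: cong_def free_star_simps rels_def image_iff)

lemma cong_rel: "p - r \<in> fun_rels q n m \<Longrightarrow> p \<approx> r"
  by (auto simp: cong_def rels_def intro: tsi.gen)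

lemma hat_in: "p \<in> hat_rels q n m \<Longrightarrow> p \<in> fun_rels q n m"
  by (simp add: fun_rels_def tilde_rels_def)

lemma powi_minus2: "q powi - 2 = 1 / q\<^sup>2"
  by (simp add: power_int_minus field_simps)

lemma tt: assumes "1 \<le> i" "i < j" "j \<le> n + m" shows "t i * t j \<approx> scl qc (t j * t i)"
proof -
  have "t i * t j - rconst q * t j * t i \<in> fun_rels q n m"
    by (rule hat_in, unfold hat_rels_def Let_def, rule UnI1, rule UnI1, rule UnI1,
        rule CollectI, rule exI [of _ i], rule exI [of _ j])
      (use assms in auto)
  then show ?thesis by (intro cong_rel) (simp add: const_mult)
qed

lemma tts: assumes "1 \<le> i" "1 \<le> j" "i \<le> n + m" "j \<le> n + m" "i \<noteq> j"
  shows "t i * ts j \<approx> scl qc (ts j * t i)"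
proof -
  have "t i * ts j - rconst q * ts j * t i \<in> fun_rels q n m"
    by (rule hat_in, unfold hat_rels_def Let_def, rule UnI1, rule UnI1, rule UnI2,
        rule CollectI, rule exI [of _ i], rule exI [of _ j])
      (use assms in auto)
  then show ?thesis by (intro cong_rel) (simp add: const_mult)
qed

lemma tsts: assumes "1 \<le> i" "i < j" "j \<le> n + m" shows "ts j * ts i \<approx> scl qc (ts i * ts j)"
  using cong_free_star [OF tt [OF assms]] by (simp add: free_star_simps)

lemma X_rec: "j \<le> n + m \<Longrightarrow> X j = scl (eps j) (t j * ts j) + X (j + 1)"
  by (simp add: X_def sum.atLeast_Suc_atMost)

lemma X_beyond [simp]: "n + m < j \<Longrightarrow> X j = 0"
  by (simp add: X_def)

lemma X_n1: "X (n + 1) = x_elt n m"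
  unfolding X_def x_elt_def by (rule sum.cong) (auto simp: eps_def)

lemma X_le_n: assumes "j \<le> n + 1" shows "X j = - (\<Sum>k\<in>{j..n}. t k * ts k) + (\<Sum>k\<in>{n+1..n+m}. t k * ts k)"
proof -
  have "X j = (\<Sum>k\<in>{j..n}. scl (eps k) (t k * ts k)) + (\<Sum>k\<in>{n+1..n+m}. scl (eps k) (t k * ts k))"
    unfolding X_def using assms by (intro sum.ub_add_nat [of j n "\<lambda>k. scl (eps k) (t k * ts k)" m]) auto
  also have "(\<Sum>k\<in>{j..n}. scl (eps k) (t k * ts k)) = - (\<Sum>k\<in>{j..n}. t k * ts k)"
    by (simp add: eps_def flip: sum_negf)
  also have "(\<Sum>k\<in>{n+1..n+m}. scl (eps k) (t k * ts k)) = (\<Sum>k\<in>{n+1..n+m}. t k * ts k)"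
    by (rule sum.cong) (auto simp: eps_def)
  finally show ?thesis .
qed

lemma tts_same: assumes "1 \<le> i" "i \<le> n + m"
  shows "t i * ts i \<approx> ts i * t i + scl (eps i * (1 / qc\<^sup>2 - 1)) (X (i + 1))"
proof (cases "i \<le> n")
  case True
  have "t i * ts i - (ts i * t i
          + rconst (q powi (-2) - 1) * (\<Sum>k\<in>{i+1..n}. t k * ts k)
          - rconst (q powi (-2) - 1) * (\<Sum>k\<in>{n+1..n+m}. t k * ts k)) \<in> fun_rels q n m"
    by (rule hat_in, unfold hat_rels_def Let_def, rule UnI2,
        rule CollectI, rule exI [of _ i])
      (use True assms in auto)
  then have "t i * ts i \<approx> ts i * t i
          + rconst (q powi (-2) - 1) * (\<Sum>k\<in>{i+1..n}. t k * ts k)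
          - rconst (q powi (-2) - 1) * (\<Sum>k\<in>{n+1..n+m}. t k * ts k)"
    by (rule cong_rel)
  also have "\<dots> = ts i * t i + scl (eps i * (1 / qc\<^sup>2 - 1)) (X (i + 1))"
    using True X_le_n [of "i + 1"]
    by (simp add: eps_def const_mult powi_minus2 scl.scale_right_distrib scl.scale_right_diff_distrib
        scl.scale_left_diff_distrib)
  finally show ?thesis .
next
  case False
  have "t i * ts i - (ts i * t i
          + rconst (q powi (-2) - 1) * (\<Sum>k\<in>{i+1..n+m}. t k * ts k)) \<in> fun_rels q n m"
    by (rule hat_in, unfold hat_rels_def Let_def, rule UnI1, rule UnI2,
        rule CollectI, rule exI [of _ i])
      (use False assms in auto)
  moreover have "X (i + 1) = (\<Sum>k\<in>{i+1..n+m}. t k * ts k)"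
    unfolding X_def using False by (intro sum.cong) (auto simp: eps_def)
  ultimately show ?thesis using False
    by (intro cong_rel) (simp add: eps_def const_mult powi_minus2)
qed

lemma ts_f0: "1 \<le> j \<Longrightarrow> j \<le> n \<Longrightarrow> ts j * f0 \<approx> 0"
  and f0_t: "1 \<le> j \<Longrightarrow> j \<le> n \<Longrightarrow> f0 * t j \<approx> 0"
  and X_f0: "X (n + 1) * f0 \<approx> f0"
  and f0_X: "f0 * X (n + 1) \<approx> f0"
  and f0_f0: "f0 * f0 \<approx> f0"
  and t_f0: "n + 1 \<le> j \<Longrightarrow> j \<le> n + m \<Longrightarrow> t j * f0 \<approx> f0 * t j"
  and ts_f0': "n + 1 \<le> j \<Longrightarrow> j \<le> n + m \<Longrightarrow> ts j * f0 \<approx> f0 * ts j"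
  by (rule cong_rel; (subst X_n1)?; force simp: fun_rels_def)+


subsection \<open>Commutation up to a scalar\<close>

text \<open>Recording the scalar reduces commutation of products to multiplication of the scalars of
  their factors.\<close>

definition qcm :: "complex \<Rightarrow> fgen free \<Rightarrow> fgen free \<Rightarrow> bool" where
  "qcm s a b \<longleftrightarrow> a * b \<approx> scl s (b * a)"

lemma qcm_sym: "qcm s a b \<Longrightarrow> s \<noteq> 0 \<Longrightarrow> qcm (1 / s) b a"
  using cong_scl [of "a * b" "scl s (b * a)" "1 / s"] by (simp add: qcm_def cong_sym)

lemma qcm_mult_right:
  assumes "qcm s a b" "qcm s' a c"
  shows "qcm (s * s') a (b * c)"
proof -
  have "a * (b * c) = a * b * c" by (simp add: mult.assoc)
  also have "\<dots> \<approx> scl s (b * a) * c"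
    using assms(1) by (intro cong_mult_right) (simp add: qcm_def)
  also have "\<dots> = scl s (b * (a * c))" by (simp add: mult.assoc)
  also have "\<dots> \<approx> scl s (b * scl s' (c * a))"
    using assms(2) by (intro cong_scl cong_mult_left) (simp add: qcm_def)
  also have "\<dots> = scl (s * s') (b * c * a)" by (simp add: mult.assoc)
  finally show ?thesis by (simp add: qcm_def)
qed

lemma qcm_mult_left:
  assumes "qcm s a c" "qcm s' b c"
  shows "qcm (s * s') (a * b) c"
proof -
  have "a * b * c = a * (b * c)" by (simp add: mult.assoc)
  also have "\<dots> \<approx> a * scl s' (c * b)"
    using assms(2) by (intro cong_mult_left) (simp add: qcm_def)
  also have "\<dots> = scl s' ((a * c) * b)" by (simp add: mult.assoc)
  also have "\<dots> \<approx> scl s' (scl s (c * a) * b)"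
    using assms(1) by (intro cong_scl cong_mult_right) (simp add: qcm_def)
  also have "\<dots> = scl (s * s') (c * (a * b))" by (simp add: mult.assoc mult.commute)
  finally show ?thesis by (simp add: qcm_def)
qed

lemma qcm_one [simp]: "qcm 1 a 1" "qcm 1 1 a"
  by (simp_all add: qcm_def)

lemma qcm_add_left: "qcm s a c \<Longrightarrow> qcm s b c \<Longrightarrow> qcm s (a + b) c"
  using cong_add [of "a * c" "scl s (c * a)" "b * c" "scl s (c * b)"]
  by (simp add: qcm_def distrib_left distrib_right scl.scale_right_distrib)

lemma qcm_scl_left: "qcm s a c \<Longrightarrow> qcm s (scl z a) c"
  using cong_scl [of "a * c" "scl s (c * a)" z] by (simp add: qcm_def mult.commute)

lemma qcm_sum_left: "(\<And>k. k \<in> A \<Longrightarrow> qcm s (f k) c) \<Longrightarrow> qcm s (sum f A) c"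
  by (induction A rule: infinite_finite_induct) (auto simp: qcm_def [of _ 0] intro: qcm_add_left)

lemma qcm_star: "qcm s a b \<Longrightarrow> qcm (cnj s) (free_star b) (free_star a)"
  using cong_free_star [of "a * b" "scl s (b * a)"] by (simp add: qcm_def free_star_simps)

lemma qcm_tt: assumes "1 \<le> i" "i < j" "j \<le> n + m"
  shows "qcm qc (t i) (t j)" "qcm (1 / qc) (t j) (t i)"
    "qcm qc (ts j) (ts i)" "qcm (1 / qc) (ts i) (ts j)"
  using tt [OF assms] tsts [OF assms] qcm_sym [of qc] by (auto simp: qcm_def)

lemma qcm_tts: assumes "1 \<le> i" "1 \<le> j" "i \<le> n + m" "j \<le> n + m" "i \<noteq> j"
  shows "qcm qc (t i) (ts j)" "qcm (1 / qc) (ts j) (t i)"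
  using tts [OF assms] qcm_sym [of qc] by (auto simp: qcm_def)

text \<open>All indices k occurring in \<open>X j\<close> exceed i, and moving \<open>t i\<close>
  past each of \<open>t k\<close> and \<open>ts k\<close> costs a factor 1/q.\<close>

lemma qcm_X_t_less: assumes "1 \<le> i" "i < j" "i \<le> n + m" shows "qcm (1 / qc\<^sup>2) (X j) (t i)"
  unfolding X_def
proof (intro qcm_sum_left qcm_scl_left)
  fix k assume "k \<in> {j..n+m}"
  then have "qcm (1 / qc * (1 / qc)) (t k * ts k) (t i)"
    using assms by (intro qcm_mult_left qcm_tt qcm_tts) auto
  then show "qcm (1 / qc\<^sup>2) (t k * ts k) (t i)"
    by (simp add: power2_eq_square)
qed

lemma tts_X: assumes "1 \<le> i" "i \<le> n + m"
  shows "t i * ts i \<approx> scl (eps i) (X i - X (i + 1))"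
  using X_rec [OF assms(2)] by simp

text \<open>Together with \<open>tts_X\<close>: in either order, a letter times its adjoint is a
  combination of \<open>X i\<close> and \<open>X (i + 1)\<close>. This is how such pairs are
  eliminated in normal ordering.\<close>

lemma tst_X: assumes "1 \<le> i" "i \<le> n + m"
  shows "ts i * t i \<approx> scl (eps i) (X i - scl (1 / qc\<^sup>2) (X (i + 1)))"
proof -
  have "ts i * t i = (ts i * t i + scl (eps i * (1 / qc\<^sup>2 - 1)) (X (i + 1)))
     - scl (eps i * (1 / qc\<^sup>2 - 1)) (X (i + 1))" by simp
  also have "\<dots> \<approx> t i * ts i - scl (eps i * (1 / qc\<^sup>2 - 1)) (X (i + 1))"
    using tts_same [OF assms] by (intro cong_diff cong_sym [OF tts_same] assms) auto
  also have "\<dots> = scl (eps i) (X i - scl (1 / qc\<^sup>2) (X (i + 1)))"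
    using X_rec [OF assms(2)]
    by (simp add: algebra_simps scl.scale_right_distrib scl.scale_right_diff_distrib scl.scale_left_diff_distrib)
  finally show ?thesis .
qed

text \<open>For j = i, \<open>X i * t i\<close> is expanded by \<open>X_rec\<close>; the multiple of
  \<open>X (i + 1)\<close> in \<open>ts i * t i\<close> cancels against the factor 1/q^2 from moving
  \<open>X (i + 1)\<close> past \<open>t i\<close>. The further summands of \<open>X j\<close> have
  k < i, where the factors q and 1/q cancel.\<close>

lemma qcm_X_t_ge: assumes "1 \<le> j" "j \<le> i" "i \<le> n + m" shows "qcm 1 (X j) (t i)"
proof -
  have i: "1 \<le> i" using assms by simp
  have "X i * t i = scl (eps i) (t i * (ts i * t i)) + X (i + 1) * t i"
    using assms by (simp add: X_rec distrib_right mult.assoc)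
  also have "\<dots> \<approx> scl (eps i) (t i * (scl (eps i) (X i - scl (1 / qc\<^sup>2) (X (i + 1)))))
      + scl (1 / qc\<^sup>2) (t i * X (i + 1))"
    using qcm_X_t_less [of i "i + 1"] assms
    by (intro cong_add cong_scl cong_mult_left tst_X) (auto simp: qcm_def)
  also have "\<dots> = t i * X i"
    by (simp add: right_diff_distrib scl.scale_right_diff_distrib)
  finally have Xi: "qcm 1 (X i) (t i)" by (simp add: qcm_def)
  have "qcm 1 (\<Sum>k\<in>{j..<i}. scl (eps k) (t k * ts k)) (t i)"
  proof (intro qcm_sum_left qcm_scl_left)
    fix k assume "k \<in> {j..<i}"
    then have "qcm (qc * (1 / qc)) (t k * ts k) (t i)"
      using assms by (intro qcm_mult_left qcm_tt qcm_tts) auto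
    then show "qcm 1 (t k * ts k) (t i)" by simp
  qed
  moreover have "X j = (\<Sum>k\<in>{j..<i}. scl (eps k) (t k * ts k)) + X i"
    unfolding X_def using assms
    by (metis (no_types, lifting) add.commute atLeastLessThanSuc_atLeastAtMost le_SucI sum.atLeastLessThan_concat)
  ultimately show ?thesis using Xi by (simp add: qcm_add_left)
qed

lemma free_star_X [simp]: "free_star (X j) = X j"
  by (simp add: X_def free_star_simps)

lemma qcm_X_ts_less: assumes "1 \<le> i" "i < j" "i \<le> n + m" shows "qcm (qc\<^sup>2) (X j) (ts i)"
  using qcm_sym [OF qcm_star [OF qcm_X_t_less [OF assms]]] by simp

lemma qcm_X_ts_ge: assumes "1 \<le> j" "j \<le> i" "i \<le> n + m" shows "qcm 1 (X j) (ts i)"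
  using qcm_sym [OF qcm_star [OF qcm_X_t_ge [OF assms]]] by simp

lemma qcm_X_X: assumes "1 \<le> i" "1 \<le> j" shows "qcm 1 (X i) (X j)"
proof -
  have *: "qcm 1 (X i) (X j)" if "1 \<le> i" "1 \<le> j" "j \<le> i" for i j
  proof -
    have "qcm 1 (t k * ts k) (X i)" if k: "k \<in> {j..n+m}" for k
    proof (cases "k < i")
      case True
      have "qcm (1 / (1 / qc\<^sup>2)) (t k) (X i)" "qcm (1 / qc\<^sup>2) (ts k) (X i)"
        using qcm_sym [OF qcm_X_t_less] qcm_sym [OF qcm_X_ts_less] k True \<open>1 \<le> j\<close> by auto
      from qcm_mult_left [OF this] show ?thesis by simp
    next
      case False
      have "qcm (1 / 1) (t k) (X i)" "qcm (1 / 1) (ts k) (X i)"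
        using qcm_sym [OF qcm_X_t_ge] qcm_sym [OF qcm_X_ts_ge] k False \<open>1 \<le> i\<close> by auto
      from qcm_mult_left [OF this] show ?thesis by simp
    qed
    then have "qcm 1 (X j) (X i)"
      unfolding X_def [of j] by (intro qcm_sum_left qcm_scl_left)
    from qcm_sym [OF this] show ?thesis by simp
  qed
  show ?thesis
    using * [of i j] qcm_sym [OF * [of j i]] assms by (cases "j \<le> i") auto
qed

text \<open>The summands of \<open>X i\<close> with index at most n annihilate \<open>f0\<close>,
  which leaves \<open>X (n + 1)\<close>.\<close>

lemma X_le_f0: assumes "1 \<le> i" "i \<le> n + 1" shows "X i * f0 \<approx> f0" "f0 * X i \<approx> f0"
proof -
  have "(\<Sum>k\<in>{i..n}. t k * ts k) * f0 \<approx> (\<Sum>k\<in>{i..n}. 0)"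
    unfolding sum_distrib_right mult.assoc using assms cong_mult_left [OF ts_f0]
    by (intro cong_sum) force
  then have "- ((\<Sum>k\<in>{i..n}. t k * ts k) * f0) + X (n + 1) * f0 \<approx> - 0 + f0"
    by (intro cong_add cong_uminus X_f0) simp
  moreover have "X i = - (\<Sum>k\<in>{i..n}. t k * ts k) + X (n + 1)"
    using X_le_n [of i] X_le_n [of "n + 1"] assms by simp
  ultimately show "X i * f0 \<approx> f0" by (simp add: left_diff_distrib)
  from cong_free_star [OF this] show "f0 * X i \<approx> f0" by (simp add: free_star_simps)
qed

end


section \<open>The representation\<close>

lemma lookup_lin:
  assumes "lin f" "keys v \<subseteq> A" "finite A"
  shows "lookup (f v) b =
    (\<Sum>a\<in>A. lookup v a * lookup (f (single a 1)) b)"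
  using lookup_lin_ext [OF assms(2,3)] lin_ext_unique [OF assms(1), of v] by metis

lemma carr_keys: "p \<in> carr G \<Longrightarrow> Word w \<in> keys p \<Longrightarrow> set w \<subseteq> G"
  by (force simp: carr_def)

lemma T_word_lin: "lin (T_word q n m w)"
proof (induction w)
  case (Cons g w)
  from lin_comp [OF lin_ext_lin Cons] show ?case by simp
qed (simp add: lin_def)

lemma T_word_append: "T_word q n m (v @ w) x = T_word q n m v (T_word q n m w x)"
  by (induction v) auto

lemma T_free_lin: "lin (\<lambda>p. T_free q n m p v)"
  by (simp add: T_free_def lin_ext_lin)

lemma T_free_mon: "T_free q n m (mon w) v = T_word q n m w v"
  by (simp add: T_free_def)

lemma T_free_one [simp]: "T_free q n m 1 v = v"
  using T_free_mon [of q n m "[]"] by simp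

lemmas T_free_linear =
  lin_zero [OF T_free_lin] lin_add [OF T_free_lin] lin_scl [OF T_free_lin]
  lin_minus [OF T_free_lin] lin_diff [OF T_free_lin] lin_sum [OF T_free_lin]

lemma T_free_lin_vec: "lin (T_free q n m p)"
proof (rule linI)
  fix x y c
  show "T_free q n m p (x + y) = T_free q n m p x + T_free q n m p y"
    by (rule free_lin_eqI [OF T_free_lin lin_plus [OF T_free_lin T_free_lin]])
      (simp add: T_free_mon lin_add [OF T_word_lin])
  show "T_free q n m p (scl c x) = scl c (T_free q n m p x)"
    by (rule free_lin_eqI [OF T_free_lin lin_scaled [OF T_free_lin]])
      (simp add: T_free_mon lin_scl [OF T_word_lin])
qed

lemmas T_free_vec =
  lin_zero [OF T_free_lin_vec] lin_add [OF T_free_lin_vec] lin_scl [OF T_free_lin_vec]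
  lin_diff [OF T_free_lin_vec] lin_sum [OF T_free_lin_vec]

lemma T_free_mult: "T_free q n m (x * y) v = T_free q n m x (T_free q n m y v)"
proof -
  have 1: "T_free q n m (mon a * mon b) v = T_free q n m (mon a) (T_free q n m (mon b) v)" for a b
    by (simp add: T_free_mon T_word_append flip: mon_append)
  have "T_free q n m (mon a * y) v = T_free q n m (mon a) (T_free q n m y v)" for a
    by (rule free_lin_eqI [OF lin_comp [OF T_free_lin lin_mult_left [OF lin_ident]]
          lin_comp [OF T_free_lin_vec T_free_lin] 1])
  then show ?thesis
    by (rule free_lin_eqI [OF lin_comp [OF T_free_lin lin_mult_right [OF lin_ident]] T_free_lin])
qed

lemma T_free_single: "T_free q n m p (single i c) = scl c (T_free q n m p (e i))"
  using T_free_vec(3) [of q n m p c "e i"] by simp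

lemma Ssum_upd: "Ssum j (i(k := x)) = (if k \<in> {1..<j} then Ssum j i - i k + x else Ssum j i)"
proof (cases "k \<in> {1..<j}")
  case True
  have "Ssum j f = f k + (\<Sum>l\<in>{1..<j}-{k}. f l)" for f
    unfolding Ssum_def using True by (simp add: sum.remove)
  moreover have "(\<Sum>l\<in>{1..<j}-{k}. (i(k := x)) l) = (\<Sum>l\<in>{1..<j}-{k}. i l)"
    by (rule sum.cong) auto
  ultimately show ?thesis using True by simp
next
  case False
  then show ?thesis by (auto simp: Ssum_def intro!: sum.cong)
qed

lemma Ssum_Suc: "1 \<le> j \<Longrightarrow> Ssum (Suc j) i = Ssum j i + i j"
  by (simp add: Ssum_def)

lemma Ssum_1 [simp]: "Ssum (Suc 0) i = 0"
  by (simp add: Ssum_def)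

context hyperboloid
begin

abbreviation TT :: "fgen free \<Rightarrow> vec \<Rightarrow> vec" where "TT \<equiv> T_free q n m"

abbreviation G :: "fgen set" where "G \<equiv> fgens (n + m)"

definition qi :: "int \<Rightarrow> complex" where "qi k = complex_of_real (q powi k)"

lemma qi_add: "qi (a + b) = qi a * qi b"
  by (simp add: qi_def power_int_add)

lemma qi_nz [simp]: "qi a \<noteq> 0"
  by (simp add: qi_def)

lemma qi_0 [simp]: "qi 0 = 1" and qi_1: "qi 1 = qc" and qi_2: "qi 2 = qc\<^sup>2"
  by (simp_all add: qi_def)

lemma qi_diff: "qi (a - b) = qi a / qi b"
  by (simp add: qi_def power_int_diff)

lemma qi_minus: "qi (- b) = 1 / qi b"
  using qi_diff [of 0 b] by simp

lemma qi_double: "qi (2 * a) = qi a * qi a"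
  using qi_add [of a a] by simp

lemma cnj_qi [simp]: "cnj (qi a) = qi a"
  by (simp add: qi_def)

text \<open>In both branches the radicand is \<open>eps j * (1 - q powi (2 * k))\<close>, so that
  \<open>eps\<close> unifies the computations.\<close>

definition sq :: "nat \<Rightarrow> int \<Rightarrow> complex" where
  "sq j k = complex_of_real (sqrt (if j \<le> n then q powi (2 * k) - 1 else 1 - q powi (2 * k)))"

lemma q_powi_ge_1: "k \<le> 0 \<Longrightarrow> 1 \<le> q powi k"
  using power_int_decreasing [of k 0 q] q_pos q_less_1 by simp

lemma q_powi_le_1: "0 \<le> k \<Longrightarrow> q powi k \<le> 1"
  using power_int_decreasing [of 0 k q] q_pos q_less_1 by simp

lemma q_powi_eq_1: "q powi k = 1 \<longleftrightarrow> k = 0"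
  using power_int_strict_decreasing [of k 0 q] power_int_strict_decreasing [of 0 k q] q_pos q_less_1
  by (cases k "0 :: int" rule: linorder_cases) auto

lemma sq_0 [simp]: "sq j 0 = 0"
  by (simp add: sq_def)

lemma sq_nz: "k \<noteq> 0 \<Longrightarrow> sq j k \<noteq> 0"
  using q_powi_eq_1 [of "2 * k"] by (auto simp: sq_def)

lemma cnj_sq [simp]: "cnj (sq j k) = sq j k"
  by (simp add: sq_def)

text \<open>For a negative argument the real \<open>sqrt\<close> is minus the root of the absolute
  value. On the stated range of k the radicand is nonnegative, and the square has the expected
  sign.\<close>

lemma sq_sq: assumes "if j \<le> n then k \<le> 0 else 0 \<le> k"
  shows "sq j k * sq j k = eps j * (1 - qi k * qi k)"
proof -
  let ?x = "if j \<le> n then q powi (2 * k) - 1 else 1 - q powi (2 * k)"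
  have "0 \<le> ?x"
    using q_powi_ge_1 [of "2 * k"] q_powi_le_1 [of "2 * k"] assms by auto
  then have "sq j k * sq j k = complex_of_real ?x"
    unfolding sq_def of_real_mult [symmetric] by simp
  then show ?thesis
    using qi_double [of k] by (auto simp: eps_def qi_def)
qed

lemma TT_t: "j < n + m \<Longrightarrow> TT (t j) (single i c) =
    single (i(j := i j - 1)) (c * qi (Ssum j i) * sq j (i j - 1))"
  by (simp add: T_free_mon sq_def qi_def mult.assoc)

lemma TT_ts: "j < n + m \<Longrightarrow> TT (ts j) (single i c) =
    single (i(j := i j + 1)) (c * qi (Ssum j i) * sq j (i j))"
  by (simp add: T_free_mon sq_def qi_def mult.assoc)

lemma TT_tN:
  "TT (t (n + m)) (single i c) = single i (c * qi (Ssum (n + m) i))"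
  "TT (ts (n + m)) (single i c) = single i (c * qi (Ssum (n + m) i))"
  using m_ge by (simp_all add: T_free_mon qi_def)

lemma TT_f0: "TT f0 (single i c) =
    (if \<forall>j\<in>{1..n}. i j = 0 then single i c else 0)"
  by (simp add: T_free_mon)

definition supp :: "vec set" where "supp = {v. keys v \<subseteq> idx n m}"

lemma supp_zero [simp]: "0 \<in> supp"
  by (simp add: supp_def)

lemma supp_add: "x \<in> supp \<Longrightarrow> y \<in> supp \<Longrightarrow> x + y \<in> supp"
  using keys_add [of x y] by (auto simp: supp_def)

lemma supp_scl: "x \<in> supp \<Longrightarrow> scl c x \<in> supp"
  by (auto simp: supp_def in_keys_iff)

lemma supp_single [simp]: "i \<in> idx n m \<Longrightarrow> single i c \<in> supp"
  by (simp add: supp_def)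

lemma supp_single': "(c \<noteq> 0 \<Longrightarrow> i \<in> idx n m) \<Longrightarrow> single i c \<in> supp"
  by (cases "c = 0") auto

lemma idx_le: "i \<in> idx n m \<Longrightarrow> 1 \<le> j \<Longrightarrow> j \<le> n \<Longrightarrow> i j \<le> 0"
  and idx_ge: "i \<in> idx n m \<Longrightarrow> n < j \<Longrightarrow> j < n + m \<Longrightarrow> 1 \<le> i j"
  by (auto simp: idx_def)

lemma idx_upd: assumes "i \<in> idx n m" "1 \<le> j" "j < n + m" "if j \<le> n then x \<le> 0 else 1 \<le> x"
  shows "i(j := x) \<in> idx n m"
  using assms by (auto simp: idx_def split: if_splits)

text \<open>A letter can lead out of \<open>idx n m\<close> only from a boundary value of i j, and
  there its coefficient is \<open>sq j 0 = 0\<close>.\<close>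

lemma TT_letter_supp: assumes "g \<in> G" "i \<in> idx n m" shows "TT (mon [g]) (e i) \<in> supp"
proof (cases g)
  case (Gen_t j)
  then have j: "1 \<le> j" "j \<le> n + m" using assms by (auto simp: fgens_def)
  show ?thesis
  proof (cases "j = n + m")
    case False
    then have "i(j := i j - 1) \<in> idx n m" if "sq j (i j - 1) \<noteq> 0"
    proof -
      have "i j - 1 \<noteq> 0" using that by (metis sq_0)
      then show ?thesis
        using j False idx_le [of i j] idx_ge [of i j] assms(2) by (intro idx_upd) auto
    qed
    then show ?thesis
      using False j by (auto simp: Gen_t TT_t intro!: supp_single')
  qed (use assms in \<open>simp add: Gen_t TT_tN\<close>)
next
  case (Gen_ts j)
  then have j: "1 \<le> j" "j \<le> n + m" using assms by (auto simp: fgens_def)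
  show ?thesis
  proof (cases "j = n + m")
    case False
    then have "i(j := i j + 1) \<in> idx n m" if "sq j (i j) \<noteq> 0"
    proof -
      have "i j \<noteq> 0" using that by (metis sq_0)
      then show ?thesis
        using j False idx_le [of i j] idx_ge [of i j] assms(2) by (intro idx_upd) auto
    qed
    then show ?thesis
      using False j by (auto simp: Gen_ts TT_ts intro!: supp_single')
  qed (use assms in \<open>simp add: Gen_ts TT_tN\<close>)
qed (use assms in \<open>auto simp: TT_f0\<close>)

lemma supp_linI:
  assumes "lin f" "v \<in> supp" "\<And>i. i \<in> idx n m \<Longrightarrow> f (e i) \<in> supp"
  shows "f v \<in> supp"
proof (rule poly_mapping_linear_induct [where p = v and P = "\<lambda>v. f v \<in> supp"])
  fix i assume "i \<in> keys v"
  then show "f (e i) \<in> supp" using assms by (auto simp: supp_def)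
qed (use assms(1) in \<open>auto simp: lin_zero lin_add lin_scl intro: supp_add supp_scl\<close>)

lemma TT_supp: assumes "p \<in> carr G" "v \<in> supp" shows "TT p v \<in> supp"
proof -
  have word: "TT (mon w) v \<in> supp" if "set w \<subseteq> G" for w
    using that
  proof (induction w)
    case (Cons g w)
    then have "TT (mon [g]) (TT (mon w) v) \<in> supp"
      by (auto intro: supp_linI [OF T_free_lin_vec [of _ _ _ "mon [g]"]] TT_letter_supp)
    then show ?case by (subst mon_Cons) (simp add: T_free_mult)
  qed (use assms in auto)
  show ?thesis
    by (rule free_linear_induct [where p = p and P = "\<lambda>p. TT p v \<in> supp"])
      (use assms(1) in \<open>auto simp: T_free_linear intro!: supp_add supp_scl word dest: carr_keys\<close>)
qed

text \<open>The induction step of \<open>TT_X\<close>, with y, x, s, a standing for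
  \<open>qi (Ssum j i)\<close>, \<open>qi (i j)\<close>, \<open>sq j (i j)\<close>,
  \<open>eps j\<close>.\<close>

lemma sq_identity:
  fixes s :: complex
  assumes s: "s * s = a * (1 - x * x)" and a: "a * a = 1"
  shows "a * (c * y * s * y * s) + y * x * (y * x) * c = y * y * c"
proof -
  have "a * (c * y * s * y * s) = c * y * y * a * (s * s)" by (simp add: mult_ac)
  also have "\<dots> = c * y * y * (a * a) * (1 - x * x)" by (simp add: s mult_ac)
  finally show ?thesis by (simp add: a algebra_simps)
qed

text \<open>Downward induction on j: the summand for j adds
  \<open>qi (2 * Ssum j i) * (1 - qi (2 * i j))\<close> to the eigenvalue at j + 1, and the sum
  telescopes because \<open>Ssum (j + 1) i = Ssum j i + i j\<close>.\<close>

lemma TT_X: assumes i: "i \<in> idx n m" and "1 \<le> j" "j \<le> n + m"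
  shows "TT (X j) (single i c) = single i (qi (Ssum j i) * qi (Ssum j i) * c)"
  using assms(3) assms(2)
proof (induction rule: inc_induct)
  case base
  then show ?case by (simp add: X_rec T_free_linear T_free_mult TT_tN eps_def mult_ac) (use m_ge in auto)
next
  case (step j)
  then have s: "sq j (i j) * sq j (i j) = eps j * (1 - qi (i j) * qi (i j))"
    using idx_le [OF i, of j] idx_ge [OF i, of j] by (intro sq_sq) auto
  have "TT (X j) (single i c) = scl (eps j) (TT (t j) (TT (ts j) (single i c)))
      + TT (X (Suc j)) (single i c)"
    using step by (subst X_rec) (auto simp: T_free_linear T_free_mult)
  then show ?case
    using step
    by (simp add: TT_t TT_ts Ssum_upd Ssum_Suc qi_add flip: single_add)
      (rule arg_cong [where f = "single i"], rule sq_identity [OF s eps_simps(1)])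
qed

text \<open>The relations restated through \<open>X\<close> and \<open>scl\<close>, as a case rule
  for all later checks on the generators of the ideal. The two families for
  \<open>t i * ts i\<close> merge into \<open>same\<close>, and c = 1 becomes
  \<open>X 1 = 1\<close>.\<close>

lemma fun_rels_cases:
  assumes "r \<in> fun_rels q n m"
  obtains (tt) i j where "1 \<le> i" "i < j" "j \<le> n + m" "r = t i * t j - scl qc (t j * t i)"
  | (tts) i j where "1 \<le> i" "1 \<le> j" "i \<le> n + m" "j \<le> n + m" "i \<noteq> j" "r = t i * ts j - scl qc (ts j * t i)"
  | (same) i where "1 \<le> i" "i \<le> n + m"
      "r = t i * ts i - (ts i * t i + scl (eps i * (1 / qc\<^sup>2 - 1)) (X (i + 1)))"
  | (c) "r = X 1 - 1"
  | (ts_f0) i where "1 \<le> i" "i \<le> n" "r = ts i * f0"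
  | (f0_t) i where "1 \<le> i" "i \<le> n" "r = f0 * t i"
  | (X_f0) "r = X (n + 1) * f0 - f0"
  | (f0_X) "r = f0 * X (n + 1) - f0"
  | (f0_f0) "r = f0 * f0 - f0"
  | (t_f0) i where "n + 1 \<le> i" "i \<le> n + m" "r = t i * f0 - f0 * t i"
  | (ts_f0') i where "n + 1 \<le> i" "i \<le> n + m" "r = ts i * f0 - f0 * ts i"
proof -
  have X1: "X 1 = central_c n m"
    using n_ge X_le_n [of 1] by (simp add: central_c_def)
  have "(\<exists>i j. 1 \<le> i \<and> i < j \<and> j \<le> n + m \<and> r = t i * t j - scl qc (t j * t i))
    \<or> (\<exists>i j. 1 \<le> i \<and> 1 \<le> j \<and> i \<le> n + m \<and> j \<le> n + m \<and> i \<noteq> j \<and> r = t i * ts j - scl qc (ts j * t i))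
    \<or> (\<exists>i. 1 \<le> i \<and> i \<le> n + m \<and> r = t i * ts i - (ts i * t i + scl (eps i * (1 / qc\<^sup>2 - 1)) (X (i + 1))))"
    if hat: "r \<in> hat_rels q n m"
  proof -
    consider (1) i j where "1 \<le> i" "i < j" "j \<le> n + m" "r = t i * t j - rconst q * t j * t i"
      | (2) i j where "1 \<le> i" "1 \<le> j" "i \<le> n + m" "j \<le> n + m" "i \<noteq> j" "r = t i * ts j - rconst q * ts j * t i"
      | (3) i where "n < i" "i \<le> n + m" "r = t i * ts i - (ts i * t i
          + rconst (q powi (-2) - 1) * (\<Sum>k\<in>{i+1..n+m}. t k * ts k))"
      | (4) i where "1 \<le> i" "i \<le> n" "r = t i * ts i - (ts i * t i
          + rconst (q powi (-2) - 1) * (\<Sum>k\<in>{i+1..n}. t k * ts k)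
          - rconst (q powi (-2) - 1) * (\<Sum>k\<in>{n+1..n+m}. t k * ts k))"
      using hat unfolding hat_rels_def Let_def Un_iff mem_Collect_eq
      by (elim disjE exE conjE) (auto simp: Suc_le_eq)
    then show ?thesis
    proof cases
      case 1
      then show ?thesis by (auto simp: const_mult)
    next
      case 2
      then show ?thesis by (auto simp: const_mult)
    next
      case 3
      have "X (i + 1) = (\<Sum>k\<in>{i+1..n+m}. t k * ts k)"
        unfolding X_def using 3 by (intro sum.cong) (auto simp: eps_def)
      then have "r = t i * ts i - (ts i * t i + scl (eps i * (1 / qc\<^sup>2 - 1)) (X (i + 1)))"
        using 3 by (simp add: eps_def const_mult powi_minus2)
      then show ?thesis using 3 by (intro disjI2 exI [of _ i]) auto
    next
      case 4
      have "r = t i * ts i - (ts i * t i + scl (eps i * (1 / qc\<^sup>2 - 1)) (X (i + 1)))"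
        using X_le_n [of "i + 1"] 4
        by (simp add: eps_def const_mult powi_minus2 scl.scale_right_distrib
            scl.scale_right_diff_distrib scl.scale_left_diff_distrib)
      then show ?thesis using 4 by (intro disjI2 exI [of _ i]) auto
    qed
  qed
  note hat = this
  show thesis
  proof (cases "r \<in> hat_rels q n m")
    case True
    show thesis using that(1-3) hat [OF True] by blast
  next
    case False
    then have "r = X 1 - 1 \<or> (\<exists>i. 1 \<le> i \<and> i \<le> n \<and> r = ts i * f0)
      \<or> (\<exists>i. 1 \<le> i \<and> i \<le> n \<and> r = f0 * t i) \<or> r = X (n + 1) * f0 - f0
      \<or> r = f0 * X (n + 1) - f0 \<or> r = f0 * f0 - f0
      \<or> (\<exists>i. n + 1 \<le> i \<and> i \<le> n + m \<and> r = t i * f0 - f0 * t i)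
      \<or> (\<exists>i. n + 1 \<le> i \<and> i \<le> n + m \<and> r = ts i * f0 - f0 * ts i)"
      using assms unfolding fun_rels_def tilde_rels_def X1 X_n1
        Un_iff mem_Collect_eq insert_iff empty_iff atLeastAtMost_iff
      by blast
    then show thesis using that(4-) by blast
  qed
qed

lemma fun_rels_carr: "fun_rels q n m \<subseteq> carr G"
proof
  have G: "Gen_t i \<in> G" "Gen_ts i \<in> G" if "1 \<le> i" "i \<le> n + m" for i
    using that by (auto simp: fgens_def)
  have "Gen_f0 \<in> G" by (simp add: fgens_def)
  moreover have "X i \<in> carr G" if "1 \<le> i" for i
    unfolding X_def using that G by (intro carr_sum carr_scl carr_mult) auto
  moreover note m_ge
  moreover fix r assume "r \<in> fun_rels q n m"
  ultimately show "r \<in> carr G"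
    using G by (elim fun_rels_cases) (auto intro!: carr_add carr_diff carr_mult carr_scl)
qed

lemma star_letter_G: "star_letter g \<in> G \<longleftrightarrow> g \<in> G"
  by (cases g) (auto simp: fgens_def)

lemma free_star_carr: "p \<in> carr G \<Longrightarrow> free_star p \<in> carr G"
  by (rule free_linear_induct [where p = p and P = "\<lambda>p. free_star p \<in> carr G"])
    (auto simp: free_star_simps free_star_mon star_letter_G dest: carr_keys [THEN subsetD])

lemma rels_carr: "rels \<subseteq> carr G"
  using fun_rels_carr free_star_carr by (auto simp: rels_def)

lemma fun_ideal_eq: "fun_ideal q n m = tsi rels \<inter> carr G"
  using genideal_free_algebra [OF rels_carr] by (simp add: fun_ideal_def rels_def)

text \<open>The scalar content of the relation \<open>same\<close>, with z = q^2.\<close>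

lemma sq_identity':
  fixes s :: complex
  assumes s: "s * s = a * (1 - x * x)" "s' * s' = a * (1 - x * x / z)"
  shows "y * s * y * s - (y * s' * y * s' + a * (1 / z - 1) * (y * x * (y * x))) = 0"
proof -
  have "y * s * y * s = y * y * (s * s)" "y * s' * y * s' = y * y * (s' * s')"
    by (simp_all add: mult_ac)
  then show ?thesis by (simp add: s algebra_simps)
qed

lemma TT_fun_rels: assumes "r \<in> fun_rels q n m" "i \<in> idx n m" shows "TT r (e i) = 0"
proof -
  have s1: "sq j (i j) * sq j (i j) = eps j * (1 - qi (i j) * qi (i j))"
    "sq j (i j - 1) * sq j (i j - 1) = eps j * (1 - qi (i j) * qi (i j) / qc\<^sup>2)"
    if "1 \<le> j" "j < n + m" for j
    using that idx_le [of i j] idx_ge [of i j] sq_sq [of j "i j"] sq_sq [of j "i j - 1"] assms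
    by (cases "j \<le> n"; simp add: qi_diff qi_1 power2_eq_square)+
  have tsf0: "TT (ts k * f0) (e i) = 0" if "1 \<le> k" "k \<le> n" for k
    using that m_ge by (auto simp: T_free_mult TT_f0 TT_ts T_free_vec)
  have Xf0: "TT (X (n + 1)) (e i) = e i" if "\<forall>j\<in>{1..n}. i j = 0"
  proof -
    have "Ssum (n + 1) i = 0" unfolding Ssum_def using that by (intro sum.neutral) auto
    then show ?thesis using m_ge assms by (subst TT_X) auto
  qed
  show ?thesis
    using assms(1)
  proof (cases rule: fun_rels_cases)
    case (tt k j)
    show ?thesis
      unfolding tt(4) using tt(1-3) m_ge
      by (cases "j = n + m")
        (auto simp: T_free_linear T_free_mult TT_t TT_tN Ssum_upd qi_diff qi_1 mult_ac fun_upd_twist)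
  next
    case (tts k j)
    show ?thesis
      unfolding tts(6) using tts(1-5) m_ge
      by (cases "j = n + m"; cases "k = n + m"; cases "k < j")
        (auto simp: T_free_linear T_free_mult TT_t TT_ts TT_tN Ssum_upd qi_diff qi_add qi_1 mult_ac
            fun_upd_twist)
  next
    case (same k)
    show ?thesis
    proof (cases "k = n + m")
      case True
      then show ?thesis using same by (simp add: T_free_linear T_free_mult TT_tN)
    next
      case False
      then have k: "k < n + m" "k + 1 \<le> n + m" using same by auto
      show ?thesis
        unfolding same(3) using k same(1-2) assms(2)
        by (simp add: T_free_linear T_free_mult TT_t TT_ts Ssum_upd TT_X Ssum_Suc qi_add
              sq_identity' [OF s1 [of k]] flip: single_add single_diff)
    qed
  next
    case c
    then show ?thesis using assms m_ge by (simp add: T_free_linear TT_X)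
  next
    case (ts_f0 k)
    then show ?thesis using tsf0 by simp
  next
    case (f0_t k)
    then show ?thesis using m_ge assms idx_le [of i k]
      by (auto simp: T_free_mult TT_f0 TT_t intro!: exI [of _ k])
  next
    case X_f0
    then show ?thesis using Xf0 by (auto simp: T_free_linear T_free_mult TT_f0 T_free_vec)
  next
    case f0_X
    then show ?thesis using Xf0 m_ge assms by (auto simp: T_free_linear T_free_mult TT_f0 TT_X)
  next
    case f0_f0
    then show ?thesis by (auto simp: T_free_linear T_free_mult TT_f0 T_free_vec)
  next
    case (t_f0 k)
    then show ?thesis
      by (cases "k = n + m") (auto simp: T_free_linear T_free_mult TT_f0 TT_t TT_tN T_free_vec)
  next
    case (ts_f0' k)
    then show ?thesis
      by (cases "k = n + m") (auto simp: T_free_linear T_free_mult TT_f0 TT_ts TT_tN T_free_vec)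
  qed
qed

lemma TT_letter_adjoint: assumes "g \<in> G" "i \<in> idx n m" "k \<in> idx n m"
  shows "lookup (TT (mon [g]) (e i)) k =
    cnj (lookup (TT (mon [star_letter g]) (e k)) i)"
proof -
  have eq: "i(j := i j + 1) = k \<longleftrightarrow> i = k(j := k j - 1)" for i k :: "nat \<Rightarrow> int" and j
    by (auto simp: fun_eq_iff)
  have *: "lookup (TT (t j) (e i)) k = cnj (lookup (TT (ts j) (e k)) i)"
    if "j \<le> n + m" for i k j
  proof (cases "j = n + m")
    case False
    then show ?thesis
      using that eq [of k j i] by (auto simp: TT_t TT_ts lookup_single when_def Ssum_upd)
  qed (auto simp: TT_tN lookup_single when_def)
  show ?thesis
  proof (cases g)
    case (Gen_t j)
    then show ?thesis using * [of j i k] assms by (auto simp: fgens_def)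
  next
    case (Gen_ts j)
    then show ?thesis using * [of j k i] assms by (auto simp: fgens_def)
  qed (auto simp: TT_f0 lookup_single when_def)
qed

text \<open>Adjointness of the letters extends to words because both sides are the same matrix
  product, summed over the intermediate indices.\<close>

lemma TT_adjoint: assumes "p \<in> carr G" "i \<in> idx n m" "k \<in> idx n m"
  shows "lookup (TT p (e i)) k = cnj (lookup (TT (free_star p) (e k)) i)"
proof -
  have word: "lookup (TT (mon w) (e i)) k =
      cnj (lookup (TT (free_star (mon w)) (e k)) i)" if "set w \<subseteq> G" "k \<in> idx n m" for w k
    using that
  proof (induction w arbitrary: k)
    case Nil
    then show ?case by (simp add: lookup_single when_def)
  next
    case (Cons g w)
    let ?u = "TT (mon w) (e i)" and ?v = "TT (mon [star_letter g]) (e k)"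
    \<comment> \<open>A finite set containing the supports of both vectors, so that
      \<open>lookup_lin\<close> applies from either end of the product.\<close>
    let ?A = "keys ?u \<union> keys ?v"
    have g: "g \<in> G" and w: "set w \<subseteq> G" using Cons.prems by auto
    have "?u \<in> supp" "?v \<in> supp"
      using TT_supp [of "mon w" "e i"] TT_letter_supp [of "star_letter g" k] g w Cons.prems assms(2)
      by (auto simp: star_letter_G)
    then have A: "?A \<subseteq> idx n m" by (auto simp: supp_def)
    have "lookup (TT (mon (g # w)) (e i)) k = lookup (TT (mon [g]) ?u) k"
      by (subst mon_Cons) (simp add: T_free_mult)
    also have "\<dots> = (\<Sum>l\<in>?A. lookup ?u l * lookup (TT (mon [g]) (e l)) k)"
      by (rule lookup_lin [OF T_free_lin_vec]) auto
    also have "\<dots> = (\<Sum>l\<in>?A. cnj (lookup ?v l *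
        lookup (TT (free_star (mon w)) (e l)) i))"
    proof (rule sum.cong)
      fix l assume "l \<in> ?A"
      then have "l \<in> idx n m" using A by auto
      then show "lookup ?u l * lookup (TT (mon [g]) (e l)) k =
        cnj (lookup ?v l * lookup (TT (free_star (mon w)) (e l)) i)"
        using Cons.IH [OF w, of l] TT_letter_adjoint [OF g, of l k] Cons.prems by simp
    qed simp
    also have "\<dots> = cnj (lookup (TT (free_star (mon w)) ?v) i)"
      unfolding cnj_sum [symmetric]
      by (rule arg_cong [where f = cnj], rule lookup_lin [OF T_free_lin_vec, symmetric]) auto
    also have "TT (free_star (mon w)) ?v = TT (free_star (mon (g # w))) (e k)"
      by (subst mon_Cons [of g w]) (simp add: free_star_mult T_free_mult free_star_mon [of "[g]"])
    finally show ?case .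
  qed
  show ?thesis
    by (rule free_linear_induct [where p = p and P = "\<lambda>p. lookup (TT p (e i)) k =
          cnj (lookup (TT (free_star p) (e k)) i)"])
      (use assms in \<open>auto simp: T_free_linear free_star_simps lookup_add word dest: carr_keys\<close>)
qed

text \<open>The matrix elements of an adjoint relation are conjugates of those of the relation
  itself, by \<open>TT_adjoint\<close>.\<close>

lemma TT_rels: assumes "r \<in> rels" "v \<in> supp" shows "TT r v = 0"
proof -
  have basis: "TT r v = 0" if "\<And>i. i \<in> idx n m \<Longrightarrow> TT r (e i) = 0" "v \<in> supp" for r v
    by (rule lin_eqI [OF T_free_lin_vec, of "\<lambda>_. 0"]) (use that in \<open>auto simp: lin_def supp_def\<close>)
  show ?thesis
  proof (cases "r \<in> fun_rels q n m")
    case True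
    then show ?thesis using assms basis TT_fun_rels by blast
  next
    case False
    then obtain s where s: "s \<in> fun_rels q n m" "r = free_star s"
      using assms by (auto simp: rels_def)
    have r: "r \<in> carr G" using rels_carr assms by auto
    have "TT r (e i) = 0" if "i \<in> idx n m" for i
    proof (rule poly_mapping_eqI)
      fix k
      have "TT r (e i) \<in> supp" using r that by (intro TT_supp) auto
      then show "lookup (TT r (e i)) k = lookup 0 k"
        using TT_adjoint [OF r that, of k] s TT_fun_rels [OF s(1), of k]
        by (cases "k \<in> idx n m") (auto simp: supp_def in_keys_iff)
    qed
    then show ?thesis using basis assms by blast
  qed
qed

lemma TT_cong: assumes "p \<approx> p'" "p \<in> carr G" "p' \<in> carr G" "v \<in> supp"
  shows "TT p v = TT p' v"
proof -
  \<comment> \<open>\<open>tsi rels\<close> also contains multiples by letters outside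
    \<open>G\<close>, for which \<open>TT\<close> need not preserve \<open>supp\<close>;
    \<open>restr G\<close> removes them.\<close>
  have "\<forall>v\<in>supp. TT (restr G x) v = 0" if "x \<in> tsi rels" for x
    using that
  proof induction
    case (gen x)
    then show ?case using rels_carr TT_rels by (auto simp: restr_carr)
  qed (auto simp: lin_zero [OF restr_lin] lin_add [OF restr_lin] T_free_linear restr_mult T_free_mult
      T_free_vec intro!: TT_supp restr_in_carr)
  then have "TT (restr G (p - p')) v = 0" using assms by (auto simp: cong_def)
  then show ?thesis using assms by (simp add: restr_carr T_free_linear lin_diff [OF restr_lin])
qed

end


section \<open>Diagonal automorphisms\<close>

text \<open>The gauge automorphisms and the actions of \<open>K j\<close> and its inverse are all of
  this form.\<close>

definition dia :: "('g \<Rightarrow> complex) \<Rightarrow> 'g free \<Rightarrow> 'g free" where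
  "dia c = lin_ext (\<lambda>w. single w (prod_list (map c (letters w))))"

lemma dia_lin: "lin (dia c)"
  by (simp add: dia_def lin_ext_lin)

lemmas dia_linear = lin_zero [OF dia_lin] lin_add [OF dia_lin] lin_scl [OF dia_lin]
  lin_diff [OF dia_lin] lin_sum [OF dia_lin] lin_minus [OF dia_lin]

lemma dia_mon: "dia c (mon w) = scl (prod_list (map c w)) (mon w)"
  by (simp add: dia_def mon_def)

lemma dia_one [simp]: "dia c 1 = 1"
  using dia_mon [of c "[]"] by simp

lemma dia_mult: "dia c (x * y) = dia c x * dia c y"
proof -
  have 1: "dia c (mon v * mon w) = dia c (mon v) * dia c (mon w)" for v w
    by (simp only: dia_mon flip: mon_append) (simp add: mon_append mult.commute)
  have "dia c (mon v * y) = dia c (mon v) * dia c y" for v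
    by (rule free_lin_eqI [OF lin_comp [OF dia_lin lin_mult_left [OF lin_ident]]
          lin_mult_left [OF dia_lin] 1])
  then show ?thesis
    by (rule free_lin_eqI [OF lin_comp [OF dia_lin lin_mult_right [OF lin_ident]]
          lin_mult_right [OF dia_lin]])
qed

lemma dia_carr: "p \<in> carr H \<Longrightarrow> dia c p \<in> carr H"
  by (rule free_linear_induct [where p = p and P = "\<lambda>p. dia c p \<in> carr H"])
    (auto simp: dia_linear dia_mon intro!: carr_scl dest: carr_keys [THEN subsetD])

lemma dia_free_star: "dia c (free_star p) = free_star (dia (\<lambda>g. cnj (c (star_letter g))) p)"
proof -
  have "(\<Prod>g\<leftarrow>w. cnj (c (star_letter g))) = cnj (prod_list (map c (map star_letter w)))" for w
    by (induction w) auto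
  then have "dia c (free_star (mon w)) = free_star (dia (\<lambda>g. cnj (c (star_letter g))) (mon w))" for w
    by (simp add: free_star_mon dia_mon free_star_scl prod_list.rev flip: rev_map)
  then show ?thesis
    by (intro free_linear_induct [where p = p and P = "\<lambda>p. dia c (free_star p) =
          free_star (dia (\<lambda>g. cnj (c (star_letter g))) p)"])
      (auto simp: dia_linear free_star_simps)
qed

lemma gauge_dia: "gauge \<phi> = dia (gauge_letter \<phi>)"
  by (simp add: gauge_def dia_def)

context hyperboloid
begin

text \<open>Since \<open>c (Gen_t i) * c (Gen_ts i) = 1\<close>, every \<open>X i\<close> is fixed,
  and each relation is multiplied by a single scalar. For the adjoint relations, the conjugated
  scalars satisfy the same constraints.\<close>

lemma dia_rels:
  assumes c: "\<And>i. c (Gen_t i) * c (Gen_ts i) = 1" "c Gen_f0 = 1" and x: "x \<in> tsi rels"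
  shows "dia c x \<in> tsi rels"
proof -
  have rel: "dia c r \<approx> 0" if r: "r \<in> fun_rels q n m"
    and c: "\<And>i. c (Gen_t i) * c (Gen_ts i) = 1" "c Gen_f0 = 1" for r c
  proof -
    have X: "dia c (X i) = X i" for i
      unfolding X_def dia_linear by (rule sum.cong) (auto simp: dia_linear dia_mult dia_mon c mult.commute)
    have "\<exists>z. dia c r = scl z r"
      using r
    proof (cases rule: fun_rels_cases)
      case (tt i j)
      then show ?thesis
        by (intro exI [of _ "c (Gen_t i) * c (Gen_t j)"])
          (simp add: dia_linear dia_mult dia_mon scl.scale_right_diff_distrib mult_ac)
    next
      case (tts i j)
      then show ?thesis
        by (intro exI [of _ "c (Gen_t i) * c (Gen_ts j)"])
          (simp add: dia_linear dia_mult dia_mon scl.scale_right_diff_distrib mult_ac)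
    next
      case (same i)
      then show ?thesis using c(1) [of i]
        by (intro exI [of _ 1]) (simp add: dia_linear dia_mult dia_mon X mult.commute)
    next
      case (ts_f0 i)
      then show ?thesis by (intro exI [of _ "c (Gen_ts i)"]) (simp add: dia_mult dia_mon c)
    next
      case (f0_t i)
      then show ?thesis by (intro exI [of _ "c (Gen_t i)"]) (simp add: dia_mult dia_mon c)
    next
      case (t_f0 i)
      then show ?thesis by (intro exI [of _ "c (Gen_t i)"])
        (simp add: dia_mult dia_mon dia_linear c scl.scale_right_diff_distrib)
    next
      case (ts_f0' i)
      then show ?thesis by (intro exI [of _ "c (Gen_ts i)"])
        (simp add: dia_mult dia_mon dia_linear c scl.scale_right_diff_distrib)
    qed (auto intro!: exI [of _ 1] simp: dia_linear dia_mult dia_mon X c)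
    moreover have "r \<approx> 0" using r by (auto simp: cong_0_iff rels_def intro: tsi.gen)
    ultimately show ?thesis using cong_scl [of r 0] by auto
  qed
  show ?thesis
    using x
  proof induction
    case (gen x)
    show ?case
    proof (cases "x \<in> fun_rels q n m")
      case True
      then show ?thesis using rel c by (simp add: cong_0_iff)
    next
      case False
      then obtain r where r: "r \<in> fun_rels q n m" "x = free_star r"
        using gen by (auto simp: rels_def)
      have "cnj (c (star_letter (Gen_t i))) * cnj (c (star_letter (Gen_ts i))) = 1" for i
        using arg_cong [OF c(1) [of i], of cnj] by (simp add: mult.commute)
      then have "dia (\<lambda>g. cnj (c (star_letter g))) r \<approx> 0"
        using r c by (intro rel) auto
      from cong_free_star [OF this] show ?thesis by (simp add: r dia_free_star cong_0_iff)
    qed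
  qed (auto simp: dia_linear dia_mult intro: tsi.intros)
qed


section \<open>The action\<close>

definition act1 :: "ugen \<Rightarrow> fgen free \<Rightarrow> fgen free" where
  "act1 u = lin_ext (\<lambda>w. act_word q n (letters w) u)"

abbreviation aE :: "nat \<Rightarrow> fgen free \<Rightarrow> fgen free" where "aE j \<equiv> act1 (Gen_E j)"
abbreviation aF :: "nat \<Rightarrow> fgen free \<Rightarrow> fgen free" where "aF j \<equiv> act1 (Gen_F j)"
abbreviation aK :: "nat \<Rightarrow> fgen free \<Rightarrow> fgen free" where "aK j \<equiv> act1 (Gen_K j)"
abbreviation aKi :: "nat \<Rightarrow> fgen free \<Rightarrow> fgen free" where "aKi j \<equiv> act1 (Gen_Kinv j)"

lemma act1_lin: "lin (act1 u)"
  by (simp add: act1_def lin_ext_lin)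

lemmas act1_linear = lin_zero [OF act1_lin] lin_add [OF act1_lin] lin_scl [OF act1_lin]
  lin_diff [OF act1_lin] lin_sum [OF act1_lin] lin_minus [OF act1_lin]

lemma act1_mon: "act1 u (mon w) = act_word q n w u"
  by (simp add: act1_def)

lemma act1_one: "act1 u 1 = const (counit_letter u)"
  using act1_mon [of u "[]"] by simp

lemma act_letter_K: "act_letter q n (Gen_K j) g = scl (qi (K_weight j g)) (mon [g])"
  "act_letter q n (Gen_Kinv j) g = scl (qi (- K_weight j g)) (mon [g])"
  by (simp_all add: const_mult qi_def)

lemma aK_dia: "aK j = dia (\<lambda>g. qi (K_weight j g))" and aKi_dia: "aKi j = dia (\<lambda>g. qi (- K_weight j g))"
proof -
  have "aK j (mon w) = dia (\<lambda>g. qi (K_weight j g)) (mon w)" for w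
    by (induction w)
      (simp_all add: act1_mon act1_one act_letter_K dia_mon mult.commute flip: mon_Cons del: act_letter.simps)
  then show "aK j = dia (\<lambda>g. qi (K_weight j g))"
    by (intro ext, rule free_lin_eqI [OF act1_lin dia_lin])
  have "aKi j (mon w) = dia (\<lambda>g. qi (- K_weight j g)) (mon w)" for w
    by (induction w)
      (simp_all add: act1_mon act1_one act_letter_K dia_mon mult.commute flip: mon_Cons del: act_letter.simps)
  then show "aKi j = dia (\<lambda>g. qi (- K_weight j g))"
    by (intro ext, rule free_lin_eqI [OF act1_lin dia_lin])
qed

lemma aK_mult: "aK j (x * y) = aK j x * aK j y" "aKi j (x * y) = aKi j x * aKi j y"
  by (simp_all add: aK_dia aKi_dia dia_mult)

lemma aK_one [simp]: "aK j 1 = 1" "aKi j 1 = 1" "aE j 1 = 0" "aF j 1 = 0"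
  by (simp_all add: act1_one)

lemma act1_letter: "act1 u (mon [g]) = act_letter q n u g"
  by (cases u) (simp_all add: act1_mon del: act_letter.simps)

text \<open>\<open>act_word\<close> splits off only the first letter. For arbitrary factors the
  twists of the single letters combine because \<open>aK\<close> is multiplicative.\<close>

lemma aE_mult: "aE j (x * y) = aE j x * y + aK j x * aE j y"
proof -
  have 1: "aE j (mon v * mon w) = aE j (mon v) * mon w + aK j (mon v) * aE j (mon w)" for v w
  proof (induction v)
    case (Cons g v)
    have "aE j (mon (g # v) * mon w) = act_letter q n (Gen_E j) g * (mon v * mon w) +
        act_letter q n (Gen_K j) g * aE j (mon v * mon w)"
      by (simp add: act1_mon del: act_letter.simps flip: mon_append)
    moreover have "aE j (mon (g # v)) = act_letter q n (Gen_E j) g * mon v +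
        act_letter q n (Gen_K j) g * aE j (mon v)"
      by (simp add: act1_mon del: act_letter.simps)
    moreover have "aK j (mon (g # v)) = act_letter q n (Gen_K j) g * aK j (mon v)"
      by (simp add: act1_mon del: act_letter.simps)
    ultimately show ?case by (simp add: Cons.IH algebra_simps del: act_letter.simps)
  qed simp
  have "aE j (mon v * y) = aE j (mon v) * y + aK j (mon v) * aE j y" for v
    by (rule free_lin_eqI [OF lin_comp [OF act1_lin lin_mult_left [OF lin_ident]]
          lin_plus [OF lin_mult_left [OF lin_ident] lin_mult_left [OF act1_lin]] 1])
  then show ?thesis
    by (rule free_lin_eqI [OF lin_comp [OF act1_lin lin_mult_right [OF lin_ident]]
          lin_plus [OF lin_mult_right [OF act1_lin] lin_mult_right [OF act1_lin]]])
qed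

lemma aF_mult: "aF j (x * y) = aF j x * aKi j y + x * aF j y"
proof -
  have 1: "aF j (mon v * mon w) = aF j (mon v) * aKi j (mon w) + mon v * aF j (mon w)" for v w
  proof (induction v)
    case (Cons g v)
    have "aF j (mon (g # v) * mon w) = act_letter q n (Gen_F j) g * aKi j (mon v * mon w) +
        mon [g] * aF j (mon v * mon w)"
      by (simp add: act1_mon del: act_letter.simps flip: mon_append)
    moreover have "aF j (mon (g # v)) = act_letter q n (Gen_F j) g * aKi j (mon v) + mon [g] * aF j (mon v)"
      by (simp add: act1_mon del: act_letter.simps)
    ultimately show ?case
      by (subst mon_Cons [of g v]) (simp add: Cons.IH aK_mult algebra_simps del: act_letter.simps)
  qed simp
  have "aF j (mon v * y) = aF j (mon v) * aKi j y + mon v * aF j y" for v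
    by (rule free_lin_eqI [OF lin_comp [OF act1_lin lin_mult_left [OF lin_ident]]
          lin_plus [OF lin_mult_left [OF act1_lin] lin_mult_left [OF act1_lin]] 1])
  then show ?thesis
    by (rule free_lin_eqI [OF lin_comp [OF act1_lin lin_mult_right [OF lin_ident]]
          lin_plus [OF lin_mult_right [OF act1_lin] lin_mult_right [OF lin_ident]]])
qed

lemma qc_div_h: "qc / h = h"
  by (simp add: divide_eq_eq)

lemma qc2_div_h: "qc\<^sup>2 / h = h * qc" "qc\<^sup>2 / (h * qc) = h"
  using qc_div_h by (simp_all add: power2_eq_square) (metis times_divide_eq_left)

lemma h_powr:
  "complex_of_real (q powr - (1 / 2)) = 1 / h" "complex_of_real (q powr - (3 / 2)) = 1 / (h * qc)"
  "complex_of_real (q powr (1 / 2)) = h" "complex_of_real (q powr (3 / 2)) = h * qc"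
proof -
  have 1: "q powr (1 / 2) = sqrt q" using q_pos by (simp add: powr_half_sqrt)
  have "q powr (3 / 2) = q powr (1 / 2 + 1)" by simp
  then have 3: "q powr (3 / 2) = sqrt q * q" unfolding powr_add using q_pos 1 by simp
  show "complex_of_real (q powr (1 / 2)) = h" "complex_of_real (q powr (3 / 2)) = h * qc"
    using 1 3 by (simp_all add: h_def)
  show "complex_of_real (q powr - (1 / 2)) = 1 / h" "complex_of_real (q powr - (3 / 2)) = 1 / (h * qc)"
    using powr_minus_divide [of q "1 / 2"] powr_minus_divide [of q "3 / 2"] 1 3 by (simp_all add: h_def)
qed

text \<open>The coefficient in \<open>aE_f0\<close>; the same constant normalises the intertwining
  operator \<open>EE\<close>.\<close>

definition C :: complex where "C = - (1 / h) / (1 / qc\<^sup>2 - 1)"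

text \<open>Cancels the terms that \<open>E n\<close> produces from the relations of
  \<open>f0\<close>. Written as C - C / q^2 = 1 / h, it also gives the intertwining property of
  \<open>EE\<close> on \<open>t (j + 1)\<close> and \<open>ts j\<close>.\<close>

lemma C_eq: "C / qc\<^sup>2 = C - 1 / h"
proof -
  have "1 / qc\<^sup>2 - 1 \<noteq> 0" by (simp add: field_simps)
  then have "C * (1 / qc\<^sup>2 - 1) = - (1 / h)" by (simp add: C_def)
  then have "C / qc\<^sup>2 - C = - (1 / h)" by (simp add: right_diff_distrib)
  then show ?thesis by (simp add: diff_eq_eq)
qed

lemma aE_t: "aE j (t i) = (if i = j + 1 then scl (1 / h) (t j) else 0)"
  by (simp add: act1_letter h_powr const_mult)

lemma aE_ts: "aE j (ts i) = (if i = j then scl (- (eps j * eps (Suc j)) / (h * qc)) (ts (j + 1)) else 0)"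
  by (auto simp add: act1_letter h_powr const_mult eps_def)

lemma aE_f0: "aE j f0 = (if j = n then scl C (t n * f0 * ts (n + 1)) else 0)"
  by (simp add: act1_letter h_powr const_mult C_def powi_minus2 flip: scl.scale_minus_left)

lemma aF_t: "aF j (t i) = (if i = j then scl h (t (j + 1)) else 0)"
  by (simp add: act1_letter h_powr const_mult)

lemma aF_ts: "aF j (ts i) = (if i = j + 1 then scl (- (eps j * eps (Suc j)) * (h * qc)) (ts j) else 0)"
  by (auto simp add: act1_letter h_powr const_mult eps_def)

lemma aF_f0: "aF j f0 = (if j = n then scl (C * qc\<^sup>2) (t (n + 1) * f0 * ts n) else 0)"
proof -
  have "complex_of_real (- (q powr (3/2) / (q powi (-2) - 1))) = C * qc\<^sup>2"
  proof -
    have "complex_of_real (- (q powr (3/2) / (q powi (-2) - 1))) = - (h * qc) / (1 / qc\<^sup>2 - 1)"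
      by (simp add: h_powr powi_minus2)
    also have "h * qc = (1 / h) * qc\<^sup>2"
      by (simp add: qc2_div_h)
    finally show ?thesis by (simp add: C_def)
  qed
  then show ?thesis by (simp add: act1_letter const_mult del: of_real_minus of_real_divide of_real_diff)
qed

lemma aK_t: "aK j (t i) = scl (if i = j then qc else if i = j + 1 then 1 / qc else 1) (t i)"
  and aK_ts: "aK j (ts i) = scl (if i = j then 1 / qc else if i = j + 1 then qc else 1) (ts i)"
  and aK_f0: "aK j f0 = f0" "aKi j f0 = f0"
  and aKi_t: "aKi j (t i) = scl (if i = j then 1 / qc else if i = j + 1 then qc else 1) (t i)"
  and aKi_ts: "aKi j (ts i) = scl (if i = j then qc else if i = j + 1 then 1 / qc else 1) (ts i)"
  by (auto simp: aK_dia aKi_dia dia_mon qi_1 qi_minus)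

lemmas act1_gens = aE_t aE_ts aE_f0 aK_t aK_ts aK_f0 aKi_t aKi_ts aF_t aF_ts aF_f0

lemma aK_rels: "x \<in> tsi rels \<Longrightarrow> aK j x \<in> tsi rels"
  unfolding aK_dia by (rule dia_rels) (auto simp: qi_1 qi_minus)

lemma aKi_rels: "x \<in> tsi rels \<Longrightarrow> aKi j x \<in> tsi rels"
  unfolding aKi_dia by (rule dia_rels) (auto simp: qi_1 qi_minus)

text \<open>This is the rule (a f)^* = S(a)^* f^* for a = E_j, since S(E_j)^* is a multiple of F_j
  by q^(-2) and a sign. The sign \<open>eps j * eps (Suc j)\<close> is -1 only for j = n, where
  E_n^* = -K_n F_n. Facts about \<open>aF\<close> are deduced from those about \<open>aE\<close> in
  this way.\<close>

lemma aF_star: "aF j p = scl (- (eps j * eps (Suc j)) * qc\<^sup>2) (free_star (aE j (free_star p)))"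
proof -
  let ?z = "- (eps j * eps (Suc j)) * qc\<^sup>2"
  have Kstar: "free_star (aK j (free_star p)) = aKi j p" for p
  proof -
    have "cnj (qi (K_weight j (star_letter g))) = qi (- K_weight j g)" for g
      by (cases g) auto
    then show ?thesis by (simp add: aK_dia aKi_dia dia_free_star)
  qed
  have cnj: "cnj h = h" "cnj C = C"
    by (simp_all add: h_def C_def)
  have letter: "aF j (mon [g]) = scl ?z (free_star (aE j (free_star (mon [g]))))" for g
  proof (cases g)
    case (Gen_t i)
    have "?z * (- (eps j * eps (Suc j)) / (h * qc)) = h"
      using qc2_div_h(2) by (auto simp: eps_def)
    moreover have "free_star (aE j (free_star (t i))) =
        (if i = j then scl (- (eps j * eps (Suc j)) / (h * qc)) (t (Suc j)) else 0)"
      by (simp add: act1_gens free_star_simps cnj)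
    ultimately show ?thesis unfolding Gen_t aF_t
      by (cases "i = j") (simp_all only: simp_thms if_True if_False scl.scale_scale scl.scale_zero_right Suc_eq_plus1)
  next
    case (Gen_ts i)
    have "?z * (1 / h) = - (eps j * eps (Suc j)) * (h * qc)"
      using qc2_div_h(1) by (auto simp: eps_def)
    moreover have "free_star (aE j (free_star (ts i))) = (if i = j + 1 then scl (1 / h) (ts j) else 0)"
      by (simp add: act1_gens free_star_simps cnj)
    ultimately show ?thesis unfolding Gen_ts aF_ts
      by (cases "i = j + 1") (simp_all only: simp_thms if_True if_False scl.scale_scale scl.scale_zero_right Suc_eq_plus1)
  next
    case Gen_f0
    have "j = n \<Longrightarrow> eps j * eps (Suc j) = - 1" by (simp add: eps_def)
    then show ?thesis using Gen_f0
      by (auto simp: act1_gens free_star_simps cnj simp flip: mult.assoc)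
  qed
  have "aF j (mon w) = scl ?z (free_star (aE j (free_star (mon w))))" for w
  proof (induction w)
    case (Cons g w)
    have "aF j (mon (g # w)) = scl ?z (free_star (aE j (free_star (mon [g])))) * aKi j (mon w)
      + mon [g] * scl ?z (free_star (aE j (free_star (mon w))))"
      by (subst mon_Cons) (simp only: aF_mult letter Cons.IH)
    moreover have "free_star (aE j (free_star (mon (g # w)))) = mon [g] * free_star (aE j (free_star (mon w)))
      + free_star (aE j (free_star (mon [g]))) * aKi j (mon w)"
      by (subst mon_Cons) (simp add: free_star_simps aE_mult Kstar)
    ultimately show ?case by (simp add: scl.scale_right_distrib add.commute)
  qed simp
  moreover have "cnj ?z = ?z" by simp
  ultimately show ?thesis
    by (intro free_linear_induct [where p = p and P = "\<lambda>p. aF j p = scl ?z (free_star (aE j (free_star p)))"])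
      (auto simp: act1_linear free_star_simps scl.scale_right_distrib mult.commute)
qed

end


text \<open>Serves \<open>aE_tts\<close>, with \<open>A\<close>, \<open>B\<close>, \<open>D\<close>
  for \<open>X j\<close>, \<open>X (j + 1)\<close>, \<open>X (j + 2)\<close> and w, z for
  \<open>h\<close>, q^2. Keeping the elements abstract reduces it to an identity between
  coefficients.\<close>

lemma tts_identity:
  fixes A B D :: "'a \<Rightarrow>\<^sub>0 complex" and u v w z :: complex
  assumes "v * v = 1"
  shows "scl (1 / w) (scl u (A - B) - scl u (A - scl (1 / z) B)) - scl (u * v / (w * z)) (scl v (B - D))
    + scl (u * v / w) (scl v (B - scl (1 / z) D)) = 0"
proof (rule poly_mapping_eqI)
  have "1 / w * (u * (a - b) - u * (a - 1 / z * b)) - u * v / (w * z) * (v * (b - c))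
      + u * v / w * (v * (b - 1 / z * c)) = 0" for a b c
  proof -
    have eq: "u * v / (w * z) * (v * (b - c)) = (v * v) * (u / (w * z) * (b - c))"
      "u * v / w * (v * (b - 1 / z * c)) = (v * v) * (u / w * (b - 1 / z * c))"
      by (simp_all add: mult_ac)
    show ?thesis unfolding eq assms by (simp add: divide_inverse algebra_simps)
  qed
  then show "lookup (scl (1 / w) (scl u (A - B) - scl u (A - scl (1 / z) B))
      - scl (u * v / (w * z)) (scl v (B - D)) + scl (u * v / w) (scl v (B - scl (1 / z) D))) k =
    lookup 0 k" for k
    by (simp only: lookup_add lookup_minus lookup_scl lookup_zero)
qed

context hyperboloid
begin

lemma cong_zero_scl: "a = scl c b \<Longrightarrow> b \<approx> 0 \<Longrightarrow> a \<approx> 0"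
  using cong_scl [of b 0 c] by simp

lemma qcm_f0: assumes "n + 1 \<le> i" "i \<le> n + m" shows "qcm 1 (t i) f0" "qcm 1 (ts i) f0"
  using t_f0 ts_f0' assms by (auto simp: qcm_def)

subsection \<open>The generators preserve the ideal\<close>

context
  fixes j :: nat
  assumes j: "1 \<le> j" "j < n + m"
begin

lemma aK_tts [simp]: "aK j (t k * ts k) = t k * ts k"
  by (simp add: aK_mult act1_gens)

lemma aK_X [simp]: "aK j (X k) = X k"
  by (simp add: X_def act1_linear)

text \<open>The images of the summands j and j + 1 under \<open>E j\<close> are opposite, so a
  remainder survives only if the sum starts at j + 1.\<close>

lemma aE_X: "aE j (X k) = (if k = j + 1 then scl (eps (j + 1) / h) (t j * ts (j + 1)) else 0)"
proof -
  let ?y = "scl (eps (j + 1) / h) (t j * ts (j + 1))"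
  have "scl (eps l) (aE j (t l * ts l)) = (if l = j + 1 then ?y else 0) - (if l = j then ?y else 0)" for l
    by (simp add: aE_mult act1_gens)
  then have "aE j (X k) = (\<Sum>l\<in>{k..n+m}. if l = j + 1 then ?y else 0)
      - (\<Sum>l\<in>{k..n+m}. if l = j then ?y else 0)"
    by (simp only: X_def act1_linear sum_subtractf)
  also have "\<dots> = (if j + 1 \<in> {k..n+m} then ?y else 0) - (if j \<in> {k..n+m} then ?y else 0)"
    by (simp add: sum.delta)
  finally show ?thesis using j by auto
qed

text \<open>The image under \<open>E j\<close> is zero or a multiple of another relation between two
  letters.\<close>

lemma aE_tt: assumes "1 \<le> i" "i < k" "k \<le> n + m"
  shows "aE j (t i * t k - scl qc (t k * t i)) \<approx> 0"
proof -
  consider "i = j + 1" | "k = j + 1" "i < j" | "k = j + 1" "i = j" | "i \<noteq> j + 1" "k \<noteq> j + 1"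
    using assms by linarith
  then show ?thesis
  proof cases
    case 1
    then have "aE j (t i * t k - scl qc (t k * t i)) = scl (1 / h) (t j * t k - scl qc (t k * t j))"
      using assms by (simp add: act1_linear aE_mult act1_gens scl.scale_right_diff_distrib)
    moreover have "t j * t k - scl qc (t k * t j) \<approx> 0"
      using tt [of j k] j assms 1 by (simp add: cong_diff_0_iff)
    ultimately show ?thesis by (metis cong_zero_scl)
  next
    case 2
    then have "aE j (t i * t k - scl qc (t k * t i)) = scl (1 / h) (t i * t j - scl qc (t j * t i))"
      using assms by (simp add: act1_linear aE_mult act1_gens scl.scale_right_diff_distrib)
    moreover have "t i * t j - scl qc (t j * t i) \<approx> 0"
      using tt [of i j] j assms 2 by (simp add: cong_diff_0_iff)
    ultimately show ?thesis by (metis cong_zero_scl)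
  qed (simp_all add: act1_linear aE_mult act1_gens)
qed

lemma aE_tsts: assumes "1 \<le> i" "i < k" "k \<le> n + m"
  shows "aE j (ts k * ts i - scl qc (ts i * ts k)) \<approx> 0"
proof -
  let ?z = "- (eps j * eps (Suc j)) / (h * qc)"
  consider "i = j" "k = j + 1" | "i = j" "k > j + 1" | "k = j" | "i \<noteq> j" "k \<noteq> j"
    using assms by linarith
  then show ?thesis
  proof cases
    case 2
    then have "aE j (ts k * ts i - scl qc (ts i * ts k)) = scl ?z (ts k * ts (j + 1) - scl qc (ts (j + 1) * ts k))"
      using assms by (simp add: act1_linear aE_mult act1_gens scl.scale_right_diff_distrib)
    moreover have "ts k * ts (j + 1) - scl qc (ts (j + 1) * ts k) \<approx> 0"
      using tsts [of "j + 1" k] j assms 2 by (simp add: cong_diff_0_iff)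
    ultimately show ?thesis by (metis cong_zero_scl)
  next
    case 3
    then have "aE j (ts k * ts i - scl qc (ts i * ts k)) = scl ?z (ts (j + 1) * ts i - scl qc (ts i * ts (j + 1)))"
      using assms by (simp add: act1_linear aE_mult act1_gens scl.scale_right_diff_distrib)
    moreover have "ts (j + 1) * ts i - scl qc (ts i * ts (j + 1)) \<approx> 0"
      using tsts [of i "j + 1"] j assms 3 by (simp add: cong_diff_0_iff)
    ultimately show ?thesis by (metis cong_zero_scl)
  qed (simp_all add: act1_linear aE_mult act1_gens)
qed

text \<open>Only for i = j + 1, k = j does \<open>E j\<close> act on both letters. There letters
  meet their own adjoints, and the result cancels after it is rewritten in terms of
  \<open>X j\<close>, \<open>X (j + 1)\<close>, \<open>X (j + 2)\<close>.\<close>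

lemma aE_tts: assumes "1 \<le> i" "1 \<le> k" "i \<le> n + m" "k \<le> n + m" "i \<noteq> k"
  shows "aE j (t i * ts k - scl qc (ts k * t i)) \<approx> 0"
proof -
  let ?z = "- (eps j * eps (Suc j)) / (h * qc)"
  consider "i = j + 1" "k = j" | "i = j + 1" "k \<noteq> j" | "i \<noteq> j + 1" "k = j" | "i \<noteq> j + 1" "k \<noteq> j"
    using assms by linarith
  then show ?thesis
  proof cases
    case 1
    let ?e = "eps j * eps (j + 1)"
    have "aE j (t i * ts k - scl qc (ts k * t i)) =
       scl (1 / h) (t j * ts j - ts j * t j)
       - scl (?e / (h * qc\<^sup>2)) (t (j + 1) * ts (j + 1)) + scl (?e / h) (ts (j + 1) * t (j + 1))"
      using 1 by (simp add: act1_linear aE_mult act1_gens scl.scale_right_diff_distrib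
          scl.scale_right_distrib power2_eq_square)
    also have "\<dots> \<approx> scl (1 / h) (scl (eps j) (X j - X (j + 1)) - scl (eps j) (X j - scl (1 / qc\<^sup>2) (X (j + 1))))
       - scl (?e / (h * qc\<^sup>2)) (scl (eps (j + 1)) (X (j + 1) - X (j + 1 + 1)))
       + scl (?e / h) (scl (eps (j + 1)) (X (j + 1) - scl (1 / qc\<^sup>2) (X (j + 1 + 1))))"
    proof -
      have "t j * ts j \<approx> scl (eps j) (X j - X (j + 1))"
        "ts j * t j \<approx> scl (eps j) (X j - scl (1 / qc\<^sup>2) (X (j + 1)))"
        "t (j + 1) * ts (j + 1) \<approx> scl (eps (j + 1)) (X (j + 1) - X (j + 1 + 1))"
        "ts (j + 1) * t (j + 1) \<approx> scl (eps (j + 1)) (X (j + 1) - scl (1 / qc\<^sup>2) (X (j + 1 + 1)))"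
        using tts_X [of j] tst_X [of j] tts_X [of "j + 1"] tst_X [of "j + 1"] j by auto
      then show ?thesis by (intro cong_add cong_diff cong_scl)
    qed
    also have "\<dots> = 0"
      by (rule tts_identity) simp
    finally show ?thesis .
  next
    case 2
    then have "aE j (t i * ts k - scl qc (ts k * t i)) = scl (1 / h) (t j * ts k - scl qc (ts k * t j))"
      using assms by (simp add: act1_linear aE_mult act1_gens scl.scale_right_diff_distrib)
    moreover have "t j * ts k - scl qc (ts k * t j) \<approx> 0"
      using tts [of j k] j assms 2 by (simp add: cong_diff_0_iff)
    ultimately show ?thesis by (metis cong_zero_scl)
  next
    case 3
    then have "aE j (t i * ts k - scl qc (ts k * t i)) = scl ?z (t i * ts (j + 1) - scl qc (ts (j + 1) * t i))"
      using assms by (simp add: act1_linear aE_mult act1_gens scl.scale_right_diff_distrib)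
    moreover have "t i * ts (j + 1) - scl qc (ts (j + 1) * t i) \<approx> 0"
      using tts [of i "j + 1"] j assms 3 by (simp add: cong_diff_0_iff)
    ultimately show ?thesis by (metis cong_zero_scl)
  qed (simp_all add: act1_linear aE_mult act1_gens)
qed

lemma aE_same: assumes "1 \<le> i" "i \<le> n + m"
  shows "aE j (t i * ts i - (ts i * t i + scl (eps i * (1 / qc\<^sup>2 - 1)) (X (i + 1)))) \<approx> 0"
proof -
  let ?e = "eps j * eps (j + 1)"
  have rel: "t j * ts (j + 1) - scl qc (ts (j + 1) * t j) \<approx> 0"
    using tts [of j "j + 1"] j by (simp add: cong_diff_0_iff)
  consider "i = j" | "i = j + 1" | "i \<noteq> j" "i \<noteq> j + 1" by blast
  then show ?thesis
  proof cases
    case 1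
    have "aE j (t i * ts i - (ts i * t i + scl (eps i * (1 / qc\<^sup>2 - 1)) (X (i + 1)))) =
       scl (- ?e / h) (t j * ts (j + 1)) - (scl (- ?e / (h * qc)) (ts (j + 1) * t j)
         + scl (eps j * (1 / qc\<^sup>2 - 1) * (eps (j + 1) / h)) (t j * ts (j + 1)))"
      using 1 by (simp add: act1_linear aE_mult act1_gens aE_X)
    also have "\<dots> = scl (- ?e / (h * qc\<^sup>2)) (t j * ts (j + 1) - scl qc (ts (j + 1) * t j))"
      by (rule poly_mapping_eqI) (simp add: lookup_add lookup_minus field_simps power2_eq_square)
    finally show ?thesis using cong_scl [OF rel, of "- ?e / (h * qc\<^sup>2)"] by simp
  next
    case 2
    have "aE j (t i * ts i - (ts i * t i + scl (eps i * (1 / qc\<^sup>2 - 1)) (X (i + 1)))) =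
       scl (1 / h) (t j * ts (j + 1) - scl qc (ts (j + 1) * t j))"
      using 2 by (simp add: act1_linear aE_mult act1_gens aE_X scl.scale_right_diff_distrib)
    then show ?thesis using cong_scl [OF rel, of "1 / h"] by simp
  qed (simp add: act1_linear aE_mult act1_gens aE_X)
qed

lemma aE_c: "aE j (X 1 - 1) \<approx> 0"
  using j by (simp add: act1_linear aE_X)

abbreviation W :: "fgen free" where "W \<equiv> t n * f0 * ts (n + 1)"

lemma aE_f0': "aE j f0 = (if j = n then scl C W else 0)"
  by (simp add: aE_f0)

text \<open>From the left, \<open>f0\<close> meets \<open>t n\<close> and kills it. From the right,
  it commutes with \<open>ts (n + 1)\<close> and is absorbed by the \<open>f0\<close> inside
  \<open>W\<close>.\<close>

lemma f0_W: "f0 * W \<approx> 0" and W_f0: "W * f0 \<approx> W"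
proof -
  have "f0 * W = f0 * t n * (f0 * ts (n + 1))" by (simp add: mult.assoc)
  also have "\<dots> \<approx> 0 * (f0 * ts (n + 1))" using n_ge by (intro cong_mult_right f0_t) auto
  finally show "f0 * W \<approx> 0" by simp
  have "W * f0 = t n * f0 * (ts (n + 1) * f0)" by (simp add: mult.assoc)
  also have "\<dots> \<approx> t n * f0 * (f0 * ts (n + 1))" using m_ge by (intro cong_mult_left ts_f0') auto
  also have "\<dots> = t n * (f0 * f0) * ts (n + 1)" by (simp add: mult.assoc)
  also have "\<dots> \<approx> W" by (intro cong_mult_left cong_mult_right f0_f0)
  finally show "W * f0 \<approx> W" .
qed

lemma aE_ts_f0: assumes "1 \<le> i" "i \<le> n" shows "aE j (ts i * f0) \<approx> 0"
proof -
  consider "j \<noteq> n" | "j = n" "i < n" | "j = n" "i = n" using assms by linarith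
  then show ?thesis
  proof cases
    case 1
    have "i = j \<Longrightarrow> ts (Suc j) * f0 \<approx> 0" using 1 assms by (intro ts_f0) auto
    then have "(if i = j then ts (Suc j) * f0 else 0) \<approx> 0" by simp
    moreover have "aE j (ts i * f0) = scl (- (eps j * eps (Suc j)) / (h * qc)) (if i = j then ts (Suc j) * f0 else 0)"
      using 1 by (simp add: aE_mult act1_gens)
    ultimately show ?thesis by (metis cong_zero_scl)
  next
    case 2
    have "ts i * W = ts i * t n * (f0 * ts (n + 1))" by (simp add: mult.assoc)
    also have "\<dots> \<approx> scl (1 / qc) (t n * ts i) * (f0 * ts (n + 1))"
      using qcm_tts(2) [of n i] n_ge 2 assms by (intro cong_mult_right) (auto simp: qcm_def)
    also have "\<dots> = scl (1 / qc) (t n * (ts i * f0) * ts (n + 1))" by (simp add: mult.assoc)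
    also have "\<dots> \<approx> scl (1 / qc) (t n * 0 * ts (n + 1))"
      using assms by (intro cong_scl cong_mult_left cong_mult_right ts_f0)
    finally have "ts i * W \<approx> 0" by simp
    then show ?thesis using 2 cong_scl [of "ts i * W" 0 C] by (simp add: aE_mult act1_gens)
  next
    case 3
    \<comment> \<open>Both terms of the twisted Leibniz rule contribute here, and they cancel by the
      choice of \<open>C\<close>.\<close>
    have "ts n * t n * f0 \<approx> scl (eps n) (X n - scl (1 / qc\<^sup>2) (X (n + 1))) * f0"
      using n_ge by (intro cong_mult_right tst_X) auto
    also have "\<dots> = scl (eps n) (X n * f0 - scl (1 / qc\<^sup>2) (X (n + 1) * f0))"
      by (simp add: left_diff_distrib)
    also have "\<dots> \<approx> scl (eps n) (f0 - scl (1 / qc\<^sup>2) f0)"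
      using n_ge by (intro cong_scl cong_diff X_le_f0) auto
    also have "\<dots> = scl (1 / qc\<^sup>2 - 1) f0"
      by (simp add: eps_def scl.scale_left_diff_distrib)
    finally have *: "ts n * t n * f0 \<approx> scl (1 / qc\<^sup>2 - 1) f0" .
    have "aE j (ts i * f0) = scl (1 / (h * qc)) (ts (n + 1) * f0) + scl (C / qc) (ts n * t n * f0 * ts (n + 1))"
      using 3 by (simp add: aE_mult act1_gens eps_def mult.assoc)
    also have "\<dots> \<approx> scl (1 / (h * qc)) (f0 * ts (n + 1)) + scl (C / qc) (scl (1 / qc\<^sup>2 - 1) f0 * ts (n + 1))"
      using m_ge by (intro cong_add cong_scl cong_mult_right * ts_f0') auto
    also have "\<dots> = scl (1 / (h * qc) + C / qc * (1 / qc\<^sup>2 - 1)) (f0 * ts (n + 1))"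
      by (simp add: scl.scale_left_distrib)
    also have "1 / (h * qc) + C / qc * (1 / qc\<^sup>2 - 1) = 0"
    proof -
      have "C * (1 / qc\<^sup>2 - 1) = - (1 / h)"
        using C_eq by (simp add: right_diff_distrib)
      then have "C / qc * (1 / qc\<^sup>2 - 1) = - (1 / h) / qc" by (metis times_divide_eq_left)
      then show ?thesis by simp
    qed
    finally show ?thesis by simp
  qed
qed

lemma aE_f0_t: assumes "1 \<le> i" "i \<le> n" shows "aE j (f0 * t i) \<approx> 0"
proof (cases "j = n")
  case True
  have "W * t i = t n * (f0 * (ts (n + 1) * t i))" by (simp add: mult.assoc)
  also have "\<dots> \<approx> t n * (f0 * scl (1 / qc) (t i * ts (n + 1)))"
    using qcm_tts(2) [of i "n + 1"] m_ge assms by (intro cong_mult_left) (auto simp: qcm_def)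
  also have "\<dots> = scl (1 / qc) (t n * (f0 * t i) * ts (n + 1))" by (simp add: mult.assoc)
  also have "\<dots> \<approx> scl (1 / qc) (t n * 0 * ts (n + 1))"
    using assms by (intro cong_scl cong_mult_left cong_mult_right f0_t)
  finally have "W * t i \<approx> 0" by simp
  then show ?thesis using True assms cong_scl [of "W * t i" 0 C]
    by (simp add: aE_mult act1_gens)
next
  case False
  have "i = j + 1 \<Longrightarrow> f0 * t j \<approx> 0" using j assms by (intro f0_t) auto
  then show ?thesis using False cong_scl [of "f0 * t j" 0] by (simp add: aE_mult act1_gens)
qed

lemma aE_X_f0: "aE j (X (n + 1) * f0 - f0) \<approx> 0"
proof (cases "j = n")
  case True
  have "X (n + 1) * W = X (n + 1) * t n * (f0 * ts (n + 1))" by (simp add: mult.assoc)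
  also have "\<dots> \<approx> scl (1 / qc\<^sup>2) (t n * X (n + 1)) * (f0 * ts (n + 1))"
    using qcm_X_t_less [of n "n + 1"] n_ge by (intro cong_mult_right) (auto simp: qcm_def)
  also have "\<dots> = scl (1 / qc\<^sup>2) (t n * (X (n + 1) * f0) * ts (n + 1))" by (simp add: mult.assoc)
  also have "\<dots> \<approx> scl (1 / qc\<^sup>2) W"
    by (intro cong_scl cong_mult_left cong_mult_right X_f0)
  finally have XW: "X (n + 1) * W \<approx> scl (1 / qc\<^sup>2) W" .
  have "aE j (X (n + 1) * f0 - f0) = scl (1 / h) (t n * (ts (n + 1) * f0)) + scl C (X (n + 1) * W) - scl C W"
    using True by (simp add: act1_linear aE_mult aE_X [unfolded True] aE_f0 aK_X [unfolded True] eps_def mult.assoc)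
  also have "\<dots> \<approx> scl (1 / h) (t n * (f0 * ts (n + 1))) + scl C (scl (1 / qc\<^sup>2) W) - scl C W"
    using m_ge by (intro cong_add cong_diff cong_scl cong_mult_left XW ts_f0') auto
  also have "\<dots> = scl (1 / h + C / qc\<^sup>2 - C) W"
    by (simp add: scl.scale_left_distrib scl.scale_left_diff_distrib mult.assoc)
  also have "\<dots> = 0" using C_eq by simp
  finally show ?thesis .
qed (simp add: act1_linear aE_mult aE_X aE_f0')

lemma aE_f0_X: "aE j (f0 * X (n + 1) - f0) \<approx> 0"
proof (cases "j = n")
  case True
  have "W * X (n + 1) = t n * (f0 * (ts (n + 1) * X (n + 1)))" by (simp add: mult.assoc)
  also have "\<dots> \<approx> t n * (f0 * (X (n + 1) * ts (n + 1)))"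
    using qcm_X_ts_ge [of "n + 1" "n + 1"] m_ge
    by (intro cong_mult_left) (auto simp: qcm_def intro: cong_sym)
  also have "\<dots> = t n * ((f0 * X (n + 1)) * ts (n + 1))" by (simp add: mult.assoc)
  also have "\<dots> \<approx> t n * (f0 * ts (n + 1))"
    by (intro cong_mult_left cong_mult_right f0_X)
  finally have WX: "W * X (n + 1) \<approx> W" by (simp add: mult.assoc)
  have "aE j (f0 * X (n + 1) - f0) = scl C (W * X (n + 1)) + scl (1 / h) (f0 * t n * ts (n + 1)) - scl C W"
    using True by (simp add: act1_linear aE_mult aE_X [unfolded True] aE_f0 aK_X [unfolded True] aK_f0 eps_def mult.assoc)
  also have "\<dots> \<approx> scl C W + scl (1 / h) (0 * ts (n + 1)) - scl C W"
    using n_ge by (intro cong_add cong_diff cong_scl cong_mult_right WX f0_t) auto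
  finally show ?thesis by simp
qed (simp add: act1_linear aE_mult aE_X aE_f0')

lemma aE_f0_f0: "aE j (f0 * f0 - f0) \<approx> 0"
proof (cases "j = n")
  case True
  have "aE j (f0 * f0 - f0) = scl C (W * f0) + scl C (f0 * W) - scl C W"
    using True by (simp add: act1_linear aE_mult aE_f0 aK_X [unfolded True] aK_f0)
  also have "\<dots> \<approx> scl C W + scl C 0 - scl C W"
    by (intro cong_add cong_diff cong_scl W_f0 f0_W) auto
  finally show ?thesis by simp
qed (simp add: act1_linear aE_mult aE_f0')

lemma aE_t_f0: assumes "n + 1 \<le> i" "i \<le> n + m" shows "aE j (t i * f0 - f0 * t i) \<approx> 0"
proof -
  consider "j \<noteq> n" | "j = n" "n + 1 < i" | "j = n" "i = n + 1" using assms by linarith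
  then show ?thesis
  proof cases
    case 1
    have "aE j (t i * f0 - f0 * t i) = scl (1 / h) (if i = j + 1 then t j * f0 - f0 * t j else 0)"
      using 1 by (simp add: act1_linear aE_mult act1_gens scl.scale_right_diff_distrib)
    moreover have "(if i = j + 1 then t j * f0 - f0 * t j else 0) \<approx> 0"
      using t_f0 [of j] 1 assms by (auto simp: cong_diff_0_iff)
    ultimately show ?thesis by (metis cong_zero_scl)
  next
    case 2
    have "qcm (1 / qc * 1 * qc) (t i) W"
      using 2 assms n_ge by (intro qcm_mult_right qcm_tt qcm_f0 qcm_tts) auto
    then have "t i * W - W * t i \<approx> 0" by (simp add: qcm_def cong_diff_0_iff)
    moreover have "aE j (t i * f0 - f0 * t i) = scl C (t i * W - W * t i)"
      using 2 by (simp add: act1_linear aE_mult act1_gens scl.scale_right_diff_distrib)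
    ultimately show ?thesis by (metis cong_zero_scl)
  next
    case 3
    let ?x = "X (n + 1)" and ?y = "X (n + 1 + 1)"
    have "qcm (1 / qc * 1) (t (n + 1)) (t n * f0)"
      using m_ge n_ge by (intro qcm_mult_right qcm_tt qcm_f0) auto
    then have 1: "t (n + 1) * (t n * f0) \<approx> scl (1 / qc) (t n * f0 * t (n + 1))" by (simp add: qcm_def)
    have tm: "t (n + 1) * ts (n + 1) \<approx> ?x - ?y"
      using tts_X [of "n + 1"] m_ge by (simp add: eps_def)
    have mt: "ts (n + 1) * t (n + 1) \<approx> ?x - scl (1 / qc\<^sup>2) ?y"
      using tst_X [of "n + 1"] m_ge by (simp add: eps_def)
    have "aE j (t i * f0 - f0 * t i) = scl (1 / h) (t n * f0) + scl (C / qc) (t (n + 1) * (t n * f0) * ts (n + 1))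
       - scl C (t n * f0 * (ts (n + 1) * t (n + 1))) - scl (1 / h) (f0 * t n)"
      using 3 by (simp add: act1_linear aE_mult act1_gens mult.assoc)
    also have "\<dots> \<approx> scl (1 / h) (t n * f0) + scl (C / qc) (scl (1 / qc) (t n * f0 * t (n + 1)) * ts (n + 1))
       - scl C (t n * f0 * (?x - scl (1 / qc\<^sup>2) ?y)) - scl (1 / h) 0"
      using n_ge by (intro cong_add cong_diff cong_scl cong_mult_left cong_mult_right 1 mt f0_t) auto
    also have "\<dots> = scl (1 / h) (t n * f0) + scl (C / qc\<^sup>2) (t n * f0 * (t (n + 1) * ts (n + 1)))
       - scl C (t n * f0 * (?x - scl (1 / qc\<^sup>2) ?y))"
      by (simp add: mult.assoc power2_eq_square)
    also have "\<dots> \<approx> scl (1 / h) (t n * f0) + scl (C / qc\<^sup>2) (t n * f0 * (?x - ?y))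
       - scl C (t n * f0 * (?x - scl (1 / qc\<^sup>2) ?y))"
      by (intro cong_add cong_diff cong_scl cong_mult_left tm) auto
    \<comment> \<open>The terms with \<open>?y\<close> cancel; \<open>?x\<close> is then absorbed by
      \<open>f0\<close>.\<close>
    also have "\<dots> = scl (1 / h) (t n * f0) + scl (C / qc\<^sup>2 - C) (t n * (f0 * ?x))"
      by (simp add: right_diff_distrib scl.scale_right_diff_distrib scl.scale_left_diff_distrib mult.assoc)
    also have "\<dots> \<approx> scl (1 / h) (t n * f0) + scl (C / qc\<^sup>2 - C) (t n * f0)"
      by (intro cong_add cong_scl cong_mult_left f0_X) auto
    also have "\<dots> = 0" by (simp add: C_eq flip: scl.scale_left_distrib)
    finally show ?thesis .
  qed
qed

lemma aE_ts_f0': assumes "n + 1 \<le> i" "i \<le> n + m" shows "aE j (ts i * f0 - f0 * ts i) \<approx> 0"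
proof -
  consider "j \<noteq> n" | "j = n" "n + 1 < i" | "j = n" "i = n + 1" using assms by linarith
  then show ?thesis
  proof cases
    case 1
    let ?z = "- (eps j * eps (Suc j)) / (h * qc)"
    have "aE j (ts i * f0 - f0 * ts i) = scl ?z (if i = j then ts (j + 1) * f0 - f0 * ts (j + 1) else 0)"
      using 1 by (simp add: act1_linear aE_mult act1_gens scl.scale_right_diff_distrib)
    moreover have "(if i = j then ts (j + 1) * f0 - f0 * ts (j + 1) else 0) \<approx> 0"
      using ts_f0' [of "j + 1"] 1 assms j by (auto simp: cong_diff_0_iff)
    ultimately show ?thesis by (metis cong_zero_scl)
  next
    case 2
    have "qcm (1 / qc * 1 * qc) (ts i) W"
      using 2 assms n_ge by (intro qcm_mult_right qcm_tt qcm_f0 qcm_tts) auto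
    then have "ts i * W - W * ts i \<approx> 0" by (simp add: qcm_def cong_diff_0_iff)
    moreover have "aE j (ts i * f0 - f0 * ts i) = scl C (ts i * W - W * ts i)"
      using 2 by (simp add: act1_linear aE_mult act1_gens scl.scale_right_diff_distrib)
    ultimately show ?thesis by (metis cong_zero_scl)
  next
    case 3
    have "qcm 1 (ts (n + 1)) (ts (n + 1))" by (simp add: qcm_def)
    then have "qcm (1 / qc * 1 * 1) (ts i) W"
      using 3 assms n_ge by (intro qcm_mult_right qcm_f0 qcm_tts) auto
    then have "scl qc (ts i * W) \<approx> scl qc (scl (1 / qc) (W * ts i))"
      by (intro cong_scl) (simp add: qcm_def)
    then have "scl qc (ts i * W) - W * ts i \<approx> 0" by (simp add: cong_diff_0_iff)
    moreover have "aE j (ts i * f0 - f0 * ts i) = scl C (scl qc (ts i * W) - W * ts i)"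
      using 3 by (simp add: act1_linear aE_mult act1_gens scl.scale_right_diff_distrib mult.commute)
    ultimately show ?thesis by (metis cong_zero_scl)
  qed
qed

lemma aE_rels: assumes "x \<in> tsi rels" shows "aE j x \<in> tsi rels"
  using assms
proof induction
  case (gen x)
  then obtain r where r: "r \<in> fun_rels q n m" "x = r \<or> x = free_star r"
    by (auto simp: rels_def)
  have neg: "aE j (- y) \<approx> 0" if "aE j y \<approx> 0" for y
    using cong_uminus [OF that] by (simp add: act1_linear)
  note E = aE_tt aE_tts aE_tsts aE_same aE_c aE_ts_f0 aE_f0_t aE_X_f0 aE_f0_X aE_f0_f0 aE_t_f0 aE_ts_f0'
  note S = free_star_simps
  \<comment> \<open>Up to sign, the adjoint of a relation is again in the list, except for
    \<open>tt\<close>, whose adjoint is treated in \<open>aE_tsts\<close>.\<close>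
  have "aE j r \<approx> 0 \<and> aE j (free_star r) \<approx> 0"
    using r(1)
  proof (cases rule: fun_rels_cases)
    case (tt i k)
    then show ?thesis using E(1,3) [of i k] by (simp add: S)
  next
    case (tts i k)
    then show ?thesis using E(2) [of i k] E(2) [of k i] by (simp add: S)
  next
    case (same i)
    then show ?thesis using E(4) [of i] by (simp add: S)
  next
    case c
    then show ?thesis using E(5) by (simp add: S)
  next
    case (ts_f0 i)
    then show ?thesis using E(6,7) [of i] by (simp add: S)
  next
    case (f0_t i)
    then show ?thesis using E(6,7) [of i] by (simp add: S)
  next
    case X_f0
    then show ?thesis using E(8,9) by (simp add: S)
  next
    case f0_X
    then show ?thesis using E(8,9) by (simp add: S)
  next
    case f0_f0
    then show ?thesis using E(10) by (simp add: S)
  next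
    case (t_f0 i)
    then show ?thesis using E(11,12) [of i] neg [of "ts i * f0 - f0 * ts i"] by (simp add: S)
  next
    case (ts_f0' i)
    then show ?thesis using E(11,12) [of i] neg [of "t i * f0 - f0 * t i"] by (simp add: S)
  qed
  then show ?case using r by (auto simp: cong_0_iff)
qed (auto simp: act1_linear aE_mult intro: tsi.intros aK_rels)

lemma aF_rels: assumes "x \<in> tsi rels" shows "aF j x \<in> tsi rels"
proof -
  have star: "free_star y \<in> tsi rels" if "y \<in> tsi rels" for y
    using that cong_free_star [of y 0] by (simp add: cong_0_iff)
  show ?thesis using assms unfolding aF_star by (intro tsi_scl star aE_rels)
qed

end

end


section \<open>The relations of the quantum group\<close>

lemma dia_dia: "dia c (dia d p) = dia (\<lambda>g. c g * d g) p"
proof (rule free_lin_eqI [OF lin_comp [OF dia_lin dia_lin] dia_lin])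
  fix w :: "'a list"
  have "(\<Prod>g\<leftarrow>w. c g * d g) = (\<Prod>g\<leftarrow>w. c g) * (\<Prod>g\<leftarrow>w. d g)"
    by (induction w) auto
  then show "dia c (dia d (mon w)) = dia (\<lambda>g. c g * d g) (mon w)"
    by (simp add: dia_mon dia_linear mult.commute)
qed

lemma dia_1: "dia (\<lambda>_. 1) p = p"
proof (rule free_lin_eqI [OF dia_lin lin_ident])
  fix w :: "'a list"
  have "(\<Prod>_\<leftarrow>w. 1 :: complex) = 1" by (induction w) auto
  then show "dia (\<lambda>_. 1) (mon w) = mon w" by (simp add: dia_mon)
qed

text \<open>The difference of the two sides of a quantum group relation, as an operator, is again a
  twisted derivation. As the ideal absorbs the twisting factors, its values need to be checked on
  single letters only.\<close>

lemma skew_derivation_in_tsi: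
  fixes D :: "'g free \<Rightarrow> 'g free"
  assumes "lin D" "\<And>x y. D (x * y) = D x * \<rho> y + \<kappa> x * D y" "D 1 = 0"
    "\<And>g. D (mon [g]) \<in> tsi R"
  shows "D p \<in> tsi R"
proof -
  have word: "D (mon w) \<in> tsi R" for w
  proof (induction w)
    case (Cons g w)
    then show ?case
      by (subst mon_Cons) (simp add: assms(2) tsi.add tsi.lmult tsi.rmult assms(4))
  qed (simp add: assms tsi.zero)
  show ?thesis
    by (rule free_linear_induct [where p = p and P = "\<lambda>p. D p \<in> tsi R"])
      (auto simp: word lin_zero [OF assms(1)] lin_add [OF assms(1)] lin_scl [OF assms(1)]
        intro: tsi.zero tsi.add tsi_scl)
qed

lemma tsi_empty: "x \<in> tsi {} \<Longrightarrow> x = 0"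
  by (induction rule: tsi.induct) auto

lemmas skew_derivation_zero = skew_derivation_in_tsi [where R = "{}", THEN tsi_empty]

lemma act_uword_append: "act_uword q n (us @ vs) p = act_uword q n us (act_uword q n vs p)"
  by (induction us) auto

lemma image_const_singleton: "x \<in> A \<Longrightarrow> (\<And>y. y \<in> A \<Longrightarrow> f y = c) \<Longrightarrow> f ` A = {c}"
  by auto

context hyperboloid
begin

abbreviation AF :: "ugen free \<Rightarrow> fgen free \<Rightarrow> fgen free" where "AF \<equiv> act_free q n"

lemma AF_lin: "lin (\<lambda>a. AF a p)"
  by (simp add: act_free_def lin_ext_lin)

lemmas AF_linear = lin_zero [OF AF_lin] lin_add [OF AF_lin] lin_scl [OF AF_lin] lin_diff [OF AF_lin]

lemma AF_mon: "AF (mon us) p = act_uword q n us p"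
  by (simp add: act_free_def)

lemma AF_one [simp]: "AF 1 p = p"
  using AF_mon [of "[]"] by simp

lemma AF_letter [simp]: "AF (mon [u]) p = act1 u p"
  by (simp add: AF_mon act1_def)

lemma act_uword_lin: "lin (act_uword q n us)"
proof (induction us)
  case (Cons u us)
  from lin_comp [OF lin_ext_lin this] show ?case by simp
qed (simp add: lin_def)

lemma AF_lin_vec: "lin (AF a)"
proof (rule linI)
  fix x y c
  show "AF a (x + y) = AF a x + AF a y"
    by (rule free_lin_eqI [OF AF_lin lin_plus [OF AF_lin AF_lin]])
      (simp add: AF_mon lin_add [OF act_uword_lin])
  show "AF a (scl c x) = scl c (AF a x)"
    by (rule free_lin_eqI [OF AF_lin lin_scaled [OF AF_lin]])
      (simp add: AF_mon lin_scl [OF act_uword_lin])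
qed

lemma AF_mult: "AF (a * b) p = AF a (AF b p)"
proof -
  have 1: "AF (mon us * mon vs) p = AF (mon us) (AF (mon vs) p)" for us vs
    by (simp add: AF_mon act_uword_append flip: mon_append)
  have "AF (mon us * b) p = AF (mon us) (AF b p)" for us
    by (rule free_lin_eqI [OF lin_comp [OF AF_lin lin_mult_left [OF lin_ident]]
          lin_comp [OF AF_lin_vec AF_lin] 1])
  then show ?thesis
    by (rule free_lin_eqI [OF lin_comp [OF AF_lin lin_mult_right [OF lin_ident]] AF_lin])
qed

lemma aK_aK: "aK i (aK j p) = aK j (aK i p)"
  by (simp add: aK_dia dia_dia mult.commute)

lemma aK_aKi_same [simp]: "aK i (aKi i p) = p" "aKi i (aK i p) = p"
  by (simp_all add: aK_dia aKi_dia dia_dia dia_1 flip: qi_add)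

lemma aK_aE: "aK i (aE j p) = scl (qi (cartan i j)) (aE j (aK i p))"
proof -
  define D where "D p = aK i (aE j p) - scl (qi (cartan i j)) (aE j (aK i p))" for p
  have "D p = 0"
  proof (rule skew_derivation_zero [where D = D and p = p and \<rho> = "aK i" and \<kappa> = "\<lambda>x. aK i (aK j x)"])
    show "lin D" unfolding D_def
      by (intro lin_minus' lin_scaled) (rule lin_comp [OF act1_lin act1_lin])+
    show "D (x * y) = D x * aK i y + aK i (aK j x) * D y" for x y
      unfolding D_def
      by (simp add: act1_linear aE_mult aK_mult aK_aK [of j i] algebra_simps
          scl.scale_right_distrib)
    show "D 1 = 0" by (simp add: D_def act1_linear)
    have "D (mon [g]) = 0" for g
      unfolding D_def
      by (cases g) (auto simp: act1_linear act1_gens aK_mult cartan_def qi_1 qi_2 qi_minus power2_eq_square)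
    then show "D (mon [g]) \<in> tsi {}" for g by (simp add: tsi.zero)
  qed
  then show ?thesis by (simp add: D_def)
qed

lemma aKi_aE: "aE j (aKi i p) = scl (qi (cartan i j)) (aKi i (aE j p))"
  using arg_cong [OF aK_aE [of i j "aKi i p"], of "aKi i"] by (simp add: act1_linear)

lemma aK_star: "aK i (free_star p) = free_star (aKi i p)"
proof -
  have "cnj (qi (K_weight i (star_letter g))) = qi (- K_weight i g)" for g
    by (cases g) auto
  then show ?thesis by (simp add: aK_dia aKi_dia dia_free_star)
qed

lemma aK_aF: "aK i (aF j p) = scl (qi (- cartan i j)) (aF j (aK i p))"
proof -
  have star: "free_star (aK i p) = aKi i (free_star p)"
    using arg_cong [OF aK_star [of i "aK i p"], of "aKi i"] by simp
  have "aKi i (aE j (free_star p)) = scl (1 / qi (cartan i j)) (aE j (aKi i (free_star p)))"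
    by (simp add: aKi_aE)
  then show ?thesis
    by (simp add: aF_star act1_linear aK_star star free_star_scl qi_minus)
qed

lemma cartan_sym: "cartan i j = cartan j i"
  by (auto simp: cartan_def)

lemma q_inv_nz: "qc - inverse qc \<noteq> 0"
proof
  assume "qc - inverse qc = 0"
  then have "qc * qc = 1" by (metis eq_iff_diff_eq_0 of_real_eq_0_iff q_simps(1) right_inverse)
  then show False using q_simps(3) by (simp add: power2_eq_square)
qed

lemma q_inv_quotient: "(1 / qc - qc) / (qc - 1 / qc) = - 1"
proof -
  have "1 / qc - qc = - (qc - 1 / qc)" by simp
  then show ?thesis using q_inv_nz unfolding inverse_eq_divide by (metis divide_self_if minus_divide_left)
qed

lemma eps_eps: "eps j * (eps k * (eps j * eps k)) = 1"
  by (simp add: mult.left_commute)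

text \<open>The two exchanges contribute 1/q and q.\<close>

lemma W_relation: "t (n + 1) * t n * f0 * (ts (n + 1) * ts n) \<approx> t n * t (n + 1) * f0 * (ts n * ts (n + 1))"
proof -
  have "t (n + 1) * t n * f0 * (ts (n + 1) * ts n) \<approx>
      scl (1 / qc) (t n * t (n + 1)) * f0 * scl qc (ts n * ts (n + 1))"
    using n_ge m_ge qcm_tt [of n "n + 1"] by (intro cong_mult cong_refl) (auto simp: qcm_def)
  then show ?thesis by simp
qed

text \<open>\<open>K n\<close> fixes \<open>f0\<close>, so the commutator of \<open>E n\<close> and
  \<open>F n\<close> has to vanish on \<open>f0\<close>. The two orders give the same terms except
  for one, which \<open>W_relation\<close> identifies.\<close>

lemma aE_aF_f0: "aE n (aF n f0) \<approx> aF n (aE n f0)"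
proof -
  have "aE n (aF n f0) = scl (C * h * qc) (t n * f0 * ts n)
     + scl (C * C * qc) (t (n + 1) * t n * f0 * (ts (n + 1) * ts n))
     + scl (C / h) (t (n + 1) * f0 * ts (n + 1))"
    using qc2_div_h
    by (simp add: act1_linear aE_mult aK_mult act1_gens eps_def mult.assoc field_simps power2_eq_square)
  also have "\<dots> \<approx> scl (C * h * qc) (t n * f0 * ts n)
     + scl (C * C * qc) (t n * t (n + 1) * f0 * (ts n * ts (n + 1)))
     + scl (C / h) (t (n + 1) * f0 * ts (n + 1))"
    by (intro cong_add cong_scl W_relation cong_refl)
  also have "\<dots> = aF n (aE n f0)"
    using qc_div_h
    by (simp add: act1_linear aF_mult aK_mult act1_gens eps_def mult.assoc field_simps power2_eq_square)
  finally show ?thesis .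
qed

lemma aE_aF:
  "aE i (aF j p) - aF j (aE i p)
     - (if i = j then scl (1 / (qc - inverse qc)) (aK i p - aKi i p) else 0) \<approx> 0"
proof -
  define D where "D p = aE i (aF j p) - aF j (aE i p)
     - scl (if i = j then 1 / (qc - inverse qc) else 0) (aK i p - aKi i p)" for p
  have "D p \<in> tsi rels"
  proof (rule skew_derivation_in_tsi [where D = D and p = p and \<rho> = "aKi j" and \<kappa> = "aK i"])
    show "lin D" unfolding D_def
      by (intro lin_minus' lin_scaled act1_lin) (rule lin_comp [OF act1_lin act1_lin])+
    show "D (x * y) = D x * aKi j y + aK i x * D y" for x y
    proof -
      \<comment> \<open>The mixed terms agree: exchanging \<open>K i\<close> with \<open>F j\<close>
        and the inverse of \<open>K j\<close> with \<open>E i\<close> produces inverse powers of q,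
        as the Cartan matrix is symmetric.\<close>
      have 1: "aK i (aF j x) * aE i (aKi j y) = aF j (aK i x) * aKi j (aE i y)"
        by (simp add: aK_aF aKi_aE cartan_sym [of i j] qi_minus)
      show ?thesis
        using 1 unfolding D_def
        by (cases "i = j")
          (simp_all add: act1_linear aE_mult aF_mult aK_mult algebra_simps
            scl.scale_right_distrib scl.scale_right_diff_distrib)
    qed
    show "D 1 = 0" by (simp add: D_def act1_linear)
    show "D (mon [g]) \<in> tsi rels" for g
    proof (cases "g = Gen_f0")
      case False
      have "D (mon [g]) = 0"
        using False q_inv_nz unfolding D_def
        by (cases g) (auto simp: act1_linear act1_gens inverse_eq_divide q_inv_quotient eps_eps simp flip: scl.scale_left_diff_distrib
            scl.scale_left_distrib)
      then show ?thesis by (simp add: tsi.zero)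
    next
      case True
      have "D f0 \<approx> 0"
      proof (cases "i = n \<and> j = n")
        case True
        then show ?thesis using aE_aF_f0 by (simp add: D_def act1_gens cong_diff_0_iff)
      next
        case False
        then have "D f0 = 0" unfolding D_def
          by (auto simp: act1_linear aE_mult aF_mult aK_mult act1_gens)
        then show ?thesis by simp
      qed
      then show ?thesis using True by (simp add: cong_0_iff)
    qed
  qed
  then show ?thesis by (auto simp: D_def cong_0_iff split: if_splits)
qed

lemma aE_aE: assumes "cartan i j = 0" shows "aE i (aE j p) - aE j (aE i p) \<approx> 0"
proof -
  define D where "D p = aE i (aE j p) - aE j (aE i p)" for p
  have "D p = 0"
  proof (rule skew_derivation_zero [where D = D and p = p and \<rho> = "\<lambda>y. y" and \<kappa> = "\<lambda>x. aK i (aK j x)"])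
    show "lin D" unfolding D_def
      by (intro lin_minus') (rule lin_comp [OF act1_lin act1_lin])+
    show "D (x * y) = D x * y + aK i (aK j x) * D y" for x y
      using assms cartan_sym [of i j] unfolding D_def
      by (simp add: act1_linear aE_mult aK_aE aK_aK [of j i] algebra_simps)
    show "D 1 = 0" by (simp add: D_def act1_linear)
    have "D (mon [g]) = 0" for g
      unfolding D_def using assms
      by (cases g) (auto simp: act1_linear act1_gens aE_mult aK_mult cartan_def split: if_splits)
    then show "D (mon [g]) \<in> tsi {}" for g by (simp add: tsi.zero)
  qed
  then show ?thesis by (simp add: D_def)
qed

lemma aF_aF: assumes "cartan i j = 0" shows "aF i (aF j p) - aF j (aF i p) \<approx> 0"
proof -
  let ?z = "(eps i * eps (Suc i) * qc\<^sup>2) * (eps j * eps (Suc j) * qc\<^sup>2)"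
  have "aF i (aF j p) - aF j (aF i p) =
      scl ?z (free_star (aE i (aE j (free_star p)) - aE j (aE i (free_star p))))"
    by (simp add: aF_star act1_linear free_star_simps scl.scale_right_diff_distrib mult_ac)
  then show ?thesis
    using cong_scl [OF cong_free_star [OF aE_aE [OF assms, of "free_star p"]], of ?z] by simp
qed

definition serreE :: "nat \<Rightarrow> nat \<Rightarrow> fgen free \<Rightarrow> fgen free" where
  "serreE i j p = aE i (aE i (aE j p)) - scl (qc + 1 / qc) (aE i (aE j (aE i p))) + aE j (aE i (aE i p))"

text \<open>Only \<open>E n\<close> moves \<open>f0\<close>. For i = n the expression collapses to a
  multiple of a commutation relation, of \<open>t n\<close> with \<open>t (n - 1)\<close> or of
  \<open>ts (n + 1)\<close> with \<open>ts (n + 2)\<close>; the other cases give 0 outright.\<close>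

lemma serreE_f0: assumes "1 \<le> i" "1 \<le> j" "i < n + m" "j < n + m" "cartan i j = - 1"
  shows "serreE i j f0 \<approx> 0"
proof -
  consider "i \<noteq> n" "j \<noteq> n" | "j = n" "i = n + 1" | "j = n" "i \<noteq> n" "i + 1 = n" | "i = n" "j \<noteq> n" "j + 1 = n" | "i = n" "j = n + 1"
    using assms by (auto simp: cartan_def split: if_splits)
  then show ?thesis
  proof cases
    case 1
    then show ?thesis by (simp add: serreE_def act1_linear act1_gens)
  next
    case 2
    then have "serreE i j f0 = 0"
      by (simp add: serreE_def act1_linear aE_mult aK_mult act1_gens)
    then show ?thesis by simp
  next
    case 3
    then have "serreE i j f0 = 0"
      by (simp add: serreE_def act1_linear aE_mult aK_mult act1_gens)
    then show ?thesis by simp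
  next
    case 4
    let ?V = "f0 * (ts (Suc n) * ts (Suc n))"
    have "serreE i j f0 = scl (C * C / h) (t n * t j - scl (1 / qc) (t j * t n)) * ?V"
      unfolding serreE_def using 4
      by (simp add: act1_linear aE_mult aK_mult act1_gens mult.assoc algebra_simps
        scl.scale_right_distrib scl.scale_right_diff_distrib scl.scale_left_distrib)
        (rule poly_mapping_eqI, simp add: lookup_add field_simps)
    also have "\<dots> \<approx> scl (C * C / h) 0 * ?V"
      using qcm_tt(2) [of j n] 4 assms m_ge
      by (intro cong_mult_right cong_scl) (simp add: qcm_def cong_diff_0_iff)
    finally show ?thesis by simp
  next
    case 5
    let ?V = "t n * t n * f0"
    have ee: "eps (Suc n) * eps (Suc (Suc n)) = 1" by (simp add: eps_def)
    have "serreE i j f0 = scl (- (C * C / h)) (?V * (ts (Suc j) * ts j - scl qc (ts j * ts (Suc j))))"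
      unfolding serreE_def using 5 ee
      by (simp add: act1_linear aE_mult aK_mult act1_gens mult.assoc algebra_simps
        scl.scale_right_distrib scl.scale_right_diff_distrib scl.scale_left_distrib)
        (rule poly_mapping_eqI, simp add: lookup_add field_simps)
    also have "\<dots> \<approx> scl (- (C * C / h)) (?V * 0)"
      using qcm_tt(3) [of j "Suc j"] 5 assms m_ge
      by (intro cong_mult_left cong_scl) (simp add: qcm_def cong_diff_0_iff)
    finally show ?thesis by simp
  qed
qed

text \<open>The q-Serre expression is itself a twisted derivation: the coefficient q + 1 / q makes
  all mixed terms of the iterated Leibniz rule cancel. Letters other than \<open>f0\<close> are sent
  to 0 exactly, and \<open>f0\<close> into the ideal.\<close>

lemma serreE: assumes "1 \<le> i" "1 \<le> j" "i < n + m" "j < n + m" "cartan i j = - 1"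
  shows "serreE i j p \<approx> 0"
proof -
  have "serreE i j p \<in> tsi rels"
  proof (rule skew_derivation_in_tsi [where D = "serreE i j" and p = p and \<rho> = "\<lambda>y. y" and \<kappa> = "\<lambda>x. aK i (aK i (aK j x))"])
    have "lin (\<lambda>p. aE i (aE j (aE k p)))" for i j k
      by (rule lin_comp [OF act1_lin lin_comp [OF act1_lin act1_lin]])
    then show "lin (serreE i j)" unfolding serreE_def
      by (intro lin_plus lin_minus' lin_scaled)
    show "serreE i j (x * y) = serreE i j x * y + aK i (aK i (aK j x)) * serreE i j y" for x y
    proof -
      have c: "cartan i i = 2" "cartan j j = 2" "cartan j i = - 1"
        using assms cartan_sym [of i j] by (auto simp: cartan_def)
      show ?thesis
        by (simp add: serreE_def aE_mult act1_linear aK_aE assms(5) c aK_aK [of j i] qi_2 qi_minus qi_1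
           algebra_simps scl.scale_right_distrib scl.scale_right_diff_distrib scl.scale_left_distrib)
          (rule poly_mapping_eqI, simp add: lookup_add field_simps power2_eq_square)
    qed
    show "serreE i j 1 = 0" by (simp add: serreE_def act1_linear)
    show "serreE i j (mon [g]) \<in> tsi rels" for g
    proof (cases "g = Gen_f0")
      case False
      then have "serreE i j (mon [g]) = 0"
        using assms unfolding serreE_def
        by (cases g) (auto simp: act1_linear act1_gens cartan_def split: if_splits)
      then show ?thesis by (simp add: tsi.zero)
    next
      case True
      then show ?thesis using serreE_f0 [OF assms] by (simp add: cong_0_iff)
    qed
  qed
  then show ?thesis by (simp add: cong_0_iff)
qed

lemma serreF: assumes "1 \<le> i" "1 \<le> j" "i < n + m" "j < n + m" "cartan i j = - 1"
  shows "aF i (aF i (aF j p)) - scl (qc + 1 / qc) (aF i (aF j (aF i p))) + aF j (aF i (aF i p)) \<approx> 0"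
proof -
  let ?z = "\<lambda>i. - (eps i * eps (Suc i)) * qc\<^sup>2"
  have real: "cnj (?z i) = ?z i" for i by simp
  have F: "aF i x = scl (?z i) (free_star (aE i (free_star x)))" for i x by (rule aF_star)
  have "aF i (aF j (aF k p)) = scl (?z i * ?z j * ?z k) (free_star (aE i (aE j (aE k (free_star p)))))" for i j k
    by (simp only: F act1_linear free_star_scl free_star_free_star real scl.scale_scale mult_ac)
  moreover have "?z i * ?z j * ?z i = ?z i * ?z i * ?z j" "?z j * ?z i * ?z i = ?z i * ?z i * ?z j"
    by (simp_all only: mult_ac)
  ultimately have "aF i (aF i (aF j p)) - scl (qc + 1 / qc) (aF i (aF j (aF i p))) + aF j (aF i (aF i p))
     = scl (?z i * ?z i * ?z j) (free_star (serreE i j (free_star p)))"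
    by (simp only: serreE_def free_star_simps scl.scale_right_distrib scl.scale_right_diff_distrib
        scl.scale_scale mult.commute) simp
  moreover have "free_star (serreE i j (free_star p)) \<approx> 0"
    using cong_free_star [OF serreE [OF assms, of "free_star p"]] by simp
  ultimately show ?thesis by (rule cong_zero_scl)
qed

section \<open>The action and the counit on cosets\<close>

abbreviation U :: "ugen set" where "U \<equiv> ugens (n + m)"

lemma ugens_cases:
  assumes "u \<in> U"
  obtains j where "1 \<le> j" "j < n + m" "u = Gen_E j" | j where "1 \<le> j" "j < n + m" "u = Gen_F j"
    | j where "1 \<le> j" "j < n + m" "u = Gen_K j" | j where "1 \<le> j" "j < n + m" "u = Gen_Kinv j"
proof -
  obtain j where "j \<in> {1..n+m-1}" "u \<in> {Gen_E j, Gen_F j, Gen_K j, Gen_Kinv j}"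
    using assms by (auto simp: ugens_def)
  moreover from this have "1 \<le> j" "j < n + m" by auto
  ultimately show thesis using that by blast
qed

lemma act1_rels: "u \<in> U \<Longrightarrow> x \<in> tsi rels \<Longrightarrow> act1 u x \<in> tsi rels"
  by (elim ugens_cases) (auto intro: aE_rels aF_rels aK_rels aKi_rels)

lemma aE_carr: assumes "1 \<le> j" "j < n + m" "x \<in> carr G" shows "aE j x \<in> carr G"
proof -
  have letter: "aE j (mon [g]) \<in> carr G" if "g \<in> G" for g
    using that assms(1,2) n_ge m_ge
    by (cases g) (auto simp: act1_gens fgens_def intro!: carr_scl carr_mult)
  have "aE j (mon w) \<in> carr G" if "set w \<subseteq> G" for w
    using that
  proof (induction w)
    case (Cons g w)
    have "aK j (mon [g]) \<in> carr G" using Cons.prems by (auto simp: aK_dia intro!: dia_carr)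
    then show ?case
      using Cons letter [of g] by (subst mon_Cons) (auto simp: aE_mult intro!: carr_add carr_mult)
  qed simp
  then show ?thesis
    by (intro free_linear_induct [where p = x and P = "\<lambda>x. aE j x \<in> carr G"])
      (use assms(3) in \<open>auto simp: act1_linear dest: carr_keys\<close>)
qed

lemma act1_carr: "u \<in> U \<Longrightarrow> x \<in> carr G \<Longrightarrow> act1 u x \<in> carr G"
proof (elim ugens_cases)
  fix j assume "1 \<le> j" "j < n + m" "u = Gen_F j" "x \<in> carr G"
  then show "act1 u x \<in> carr G"
    by (simp only: aF_star) (intro carr_scl free_star_carr aE_carr)
qed (auto intro: aE_carr simp: aK_dia aKi_dia intro!: dia_carr)

lemma AF_closed:
  assumes S: "0 \<in> S" "\<And>x y. x \<in> S \<Longrightarrow> y \<in> S \<Longrightarrow> x + y \<in> S" "\<And>c x. x \<in> S \<Longrightarrow> scl c x \<in> S"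
    "\<And>u x. u \<in> U \<Longrightarrow> x \<in> S \<Longrightarrow> act1 u x \<in> S"
    and "a \<in> carr U" "x \<in> S"
  shows "AF a x \<in> S"
proof -
  have "AF (mon us) x \<in> S" if "set us \<subseteq> U" for us
    using that
  proof (induction us)
    case (Cons u us)
    then show ?case using S(4) by (subst mon_Cons) (simp add: AF_mult)
  qed (use assms in simp)
  then show ?thesis
    by (intro free_linear_induct [where p = a and P = "\<lambda>a. AF a x \<in> S"])
      (use assms in \<open>auto simp: AF_linear dest: carr_keys\<close>)
qed

lemma AF_rels: "a \<in> carr U \<Longrightarrow> x \<in> tsi rels \<Longrightarrow> AF a x \<in> tsi rels"
  by (rule AF_closed) (auto intro: tsi.zero tsi.add tsi_scl act1_rels)

lemma AF_carr: "a \<in> carr U \<Longrightarrow> x \<in> carr G \<Longrightarrow> AF a x \<in> carr G"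
  by (rule AF_closed) (auto intro: act1_carr)

lemma counit_free_linear: "counit_free (x + y) = counit_free x + counit_free y"
  "counit_free (scl c x) = c * counit_free x" "counit_free 0 = 0"
  and counit_free_mon: "counit_free (mon us) = prod_list (map counit_letter us)"
proof -
  \<comment> \<open>A linear functional is a linear map into the functions on a one-point type, so
    the lemmas on \<open>lin_ext\<close> apply.\<close>
  define L where "L = lin_ext (\<lambda>w. single () (prod_list (map counit_letter (letters w))))"
  have lin: "lin L" by (simp add: L_def lin_ext_lin)
  have eq: "counit_free p = lookup (L p) ()" for p
    unfolding counit_free_def L_def
    by (subst lookup_lin_ext [OF subset_refl finite_keys]) simp
  show "counit_free (x + y) = counit_free x + counit_free y"
    "counit_free (scl c x) = c * counit_free x" "counit_free 0 = 0"
    by (simp_all add: eq lin_add [OF lin] lin_scl [OF lin] lin_zero [OF lin] lookup_add)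
  show "counit_free (mon us) = prod_list (map counit_letter us)"
    by (simp add: eq L_def)
qed

lemma counit_free_diff: "counit_free (x - y) = counit_free x - counit_free y"
  using counit_free_linear(1) [of "x - y" y] by simp

lemma counit_free_mult: "counit_free (x * y) = counit_free x * counit_free y"
proof -
  have "counit_free (mon us * y) = counit_free (mon us) * counit_free y" for us
    by (rule free_linear_induct [where p = y and P = "\<lambda>y. counit_free (mon us * y) = counit_free (mon us) * counit_free y"])
      (auto simp: counit_free_linear counit_free_mon distrib_left simp flip: mon_append)
  then show ?thesis
    by (intro free_linear_induct [where p = x and P = "\<lambda>x. counit_free (x * y) = counit_free x * counit_free y"])
      (auto simp: counit_free_linear distrib_right)
qed

lemma uq_rels_carr: "uq_rels q (n + m) \<subseteq> carr U"
proof -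
  have if_carr: "(if b then x else y) \<in> carr U" if "x \<in> carr U" "y \<in> carr U" for b x y
    using that by simp
  have *: "Gen_E i \<in> U" "Gen_F i \<in> U" "Gen_K i \<in> U" "Gen_Kinv i \<in> U" if "i \<in> {1..n+m-1}" for i
    using that by (auto simp: ugens_def)
  show ?thesis
    unfolding uq_rels_def Let_def serre_def
    by (rule subsetI; elim UnE CollectE exE conjE; erule ssubst;
        intro carr_diff carr_add carr_mult if_carr; simp add: *)
qed

lemma uq_rels_zero:
  assumes "r \<in> uq_rels q (n + m)"
  shows "AF r p \<approx> 0" and "counit_free r = 0"
proof -
  let ?P = "\<lambda>r. AF r p \<approx> 0 \<and> counit_free r = 0"
  let ?J = "{1..n+m-1}"
  have J: "1 \<le> i \<and> i < n + m" if "i \<in> ?J" for i using that by auto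
  have c: "counit_free (K i) = 1" "counit_free (Kinv i) = 1" "counit_free (E i) = 0" "counit_free (F i) = 0"
    "counit_free 1 = 1" for i
    using counit_free_mon [of "[]"] by (simp_all add: counit_free_mon)
  note simps = AF_linear AF_mult const_mult c counit_free_linear counit_free_diff counit_free_mult
  have P1: "?P (K i * K j - K j * K i)" for i j
    by (simp add: simps aK_aK [of i j])
  have P2: "?P (K i * Kinv i - 1)" "?P (Kinv i * K i - 1)" for i
    by (simp_all add: simps)
  have P3: "?P (K i * E j - rconst (q powi cartan i j) * E j * K i)" for i j
    by (simp add: simps aK_aE qi_def)
  have P4: "?P (K i * F j - rconst (q powi (- cartan i j)) * F j * K i)" for i j
    by (simp add: simps aK_aF qi_def)
  have P5: "?P (E i * F j - F j * E i - (if i = j then rconst (1 / (q - inverse q)) * (K i - Kinv i) else 0))" for i j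
    using aE_aF [of i j p] by (auto simp: simps scl.scale_right_diff_distrib)
  have P6: "?P (serre q (E i) (E j))" if "i \<in> ?J" "j \<in> ?J" "cartan i j = - 1" for i j
    using serreE [of i j p] J [OF that(1)] J [OF that(2)] that(3)
    by (simp add: serre_def serreE_def simps inverse_eq_divide)
  have P7: "?P (serre q (F i) (F j))" if "i \<in> ?J" "j \<in> ?J" "cartan i j = - 1" for i j
    using serreF [of i j p] J [OF that(1)] J [OF that(2)] that(3)
    by (simp add: serre_def simps inverse_eq_divide)
  have P8: "?P (E i * E j - E j * E i)" if "cartan i j = 0" for i j
    using aE_aE [OF that, of p] by (simp add: simps)
  have P9: "?P (F i * F j - F j * F i)" if "cartan i j = 0" for i j
    using aF_aF [OF that, of p] by (simp add: simps)
  have "?P r"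
    using assms unfolding uq_rels_def Let_def
    by - (elim UnE CollectE exE conjE; erule ssubst; rule P1 P2 P3 P4 P5 P6 P7 P8 P9; assumption)
  then show "AF r p \<approx> 0" "counit_free r = 0" by auto
qed

text \<open>As in \<open>TT_cong\<close>, \<open>restr U\<close> discards letters outside
  \<open>U\<close>, whose action need not preserve the ideal.\<close>

lemma uq_ideal_zero:
  assumes "a \<in> genideal (free_algebra U) (uq_rels q (n + m))"
  shows "AF a p \<in> tsi rels" and "counit_free a = 0"
proof -
  have *: "(\<forall>p. AF (restr U a) p \<in> tsi rels) \<and> counit_free (restr U a) = 0" if "a \<in> tsi (uq_rels q (n + m))" for a
    using that
  proof induction
    case (gen r)
    then show ?case using uq_rels_carr uq_rels_zero by (auto simp: restr_carr cong_0_iff)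
  qed (auto simp: lin_zero [OF restr_lin] lin_add [OF restr_lin] restr_mult AF_linear AF_mult
      counit_free_linear counit_free_mult intro: tsi.zero tsi.add AF_rels restr_in_carr)
  have "a \<in> tsi (uq_rels q (n + m)) \<inter> carr U"
    using assms genideal_free_algebra [OF uq_rels_carr] by simp
  then show "AF a p \<in> tsi rels" "counit_free a = 0" using * [of a] by (auto simp: restr_carr)
qed

lemma r_coset_free_algebra: "I +>\<^bsub>free_algebra H\<^esub> p = {x. x - p \<in> I}"
proof -
  have "x \<in> I +>\<^bsub>free_algebra H\<^esub> p \<longleftrightarrow> x - p \<in> I" for x
  proof
    assume "x - p \<in> I"
    then have "\<exists>h\<in>I. x = h + p" by (intro bexI [of _ "x - p"]) auto
    then show "x \<in> I +>\<^bsub>free_algebra H\<^esub> p" by (simp add: a_r_coset_def r_coset_def)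
  qed (auto simp: a_r_coset_def r_coset_def)
  then show ?thesis by auto
qed

lemma fun_class_eq: "fun_class q n m p = {x. x - p \<in> fun_ideal q n m}"
  by (simp add: fun_class_def r_coset_free_algebra)

lemma fun_class_mem: "p \<in> carr G \<Longrightarrow> x \<in> fun_class q n m p \<longleftrightarrow> x \<in> carr G \<and> x \<approx> p"
  using carr_add [of "x - p" G p] by (auto simp: fun_class_eq fun_ideal_eq cong_def)

lemma fun_class_cong: "p \<in> carr G \<Longrightarrow> p' \<in> carr G \<Longrightarrow> p \<approx> p' \<Longrightarrow> fun_class q n m p = fun_class q n m p'"
  using cong_trans [of _ p p'] cong_trans [of _ p' p] cong_sym [of p p'] by (auto simp: fun_class_mem)

text \<open>\<open>act\<close> and \<open>counit\<close> are given by \<open>the_elem\<close>, so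
  the images of the cosets have to be shown to be singletons.\<close>

lemma act_class:
  assumes a: "a \<in> carr U" and p: "p \<in> carr G"
  shows "act q n m (genideal (free_algebra U) (uq_rels q (n + m)) +>\<^bsub>free_algebra U\<^esub> a)
    (fun_class q n m p) = fun_class q n m (AF a p)"
    and "counit (genideal (free_algebra U) (uq_rels q (n + m)) +>\<^bsub>free_algebra U\<^esub> a) = counit_free a"
proof -
  let ?I = "genideal (free_algebra U) (uq_rels q (n + m))"
  have I: "?I = tsi (uq_rels q (n + m)) \<inter> carr U"
    using genideal_free_algebra [OF uq_rels_carr] by simp
  have mem: "b \<in> carr U \<and> b - a \<in> ?I" if "b \<in> ?I +>\<^bsub>free_algebra U\<^esub> a" for b
    using that carr_add [of "b - a" U a] a by (auto simp: r_coset_free_algebra I)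
  have a_mem: "a \<in> ?I +>\<^bsub>free_algebra U\<^esub> a"
    by (simp add: r_coset_free_algebra I tsi.zero)
  have p_mem: "p \<in> fun_class q n m p"
    using p by (simp add: fun_class_mem)
  have "fun_class q n m (AF b x) = fun_class q n m (AF a p)"
    if "b \<in> ?I +>\<^bsub>free_algebra U\<^esub> a" "x \<in> fun_class q n m p" for b x
  proof (rule fun_class_cong)
    have b: "b \<in> carr U" "b - a \<in> ?I" and x: "x \<in> carr G" "x \<approx> p"
      using mem [OF that(1)] that(2) p by (auto simp: fun_class_mem)
    have "AF b x \<approx> AF a x"
      using uq_ideal_zero(1) [OF b(2), of x] by (simp add: AF_linear cong_def)
    also have "\<dots> \<approx> AF a p"
      using AF_rels [OF a, of "x - p"] x(2) by (simp add: lin_diff [OF AF_lin_vec] cong_def)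
    finally show "AF b x \<approx> AF a p" .
    show "AF b x \<in> carr G" "AF a p \<in> carr G" using AF_carr a b x p by auto
  qed
  then have "(\<lambda>(a', p). fun_class q n m (act_free q n a' p)) ` ((?I +>\<^bsub>free_algebra U\<^esub> a) \<times> fun_class q n m p)
      = {fun_class q n m (AF a p)}"
    by (intro image_const_singleton [of "(a, p)"] SigmaI a_mem p_mem) (auto simp: split_beta)
  then show "act q n m (?I +>\<^bsub>free_algebra U\<^esub> a) (fun_class q n m p) = fun_class q n m (AF a p)"
    by (simp add: act_def)
  have "counit_free b = counit_free a" if "b \<in> ?I +>\<^bsub>free_algebra U\<^esub> a" for b
    using uq_ideal_zero(2) [of "b - a"] mem [OF that] by (simp add: counit_free_diff)
  then have "counit_free ` (?I +>\<^bsub>free_algebra U\<^esub> a) = {counit_free a}"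
    by (intro image_const_singleton [OF a_mem])
  then show "counit (?I +>\<^bsub>free_algebra U\<^esub> a) = counit_free a"
    by (simp add: counit_def)
qed

end


section \<open>Normal forms\<close>

lemma upt_split: "lo \<le> i \<Longrightarrow> i \<le> hi \<Longrightarrow> [lo..<hi] = [lo..<i] @ [i..<hi]"
  by (metis le_add_diff_inverse upt_add_eq_append)

lemma prod_upt_split:
  fixes f :: "nat \<Rightarrow> 'a :: monoid_mult"
  assumes "lo \<le> i" "i < hi"
  shows "prod_list (map f [lo..<hi]) = prod_list (map f [lo..<i]) * (f i * prod_list (map f [i + 1..<hi]))"
proof -
  have "[lo..<hi] = [lo..<i] @ i # [i + 1..<hi]"
    using assms upt_split [of lo i hi] upt_conv_Cons [of i hi] by simp
  then show ?thesis by (simp only: map_append prod_list.append list.map prod_list.Cons)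
qed

context hyperboloid
begin

text \<open>Spans absorb nonzero scalars, so for normal ordering only the existence of the scalar is
  recorded.\<close>

definition qcc :: "fgen free \<Rightarrow> fgen free \<Rightarrow> bool" where
  "qcc a b \<longleftrightarrow> (\<exists>s. s \<noteq> 0 \<and> qcm s a b)"

lemma qccI: "qcm s a b \<Longrightarrow> s \<noteq> 0 \<Longrightarrow> qcc a b"
  by (auto simp: qcc_def)

lemma qccE: assumes "qcc a b" obtains s where "a * b \<approx> scl s (b * a)"
  using assms by (auto simp: qcc_def qcm_def)

lemma qcc_sym: "qcc a b \<Longrightarrow> qcc b a"
  unfolding qcc_def using qcm_sym by (metis divide_eq_0_iff one_neq_zero)

lemma qcc_mult_right: "qcc a b \<Longrightarrow> qcc a c \<Longrightarrow> qcc a (b * c)"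
  unfolding qcc_def using qcm_mult_right by (metis mult_eq_0_iff)

lemma qcc_one: "qcc a 1"
  unfolding qcc_def using qcm_one by (metis one_neq_zero)

lemma qcc_power_right: "qcc a b \<Longrightarrow> qcc a (b ^ k)"
  by (induction k) (auto intro: qcc_one qcc_mult_right)

lemma qcc_prod_list: "(\<And>j. j \<in> set js \<Longrightarrow> qcc a (f j)) \<Longrightarrow> qcc a (prod_list (map f js))"
  by (induction js) (auto intro: qcc_one qcc_mult_right)

lemma qcc_letters: assumes "1 \<le> i" "1 \<le> j" "i \<le> n + m" "j \<le> n + m" "i \<noteq> j" "x \<in> {t i, ts i}"
  shows "qcc x (t j)" "qcc x (ts j)"
proof -
  have "i < j \<or> j < i" using assms by auto
  moreover have "qcc (t i) (ts j)" "qcc (ts i) (t j)"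
    using qccI [OF qcm_tts(1) [of i j]] qccI [OF qcm_tts(2) [of j i]] assms by simp_all
  moreover have "i < j \<Longrightarrow> qcc (t i) (t j)" "i < j \<Longrightarrow> qcc (ts i) (ts j)"
    using qccI [OF qcm_tt(1) [of i j]] qccI [OF qcm_tt(4) [of i j]] assms by simp_all
  moreover have "j < i \<Longrightarrow> qcc (t i) (t j)" "j < i \<Longrightarrow> qcc (ts i) (ts j)"
    using qccI [OF qcm_tt(2) [of j i]] qccI [OF qcm_tt(3) [of j i]] assms by simp_all
  ultimately show "qcc x (t j)" "qcc x (ts j)" using assms(6) by auto
qed

lemma qcc_X: assumes "1 \<le> i" "1 \<le> j" "j \<le> n + m" shows "qcc (X i) (t j)" "qcc (X i) (ts j)"
  using assms qccI [OF qcm_X_t_less [of j i]] qccI [OF qcm_X_t_ge [of i j]]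
    qccI [OF qcm_X_ts_less [of j i]] qccI [OF qcm_X_ts_ge [of i j]]
  by (cases "j < i"; simp)+

text \<open>A signed exponent covers powers of \<open>t j\<close> and of \<open>ts j\<close>: when
  both letters meet, they cancel into elements \<open>X\<close>, so a normal form contains only one
  of them for each j.\<close>

definition tpow :: "nat \<Rightarrow> int \<Rightarrow> fgen free" where
  "tpow j k = (if 0 \<le> k then t j ^ nat k else ts j ^ nat (- k))"

lemma tpow_0 [simp]: "tpow j 0 = 1"
  by (simp add: tpow_def)

lemma qcc_tpow: "qcc a (t j) \<Longrightarrow> qcc a (ts j) \<Longrightarrow> qcc a (tpow j k)"
  by (simp add: tpow_def qcc_power_right)

definition tpow_prod :: "nat \<Rightarrow> nat \<Rightarrow> (nat \<Rightarrow> int) \<Rightarrow> fgen free" where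
  "tpow_prod lo hi D = prod_list (map (\<lambda>j. tpow j (D j)) [lo..<hi])"

lemma tpow_prod_split: "lo \<le> i \<Longrightarrow> i < hi \<Longrightarrow> tpow_prod lo hi D = tpow_prod lo i D * (tpow i (D i) * tpow_prod (i + 1) hi D)"
  unfolding tpow_prod_def by (rule prod_upt_split)

lemma tpow_prod_append: "lo \<le> i \<Longrightarrow> i \<le> hi \<Longrightarrow> tpow_prod lo hi D = tpow_prod lo i D * tpow_prod i hi D"
  unfolding tpow_prod_def by (subst upt_split [of lo i hi]) auto

lemma tpow_prod_cong: "(\<And>j. lo \<le> j \<Longrightarrow> j < hi \<Longrightarrow> D j = D' j) \<Longrightarrow> tpow_prod lo hi D = tpow_prod lo hi D'"
  unfolding tpow_prod_def by (intro arg_cong [where f = prod_list] map_cong) auto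

lemma tpow_prod_upd: "i < lo \<or> hi \<le> i \<Longrightarrow> tpow_prod lo hi (D(i := k)) = tpow_prod lo hi D"
  by (rule tpow_prod_cong) auto

lemma tpow_prod_one: "(\<And>j. lo \<le> j \<Longrightarrow> j < hi \<Longrightarrow> D j = 0) \<Longrightarrow> tpow_prod lo hi D = 1"
  using tpow_prod_cong [of lo hi D "\<lambda>_. 0"] by (auto simp: tpow_prod_def map_replicate_const)

lemma qcc_tpow_prod: assumes "1 \<le> i" "i \<le> n + m" "x \<in> {t i, ts i}" "1 \<le> lo" "hi \<le> n + m + 1" "i < lo \<or> hi \<le> i"
  shows "qcc x (tpow_prod lo hi D)"
  unfolding tpow_prod_def using assms by (intro qcc_prod_list qcc_tpow qcc_letters [of i]) auto

lemma qcc_X_tpow_prod: assumes "1 \<le> i" "1 \<le> lo" "hi \<le> n + m + 1" shows "qcc (X i) (tpow_prod lo hi D)"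
  unfolding tpow_prod_def using assms by (intro qcc_prod_list qcc_tpow qcc_X) auto

text \<open>The product starts at n + 2 because \<open>X j\<close> with j <= n + 1 is absorbed by
  \<open>f0\<close>.\<close>

definition X_prod :: "(nat \<Rightarrow> nat) \<Rightarrow> fgen free" where
  "X_prod c = prod_list (map (\<lambda>j. X j ^ c j) [n+2..<n+m+1])"

lemma qcc_X_X: "1 \<le> i \<Longrightarrow> 1 \<le> j \<Longrightarrow> qcc (X i) (X j)"
  unfolding qcc_def using qcm_X_X by (metis one_neq_zero)

lemma qcc_X_X_prod: "1 \<le> i \<Longrightarrow> qcc (X i) (X_prod c)"
  unfolding X_prod_def by (intro qcc_prod_list qcc_power_right qcc_X_X) auto

lemma qcc_X_prod: assumes "1 \<le> i" "i \<le> n + m" "x \<in> {t i, ts i}" shows "qcc x (X_prod c)"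
  unfolding X_prod_def using assms
  by (intro qcc_prod_list qcc_power_right; intro qcc_sym [of "X _"]) (auto intro: qcc_X)

definition nf :: "(nat \<Rightarrow> int) \<Rightarrow> (nat \<Rightarrow> nat) \<Rightarrow> (nat \<Rightarrow> int) \<Rightarrow> fgen free" where
  "nf D c B = tpow_prod 1 (n + m + 1) D * (X_prod c * (f0 * tpow_prod 1 (n + 1) B))"

text \<open>For j <= n the signs reflect that \<open>ts j\<close> is killed by \<open>f0\<close> on
  its right and \<open>t j\<close> by \<open>f0\<close> on its left. Letters with j > n commute with
  \<open>f0\<close> and all stand to its left. Fixing the exponents to 0 outside their ranges makes
  a triple determined by the exponents that occur in the word.\<close>

definition valid :: "(nat \<Rightarrow> int) \<Rightarrow> (nat \<Rightarrow> nat) \<Rightarrow> (nat \<Rightarrow> int) \<Rightarrow> bool" where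
  "valid D c B \<longleftrightarrow> (\<forall>j\<in>{1..n}. 0 \<le> D j) \<and> (\<forall>j. j \<notin> {1..n+m} \<longrightarrow> D j = 0) \<and>
     (\<forall>j. j \<notin> {n+2..n+m} \<longrightarrow> c j = 0) \<and> (\<forall>j\<in>{1..n}. B j \<le> 0) \<and> (\<forall>j. j \<notin> {1..n} \<longrightarrow> B j = 0)"

definition nf_weight :: "(nat \<Rightarrow> int) \<Rightarrow> (nat \<Rightarrow> int) \<Rightarrow> int" where
  "nf_weight D B = sum D {1..n+m} + sum B {1..n}"

text \<open>The grading by gauge weight d is kept because it is needed to recover the exponent of
  the diagonally acting letter \<open>t (n + m)\<close> in \<open>nf_lin_faithful\<close>.\<close>

inductive nf_span :: "int \<Rightarrow> fgen free \<Rightarrow> bool" where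
  nf_span_nf: "valid D c B \<Longrightarrow> nf_span (nf_weight D B) (nf D c B)"
| nf_span_zero: "nf_span d 0"
| nf_span_add: "nf_span d x \<Longrightarrow> nf_span d y \<Longrightarrow> nf_span d (x + y)"
| nf_span_scl: "nf_span d x \<Longrightarrow> nf_span d (scl z x)"
| nf_span_cong: "nf_span d x \<Longrightarrow> x \<approx> y \<Longrightarrow> nf_span d y"

lemma nf_span_cong_scl: "nf_span d y \<Longrightarrow> x \<approx> scl s y \<Longrightarrow> nf_span d x"
  using nf_span_cong nf_span_scl cong_sym by blast

lemma nf_span_cong_zero: "x \<approx> 0 \<Longrightarrow> nf_span d x"
  using nf_span_cong nf_span_zero cong_sym by blast

lemma nf_span_diff: "nf_span d x \<Longrightarrow> nf_span d y \<Longrightarrow> nf_span d (x - y)"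
  using nf_span_add [of d x "scl (- 1) y"] nf_span_scl [of d y "- 1"] by simp

section \<open>Left multiplication of normal forms\<close>

lemma X_prod_upd: assumes "n + 2 \<le> i" "i \<le> n + m"
  shows "\<exists>s. X i * X_prod c \<approx> scl s (X_prod (c(i := c i + 1)))"
proof -
  define XPP where "XPP lo hi c = prod_list (map (\<lambda>j. X j ^ c j) [lo..<hi])" for lo hi and c :: "nat \<Rightarrow> nat"
  have split: "X_prod c = XPP (n+2) i c * (X i ^ c i * XPP (i+1) (n+m+1) c)" for c
    unfolding X_prod_def XPP_def using assms by (intro prod_upt_split) auto
  have upd: "XPP (n+2) i (c(i := k)) = XPP (n+2) i c" "XPP (i+1) (n+m+1) (c(i := k)) = XPP (i+1) (n+m+1) c" for k
    unfolding XPP_def by (intro arg_cong [where f = prod_list] map_cong; auto)+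
  have "qcc (X i) (XPP (n+2) i c)"
    unfolding XPP_def using assms by (intro qcc_prod_list qcc_power_right qcc_X_X) auto
  then obtain s where "X i * XPP (n+2) i c \<approx> scl s (XPP (n+2) i c * X i)"
    by (rule qccE)
  from cong_mult_right [OF this, of "X i ^ c i * XPP (i+1) (n+m+1) c"]
  have "X i * X_prod c \<approx> scl s (X_prod (c(i := c i + 1)))"
    unfolding split [of c] split [of "c(i := c i + 1)"] upd by (simp add: mult.assoc)
  then show ?thesis ..
qed

text \<open>For i <= n + 1 the inserted \<open>X i\<close> is absorbed by \<open>f0\<close>, up to n
  + m it raises an exponent of \<open>X_prod\<close>, and beyond that it is 0.\<close>

lemma nf_span_X: assumes "valid D c B" "1 \<le> i"
  shows "nf_span (nf_weight D B) (tpow_prod 1 (n + m + 1) D * (X i * (X_prod c * (f0 * tpow_prod 1 (n + 1) B))))"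
proof -
  let ?P = "tpow_prod 1 (n + m + 1) D" and ?R = "f0 * tpow_prod 1 (n + 1) B"
  consider "i \<le> n + 1" | "n + 2 \<le> i" "i \<le> n + m" | "n + m < i" by linarith
  then show ?thesis
  proof cases
    case 1
    obtain s where s: "X i * X_prod c \<approx> scl s (X_prod c * X i)"
      using qccE [OF qcc_X_X_prod [OF assms(2)]] by blast
    have "?P * (X i * (X_prod c * ?R)) = ?P * ((X i * X_prod c) * ?R)" by (simp add: mult.assoc)
    also have "\<dots> \<approx> ?P * (scl s (X_prod c * X i) * ?R)"
      by (intro cong_mult_left cong_mult_right s)
    also have "\<dots> = scl s (?P * (X_prod c * (X i * f0 * tpow_prod 1 (n + 1) B)))" by (simp add: mult.assoc)
    also have "\<dots> \<approx> scl s (?P * (X_prod c * ?R))"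
      using 1 assms by (intro cong_scl cong_mult_left cong_mult_right X_le_f0)
    also have "\<dots> = scl s (nf D c B)" by (simp add: nf_def)
    finally show ?thesis by (rule nf_span_cong_scl [OF nf_span_nf [OF assms(1)]])
  next
    case 2
    obtain s where s: "X i * X_prod c \<approx> scl s (X_prod (c(i := c i + 1)))"
      using X_prod_upd [OF 2] by blast
    have "?P * (X i * (X_prod c * ?R)) = ?P * ((X i * X_prod c) * ?R)" by (simp add: mult.assoc)
    also have "\<dots> \<approx> ?P * (scl s (X_prod (c(i := c i + 1))) * ?R)"
      by (intro cong_mult_left cong_mult_right s)
    also have "\<dots> = scl s (nf D (c(i := c i + 1)) B)" by (simp add: nf_def)
    finally show ?thesis
      using assms 2 by (elim nf_span_cong_scl [OF nf_span_nf, rotated]) (auto simp: valid_def)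
  next
    case 3
    then show ?thesis by (simp add: nf_span_zero)
  qed
qed

lemma nf_span_insert_X: assumes "valid D c B" "1 \<le> i" "1 \<le> j" "j \<le> n + m + 1"
  shows "nf_span (nf_weight D B) (tpow_prod 1 j D * (X i * (tpow_prod j (n + m + 1) D * (X_prod c * (f0 * tpow_prod 1 (n + 1) B)))))"
proof -
  let ?R = "X_prod c * (f0 * tpow_prod 1 (n + 1) B)"
  obtain s where s: "X i * tpow_prod j (n + m + 1) D \<approx> scl s (tpow_prod j (n + m + 1) D * X i)"
    using qcc_X_tpow_prod [of i j "n + m + 1"] assms by (auto elim: qccE)
  have "tpow_prod 1 j D * (X i * (tpow_prod j (n + m + 1) D * ?R)) = tpow_prod 1 j D * ((X i * tpow_prod j (n + m + 1) D) * ?R)"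
    by (simp add: mult.assoc)
  also have "\<dots> \<approx> tpow_prod 1 j D * (scl s (tpow_prod j (n + m + 1) D * X i) * ?R)"
    by (intro cong_mult_left cong_mult_right s)
  also have "\<dots> = scl s (tpow_prod 1 (n + m + 1) D * (X i * ?R))"
    using assms tpow_prod_append [of 1 j "n + m + 1" D] by (simp add: mult.assoc)
  finally show ?thesis by (rule nf_span_cong_scl [OF nf_span_X [OF assms(1,2)]])
qed

text \<open>Either the letter extends the power, or it meets its adjoint and the pair becomes a
  combination of \<open>X i\<close> and \<open>X (i + 1)\<close> by \<open>tts_X\<close> or
  \<open>tst_X\<close>.\<close>

lemma tpow_step:
  assumes "1 \<le> i" "i \<le> n + m" "(x, \<delta>) \<in> {(t i, 1), (ts i, - 1)}"
  shows "x * tpow i k = tpow i (k + \<delta>) \<or>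
    (\<exists>z z'. x * tpow i k \<approx> scl z ((X i - scl z' (X (i + 1))) * tpow i (k + \<delta>)))"
proof -
  have pow: "tpow i k = ts i * tpow i (k + 1)" if "k < 0" for k
  proof -
    have "nat (- k) = Suc (nat (- (k + 1)))" using that by simp
    then show ?thesis using that by (cases "k = - 1") (auto simp: tpow_def)
  qed
  have pow': "tpow i k = t i * tpow i (k - 1)" if "0 < k" for k
  proof -
    have "nat k = Suc (nat (k - 1))" using that by simp
    then show ?thesis using that by (auto simp: tpow_def)
  qed
  consider "x = t i" "\<delta> = 1" "k < 0" | "x = ts i" "\<delta> = - 1" "0 < k" | "x = t i" "\<delta> = 1" "0 \<le> k"
    | "x = ts i" "\<delta> = - 1" "k \<le> 0" using assms(3) by force
  then show ?thesis
  proof cases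
    case 1
    have "x * tpow i k = t i * ts i * tpow i (k + \<delta>)" using 1 by (simp add: pow mult.assoc)
    also have "\<dots> \<approx> scl (eps i) (X i - X (i + 1)) * tpow i (k + \<delta>)"
      using assms by (intro cong_mult_right tts_X)
    also have "\<dots> = scl (eps i) ((X i - scl 1 (X (i + 1))) * tpow i (k + \<delta>))" by simp
    finally show ?thesis by blast
  next
    case 2
    have "x * tpow i k = ts i * t i * tpow i (k + \<delta>)" using 2 by (simp add: pow' mult.assoc)
    also have "\<dots> \<approx> scl (eps i) (X i - scl (1 / qc\<^sup>2) (X (i + 1))) * tpow i (k + \<delta>)"
      using assms by (intro cong_mult_right tst_X)
    also have "\<dots> = scl (eps i) ((X i - scl (1 / qc\<^sup>2) (X (i + 1))) * tpow i (k + \<delta>))" by simp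
    finally show ?thesis by blast
  next
    case 3
    then show ?thesis using pow' [of "k + 1"] by simp
  next
    case 4
    then show ?thesis using pow [of "k - 1"] by simp
  qed
qed

lemma sum_upd: "finite A \<Longrightarrow> i \<in> A \<Longrightarrow> sum (D(i := D i + \<delta>)) A = sum D A + (\<delta> :: int)"
  by (simp add: sum.remove [of A i])

lemma nf_span_left_nf:
  assumes v: "valid D c B" and i: "1 \<le> i" "i \<le> n + m" and x: "(x, \<delta>) \<in> {(t i, 1), (ts i, - 1)}"
  shows "nf_span (nf_weight D B + \<delta>) (x * nf D c B)"
proof (cases "i \<le> n \<and> \<delta> = - 1 \<and> D i = 0")
  case True
  \<comment> \<open>The exponent of i would become negative here. As \<open>D i = 0\<close>, the
    letter \<open>ts i\<close> commutes up to scalars with everything to the left of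
    \<open>f0\<close>, and then it annihilates \<open>f0\<close>.\<close>
  let ?P = "tpow_prod 1 (n + m + 1) D"
  have x': "x = ts i" using x True by auto
  have Psplit: "?P = tpow_prod 1 i D * tpow_prod (i + 1) (n + m + 1) D"
    using tpow_prod_split [of 1 i "n + m + 1" D] i True by simp
  have "qcc x ?P"
    unfolding Psplit using i x by (intro qcc_mult_right qcc_tpow_prod) auto
  then obtain s where s: "x * ?P \<approx> scl s (?P * x)" by (rule qccE)
  obtain s' where s': "x * X_prod c \<approx> scl s' (X_prod c * x)"
    using qcc_X_prod [of i x c] i x by (auto elim: qccE)
  have "x * nf D c B = (x * ?P) * (X_prod c * (f0 * tpow_prod 1 (n + 1) B))"
    by (simp add: nf_def mult.assoc)
  also have "\<dots> \<approx> scl s (?P * x) * (X_prod c * (f0 * tpow_prod 1 (n + 1) B))"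
    by (intro cong_mult_right s)
  also have "\<dots> = scl s (?P * ((x * X_prod c) * (f0 * tpow_prod 1 (n + 1) B)))" by (simp add: mult.assoc)
  also have "\<dots> \<approx> scl s (?P * (scl s' (X_prod c * x) * (f0 * tpow_prod 1 (n + 1) B)))"
    by (intro cong_scl cong_mult_left cong_mult_right s')
  also have "\<dots> = scl s (scl s' (?P * (X_prod c * ((x * f0) * tpow_prod 1 (n + 1) B))))" by (simp add: mult.assoc)
  also have "\<dots> \<approx> scl s (scl s' (?P * (X_prod c * (0 * tpow_prod 1 (n + 1) B))))"
    unfolding x' using i True by (intro cong_scl cong_mult_left cong_mult_right ts_f0) auto
  finally show ?thesis by (intro nf_span_cong_zero) simp
next
  case False
  let ?N = "n + m + 1" and ?R = "X_prod c * (f0 * tpow_prod 1 (n + 1) B)"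
  let ?D = "D(i := D i + \<delta>)"
  have "0 \<le> D i + \<delta>" if "i \<le> n"
  proof -
    have "0 \<le> D i" using v i that by (auto simp: valid_def)
    then show ?thesis using x False that by auto
  qed
  then have v': "valid ?D c B"
    using v i by (auto simp: valid_def)
  have w: "nf_weight ?D B = nf_weight D B + \<delta>"
    unfolding nf_weight_def using i sum_upd [of "{1..n+m}" i D \<delta>] by (simp del: fun_upd_apply)
  have split: "tpow_prod 1 ?N D = tpow_prod 1 i D * (tpow i (D i) * tpow_prod (i + 1) ?N D)"
    "tpow_prod 1 ?N ?D = tpow_prod 1 i D * (tpow i (D i + \<delta>) * tpow_prod (i + 1) ?N D)"
    "tpow_prod i ?N ?D = tpow i (D i + \<delta>) * tpow_prod (i + 1) ?N D" "tpow_prod 1 i ?D = tpow_prod 1 i D"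
    using i tpow_prod_split [of 1 i ?N] tpow_prod_split [of i i ?N ?D] by (auto simp: tpow_prod_upd) (simp add: tpow_prod_def)
  obtain s where s: "x * tpow_prod 1 i D \<approx> scl s (tpow_prod 1 i D * x)"
    using qcc_tpow_prod [of i x 1 i D] i x by (auto elim: qccE)
  have "x * nf D c B = (x * tpow_prod 1 i D) * (tpow i (D i) * tpow_prod (i + 1) ?N D * ?R)"
    unfolding nf_def split by (simp add: mult.assoc)
  also have "\<dots> \<approx> scl s (tpow_prod 1 i D * x) * (tpow i (D i) * tpow_prod (i + 1) ?N D * ?R)"
    by (intro cong_mult_right s)
  also have "\<dots> = scl s (tpow_prod 1 i D * ((x * tpow i (D i)) * (tpow_prod (i + 1) ?N D * ?R)))"
    by (simp add: mult.assoc)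
  finally have 1: "x * nf D c B \<approx> \<dots>" .
  have 2: "nf_span (nf_weight D B + \<delta>) (tpow_prod 1 i D * ((x * tpow i (D i)) * (tpow_prod (i + 1) ?N D * ?R)))"
    using tpow_step [OF i x, of "D i"]
  proof (elim disjE exE)
    assume "x * tpow i (D i) = tpow i (D i + \<delta>)"
    then have "tpow_prod 1 i D * ((x * tpow i (D i)) * (tpow_prod (i + 1) ?N D * ?R)) = nf ?D c B"
      unfolding nf_def split by (simp add: mult.assoc)
    then show ?thesis using nf_span_nf [OF v'] by (simp add: w)
  next
    fix z z'
    assume "x * tpow i (D i) \<approx> scl z ((X i - scl z' (X (i + 1))) * tpow i (D i + \<delta>))"
    then have "tpow_prod 1 i D * ((x * tpow i (D i)) * (tpow_prod (i + 1) ?N D * ?R)) \<approx>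
       tpow_prod 1 i D * (scl z ((X i - scl z' (X (i + 1))) * tpow i (D i + \<delta>)) * (tpow_prod (i + 1) ?N D * ?R))"
      by (intro cong_mult_left cong_mult_right)
    also have "\<dots> = scl z (tpow_prod 1 i ?D * (X i * (tpow_prod i ?N ?D * ?R)) -
        scl z' (tpow_prod 1 i ?D * (X (i + 1) * (tpow_prod i ?N ?D * ?R))))"
      unfolding split by (simp add: left_diff_distrib right_diff_distrib mult.assoc)
    finally show ?thesis
      using nf_span_insert_X [OF v', of i i] nf_span_insert_X [OF v', of "i + 1" i] i
      by (elim nf_span_cong_scl [rotated]) (intro nf_span_diff nf_span_scl; simp add: w)
  qed
  show ?thesis by (rule nf_span_cong_scl [OF 2 1])
qed

text \<open>If \<open>D i > 0\<close> for some i <= n, a letter \<open>t i\<close> can be brought to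
  the front, where \<open>f0\<close> annihilates it. Otherwise all factors before the inner
  \<open>f0\<close> have index above n and commute with \<open>f0\<close> up to scalars, and
  \<open>f0\<close> is idempotent.\<close>

lemma nf_span_left_f0: assumes v: "valid D c B" shows "nf_span (nf_weight D B) (f0 * nf D c B)"
proof (cases "\<exists>i\<in>{1..n}. 0 < D i")
  case True
  let ?N = "n + m + 1"
  obtain i where i: "1 \<le> i" "i \<le> n" "0 < D i" using True by auto
  obtain s where s: "t i * tpow_prod 1 i D \<approx> scl s (tpow_prod 1 i D * t i)" "s \<noteq> 0"
    using qcc_tpow_prod [of i "t i" 1 i D] i by (auto simp: qcc_def qcm_def)
  have s': "tpow_prod 1 i D * t i \<approx> scl (1 / s) (t i * tpow_prod 1 i D)"
    using cong_scl [OF s(1), of "1 / s"] s(2) by (simp add: cong_sym)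
  have "nat (D i) = Suc (nat (D i - 1))" using i by simp
  then have tpow: "tpow i (D i) = t i * tpow i (D i - 1)" using i by (simp add: tpow_def)
  have "f0 * nf D c B = f0 * ((tpow_prod 1 i D * t i) * (tpow i (D i - 1) * tpow_prod (i + 1) ?N D * (X_prod c * (f0 * tpow_prod 1 (n + 1) B))))"
    using i tpow_prod_split [of 1 i ?N D] by (simp add: nf_def tpow mult.assoc)
  also have "\<dots> \<approx> f0 * (scl (1 / s) (t i * tpow_prod 1 i D) * (tpow i (D i - 1) * tpow_prod (i + 1) ?N D * (X_prod c * (f0 * tpow_prod 1 (n + 1) B))))"
    by (intro cong_mult_left cong_mult_right s')
  also have "\<dots> = scl (1 / s) ((f0 * t i) * (tpow_prod 1 i D * (tpow i (D i - 1) * tpow_prod (i + 1) ?N D * (X_prod c * (f0 * tpow_prod 1 (n + 1) B)))))"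
    by (simp add: mult.assoc)
  also have "\<dots> \<approx> scl (1 / s) (0 * (tpow_prod 1 i D * (tpow i (D i - 1) * tpow_prod (i + 1) ?N D * (X_prod c * (f0 * tpow_prod 1 (n + 1) B)))))"
    using i by (intro cong_scl cong_mult_right f0_t)
  finally show ?thesis by (intro nf_span_cong_zero) simp
next
  case False
  let ?N = "n + m + 1"
  have "D j = 0" if "1 \<le> j" "j < n + 1" for j
  proof -
    have "0 \<le> D j" using v that by (auto simp: valid_def)
    moreover have "\<not> 0 < D j" using False that by auto
    ultimately show ?thesis by simp
  qed
  then have "tpow_prod 1 (n + 1) D = 1" by (rule tpow_prod_one)
  then have P: "tpow_prod 1 ?N D = tpow_prod (n + 1) ?N D" using tpow_prod_append [of 1 "n + 1" ?N D] by simp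
  have q: "qcc f0 (t j)" "qcc f0 (ts j)" if "n + 1 \<le> j" "j \<le> n + m" for j
    using qcm_f0 [OF that] by (auto intro!: qcc_sym [OF qccI])
  have "qcm 1 (X j) f0" if "n + 1 \<le> j" for j
    unfolding X_def
  proof (intro qcm_sum_left qcm_scl_left)
    fix k assume "k \<in> {j..n+m}"
    then have "qcm (1 * 1) (t k * ts k) f0" using that by (intro qcm_mult_left qcm_f0) auto
    then show "qcm 1 (t k * ts k) f0" by simp
  qed
  then have "qcc f0 (X j)" if "n + 1 \<le> j" for j
    using that by (auto intro!: qcc_sym [OF qccI])
  then have "qcc f0 (tpow_prod (n + 1) ?N D * X_prod c)"
    unfolding tpow_prod_def X_prod_def using q
    by (intro qcc_mult_right qcc_prod_list qcc_power_right qcc_tpow) auto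
  then obtain s where s: "f0 * (tpow_prod (n + 1) ?N D * X_prod c) \<approx> scl s (tpow_prod (n + 1) ?N D * X_prod c * f0)"
    by (rule qccE)
  have "f0 * nf D c B = f0 * (tpow_prod (n + 1) ?N D * X_prod c) * (f0 * tpow_prod 1 (n + 1) B)"
    unfolding nf_def P by (simp add: mult.assoc)
  also have "\<dots> \<approx> scl s (tpow_prod (n + 1) ?N D * X_prod c * f0) * (f0 * tpow_prod 1 (n + 1) B)"
    by (intro cong_mult_right s)
  also have "\<dots> = scl s (tpow_prod (n + 1) ?N D * (X_prod c * ((f0 * f0) * tpow_prod 1 (n + 1) B)))" by (simp add: mult.assoc)
  also have "\<dots> \<approx> scl s (tpow_prod (n + 1) ?N D * (X_prod c * (f0 * tpow_prod 1 (n + 1) B)))"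
    by (intro cong_scl cong_mult_left cong_mult_right f0_f0)
  also have "\<dots> = scl s (nf D c B)" unfolding nf_def P ..
  finally show ?thesis by (rule nf_span_cong_scl [OF nf_span_nf [OF v]])
qed

fun gw :: "fgen \<Rightarrow> int" where
  "gw (Gen_t j) = 1"
| "gw (Gen_ts j) = - 1"
| "gw Gen_f0 = 0"

lemma nf_span_left: assumes "g \<in> G" "nf_span d x" shows "nf_span (d + gw g) (mon [g] * x)"
  using assms(2)
proof induction
  case (nf_span_nf D c B)
  show ?case
  proof (cases g)
    case (Gen_t i)
    then show ?thesis using nf_span_left_nf [OF nf_span_nf, of i "t i" 1] assms(1) by (auto simp: fgens_def)
  next
    case (Gen_ts i)
    then show ?thesis using nf_span_left_nf [OF nf_span_nf, of i "ts i" "- 1"] assms(1) by (auto simp: fgens_def)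
  next
    case Gen_f0
    then show ?thesis using nf_span_left_f0 [OF nf_span_nf] by simp
  qed
next
  case (nf_span_cong d x y)
  then show ?case using nf_span.nf_span_cong cong_mult_left by blast
qed (auto simp: distrib_left intro: nf_span_zero nf_span_add nf_span_scl)

lemma nf_span_left_word: "set w \<subseteq> G \<Longrightarrow> nf_span d x \<Longrightarrow> nf_span (d + sum_list (map gw w)) (mon w * x)"
proof (induction w)
  case (Cons g w)
  then show ?case
    using nf_span_left [of g "d + sum_list (map gw w)" "mon w * x"]
    by (subst mon_Cons) (simp add: mult.assoc add_ac)
qed simp

section \<open>Right multiplication of normal forms\<close>

definition f0R :: "(nat \<Rightarrow> int) \<Rightarrow> fgen free" where
  "f0R B = f0 * tpow_prod 1 (n + 1) B"

lemma nf_f0R: "nf D c B = tpow_prod 1 (n + m + 1) D * (X_prod c * f0R B)"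
  by (simp add: nf_def f0R_def)

definition validR :: "(nat \<Rightarrow> int) \<Rightarrow> bool" where
  "validR B \<longleftrightarrow> (\<forall>j\<in>{1..n}. B j \<le> 0) \<and> (\<forall>j. j \<notin> {1..n} \<longrightarrow> B j = 0)"

lemma nf_span_f0R: assumes "validR B" shows "nf_span (sum B {1..n}) (f0R B)"
proof -
  have "valid (\<lambda>_. 0) (\<lambda>_. 0) B" using assms by (simp add: valid_def validR_def)
  moreover have "nf (\<lambda>_. 0) (\<lambda>_. 0) B = f0R B"
  proof -
    have "tpow_prod 1 (n + m + 1) (\<lambda>_. 0) = 1" by (rule tpow_prod_one) simp
    moreover have "X_prod (\<lambda>_. 0) = 1" by (simp add: X_prod_def map_replicate_const)
    ultimately show ?thesis by (simp add: nf_f0R)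
  qed
  ultimately show ?thesis using nf_span_nf [of "\<lambda>_. 0" "\<lambda>_. 0" B] by (simp add: nf_weight_def)
qed

lemma qcm_zero_right: "qcc a b \<Longrightarrow> c * a \<approx> 0 \<Longrightarrow> c * (b * a) \<approx> 0"
proof -
  assume "qcc a b" and c: "c * a \<approx> 0"
  then obtain s where s: "b * a \<approx> scl s (a * b)" using qcc_sym by (metis qccE)
  have "c * (b * a) \<approx> c * scl s (a * b)" by (intro cong_mult_left s)
  also have "\<dots> = scl s ((c * a) * b)" by (simp add: mult.assoc)
  also have "\<dots> \<approx> scl s (0 * b)" by (intro cong_scl cong_mult_right c)
  finally show ?thesis by simp
qed

text \<open>Letters \<open>t i\<close>, \<open>ts i\<close> with i > n pass to the left of
  \<open>f0\<close>. For i <= n, \<open>ts i\<close> extends the power, while \<open>t i\<close>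
  cancels against it into elements \<open>X\<close> that \<open>f0\<close> absorbs, or is
  annihilated by \<open>f0\<close> if \<open>B i = 0\<close>. Multiplication by \<open>f0\<close>
  gives 0 unless B vanishes.\<close>

lemma nf_span_f0R_right: assumes B: "validR B" and g: "g \<in> G"
  shows "nf_span (sum B {1..n} + gw g) (f0R B * mon [g])"
proof (cases g)
  case Gen_f0
  show ?thesis
  proof (cases "\<exists>i\<in>{1..n}. B i \<noteq> 0")
    case True
    then obtain i where i': "i \<in> {1..n}" "B i \<noteq> 0" by blast
    moreover from this have "B i \<le> 0" using B by (simp add: validR_def)
    ultimately have i: "1 \<le> i" "i \<le> n" "B i < 0" by auto
    let ?A = "tpow_prod 1 i B" and ?C = "tpow_prod (i + 1) (n + 1) B"
    have "nat (- B i) = Suc (nat (- B i - 1))" using i by simp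
    then have tpow: "tpow i (B i) = ts i ^ nat (- B i - 1) * ts i"
      using i by (simp add: tpow_def power_Suc2 del: power_Suc)
    obtain s where s: "ts i * ?C \<approx> scl s (?C * ts i)"
      using qccE [OF qcc_tpow_prod [of i "ts i" "i + 1" "n + 1" B]] i by auto
    have "f0R B * f0 = f0 * (?A * (ts i ^ nat (- B i - 1) * ((ts i * ?C) * f0)))"
      unfolding f0R_def using tpow_prod_split [of 1 i "n + 1" B] i by (simp add: tpow mult.assoc)
    also have "\<dots> \<approx> f0 * (?A * (ts i ^ nat (- B i - 1) * (scl s (?C * ts i) * f0)))"
      by (intro cong_mult_left cong_mult_right s)
    also have "\<dots> = scl s (f0 * (?A * (ts i ^ nat (- B i - 1) * (?C * (ts i * f0)))))"
      by (simp add: mult.assoc)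
    also have "\<dots> \<approx> scl s (f0 * (?A * (ts i ^ nat (- B i - 1) * (?C * 0))))"
      using i by (intro cong_scl cong_mult_left ts_f0)
    finally show ?thesis using Gen_f0 by (intro nf_span_cong_zero) simp
  next
    case False
    then have "tpow_prod 1 (n + 1) B = 1" by (intro tpow_prod_one) auto
    then have "f0R B * f0 \<approx> f0R B" using f0_f0 by (simp add: f0R_def)
    then show ?thesis using nf_span_cong [OF nf_span_f0R [OF B]] cong_sym Gen_f0 by auto
  qed
next
  case (Gen_t i)
  then have i: "1 \<le> i" "i \<le> n + m" using g by (auto simp: fgens_def)
  show ?thesis
  proof (cases "i \<le> n")
    case False
    obtain s where s: "tpow_prod 1 (n + 1) B * t i \<approx> scl s (t i * tpow_prod 1 (n + 1) B)"
      using qccE [OF qcc_sym [OF qcc_tpow_prod [of i "t i" 1 "n + 1" B]]] i False by auto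
    have "f0R B * t i = f0 * (tpow_prod 1 (n + 1) B * t i)" by (simp add: f0R_def mult.assoc)
    also have "\<dots> \<approx> f0 * scl s (t i * tpow_prod 1 (n + 1) B)" by (intro cong_mult_left s)
    also have "\<dots> = scl s ((f0 * t i) * tpow_prod 1 (n + 1) B)" by (simp add: mult.assoc)
    also have "\<dots> \<approx> scl s ((t i * f0) * tpow_prod 1 (n + 1) B)"
      using False i by (intro cong_scl cong_mult_right cong_sym [OF t_f0]) auto
    also have "\<dots> = scl s (t i * f0R B)" by (simp add: f0R_def mult.assoc)
    finally show ?thesis
      using nf_span_left [OF g nf_span_f0R [OF B]] Gen_t by (auto intro: nf_span_cong_scl)
  next
    case True
    let ?A = "tpow_prod 1 i B" and ?C = "tpow_prod (i + 1) (n + 1) B"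
    obtain s where s: "?C * t i \<approx> scl s (t i * ?C)"
      using qccE [OF qcc_sym [OF qcc_tpow_prod [of i "t i" "i + 1" "n + 1" B]]] i True by auto
    have "f0R B * t i = f0 * (?A * (tpow i (B i) * (?C * t i)))"
      unfolding f0R_def using tpow_prod_split [of 1 i "n + 1" B] i True by (simp add: mult.assoc)
    also have "\<dots> \<approx> f0 * (?A * (tpow i (B i) * scl s (t i * ?C)))"
      by (intro cong_mult_left s)
    also have "\<dots> = scl s (f0 * (?A * (tpow i (B i) * t i)) * ?C)" by (simp add: mult.assoc)
    finally have eq: "f0R B * t i \<approx> scl s (f0 * (?A * (tpow i (B i) * t i)) * ?C)" .
    show ?thesis
    proof (cases "B i = 0")
      case True
      have "qcc (t i) ?A" using i by (intro qcc_tpow_prod) auto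
      then have "f0 * (?A * t i) \<approx> 0"
        using i \<open>i \<le> n\<close> f0_t by (intro qcm_zero_right)
      then have "scl s (f0 * (?A * (tpow i (B i) * t i)) * ?C) \<approx> scl s (0 * ?C)"
        using True by (intro cong_scl cong_mult_right) simp
      then show ?thesis using cong_trans [OF eq] Gen_t by (intro nf_span_cong_zero) simp
    next
      case False
      let ?B = "B(i := B i + 1)"
      have "B i \<le> 0" using B i \<open>i \<le> n\<close> by (simp add: validR_def)
      then have Bi: "B i < 0" using False by simp
      let ?p = "ts i ^ nat (- B i - 1)"
      have "nat (- B i) = Suc (nat (- B i - 1))" using Bi by simp
      then have tpow: "tpow i (B i) = ?p * ts i" "tpow i (B i + 1) = ?p"
        using Bi by (auto simp: tpow_def power_Suc2 simp del: power_Suc intro: arg_cong [where f = "\<lambda>k. ts i ^ k"])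
      have v: "validR ?B" using B i \<open>i \<le> n\<close> Bi by (auto simp: validR_def)
      \<comment> \<open>Both \<open>X i\<close> and \<open>X (i + 1)\<close> have index at most n +
        1, so they can be moved to the left and absorbed by \<open>f0\<close>.\<close>
      have move: "\<exists>z. f0 * ((?A * ?p) * X k) \<approx> scl z (f0 * (?A * ?p))" if "1 \<le> k" "k \<le> n + 1" for k
      proof -
        have "qcc (X k) (?A * ?p)"
          using i that by (intro qcc_mult_right qcc_X_tpow_prod qcc_power_right qcc_X) auto
        then obtain z where z: "?A * ?p * X k \<approx> scl z (X k * (?A * ?p))"
          by (metis qccE qcc_sym)
        have "f0 * ((?A * ?p) * X k) \<approx> f0 * scl z (X k * (?A * ?p))" by (intro cong_mult_left z)
        also have "\<dots> = scl z ((f0 * X k) * (?A * ?p))" by (simp add: mult.assoc)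
        also have "\<dots> \<approx> scl z (f0 * (?A * ?p))"
          using that by (intro cong_scl cong_mult_right X_le_f0)
        finally show ?thesis by blast
      qed
      obtain z where z: "f0 * ((?A * ?p) * X i) \<approx> scl z (f0 * (?A * ?p))"
        using move [of i] i \<open>i \<le> n\<close> by auto
      obtain z' where z': "f0 * ((?A * ?p) * X (i + 1)) \<approx> scl z' (f0 * (?A * ?p))"
        using move [of "i + 1"] i \<open>i \<le> n\<close> by auto
      have "f0 * (?A * (tpow i (B i) * t i)) = f0 * ((?A * ?p) * (ts i * t i))"
        by (simp add: tpow mult.assoc)
      also have "\<dots> \<approx> f0 * ((?A * ?p) * scl (eps i) (X i - scl (1 / qc\<^sup>2) (X (i + 1))))"
        using i by (intro cong_mult_left tst_X)
      also have "\<dots> = scl (eps i) (f0 * ((?A * ?p) * X i) - scl (1 / qc\<^sup>2) (f0 * ((?A * ?p) * X (i + 1))))"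
        by (simp add: right_diff_distrib)
      also have "\<dots> \<approx> scl (eps i) (scl z (f0 * (?A * ?p)) - scl (1 / qc\<^sup>2) (scl z' (f0 * (?A * ?p))))"
        by (intro cong_scl cong_diff z z')
      also have "\<dots> = scl (eps i * (z - 1 / qc\<^sup>2 * z')) (f0 * (?A * ?p))"
        by (simp add: scl.scale_right_diff_distrib scl.scale_left_diff_distrib right_diff_distrib)
      finally have "scl s (f0 * (?A * (tpow i (B i) * t i)) * ?C) \<approx>
          scl s (scl (eps i * (z - 1 / qc\<^sup>2 * z')) (f0 * (?A * ?p)) * ?C)"
        by (intro cong_scl cong_mult_right)
      also have "\<dots> = scl (s * (eps i * (z - 1 / qc\<^sup>2 * z'))) (f0R ?B)"
        unfolding f0R_def using tpow_prod_split [of 1 i "n + 1" ?B] i \<open>i \<le> n\<close>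
        by (simp add: tpow_prod_upd tpow mult.assoc)
      finally have "f0R B * t i \<approx> scl (s * (eps i * (z - 1 / qc\<^sup>2 * z'))) (f0R ?B)"
        using eq cong_trans by blast
      moreover have "sum ?B {1..n} = sum B {1..n} + 1"
        using sum_upd [of "{1..n}" i B 1] i \<open>i \<le> n\<close> by (simp del: fun_upd_apply)
      ultimately show ?thesis
        using nf_span_cong_scl [OF nf_span_f0R [OF v]] Gen_t by simp
    qed
  qed
next
  case (Gen_ts i)
  then have i: "1 \<le> i" "i \<le> n + m" using g by (auto simp: fgens_def)
  show ?thesis
  proof (cases "i \<le> n")
    case False
    obtain s where s: "tpow_prod 1 (n + 1) B * ts i \<approx> scl s (ts i * tpow_prod 1 (n + 1) B)"
      using qccE [OF qcc_sym [OF qcc_tpow_prod [of i "ts i" 1 "n + 1" B]]] i False by auto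
    have "f0R B * ts i = f0 * (tpow_prod 1 (n + 1) B * ts i)" by (simp add: f0R_def mult.assoc)
    also have "\<dots> \<approx> f0 * scl s (ts i * tpow_prod 1 (n + 1) B)" by (intro cong_mult_left s)
    also have "\<dots> = scl s ((f0 * ts i) * tpow_prod 1 (n + 1) B)" by (simp add: mult.assoc)
    also have "\<dots> \<approx> scl s ((ts i * f0) * tpow_prod 1 (n + 1) B)"
      using False i by (intro cong_scl cong_mult_right cong_sym [OF ts_f0']) auto
    also have "\<dots> = scl s (ts i * f0R B)" by (simp add: f0R_def mult.assoc)
    finally show ?thesis
      using nf_span_left [OF g nf_span_f0R [OF B]] Gen_ts by (auto intro: nf_span_cong_scl)
  next
    case True
    let ?A = "tpow_prod 1 i B" and ?C = "tpow_prod (i + 1) (n + 1) B" and ?B = "B(i := B i - 1)"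
    obtain s where s: "?C * ts i \<approx> scl s (ts i * ?C)"
      using qccE [OF qcc_sym [OF qcc_tpow_prod [of i "ts i" "i + 1" "n + 1" B]]] i True by auto
    have Bi: "B i \<le> 0" using B i True by (auto simp: validR_def)
    then have "nat (- (B i - 1)) = Suc (nat (- B i))" by simp
    then have tpow: "tpow i (B i - 1) = tpow i (B i) * ts i"
      using Bi by (cases "B i = 0") (auto simp: tpow_def power_Suc2 simp del: power_Suc)
    have v: "validR ?B" using B i True by (auto simp: validR_def) (use Bi in linarith)
    have "f0R B * ts i = f0 * (?A * (tpow i (B i) * (?C * ts i)))"
      unfolding f0R_def using tpow_prod_split [of 1 i "n + 1" B] i True by (simp add: mult.assoc)
    also have "\<dots> \<approx> f0 * (?A * (tpow i (B i) * scl s (ts i * ?C)))"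
      by (intro cong_mult_left s)
    also have "\<dots> = scl s (f0R ?B)"
      unfolding f0R_def using tpow_prod_split [of 1 i "n + 1" ?B] i True by (simp add: tpow_prod_upd tpow mult.assoc)
    finally have "f0R B * ts i \<approx> scl s (f0R ?B)" .
    moreover have "sum ?B {1..n} = sum B {1..n} - 1"
      using sum_upd [of "{1..n}" i B "- 1"] i True by (simp del: fun_upd_apply)
    ultimately show ?thesis
      using nf_span_cong_scl [OF nf_span_f0R [OF v]] Gen_ts by simp
  qed
qed

text \<open>Written as explicit words, the factors of a normal form can be put back by
  \<open>nf_span_left_word\<close>, with their gauge weight known.\<close>

lemma tpow_prod_words: assumes "1 \<le> lo" "hi \<le> n + m + 1"
  shows "\<exists>w. set w \<subseteq> G \<and> tpow_prod lo hi D = mon w \<and> sum_list (map gw w) = sum D {lo..<hi}"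
  using assms(2)
proof (induction hi)
  case 0
  then show ?case by (intro exI [of _ "[]"]) (simp add: tpow_prod_def)
next
  case (Suc hi)
  have pow: "\<exists>w. set w \<subseteq> G \<and> mon [g] ^ k = mon w \<and> sum_list (map gw w) = int k * gw g" if "g \<in> G" for g k
  proof (induction k)
    case (Suc k)
    then obtain w where "set w \<subseteq> G" "mon [g] ^ k = mon w" "sum_list (map gw w) = int k * gw g" by blast
    then show ?case using that mon_Cons [of g w]
      by (intro exI [of _ "g # w"]) (auto simp: algebra_simps)
  qed (auto intro!: exI [of _ "[]"])
  obtain w where w: "set w \<subseteq> G" "tpow_prod lo hi D = mon w" "sum_list (map gw w) = sum D {lo..<hi}"
    using Suc by auto
  show ?case
  proof (cases "lo \<le> hi")
    case True
    then have "Gen_t hi \<in> G" "Gen_ts hi \<in> G" using assms(1) Suc.prems by (auto simp: fgens_def)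
    from pow [OF this(1), of "nat (D hi)"] pow [OF this(2), of "nat (- D hi)"]
    obtain v where v: "set v \<subseteq> G" "tpow hi (D hi) = mon v" "sum_list (map gw v) = D hi"
      by (cases "0 \<le> D hi") (auto simp: tpow_def)
    have "tpow_prod lo (Suc hi) D = tpow_prod lo hi D * tpow hi (D hi)" using True by (simp add: tpow_prod_def)
    then show ?thesis using w v True
      by (intro exI [of _ "w @ v"]) (auto simp: mon_append)
  next
    case False
    then show ?thesis by (intro exI [of _ "[]"]) (simp add: tpow_prod_def)
  qed
qed

lemma nf_span_X_prod: assumes "nf_span d x" shows "nf_span d (X_prod c * x)"
proof -
  have X: "nf_span d (X j * x)" if "nf_span d x" "1 \<le> j" for d j x
  proof -
    have "nf_span d (t k * ts k * x)" if "k \<in> {j..n+m}" for k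
      using that nf_span_left_word [of "[Gen_t k, Gen_ts k]" d x] \<open>nf_span d x\<close> \<open>1 \<le> j\<close> mon_Cons [of "Gen_t k" "[Gen_ts k]"]
      by (auto simp: fgens_def)
    then have "nf_span d (\<Sum>k\<in>A. scl (eps k) (t k * ts k) * x)" if "A \<subseteq> {j..n+m}" for A
      using that infinite_super [OF that]
      by (induction A rule: infinite_finite_induct) (auto intro: nf_span_zero nf_span_add nf_span_scl)
    then show ?thesis by (simp add: X_def sum_distrib_right)
  qed
  have pow: "nf_span d (X j ^ k * x)" if "nf_span d x" "1 \<le> j" for d j k x
    using that by (induction k) (auto simp: mult.assoc intro: X)
  have *: "nf_span d (prod_list (map (\<lambda>j. X j ^ c j) js) * x)" if "\<forall>j\<in>set js. 1 \<le> j" for js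
    using that by (induction js) (auto simp: mult.assoc assms intro: pow)
  show ?thesis unfolding X_prod_def by (rule *) auto
qed

lemma nf_span_right: assumes g: "g \<in> G" and "nf_span d x" shows "nf_span (d + gw g) (x * mon [g])"
  using assms(2)
proof induction
  case (nf_span_nf D c B)
  have "{1..<n + m + 1} = {1..n+m}" by auto
  then obtain w where w: "set w \<subseteq> G" "tpow_prod 1 (n + m + 1) D = mon w" "sum_list (map gw w) = sum D {1..n + m}"
    using tpow_prod_words [of 1 "n + m + 1" D] by (metis le_refl)
  have "validR B" using nf_span_nf by (auto simp: valid_def validR_def)
  then have "nf_span (sum B {1..n} + gw g) (X_prod c * (f0R B * mon [g]))"
    by (intro nf_span_X_prod nf_span_f0R_right g)
  from nf_span_left_word [OF w(1) this]
  have "nf_span (sum B {1..n} + gw g + sum_list (map gw w)) (nf D c B * mon [g])"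
    unfolding nf_f0R w(2) by (simp add: mult.assoc)
  then show ?case unfolding w(3) nf_weight_def by (simp add: add_ac)
next
  case (nf_span_cong d x y)
  then show ?case using nf_span.nf_span_cong cong_mult_right by blast
qed (auto simp: distrib_right intro: nf_span_zero nf_span_add nf_span_scl)

lemma nf_span_right_word: "set w \<subseteq> G \<Longrightarrow> nf_span d x \<Longrightarrow> nf_span (d + sum_list (map gw w)) (x * mon w)"
proof (induction w arbitrary: x d)
  case (Cons g w)
  then show ?case
    using Cons.IH [of "d + gw g" "x * mon [g]"] nf_span_right [of g d x]
    by (subst mon_Cons) (simp add: mult.assoc add_ac)
qed simp

lemma nf_span_word: assumes "set w \<subseteq> G" "Gen_f0 \<in> set w" shows "nf_span (sum_list (map gw w)) (mon w)"
proof -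
  obtain u v where w: "w = u @ Gen_f0 # v" using assms by (auto simp: in_set_conv_decomp)
  have "nf_span 0 f0"
    using nf_span_f0R [of "\<lambda>_. 0"] tpow_prod_one [of 1 "n + 1" "\<lambda>_. 0"] by (simp add: f0R_def validR_def)
  then have "nf_span (0 + sum_list (map gw u) + sum_list (map gw v)) (mon u * f0 * mon v)"
    using assms w by (intro nf_span_left_word nf_span_right_word) auto
  moreover have "mon w = mon u * f0 * mon v"
    using w mon_append [of u "Gen_f0 # v"] mon_Cons [of Gen_f0 v] by (simp add: mult.assoc)
  ultimately show ?thesis using w by simp
qed

definition nf_lin :: "((nat \<Rightarrow> int) \<times> (nat \<Rightarrow> nat) \<times> (nat \<Rightarrow> int) \<Rightarrow>\<^sub>0 complex) \<Rightarrow> fgen free" where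
  "nf_lin = lin_ext (\<lambda>(D, c, B). nf D c B)"

lemma nf_lin_lin: "lin nf_lin"
  by (simp add: nf_lin_def lin_ext_lin)

lemma nf_span_nf_lin: assumes "nf_span d x"
  shows "\<exists>k. (\<forall>(D, c, B)\<in>keys k. valid D c B \<and> nf_weight D B = d) \<and> x \<approx> nf_lin k"
  using assms
proof induction
  case (nf_span_nf D c B)
  then show ?case
    by (intro exI [of _ "single (D, c, B) 1"]) (simp add: nf_lin_def)
next
  case (nf_span_zero d)
  then show ?case by (intro exI [of _ 0]) (simp add: lin_zero [OF nf_lin_lin])
next
  case (nf_span_add d x y)
  then obtain k l where
    "\<forall>(D, c, B)\<in>keys k. valid D c B \<and> nf_weight D B = d" "x \<approx> nf_lin k"
    "\<forall>(D, c, B)\<in>keys l. valid D c B \<and> nf_weight D B = d" "y \<approx> nf_lin l" by blast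
  then show ?case
    using keys_add [of k l] by (intro exI [of _ "k + l"]) (auto simp: lin_add [OF nf_lin_lin] intro!: cong_add)
next
  case (nf_span_scl d x z)
  then obtain k where
    "\<forall>(D, c, B)\<in>keys k. valid D c B \<and> nf_weight D B = d" "x \<approx> nf_lin k" by blast
  then show ?case
    by (intro exI [of _ "scl z k"]) (auto simp: lin_scl [OF nf_lin_lin] in_keys_iff intro!: cong_scl)
next
  case (nf_span_cong d x y)
  then obtain k where k: "\<forall>(D, c, B)\<in>keys k. valid D c B \<and> nf_weight D B = d" "x \<approx> nf_lin k"
    by blast
  then show ?case using cong_trans [OF cong_sym [OF nf_span_cong(2)] k(2)] by blast
qed

end


section \<open>Faithfulness of the representation\<close>

lemma digits_less: "(\<And>j. j \<in> {a..<b} \<Longrightarrow> c j < r) \<Longrightarrow> (\<Sum>j\<in>{a..<b}. c j * r ^ j) < (r :: nat) ^ b" if "0 < r"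
proof (induction b)
  case (Suc b)
  show ?case
  proof (cases "a \<le> b")
    case True
    have "(\<Sum>j\<in>{a..<b}. c j * r ^ j) + c b * r ^ b < r ^ b + c b * r ^ b"
      using Suc by simp
    also have "\<dots> = (c b + 1) * r ^ b" by simp
    also have "\<dots> \<le> r * r ^ b"
      using Suc.prems [of b] True by (intro mult_right_mono) auto
    finally show ?thesis using True by simp
  qed (use that in simp)
qed simp

lemma digits_inj:
  assumes "0 < (r :: nat)" "\<And>j. j \<in> {a..<b} \<Longrightarrow> c j < r" "\<And>j. j \<in> {a..<b} \<Longrightarrow> c' j < r"
    "(\<Sum>j\<in>{a..<b}. c j * r ^ j) = (\<Sum>j\<in>{a..<b}. c' j * r ^ j)" "j \<in> {a..<b}"
  shows "c j = c' j"
  using assms(2-)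
proof (induction b)
  case (Suc b)
  let ?s = "\<lambda>c. \<Sum>j\<in>{a..<b}. c j * r ^ j"
  have ab: "a \<le> b" using Suc.prems(4) by auto
  have less: "?s c < r ^ b" "?s c' < r ^ b"
    using Suc.prems assms(1) by (auto intro!: digits_less)
  have eq: "?s c + c b * r ^ b = ?s c' + c' b * r ^ b"
    using Suc.prems(3) ab by simp
  have "(?s c + c b * r ^ b) div r ^ b = c b" "(?s c' + c' b * r ^ b) div r ^ b = c' b"
    using less assms(1) by simp_all
  then have b: "c b = c' b" using eq by simp
  then have "?s c = ?s c'" using eq by simp
  then show ?case using Suc b by (cases "j = b") auto
qed simp

context hyperboloid
begin

text \<open>The coefficient contains \<open>sq j 0 = 0\<close> exactly if the entry passes from 1 to
  0 on its way down, that is, if it starts positive and ends nonpositive.\<close>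

lemma TT_power_t: "j < n + m \<Longrightarrow> \<exists>z. TT (t j ^ k) (single i y) = single (i(j := i j - int k)) (y * z)
    \<and> (z \<noteq> 0 \<longleftrightarrow> (1 \<le> i j \<longrightarrow> 1 \<le> i j - int k))"
proof (induction k)
  case (Suc k)
  then obtain z where z: "TT (t j ^ k) (single i y) = single (i(j := i j - int k)) (y * z)"
    "z \<noteq> 0 \<longleftrightarrow> (1 \<le> i j \<longrightarrow> 1 \<le> i j - int k)" by blast
  let ?i = "i(j := i j - int k)"
  let ?z = "z * qi (Ssum j ?i) * sq j (?i j - 1)"
  have "TT (t j ^ Suc k) (single i y) = single (i(j := i j - int (Suc k))) (y * ?z)"
    using Suc.prems by (simp add: T_free_mult z TT_t mult.assoc algebra_simps)
  moreover have "?z \<noteq> 0 \<longleftrightarrow> (1 \<le> i j \<longrightarrow> 1 \<le> i j - int (Suc k))"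
    using z(2) sq_nz [of "i j - int k - 1" j] by (cases "i j - int k - 1 = 0") auto
  ultimately show ?case by blast
qed (auto intro: exI [of _ 1])

lemma TT_power_ts: "j < n + m \<Longrightarrow> \<exists>z. TT (ts j ^ k) (single i y) = single (i(j := i j + int k)) (y * z)
    \<and> (z \<noteq> 0 \<longleftrightarrow> (1 \<le> i j + int k \<longrightarrow> 1 \<le> i j))"
proof (induction k)
  case (Suc k)
  then obtain z where z: "TT (ts j ^ k) (single i y) = single (i(j := i j + int k)) (y * z)"
    "z \<noteq> 0 \<longleftrightarrow> (1 \<le> i j + int k \<longrightarrow> 1 \<le> i j)" by blast
  let ?i = "i(j := i j + int k)"
  let ?z = "z * qi (Ssum j ?i) * sq j (?i j)"
  have "TT (ts j ^ Suc k) (single i y) = single (i(j := i j + int (Suc k))) (y * ?z)"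
    using Suc.prems by (simp add: T_free_mult z TT_ts mult.assoc algebra_simps)
  moreover have "?z \<noteq> 0 \<longleftrightarrow> (1 \<le> i j + int (Suc k) \<longrightarrow> 1 \<le> i j)"
    using z(2) sq_nz [of "i j + int k" j] by (cases "i j + int k = 0") auto
  ultimately show ?case by blast
qed (auto intro: exI [of _ 1])

lemma TT_power_N: "\<exists>z. TT (t (n + m) ^ k) (single i y) = single i (y * z) \<and> z \<noteq> 0"
  "\<exists>z. TT (ts (n + m) ^ k) (single i y) = single i (y * z) \<and> z \<noteq> 0"
proof -
  have "TT (t (n + m) ^ k) (single i y) = single i (y * qi (Ssum (n + m) i) ^ k)"
    "TT (ts (n + m) ^ k) (single i y) = single i (y * qi (Ssum (n + m) i) ^ k)"
    by (induction k) (simp_all add: T_free_mult TT_tN mult_ac)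
  then show "\<exists>z. TT (t (n + m) ^ k) (single i y) = single i (y * z) \<and> z \<noteq> 0"
    "\<exists>z. TT (ts (n + m) ^ k) (single i y) = single i (y * z) \<and> z \<noteq> 0"
    by (metis power_not_zero qi_nz)+
qed

lemma TT_tpow: assumes "j \<le> n + m"
  shows "\<exists>z. TT (tpow j k) (single i y) =
      single (if j < n + m then i(j := i j - k) else i) (y * z)
    \<and> (z \<noteq> 0 \<longleftrightarrow> (j < n + m \<longrightarrow> (1 \<le> i j \<longleftrightarrow> 1 \<le> i j - k)))"
proof (cases "j < n + m")
  case True
  show ?thesis
  proof (cases "0 \<le> k")
    case True
    then show ?thesis using TT_power_t [of j "nat k" i y] \<open>j < n + m\<close> by (auto simp: tpow_def)
  next
    case False
    then show ?thesis using TT_power_ts [of j "nat (- k)" i y] \<open>j < n + m\<close> by (auto simp: tpow_def)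
  qed
next
  case False
  then have "j = n + m" using assms by simp
  then show ?thesis using TT_power_N by (auto simp: tpow_def)
qed

text \<open>The bound \<open>j < n + m\<close> is there because \<open>t (n + m)\<close> and its
  adjoint act diagonally.\<close>

definition shift :: "nat \<Rightarrow> nat \<Rightarrow> (nat \<Rightarrow> int) \<Rightarrow> (nat \<Rightarrow> int) \<Rightarrow> (nat \<Rightarrow> int)" where
  "shift lo hi D i = (\<lambda>j. if lo \<le> j \<and> j < hi \<and> j < n + m then i j - D j else i j)"

lemma TT_tpow_prod: assumes "hi \<le> n + m + 1"
  shows "\<exists>z. \<forall>y. TT (tpow_prod lo hi D) (single i y) = single (shift lo hi D i) (y * z)
    \<and> (z \<noteq> 0 \<longleftrightarrow> (\<forall>j. lo \<le> j \<and> j < hi \<and> j < n + m \<longrightarrow> (1 \<le> i j \<longleftrightarrow> 1 \<le> i j - D j)))"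
proof -
  have "\<exists>z. TT (tpow_prod lo hi D) (single i y) = single (shift lo hi D i) (y * z)
    \<and> (z \<noteq> 0 \<longleftrightarrow> (\<forall>j. lo \<le> j \<and> j < hi \<and> j < n + m \<longrightarrow> (1 \<le> i j \<longleftrightarrow> 1 \<le> i j - D j)))" for y
    using assms
  proof (induction hi arbitrary: i y)
    case 0
    then show ?case by (intro exI [of _ 1]) (simp add: tpow_prod_def shift_def)
  next
    case (Suc hi)
    show ?case
    proof (cases "lo \<le> hi")
      case True
      let ?i = "if hi < n + m then i(hi := i hi - D hi) else i"
      have tpow_prod: "tpow_prod lo (Suc hi) D = tpow_prod lo hi D * tpow hi (D hi)" using True by (simp add: tpow_prod_def)
      obtain z where z: "TT (tpow hi (D hi)) (single i y) = single ?i (y * z)"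
        "z \<noteq> 0 \<longleftrightarrow> (hi < n + m \<longrightarrow> (1 \<le> i hi \<longleftrightarrow> 1 \<le> i hi - D hi))"
        using TT_tpow [of hi "D hi" i y] Suc.prems by auto
      obtain z' where z': "TT (tpow_prod lo hi D) (single ?i (y * z)) = single (shift lo hi D ?i) (y * z * z')"
        "z' \<noteq> 0 \<longleftrightarrow> (\<forall>j. lo \<le> j \<and> j < hi \<and> j < n + m \<longrightarrow> (1 \<le> ?i j \<longleftrightarrow> 1 \<le> ?i j - D j))"
        using Suc.IH [of ?i "y * z"] Suc.prems by auto
      have "shift lo hi D ?i = shift lo (Suc hi) D i"
        using True by (auto simp: shift_def fun_eq_iff less_Suc_eq)
      then have "TT (tpow_prod lo (Suc hi) D) (single i y) = single (shift lo (Suc hi) D i) (y * (z * z'))"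
        by (simp only: tpow_prod T_free_mult z(1) z'(1) mult.assoc)
      moreover have "z * z' \<noteq> 0 \<longleftrightarrow> (\<forall>j. lo \<le> j \<and> j < Suc hi \<and> j < n + m \<longrightarrow> (1 \<le> i j \<longleftrightarrow> 1 \<le> i j - D j))"
        unfolding mult_eq_0_iff de_Morgan_disj z(2) z'(2) using True by (auto simp: less_Suc_eq)
      ultimately show ?thesis by blast
    next
      case False
      then have "shift lo (Suc hi) D i = i" by (auto simp: shift_def fun_eq_iff)
      then show ?thesis using False by (intro exI [of _ 1]) (auto simp: tpow_prod_def)
    qed
  qed
  \<comment> \<open>The scalar found for coefficient 1 serves all y by linearity.\<close>
  from this [of 1] obtain z where z: "TT (tpow_prod lo hi D) (e i) = single (shift lo hi D i) z"
    "z \<noteq> 0 \<longleftrightarrow> (\<forall>j. lo \<le> j \<and> j < hi \<and> j < n + m \<longrightarrow> (1 \<le> i j \<longleftrightarrow> 1 \<le> i j - D j))" by auto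
  show ?thesis
  proof (intro exI [of _ z] allI conjI z(2))
    fix y
    have "TT (tpow_prod lo hi D) (single i y) = scl y (TT (tpow_prod lo hi D) (e i))"
      by (rule T_free_single)
    then show "TT (tpow_prod lo hi D) (single i y) = single (shift lo hi D i) (y * z)"
      by (simp only: z(1) scl_single)
  qed
qed

lemma TT_tpow_prod_E:
  assumes "hi \<le> n + m + 1"
  obtains z where "\<And>y. TT (tpow_prod lo hi D) (single i y) = single (shift lo hi D i) (y * z)"
    "z \<noteq> 0 \<longleftrightarrow> (\<forall>j. lo \<le> j \<and> j < hi \<and> j < n + m \<longrightarrow> (1 \<le> i j \<longleftrightarrow> 1 \<le> i j - D j))"
proof -
  obtain z where z: "\<forall>y. TT (tpow_prod lo hi D) (single i y) = single (shift lo hi D i) (y * z)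
    \<and> (z \<noteq> 0 \<longleftrightarrow> (\<forall>j. lo \<le> j \<and> j < hi \<and> j < n + m \<longrightarrow> (1 \<le> i j \<longleftrightarrow> 1 \<le> i j - D j)))"
    using TT_tpow_prod [OF assms, of lo D i] ..
  show thesis
    by (rule that [OF conjunct1 [OF spec [OF z]] conjunct2 [OF spec [OF z]]])
qed

text \<open>The eigenvalue of \<open>X_prod c\<close> at \<open>e i\<close>, see
  \<open>TT_X_prod\<close>.\<close>

definition chi :: "(nat \<Rightarrow> nat) \<Rightarrow> (nat \<Rightarrow> int) \<Rightarrow> complex" where
  "chi c i = (\<Prod>j\<leftarrow>[n+2..<n+m+1]. (qi (Ssum j i) * qi (Ssum j i)) ^ c j)"

lemma TT_X_prod: assumes "i \<in> idx n m"
  shows "TT (X_prod c) (single i y) = single i (y * chi c i)"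
proof -
  have pow: "TT (X j ^ k) (single i y) = single i (y * (qi (Ssum j i) * qi (Ssum j i)) ^ k)"
    if "1 \<le> j" "j \<le> n + m" for j k y
    by (induction k) (use that assms in \<open>simp_all add: T_free_mult TT_X mult_ac\<close>)
  have *: "TT (prod_list (map (\<lambda>j. X j ^ c j) js)) (single i y) =
     single i (y * (\<Prod>j\<leftarrow>js. (qi (Ssum j i) * qi (Ssum j i)) ^ c j))"
    if "set js \<subseteq> {1..n+m}" for js y
    using that by (induction js arbitrary: y) (auto simp: T_free_mult pow mult_ac)
  show ?thesis unfolding X_prod_def chi_def by (rule *) auto
qed

text \<open>The index that is reached from i when the factors to the right of \<open>X_prod\<close>
  have acted without annihilating \<open>e i\<close>.\<close>

definition base :: "(nat \<Rightarrow> int) \<Rightarrow> (nat \<Rightarrow> int)" where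
  "base i = (\<lambda>j. if j \<le> n then 0 else i j)"

definition out :: "(nat \<Rightarrow> int) \<Rightarrow> (nat \<Rightarrow> int) \<Rightarrow> (nat \<Rightarrow> int)" where
  "out D i = shift 1 (n + m + 1) D (base i)"

text \<open>The factor to the right of \<open>f0\<close> turns the entry i j into i j - B j, and
  \<open>f0\<close> keeps only the value 0.\<close>

lemma TT_nf_zero:
  assumes v: "valid D c B" and i: "i \<in> idx n m" "j \<in> {1..n}" "i j \<noteq> B j"
  shows "TT (nf D c B) (e i) = 0"
proof -
  obtain z where z: "TT (tpow_prod 1 (n + 1) B) (single i y) = single (shift 1 (n + 1) B i) (y * z)" for y
    by (rule TT_tpow_prod_E [of "n + 1" 1 B i]) auto
  have "shift 1 (n + 1) B i j \<noteq> 0" using i m_ge by (auto simp: shift_def)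
  then have "TT f0 (TT (tpow_prod 1 (n + 1) B) (e i)) = 0"
    unfolding z TT_f0 using i(2) by auto
  then show ?thesis by (simp add: nf_def T_free_mult T_free_vec)
qed

text \<open>The scalar \<open>\<zeta>\<close> is chosen before c: all dependence on c sits in
  \<open>chi\<close>, so that a combination over c becomes a multiple of a polynomial value on
  sparse indices.\<close>

lemma TT_nf:
  assumes i: "i \<in> idx n m" and iB: "\<And>j. j \<in> {1..n} \<Longrightarrow> i j = B j"
  shows "\<exists>\<zeta>. (\<forall>c. valid D c B \<longrightarrow> TT (nf D c B) (e i) = single (out D i) (\<zeta> * chi c (base i))
     \<and> ((\<forall>j. n < j \<and> j < n + m \<longrightarrow> 1 \<le> i j - D j) \<longrightarrow> \<zeta> \<noteq> 0))"
proof -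
  have base: "base i \<in> idx n m" using i by (auto simp: idx_def base_def)
  obtain z where z: "\<And>y. TT (tpow_prod 1 (n + 1) B) (single i y) = single (shift 1 (n + 1) B i) (y * z)"
    "z \<noteq> 0 \<longleftrightarrow> (\<forall>j. 1 \<le> j \<and> j < n + 1 \<and> j < n + m \<longrightarrow> (1 \<le> i j \<longleftrightarrow> 1 \<le> i j - B j))"
    by (rule TT_tpow_prod_E [of "n + 1" 1 B i]) auto
  have sh: "shift 1 (n + 1) B i = base i"
    using i iB m_ge by (auto simp: shift_def base_def fun_eq_iff idx_def)
  have z0: "z \<noteq> 0" unfolding z(2)
  proof (intro allI impI)
    fix j assume "1 \<le> j \<and> j < n + 1 \<and> j < n + m"
    then have "i j \<le> 0" "i j = B j" using idx_le [OF i, of j] iB [of j] by auto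
    then show "1 \<le> i j \<longleftrightarrow> 1 \<le> i j - B j" by simp
  qed
  obtain y where y: "\<And>w. TT (tpow_prod 1 (n + m + 1) D) (single (base i) w) = single (out D i) (w * y)"
    "y \<noteq> 0 \<longleftrightarrow> (\<forall>j. 1 \<le> j \<and> j < n + m + 1 \<and> j < n + m \<longrightarrow> (1 \<le> base i j \<longleftrightarrow> 1 \<le> base i j - D j))"
    unfolding out_def by (rule TT_tpow_prod_E [of "n + m + 1" 1 D "base i"]) auto
  have 1: "TT (nf D c B) (e i) = single (out D i) (z * y * chi c (base i))" for c
  proof -
    have f0: "TT f0 (single (base i) w) = single (base i) w" for w
      by (simp add: TT_f0 base_def)
    have "TT (nf D c B) (e i) = TT (tpow_prod 1 (n + m + 1) D) (TT (X_prod c) (TT f0 (TT (tpow_prod 1 (n + 1) B) (e i))))"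
      by (simp only: nf_def T_free_mult)
    also have "\<dots> = single (out D i) (1 * z * chi c (base i) * y)"
      unfolding z(1) sh f0 TT_X_prod [OF base] y(1) ..
    finally show ?thesis by (simp add: mult_ac)
  qed
  have 2: "z * y \<noteq> 0" if "valid D c B" "\<forall>j. n < j \<and> j < n + m \<longrightarrow> 1 \<le> i j - D j" for c
  proof -
    have "y \<noteq> 0" unfolding y(2)
    proof (intro allI impI)
      fix j assume j: "1 \<le> j \<and> j < n + m + 1 \<and> j < n + m"
      show "1 \<le> base i j \<longleftrightarrow> 1 \<le> base i j - D j"
      proof (cases "j \<le> n")
        case True
        then have "0 \<le> D j" using that(1) j by (simp add: valid_def)
        then show ?thesis using True by (simp add: base_def)
      next
        case False
        then show ?thesis using that(2) idx_ge [OF i, of j] j by (simp add: base_def)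
      qed
    qed
    then show ?thesis using z0 by simp
  qed
  show ?thesis
    by (intro exI [of _ "z * y"] allI impI conjI 1) (rule 2)
qed

text \<open>For the multi-indices \<open>sparse r s B\<close> the partial sums \<^const>\<open>Ssum\<close> are the numbers \<open>s * r ^ j\<close>, so that
  \<^const>\<open>chi\<close> becomes a power of \<open>q ^ (2 * s)\<close> whose exponent has the \<open>r\<close>-adic digits \<open>c\<close>.\<close>

definition sparse :: "nat \<Rightarrow> nat \<Rightarrow> (nat \<Rightarrow> int) \<Rightarrow> (nat \<Rightarrow> int)" where
  "sparse r s B = (\<lambda>j. if 1 \<le> j \<and> j \<le> n then B j else if j = n + 1 then int (s * r ^ (j + 1))
     else if n + 1 < j \<and> j < n + m then int (s * r ^ (j + 1)) - int (s * r ^ j) else 0)"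

lemma sparse_ge: assumes "2 \<le> r" "n < j" "j < n + m" shows "int s \<le> sparse r s B j"
proof -
  have 1: "int s \<le> int s * int r ^ k" for k
    using mult_left_mono [of 1 "int r ^ k" "int s"] assms by simp
  have "2 * int r ^ j \<le> int r * int r ^ j"
    using assms by (intro mult_right_mono) auto
  then have "int s * (2 * int r ^ j) \<le> int s * (int r * int r ^ j)"
    by (intro mult_left_mono) auto
  then have "int s \<le> int (s * r ^ (j + 1)) - int (s * r ^ j)"
    using 1 [of j] by (simp add: mult_ac)
  moreover have "int s \<le> int (s * r ^ (j + 1))"
    using 1 [of "j + 1"] by simp
  ultimately show ?thesis
    using assms unfolding sparse_def by auto
qed

lemma sparse_idx: assumes "2 \<le> r" "1 \<le> s" "validR B" shows "sparse r s B \<in> idx n m"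
proof -
  have "1 \<le> sparse r s B j" if "j \<in> {n+1..n+m-1}" for j
  proof -
    have "j \<le> n + m - 1" using that by simp
    then have "j < n + m" using m_ge by linarith
    then show ?thesis using sparse_ge [OF assms(1), of j s B] that assms(2) by auto
  qed
  then show ?thesis using assms(3) m_ge by (auto simp: idx_def sparse_def validR_def)
qed

lemma Ssum_sparse: assumes "n + 2 \<le> j" "j \<le> n + m"
  shows "Ssum j (base (sparse r s B)) = int (s * r ^ j)"
  using assms
proof (induction j rule: dec_induct)
  case base
  have "Ssum (n + 1) (base (sparse r s B)) = 0"
    unfolding Ssum_def by (rule sum.neutral) (auto simp: base_def)
  then show ?case
    using Ssum_Suc [of "n + 1" "base (sparse r s B)"] by (simp add: base_def sparse_def)
next
  case (step j)
  then show ?case by (simp add: Ssum_Suc base_def sparse_def)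
qed

lemma chi_sparse: "chi c (base (sparse r s B)) = (qc ^ (2 * s)) ^ (\<Sum>j\<in>{n+2..<n+m+1}. c j * r ^ j)"
proof -
  have qi: "qi (int k) = qc ^ k" for k by (simp add: qi_def)
  have "chi c (base (sparse r s B)) = (\<Prod>j\<leftarrow>[n+2..<n+m+1]. (qc ^ (2 * s)) ^ (c j * r ^ j))"
    unfolding chi_def
  proof (intro arg_cong [where f = prod_list] map_cong refl)
    fix j assume "j \<in> set [n+2..<n+m+1]"
    then have "Ssum j (base (sparse r s B)) = int (s * r ^ j)" by (intro Ssum_sparse) auto
    then have "(qi (Ssum j (base (sparse r s B))) * qi (Ssum j (base (sparse r s B)))) ^ c j
        = (qc ^ (s * r ^ j) * qc ^ (s * r ^ j)) ^ c j" by (simp only: qi)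
    also have "\<dots> = (qc ^ (2 * s)) ^ (c j * r ^ j)"
      by (simp flip: power_add power_mult) (rule arg_cong [where f = "power qc"], simp add: algebra_simps)
    finally show "(qi (Ssum j (base (sparse r s B))) * qi (Ssum j (base (sparse r s B)))) ^ c j
        = (qc ^ (2 * s)) ^ (c j * r ^ j)" .
  qed
  also have "\<dots> = (\<Prod>j\<in>{n+2..<n+m+1}. (qc ^ (2 * s)) ^ (c j * r ^ j))"
    by (simp only: prod.distinct_set_conv_list [symmetric] distinct_upt set_upt)
  finally show ?thesis by (simp only: power_sum)
qed

text \<open>One triple occurring in k is singled out. At a sparse index, the coefficient at the
  target \<open>out D0\<close> receives contributions only from triples with the same D and B. Up to
  a common nonzero factor it is a polynomial evaluated at q^(2s); infinitely many s force the
  polynomial to vanish.\<close>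

lemma nf_lin_faithful:
  assumes k: "\<forall>(D, c, B)\<in>keys k. valid D c B \<and> nf_weight D B = d"
    and zero: "\<And>i. i \<in> idx n m \<Longrightarrow> TT (nf_lin k) (e i) = 0"
  shows "k = 0"
proof (rule ccontr)
  assume "k \<noteq> 0"
  then obtain D0 c0 B0 where key: "(D0, c0, B0) \<in> keys k"
    by (metis in_keys_iff lookup_zero poly_mapping_eqI prod_cases3)
  have v0: "valid D0 c0 B0" "nf_weight D0 B0 = d" using k key by auto
  then have B0: "validR B0" by (auto simp: valid_def validR_def)
  define A where "A = {c. (D0, c, B0) \<in> keys k}"
  have finA: "finite A"
    unfolding A_def by (rule finite_imageD [of "\<lambda>c. (D0, c, B0)"]) (auto intro: finite_subset [OF _ finite_keys [of k]] inj_onI)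
  \<comment> \<open>Larger than every digit of every c in \<open>A\<close>, so that
    \<open>code\<close> is injective there; the summand 2 provides the hypothesis of
    \<open>sparse_ge\<close>.\<close>
  define r where "r = 2 + (\<Sum>c\<in>A. \<Sum>j\<in>{n+2..<n+m+1}. c j)"
  have r: "c j < r" if "c \<in> A" "j \<in> {n+2..<n+m+1}" for c j
  proof -
    have "c j \<le> (\<Sum>j\<in>{n+2..<n+m+1}. c j)" using that by (intro member_le_sum) auto
    also have "\<dots> \<le> (\<Sum>c\<in>A. \<Sum>j\<in>{n+2..<n+m+1}. c j)" using that finA
      by (intro member_le_sum [where f = "\<lambda>c. \<Sum>j\<in>{n+2..<n+m+1}. c j"]) auto
    finally show ?thesis by (simp add: r_def)
  qed
  define code where "code c = (\<Sum>j\<in>{n+2..<n+m+1}. c j * r ^ j)" for c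
  have code_inj: "c = c'" if "c \<in> A" "c' \<in> A" "code c = code c'" for c c'
  proof
    fix j
    have v: "valid D0 c B0" "valid D0 c' B0" using that k by (auto simp: A_def)
    show "c j = c' j"
    proof (cases "j \<in> {n+2..<n+m+1}")
      case True
      then show ?thesis
        using that r digits_inj [of r "n+2" "n+m+1" c c' j] by (auto simp: code_def r_def)
    next
      case False
      then show ?thesis using v by (auto simp: valid_def)
    qed
  qed
  \<comment> \<open>By \<open>chi_sparse\<close>, the matrix coefficient at \<open>out D0\<close> is
    \<open>\<zeta>\<close> times the value of \<open>p\<close> at q^(2s).\<close>
  define p where "p = (\<Sum>c\<in>A. Polynomial.monom (lookup k (D0, c, B0)) (code c))"
  \<comment> \<open>Bounds the downward shifts by \<open>D0\<close>: for s > M the shifted entries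
    beyond n stay positive, hence \<open>\<zeta>\<close> is nonzero.\<close>
  define M where "M = (\<Sum>j\<in>{n<..<n+m}. \<bar>D0 j\<bar>)"
  have root: "poly p (qc ^ (2 * s)) = 0" if s: "nat M + 1 \<le> s" for s
  proof -
    let ?i = "sparse r s B0"
    have i: "?i \<in> idx n m" using s B0 by (intro sparse_idx) (auto simp: r_def)
    have iB: "?i j = B0 j" if "j \<in> {1..n}" for j using that by (auto simp: sparse_def)
    have large: "1 \<le> ?i j - D0 j" if "n < j" "j < n + m" for j
    proof -
      have "D0 j \<le> \<bar>D0 j\<bar>" by simp
      also have "\<dots> \<le> M" unfolding M_def using that
        by (intro member_le_sum [where f = "\<lambda>j. \<bar>D0 j\<bar>"]) auto
      moreover have "int s \<le> ?i j" using that by (intro sparse_ge) (auto simp: r_def)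
      ultimately show ?thesis using s by linarith
    qed
    obtain \<zeta> where \<zeta>: "\<And>c. valid D0 c B0 \<Longrightarrow> TT (nf D0 c B0) (e ?i) = single (out D0 ?i) (\<zeta> * chi c (base ?i))"
      "\<zeta> \<noteq> 0"
      using TT_nf [OF i iB, of D0] v0(1) large by blast
    have other: "lookup (TT (nf D c B) (e ?i)) (out D0 ?i) = 0"
      if "(D, c, B) \<in> keys k" "(D, B) \<noteq> (D0, B0)" for D c B
    proof -
      have v: "valid D c B" "nf_weight D B = d" using that k by auto
      show ?thesis
      proof (cases "B = B0")
        case False
        then obtain j where "B j \<noteq> B0 j" by (auto simp: fun_eq_iff)
        moreover from this have "j \<in> {1..n}" using v(1) v0(1) unfolding valid_def by metis
        ultimately show ?thesis using TT_nf_zero [OF v(1) i, of j] iB [of j] by simp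
      next
        case True
        \<comment> \<open>All exponents but the last are visible as shifts of the index, and the
          last one is fixed by the common weight.\<close>
        have "\<exists>j\<in>{1..<n+m}. D j \<noteq> D0 j"
        proof (rule ccontr)
          assume "\<not> ?thesis"
          then have eq: "D j = D0 j" if "j \<in> {1..<n+m}" for j using that by blast
          have "sum D {1..<n+m} = sum D0 {1..<n+m}" by (rule sum.cong) (auto simp: eq)
          moreover have "sum f {1..n+m} = sum f {1..<n+m} + f (n+m)" for f :: "nat \<Rightarrow> int"
            using m_ge sum.atLeastLessThan_Suc [of 1 "n + m" f] by (simp add: atLeastLessThanSuc_atLeastAtMost)
          ultimately have "D (n + m) = D0 (n + m)"
            using v(2) v0(2) True by (simp add: nf_weight_def)
          then have "D j = D0 j" for j
            using eq [of j] v(1) v0(1) by (cases "j \<in> {1..n+m}"; cases "j = n + m") (auto simp: valid_def)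
          then show False using that(2) True by auto
        qed
        then obtain j where "j \<in> {1..<n+m}" "D j \<noteq> D0 j" by blast
        then have "out D ?i j \<noteq> out D0 ?i j" by (auto simp: out_def shift_def)
        then have ne: "out D ?i \<noteq> out D0 ?i" by metis
        obtain z where "TT (nf D c B0) (e ?i) = single (out D ?i) z"
          using TT_nf [OF i iB, of D] v True by blast
        then show ?thesis using ne True by (simp add: lookup_single)
      qed
    qed
    have "nf_lin k = (\<Sum>(D, c, B)\<in>keys k. scl (lookup k (D, c, B)) (nf D c B))"
      unfolding nf_lin_def lin_ext_def scl_def by (intro sum.cong) auto
    then have "0 = lookup (TT (\<Sum>(D, c, B)\<in>keys k.
        scl (lookup k (D, c, B)) (nf D c B)) (e ?i)) (out D0 ?i)"
      using zero [OF i] by simp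
    also have "\<dots> = (\<Sum>(D, c, B)\<in>keys k. lookup k (D, c, B) *
        lookup (TT (nf D c B) (e ?i)) (out D0 ?i))"
      by (simp add: T_free_linear lookup_sum split_beta)
    also have "\<dots> = (\<Sum>(D, c, B)\<in>(\<lambda>c. (D0, c, B0)) ` A. lookup k (D, c, B) *
        lookup (TT (nf D c B) (e ?i)) (out D0 ?i))"
    proof (rule sum.mono_neutral_right)
      show "\<forall>x\<in>keys k - (\<lambda>c. (D0, c, B0)) ` A. (case x of (D, c, B) \<Rightarrow>
          lookup k (D, c, B) * lookup (TT (nf D c B) (e ?i)) (out D0 ?i)) = 0"
      proof clarify
        fix D c B
        assume key: "(D, c, B) \<in> keys k" and "(D, c, B) \<notin> (\<lambda>c. (D0, c, B0)) ` A"
        then have "(D, B) \<noteq> (D0, B0)" by (auto simp: A_def)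
        then show "lookup k (D, c, B) * lookup (TT (nf D c B) (e ?i)) (out D0 ?i) = 0"
          using other [OF key] by simp
      qed
    qed (auto simp: A_def)
    also have "\<dots> = (\<Sum>c\<in>A. lookup k (D0, c, B0) *
        lookup (TT (nf D0 c B0) (e ?i)) (out D0 ?i))"
      by (subst sum.reindex) (auto intro: inj_onI)
    also have "\<dots> = (\<Sum>c\<in>A. lookup k (D0, c, B0) * (\<zeta> * (qc ^ (2 * s)) ^ code c))"
    proof (rule sum.cong)
      fix c assume "c \<in> A"
      then have "valid D0 c B0" using k by (auto simp: A_def)
      then show "lookup k (D0, c, B0) * lookup (TT (nf D0 c B0) (e ?i)) (out D0 ?i) =
          lookup k (D0, c, B0) * (\<zeta> * (qc ^ (2 * s)) ^ code c)"
        by (simp only: \<zeta>(1) lookup_single_eq chi_sparse code_def)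
    qed simp
    also have "\<dots> = \<zeta> * poly p (qc ^ (2 * s))"
      by (simp add: p_def poly_sum poly_monom sum_distrib_left mult_ac)
    finally show ?thesis using \<zeta>(2) by simp
  qed
  have "inj (\<lambda>s. qc ^ (2 * s))"
  proof (rule injI)
    fix x y :: nat assume "qc ^ (2 * x) = qc ^ (2 * y)"
    then have "q ^ (2 * x) = q ^ (2 * y)" by (metis of_real_eq_iff of_real_power)
    then show "x = y"
      using power_strict_decreasing [of "2 * x" "2 * y" q] power_strict_decreasing [of "2 * y" "2 * x" q]
        q_pos q_less_1 by (cases x y rule: linorder_cases) auto
  qed
  then have "infinite ((\<lambda>s. qc ^ (2 * s)) ` {nat M + 1..})"
    using infinite_Ici finite_imageD inj_on_subset by blast
  moreover have "(\<lambda>s. qc ^ (2 * s)) ` {nat M + 1..} \<subseteq> {x. poly p x = 0}"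
    using root by auto
  ultimately have "infinite {x. poly p x = 0}" using finite_subset by blast
  then have "p = 0" using poly_roots_finite by blast
  moreover have "Polynomial.coeff p (code c0) = (\<Sum>c\<in>A. if c = c0 then lookup k (D0, c, B0) else 0)"
    unfolding p_def coeff_sum
  proof (rule sum.cong)
    fix c assume "c \<in> A"
    moreover have "c0 \<in> A" using key by (simp add: A_def)
    ultimately show "Polynomial.coeff (Polynomial.monom (lookup k (D0, c, B0)) (code c)) (code c0) =
        (if c = c0 then lookup k (D0, c, B0) else 0)"
      using code_inj by auto
  qed simp
  ultimately have "lookup k (D0, c0, B0) = 0"
    using finA key by (simp add: A_def)
  then show False using key by (simp add: in_keys_iff)
qed

end


section \<open>The quotient algebras\<close>

context hyperboloid
begin

abbreviation cls :: "fgen free \<Rightarrow> fgen free set" where "cls \<equiv> fun_class q n m"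

lemma fun_ideal_ideal: "ideal (fun_ideal q n m) (free_algebra G)"
proof -
  interpret ring "free_algebra G" by (rule free_algebra_ring)
  show ?thesis
    unfolding fun_ideal_def rels_def [symmetric]
    by (rule genideal_ideal) (simp add: carrier_free_algebra rels_carr)
qed

lemma Fun_tilde_ring: "ring (Fun_tilde q n m)"
  unfolding Fun_tilde_def by (rule ideal.quotient_is_ring [OF fun_ideal_ideal])

lemma carrier_Fun_tilde: "carrier (Fun_tilde q n m) = cls ` carr G"
  by (auto simp: Fun_tilde_def FactRing_def A_RCOSETS_def' fun_class_def carrier_free_algebra)

lemma cls_add: "x \<in> carr G \<Longrightarrow> y \<in> carr G \<Longrightarrow> cls x \<oplus>\<^bsub>Fun_tilde q n m\<^esub> cls y = cls (x + y)"
  using ideal.a_rcos_sum [OF fun_ideal_ideal, of x y]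
  by (simp add: Fun_tilde_def FactRing_def fun_class_def carrier_free_algebra)

lemma cls_mult: "x \<in> carr G \<Longrightarrow> y \<in> carr G \<Longrightarrow> cls x \<otimes>\<^bsub>Fun_tilde q n m\<^esub> cls y = cls (x * y)"
  using ideal.rcoset_mult_add [OF fun_ideal_ideal, of x y]
  by (simp add: Fun_tilde_def FactRing_def fun_class_def carrier_free_algebra)

lemma cls_zero: "\<zero>\<^bsub>Fun_tilde q n m\<^esub> = cls 0"
  by (simp add: Fun_tilde_def FactRing_def fun_class_eq)

lemma cls_one: "\<one>\<^bsub>Fun_tilde q n m\<^esub> = cls 1"
  by (simp add: Fun_tilde_def FactRing_def fun_class_def)

lemma cls_uminus: assumes "x \<in> carr G" shows "\<ominus>\<^bsub>Fun_tilde q n m\<^esub> cls x = cls (- x)"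
proof -
  interpret ring "Fun_tilde q n m" by (rule Fun_tilde_ring)
  have "cls (- x) \<oplus>\<^bsub>Fun_tilde q n m\<^esub> cls x = \<zero>\<^bsub>Fun_tilde q n m\<^esub>"
    using assms by (simp add: cls_add cls_zero carr_uminus)
  then show ?thesis
    using assms minus_equality by (auto simp: carrier_Fun_tilde carr_uminus)
qed

lemma cls_scale: "x \<in> carr G \<Longrightarrow> fun_scale q n m z (cls x) = cls (scl z x)"
  by (simp add: fun_scale_def cls_mult const_mult)

lemma cls_star: assumes "x \<in> carr G" shows "fun_star (cls x) = cls (free_star x)"
proof
  show "fun_star (cls x) \<subseteq> cls (free_star x)"
    using assms cong_free_star by (auto simp: fun_star_def fun_class_mem free_star_carr)
  show "cls (free_star x) \<subseteq> fun_star (cls x)"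
  proof
    fix y assume "y \<in> cls (free_star x)"
    then have "free_star y \<in> cls x"
      using assms cong_free_star [of y "free_star x"] by (simp add: fun_class_mem free_star_carr)
    then show "y \<in> fun_star (cls x)"
      unfolding fun_star_def by (metis free_star_free_star imageI)
  qed
qed

lemma gauge_cong: "x \<approx> y \<Longrightarrow> gauge \<phi> x \<approx> gauge \<phi> y"
  using dia_rels [of "gauge_letter \<phi>" "x - y"]
  by (simp add: cong_def gauge_dia dia_linear cis_mult)

lemma gauge_gauge: "gauge \<phi> (gauge (- \<phi>) x) = x"
proof -
  have "(\<lambda>g. gauge_letter \<phi> g * gauge_letter (- \<phi>) g) = (\<lambda>_. 1)"
  proof
    fix g show "gauge_letter \<phi> g * gauge_letter (- \<phi>) g = 1" by (cases g) (simp_all add: cis_mult)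
  qed
  then show ?thesis by (simp add: gauge_dia dia_dia dia_1)
qed

lemma gauge_carr: "x \<in> carr G \<Longrightarrow> gauge \<phi> x \<in> carr G"
  by (simp add: gauge_dia dia_carr)

lemma gauge_cls: assumes "x \<in> carr G" shows "gauge \<phi> ` cls x = cls (gauge \<phi> x)"
proof
  show "gauge \<phi> ` cls x \<subseteq> cls (gauge \<phi> x)"
    using assms gauge_cong by (auto simp: fun_class_mem gauge_carr)
  show "cls (gauge \<phi> x) \<subseteq> gauge \<phi> ` cls x"
  proof
    fix y assume "y \<in> cls (gauge \<phi> x)"
    then have "gauge (- \<phi>) y \<in> cls x"
      using assms gauge_cong [of y "gauge \<phi> x" "- \<phi>"] gauge_gauge [of "- \<phi>" x]
      by (simp add: fun_class_mem gauge_carr)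
    then show "y \<in> gauge \<phi> ` cls x"
      using gauge_gauge [of \<phi> y] by (metis imageI)
  qed
qed

lemma cls_eq_iff: "x \<in> carr G \<Longrightarrow> y \<in> carr G \<Longrightarrow> cls x = cls y \<longleftrightarrow> x \<approx> y"
  using fun_class_cong [of x y] fun_class_mem [of y x] fun_class_mem [of x x] by auto

section \<open>Spaces of words with prescribed gauge weight or containing \<open>f0\<close>\<close>

definition wspace :: "int \<Rightarrow> bool \<Rightarrow> fgen free set" where
  "wspace d b = {p \<in> carr G. \<forall>w\<in>keys p. sum_list (map gw (letters w)) = d
     \<and> (b \<longrightarrow> Gen_f0 \<in> set (letters w))}"

definition f0_span :: "fgen free set" where
  "f0_span = {p \<in> carr G. \<forall>w\<in>keys p. Gen_f0 \<in> set (letters w)}"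

lemma f0_span_mult: assumes "x \<in> carr G" "y \<in> carr G" "x \<in> f0_span \<or> y \<in> f0_span"
  shows "x * y \<in> f0_span"
proof -
  have "Gen_f0 \<in> set (letters w)" if w: "w \<in> keys (x * y)" for w
  proof -
    obtain u v where "u \<in> keys x" "v \<in> keys y" "w = u + v"
      using keys_mult [of x y] w by auto
    then show ?thesis using assms(3) by (auto simp: plus_word_def f0_span_def)
  qed
  then show ?thesis using assms by (auto simp: f0_span_def)
qed

lemma f0_span_add: "x \<in> f0_span \<Longrightarrow> y \<in> f0_span \<Longrightarrow> x + y \<in> f0_span"
  using keys_add [of x y] by (auto simp: f0_span_def)

lemma f0_span_scl: "x \<in> f0_span \<Longrightarrow> scl c x \<in> f0_span"
  by (auto simp: f0_span_def in_keys_iff)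

text \<open>Replacing \<open>p\<close> by the mean of \<open>p\<close> and \<open>gauge (pi / k) p\<close> removes the words of weight \<open>k\<close>.\<close>

lemma gauge_invariant_weight_zero:
  assumes "\<And>\<phi>. gauge \<phi> p \<approx> p"
  shows "\<exists>p'. p' \<approx> p \<and> keys p' \<subseteq> {w \<in> keys p. sum_list (map gw (letters w)) = 0}"
proof -
  let ?gw = "\<lambda>w. sum_list (map gw (letters w))"
  have look: "lookup (gauge \<phi> p) w = cis (\<phi> * ?gw w) * lookup p w" for \<phi> p w
  proof -
    have letter: "gauge_letter \<phi> g = cis (\<phi> * real_of_int (gw g))" for g
      by (cases g) simp_all
    have word: "prod_list (map (gauge_letter \<phi>) v) = cis (\<phi> * real_of_int (sum_list (map gw v)))" for v
      by (induction v) (simp_all add: letter cis_mult distrib_left)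
    show ?thesis
    proof -
      have "lookup (gauge \<phi> p) w = (\<Sum>a\<in>keys p.
          if a = w then cis (\<phi> * ?gw w) * lookup p w else 0)"
        unfolding gauge_def lookup_lin_ext [OF subset_refl finite_keys]
        by (rule sum.cong) (auto simp: lookup_single when_def word)
      then show ?thesis by (simp add: sum.delta in_keys_iff)
    qed
  qed
  define bad where "bad p = {w \<in> keys p. ?gw w \<noteq> 0}" for p :: "fgen free"
  show ?thesis
    using assms
  proof (induction "card (bad p)" arbitrary: p rule: less_induct)
    case less
    show ?case
    proof (cases "bad p = {}")
      case True
      then show ?thesis by (intro exI [of _ p]) (auto simp: bad_def)
    next
      case False
      then obtain w where w: "w \<in> bad p" by blast
      define \<phi> where "\<phi> = pi / real_of_int (?gw w)"
      define r where "r = scl (1 / 2) (p + gauge \<phi> p)"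
      have lr: "lookup r v = (1 + cis (\<phi> * ?gw v)) / 2 * lookup p v" for v
        by (simp add: r_def lookup_add look algebra_simps)
      have keys: "keys r \<subseteq> keys p"
        by (auto simp: in_keys_iff lr)
      have "\<phi> * ?gw w = pi" using w by (simp add: \<phi>_def bad_def)
      then have "w \<notin> keys r" by (simp add: in_keys_iff lr)
      then have "bad r \<subset> bad p" using keys w by (auto simp: bad_def)
      moreover have "finite (bad p)" by (simp add: bad_def)
      ultimately have card: "card (bad r) < card (bad p)" by (rule psubset_card_mono [rotated])
      have "r \<approx> scl (1 / 2) (p + p)"
        unfolding r_def by (intro cong_scl cong_add cong_refl less.prems)
      also have "scl (1 / 2) (p + p) = p" by (rule poly_mapping_eqI) (simp add: lookup_add)
      finally have rp: "r \<approx> p" .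
      have inv: "gauge \<psi> r \<approx> r" for \<psi>
        using cong_trans [OF cong_trans [OF gauge_cong [OF rp] less.prems] cong_sym [OF rp]] .
      obtain p' where "p' \<approx> r" "keys p' \<subseteq> {w \<in> keys r. ?gw w = 0}"
        using less.hyps [OF card inv] by blast
      then show ?thesis using cong_trans [OF _ rp] keys by (intro exI [of _ p']) auto
    qed
  qed
qed

lemma Fun_H_ring: "ring (Fun_H q n m)"
proof -
  interpret ring "Fun_tilde q n m" by (rule Fun_tilde_ring)
  have "subring {f \<in> carrier (Fun_tilde q n m). \<forall>\<phi>. gauge \<phi> ` f = f} (Fun_tilde q n m)"
  proof (rule subringI)
    show "\<one>\<^bsub>Fun_tilde q n m\<^esub> \<in> {f \<in> carrier (Fun_tilde q n m). \<forall>\<phi>. gauge \<phi> ` f = f}"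
      by (auto simp: cls_one carrier_Fun_tilde gauge_cls) (simp_all add: gauge_dia)
  next
    fix f assume f: "f \<in> {f \<in> carrier (Fun_tilde q n m). \<forall>\<phi>. gauge \<phi> ` f = f}"
    then obtain x where x: "x \<in> carr G" "f = cls x" by (auto simp: carrier_Fun_tilde)
    then have "cls (gauge \<phi> x) = cls x" for \<phi> using f by (simp add: gauge_cls)
    then have "cls (gauge \<phi> (- x)) = cls (- x)" for \<phi>
      using x cong_uminus by (simp add: cls_eq_iff gauge_carr carr_uminus gauge_dia dia_linear dia_carr)
    then show "\<ominus>\<^bsub>Fun_tilde q n m\<^esub> f \<in> {f \<in> carrier (Fun_tilde q n m). \<forall>\<phi>. gauge \<phi> ` f = f}"
      using x by (auto simp: cls_uminus gauge_cls carr_uminus carrier_Fun_tilde)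
  next
    fix f g assume f: "f \<in> {f \<in> carrier (Fun_tilde q n m). \<forall>\<phi>. gauge \<phi> ` f = f}"
      and g: "g \<in> {f \<in> carrier (Fun_tilde q n m). \<forall>\<phi>. gauge \<phi> ` f = f}"
    then obtain x y where xy: "x \<in> carr G" "f = cls x" "y \<in> carr G" "g = cls y"
      by (auto simp: carrier_Fun_tilde)
    then have inv: "gauge \<phi> x \<approx> x" "gauge \<phi> y \<approx> y" for \<phi>
      using f g by (simp_all add: gauge_cls gauge_carr flip: cls_eq_iff)
    have "gauge \<phi> (x * y) \<approx> x * y" "gauge \<phi> (x + y) \<approx> x + y" for \<phi>
      using cong_mult [OF inv] cong_add [OF inv] by (simp_all add: gauge_dia dia_mult dia_linear)
    then show "f \<otimes>\<^bsub>Fun_tilde q n m\<^esub> g \<in> {f \<in> carrier (Fun_tilde q n m). \<forall>\<phi>. gauge \<phi> ` f = f}"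
      "f \<oplus>\<^bsub>Fun_tilde q n m\<^esub> g \<in> {f \<in> carrier (Fun_tilde q n m). \<forall>\<phi>. gauge \<phi> ` f = f}"
      using xy by (auto simp: cls_mult cls_add gauge_cls carrier_Fun_tilde carr_mult carr_add gauge_carr cls_eq_iff)
  qed auto
  from subring_is_ring [OF this] show ?thesis by (simp add: Fun_H_def)
qed

text \<open>The gauge-invariant classes represented by words containing \<open>f0\<close> form an
  ideal that contains the class of \<open>f0\<close>. By gauge invariance, the words of nonzero
  weight can then be dropped, and the remaining words still contain \<open>f0\<close>.\<close>

lemma D_H_representative: assumes "f \<in> D_H q n m" shows "\<exists>p\<in>wspace 0 True. f = cls p"
proof -
  interpret H: ring "Fun_H q n m" by (rule Fun_H_ring)
  interpret R: ring "Fun_tilde q n m" by (rule Fun_tilde_ring)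
  define S where "S = {f \<in> carrier (Fun_H q n m). \<exists>p\<in>f0_span. f = cls p}"
  have carrH: "carrier (Fun_H q n m) \<subseteq> carrier (Fun_tilde q n m)" by (auto simp: Fun_H_def)
  have ops: "x \<oplus>\<^bsub>Fun_H q n m\<^esub> y = x \<oplus>\<^bsub>Fun_tilde q n m\<^esub> y" "x \<otimes>\<^bsub>Fun_H q n m\<^esub> y = x \<otimes>\<^bsub>Fun_tilde q n m\<^esub> y"
    "\<zero>\<^bsub>Fun_H q n m\<^esub> = \<zero>\<^bsub>Fun_tilde q n m\<^esub>" for x y
    by (simp_all add: Fun_H_def)
  have sub: "f0_span \<subseteq> carr G" by (auto simp: f0_span_def)
  have zero: "0 \<in> f0_span" by (simp add: f0_span_def)
  have "ideal S (Fun_H q n m)"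
  proof (rule idealI)
    show "ring (Fun_H q n m)" by (rule Fun_H_ring)
    show "subgroup S (add_monoid (Fun_H q n m))"
    proof (rule H.add.subgroupI)
      show "S \<subseteq> carrier (Fun_H q n m)" by (auto simp: S_def)
      have "\<zero>\<^bsub>Fun_H q n m\<^esub> \<in> S" using zero H.zero_closed by (auto simp: S_def ops cls_zero)
      then show "S \<noteq> {}" by auto
    next
      fix f assume f: "f \<in> S"
      then obtain p where p: "p \<in> f0_span" "f = cls p" by (auto simp: S_def)
      have fH: "f \<in> carrier (Fun_H q n m)" using f by (simp add: S_def)
      have mp: "- p \<in> f0_span" using f0_span_scl [OF p(1), of "- 1"] by simp
      have "\<ominus>\<^bsub>Fun_H q n m\<^esub> f \<oplus>\<^bsub>Fun_tilde q n m\<^esub> f = \<zero>\<^bsub>Fun_tilde q n m\<^esub>"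
        using H.l_neg [OF fH] by (simp add: ops)
      then have "\<ominus>\<^bsub>Fun_tilde q n m\<^esub> f = \<ominus>\<^bsub>Fun_H q n m\<^esub> f"
        using fH H.a_inv_closed [OF fH] carrH by (intro R.minus_equality) auto
      then have "\<ominus>\<^bsub>Fun_H q n m\<^esub> f = cls (- p)" using p sub by (auto simp: cls_uminus)
      then show "\<ominus>\<^bsub>Fun_H q n m\<^esub> f \<in> S"
        using mp H.a_inv_closed [OF fH] by (auto simp: S_def)
    next
      fix f g assume fg: "f \<in> S" "g \<in> S"
      then obtain p r where pr: "p \<in> f0_span" "f = cls p" "r \<in> f0_span" "g = cls r"
        by (auto simp: S_def)
      then have "f \<oplus>\<^bsub>Fun_H q n m\<^esub> g = cls (p + r)"
        using sub cls_add [of p r] by (auto simp: ops)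
      moreover have "f \<oplus>\<^bsub>Fun_H q n m\<^esub> g \<in> carrier (Fun_H q n m)"
        using fg by (intro H.a_closed) (auto simp: S_def)
      ultimately show "f \<oplus>\<^bsub>Fun_H q n m\<^esub> g \<in> S"
        using f0_span_add [OF pr(1,3)] by (auto simp: S_def)
    qed
  next
    fix f g assume f: "f \<in> S" and g: "g \<in> carrier (Fun_H q n m)"
    then obtain p x where p: "p \<in> f0_span" "f = cls p" "f \<in> carrier (Fun_H q n m)"
      and x: "x \<in> carr G" "g = cls x"
      using carrH by (auto simp: S_def carrier_Fun_tilde)
    have pG: "p \<in> carr G" using p sub by auto
    have "g \<otimes>\<^bsub>Fun_H q n m\<^esub> f = cls (x * p)" "f \<otimes>\<^bsub>Fun_H q n m\<^esub> g = cls (p * x)"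
      using p x pG by (simp_all add: ops cls_mult)
    moreover have "x * p \<in> f0_span" "p * x \<in> f0_span"
      using p x pG by (auto intro: f0_span_mult)
    ultimately show "g \<otimes>\<^bsub>Fun_H q n m\<^esub> f \<in> S" "f \<otimes>\<^bsub>Fun_H q n m\<^esub> g \<in> S"
      using H.m_closed [OF g p(3)] H.m_closed [OF p(3) g] by (auto simp: S_def)
  qed
  moreover have "cls f0 \<in> S"
  proof -
    have "f0 \<in> f0_span" by (simp add: f0_span_def fgens_def)
    moreover have "gauge \<phi> f0 = f0" for \<phi> by (simp add: gauge_dia dia_mon)
    ultimately show ?thesis
      using sub by (auto simp: S_def Fun_H_def carrier_Fun_tilde gauge_cls fgens_def)
  qed
  ultimately have "D_H q n m \<subseteq> S"
    unfolding D_H_def by (intro H.genideal_minimal) auto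
  then obtain p where p: "p \<in> f0_span" "f = cls p" "f \<in> carrier (Fun_H q n m)"
    using assms by (auto simp: S_def)
  have pG: "p \<in> carr G" using p sub by auto
  have "gauge \<phi> p \<approx> p" for \<phi>
    using p pG by (simp add: Fun_H_def gauge_cls gauge_carr flip: cls_eq_iff)
  then obtain p' where p': "p' \<approx> p" "keys p' \<subseteq> {w \<in> keys p. sum_list (map gw (letters w)) = 0}"
    using gauge_invariant_weight_zero by blast
  then have "p' \<in> wspace 0 True" using p(1) by (auto simp: wspace_def f0_span_def carr_def)
  moreover from this have "cls p' = cls p" using pG p' by (simp add: cls_eq_iff wspace_def)
  ultimately show ?thesis using p by blast
qed

lemma T_cls: assumes "p \<in> carr G" "v \<in> supp" shows "T q n m (cls p) v = TT p v"
proof -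
  have "(\<lambda>p. TT p v) ` cls p = {TT p v}"
    by (rule image_const_singleton [of p]) (use assms TT_cong in \<open>auto simp: fun_class_mem\<close>)
  then show ?thesis by (simp add: T_def)
qed

lemma wspace_add: "x \<in> wspace d b \<Longrightarrow> y \<in> wspace d b \<Longrightarrow> x + y \<in> wspace d b"
  using keys_add [of x y] by (auto simp: wspace_def)

lemma wspace_zero [simp]: "0 \<in> wspace d b"
  by (simp add: wspace_def)

lemma wspace_scl: "x \<in> wspace d b \<Longrightarrow> scl c x \<in> wspace d b"
  by (auto simp: wspace_def in_keys_iff)

lemma wspace_uminus: "x \<in> wspace d b \<Longrightarrow> - x \<in> wspace d b"
  using wspace_scl [of x d b "- 1"] by simp

lemma wspace_mult: assumes "x \<in> wspace d b" "y \<in> wspace d' b'" shows "x * y \<in> wspace (d + d') (b \<or> b')"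
proof -
  have "sum_list (map gw (letters w)) = d + d' \<and> (b \<or> b' \<longrightarrow> Gen_f0 \<in> set (letters w))"
    if w: "w \<in> keys (x * y)" for w
  proof -
    obtain u v where "u \<in> keys x" "v \<in> keys y" "w = u + v"
      using keys_mult [of x y] w by auto
    then show ?thesis using assms by (auto simp: plus_word_def wspace_def)
  qed
  moreover have "x * y \<in> carr G" using assms by (auto simp: wspace_def)
  ultimately show ?thesis unfolding wspace_def by blast
qed

lemma wspace_mon: "mon w \<in> wspace d b \<longleftrightarrow> set w \<subseteq> G \<and> sum_list (map gw w) = d \<and> (b \<longrightarrow> Gen_f0 \<in> set w)"
  by (simp add: wspace_def)

lemma wspace_star: assumes "x \<in> wspace 0 True" shows "free_star x \<in> wspace 0 True"
proof -
  have "gw (star_letter g) = - gw g" for g by (cases g) auto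
  then have "sum_list (map gw (map star_letter w)) = - sum_list (map gw w)" for w
    by (induction w) auto
  note neg = this
  have "free_star (mon w) \<in> wspace 0 True" if "Word w \<in> keys x" for w
  proof -
    have "set w \<subseteq> G" "sum_list (map gw w) = 0" "Gen_f0 \<in> set w"
      using that assms carr_keys [of x G w] by (auto simp: wspace_def)
    moreover from this(3) have "Gen_f0 \<in> star_letter ` set w" by force
    ultimately show ?thesis
      using neg [of w] star_letter_G
      by (auto simp: free_star_mon wspace_mon rev_map [symmetric])
  qed
  then show ?thesis
    by (intro free_linear_induct [where p = x and P = "\<lambda>x. free_star x \<in> wspace 0 True"])
      (auto simp: free_star_simps intro: wspace_add wspace_scl)
qed

text \<open>Such an element is congruent to a combination of normal forms of weight 0. Congruent
  elements act alike on \<open>supp\<close>, so \<open>nf_lin_faithful\<close> makes all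
  coefficients vanish.\<close>

lemma wspace_faithful: assumes p: "p \<in> wspace 0 True" and zero: "\<And>i. i \<in> idx n m \<Longrightarrow> TT p (e i) = 0"
  shows "p \<approx> 0"
proof -
  have "nf_span 0 (mon w)" if "Word w \<in> keys p" for w
    using nf_span_word [of w] that p carr_keys [of p G w] by (auto simp: wspace_def)
  then have "nf_span 0 p"
    by (intro free_linear_induct [where p = p and P = "nf_span 0"]) (auto intro: nf_span_zero nf_span_add nf_span_scl)
  then obtain k where k: "\<forall>(D, c, B)\<in>keys k. valid D c B \<and> nf_weight D B = 0" "p \<approx> nf_lin k"
    using nf_span_nf_lin by blast
  have nf: "nf D c B \<in> carr G" for D c B
  proof -
    obtain w where "set w \<subseteq> G" "tpow_prod 1 (n + m + 1) D = mon w"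
      using tpow_prod_words [of 1 "n + m + 1" D] by auto
    then have 1: "tpow_prod 1 (n + m + 1) D \<in> carr G" by simp
    obtain w where "set w \<subseteq> G" "tpow_prod 1 (n + 1) B = mon w"
      using tpow_prod_words [of 1 "n + 1" B] by auto
    then have 2: "tpow_prod 1 (n + 1) B \<in> carr G" by simp
    have X: "X j \<in> carr G" if "1 \<le> j" for j
      unfolding X_def using that by (intro carr_sum carr_scl carr_mult) (auto simp: fgens_def)
    have pow: "X j ^ k \<in> carr G" if "1 \<le> j" for j k
      by (induction k) (auto intro: X [OF that])
    have *: "prod_list (map (\<lambda>j. X j ^ c j) js) \<in> carr G" if "\<forall>j\<in>set js. 1 \<le> j" for js
      using that by (induction js) (auto intro!: carr_mult pow)
    have 3: "X_prod c \<in> carr G" unfolding X_prod_def by (rule *) auto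
    show ?thesis unfolding nf_def by (intro carr_mult 1 2 3) (simp add: fgens_def)
  qed
  have nf_single: "nf_lin (single (D, c, B) 1) = nf D c B" for D c B
    by (simp add: nf_lin_def)
  have "nf_lin k \<in> carr G"
    by (rule poly_mapping_linear_induct [where p = k and P = "\<lambda>k. nf_lin k \<in> carr G"])
      (auto simp: lin_zero [OF nf_lin_lin] lin_add [OF nf_lin_lin] lin_scl [OF nf_lin_lin] nf_single nf
        intro!: carr_scl simp del: scl_single)
  then have "TT (nf_lin k) (e i) = 0" if "i \<in> idx n m" for i
    using TT_cong [OF k(2), of "e i"] zero [OF that] p that by (simp add: wspace_def)
  then have "k = 0" using nf_lin_faithful k(1) by blast
  then show ?thesis using k(2) by (simp add: lin_zero [OF nf_lin_lin])
qed

text \<open>The generators preserve the gauge weight of each letter and send \<open>f0\<close> to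
  words containing \<open>f0\<close>. The representatives from \<open>D_H_representative\<close>
  therefore stay in the same space under the action.\<close>

lemma act1_wspace: assumes u: "u \<in> U" and p: "p \<in> wspace 0 True" shows "act1 u p \<in> wspace 0 True"
proof -
  let ?b = "\<lambda>w. Gen_f0 \<in> set w" and ?d = "\<lambda>w. sum_list (map gw w)"
  have K: "aK j (mon w) \<in> wspace (?d w) (?b w)" "aKi j (mon w) \<in> wspace (?d w) (?b w)" if "set w \<subseteq> G" for j w
    using that by (auto simp: aK_dia aKi_dia dia_mon wspace_mon intro!: wspace_scl)
  have letter: "aE j (mon [g]) \<in> wspace (gw g) (g = Gen_f0) \<and> aF j (mon [g]) \<in> wspace (gw g) (g = Gen_f0)"
    if "g \<in> G" "1 \<le> j" "j < n + m" for g j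
  proof -
    have W: "t n * f0 * ts (n + 1) \<in> wspace 0 True" "t (n + 1) * f0 * ts n \<in> wspace 0 True"
      using n_ge m_ge wspace_mon [of "[Gen_t n, Gen_f0, Gen_ts (n + 1)]"] wspace_mon [of "[Gen_t (n + 1), Gen_f0, Gen_ts n]"]
      by (simp_all add: fgens_def mon_Cons [of _ "_ # _"] mult.assoc)
    show ?thesis
      using that by (cases g) (auto simp: act1_gens fgens_def wspace_mon intro!: wspace_uminus wspace_scl W [simplified])
  qed
  have word: "aE j (mon w) \<in> wspace (?d w) (?b w) \<and> aF j (mon w) \<in> wspace (?d w) (?b w)"
    if "set w \<subseteq> G" "1 \<le> j" "j < n + m" for j w
    using that
  proof (induction w)
    case (Cons g w)
    have b: "?b (g # w) = (g = Gen_f0 \<or> ?b w)" and d: "?d (g # w) = gw g + ?d w" by auto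
    have w: "mon w \<in> wspace (?d w) (?b w)" "mon [g] \<in> wspace (gw g) (g = Gen_f0)"
      using Cons.prems by (auto simp: wspace_mon)
    have Kg: "aK j (mon [g]) \<in> wspace (gw g) (g = Gen_f0)"
      using K(1) [of "[g]" j] Cons.prems by (auto simp: eq_commute)
    have "aE j (mon [g] * mon w) \<in> wspace (?d (g # w)) (?b (g # w))"
      unfolding aE_mult b d using Cons letter [of g j] w Kg by (intro wspace_add wspace_mult) auto
    moreover have "aF j (mon [g] * mon w) \<in> wspace (?d (g # w)) (?b (g # w))"
      unfolding aF_mult b d using Cons letter [of g j] w K by (intro wspace_add wspace_mult) auto
    ultimately show ?case by (simp only: mon_Cons [of g w])
  qed simp
  have "act1 u (mon w) \<in> wspace 0 True" if "Word w \<in> keys p" for w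
  proof -
    have w: "set w \<subseteq> G" "?d w = 0" "?b w" using that p carr_keys [of p G w] by (auto simp: wspace_def)
    show ?thesis using u
      by (cases rule: ugens_cases) (use word [OF w(1)] K [OF w(1)] w(2,3) in auto)
  qed
  then show ?thesis
    by (intro free_linear_induct [where p = p and P = "\<lambda>p. act1 u p \<in> wspace 0 True"])
      (auto simp: act1_linear intro: wspace_add wspace_scl)
qed

end


section \<open>Matrix elements\<close>

context hyperboloid
begin

fun cntl :: "nat \<Rightarrow> fgen \<Rightarrow> int" where
  "cntl l (Gen_t i) = (if i = l then 1 else 0)"
| "cntl l (Gen_ts i) = (if i = l then - 1 else 0)"
| "cntl l Gen_f0 = 0"

definition cnt :: "nat \<Rightarrow> fgen list \<Rightarrow> int" where
  "cnt l w = sum_list (map (cntl l) w)"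

lemma cnt_simps [simp]: "cnt l [] = 0" "cnt l (g # w) = cntl l g + cnt l w"
  by (simp_all add: cnt_def)

lemma abs_cnt_le: "\<bar>cnt l w\<bar> \<le> int (length w)"
proof (induction w)
  case (Cons g w)
  have "\<bar>cntl l g\<bar> \<le> 1" by (cases g) auto
  then show ?case using Cons by simp
qed simp

lemma K_weight_cnt: "sum_list (map (K_weight j) w) = cnt j w - cnt (j + 1) w"
proof (induction w)
  case (Cons g w)
  have "K_weight j g = cntl j g - cntl (j + 1) g" by (cases g) auto
  then show ?case using Cons by simp
qed simp

lemma gw_cnt: "set w \<subseteq> G \<Longrightarrow> sum_list (map gw w) = (\<Sum>l\<in>{1..<n+m}. cnt l w) + cnt (n + m) w"
proof (induction w)
  case (Cons g w)
  have "gw g = (\<Sum>l\<in>{1..<n+m}. cntl l g) + cntl (n + m) g"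
  proof (cases g)
    case (Gen_t i)
    then have "i \<in> {1..<n+m} \<or> i = n + m" using Cons.prems by (auto simp: fgens_def)
    then show ?thesis using Gen_t by (auto simp: sum.delta)
  next
    case (Gen_ts i)
    then have "i \<in> {1..<n+m} \<or> i = n + m" using Cons.prems by (auto simp: fgens_def)
    then show ?thesis using Gen_ts by (auto simp: sum.delta)
  qed simp
  then show ?case using Cons by (simp add: sum.distrib)
qed simp

lemma TT_letter: assumes "g \<in> G" "i \<in> idx n m"
  shows "TT (mon [g]) (e i) = 0 \<or> (\<exists>k\<in>idx n m. \<exists>c. TT (mon [g]) (e i) = single k c
    \<and> (\<forall>l\<in>{1..<n+m}. k l = i l - cntl l g))"
proof -
  have "\<exists>k c. TT (mon [g]) (e i) = single k c \<and> (\<forall>l\<in>{1..<n+m}. k l = i l - cntl l g)"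
  proof (cases g)
    case (Gen_t j)
    then have "j < n + m \<or> j = n + m" using assms by (auto simp: fgens_def)
    then show ?thesis
    proof
      assume "j < n + m"
      then show ?thesis using Gen_t
        by (intro exI [of _ "i(j := i j - 1)"] exI [of _ "qi (Ssum j i) * sq j (i j - 1)"]) (simp add: TT_t)
    next
      assume "j = n + m"
      then show ?thesis using Gen_t by (intro exI [of _ i] exI [of _ "qi (Ssum (n+m) i)"]) (simp add: TT_tN)
    qed
  next
    case (Gen_ts j)
    then have "j < n + m \<or> j = n + m" using assms by (auto simp: fgens_def)
    then show ?thesis
    proof
      assume "j < n + m"
      then show ?thesis using Gen_ts
        by (intro exI [of _ "i(j := i j + 1)"] exI [of _ "qi (Ssum j i) * sq j (i j)"]) (simp add: TT_ts)
    next
      assume "j = n + m"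
      then show ?thesis using Gen_ts by (intro exI [of _ i] exI [of _ "qi (Ssum (n+m) i)"]) (simp add: TT_tN)
    qed
  next
    case Gen_f0
    then show ?thesis
      by (intro exI [of _ i] exI [of _ "if \<forall>j\<in>{1..n}. i j = 0 then 1 else 0"]) (simp add: TT_f0)
  qed
  then obtain k c where kc: "TT (mon [g]) (e i) = single k c" "\<forall>l\<in>{1..<n+m}. k l = i l - cntl l g"
    by blast
  show ?thesis
  proof (cases "c = 0")
    case False
    then have "k \<in> idx n m" using TT_letter_supp [OF assms] kc(1) by (simp add: supp_def)
    then show ?thesis using kc by blast
  qed (use kc in simp)
qed

lemma TT_word: assumes "set w \<subseteq> G" "i \<in> idx n m"
  shows "TT (mon w) (e i) = 0 \<or> (\<exists>k\<in>idx n m. \<exists>c. TT (mon w) (e i) = single k c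
    \<and> (\<forall>l\<in>{1..<n+m}. k l = i l - cnt l w))"
  using assms(1)
proof (induction w)
  case Nil
  then show ?case using assms(2) by (intro disjI2 bexI [of _ i] exI [of _ 1]) auto
next
  case (Cons g w)
  have step: "TT (mon (g # w)) (e i) = TT (mon [g]) (TT (mon w) (e i))"
    by (subst mon_Cons) (simp add: T_free_mult)
  show ?case
  proof (cases "TT (mon w) (e i) = 0")
    case True
    then show ?thesis by (simp add: step T_free_vec)
  next
    case False
    then obtain k c where k: "k \<in> idx n m" "TT (mon w) (e i) = single k c"
      "\<forall>l\<in>{1..<n+m}. k l = i l - cnt l w" using Cons by auto
    then have step: "TT (mon (g # w)) (e i) = scl c (TT (mon [g]) (e k))"
      using step T_free_single [of q n m "mon [g]" k c] by simp
    have g: "g \<in> G" using Cons.prems by simp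
    from TT_letter [OF g k(1)] show ?thesis
    proof
      assume "TT (mon [g]) (e k) = 0"
      then show ?thesis by (simp add: step)
    next
      assume "\<exists>k'\<in>idx n m. \<exists>c. TT (mon [g]) (e k) = single k' c \<and> (\<forall>l\<in>{1..<n+m}. k' l = k l - cntl l g)"
      then obtain k' c' where k': "k' \<in> idx n m" "TT (mon [g]) (e k) = single k' c'"
        "\<forall>l\<in>{1..<n+m}. k' l = k l - cntl l g" by blast
      then have "TT (mon (g # w)) (e i) = single k' (c * c')" by (simp add: step)
      then show ?thesis using k k' by (intro disjI2 bexI [of _ k'] exI [of _ "c * c'"]) auto
    qed
  qed
qed

text \<open>The \<open>K j\<close>-weight of every word of gauge weight \<open>0\<close> that maps \<open>e i\<close> to a multiple of \<open>e k\<close>.\<close>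

definition delta :: "nat \<Rightarrow> (nat \<Rightarrow> int) \<Rightarrow> (nat \<Rightarrow> int) \<Rightarrow> int" where
  "delta j i k = (i j - k j) - (if j + 1 < n + m then i (j + 1) - k (j + 1) else - (\<Sum>l\<in>{1..<n+m}. i l - k l))"

text \<open>The matrix element from i to k sees only words whose signed letter counts below n + m
  are the entries of i - k. Weight 0 determines the count of the index n + m, and with it the
  \<open>K j\<close>-weight.\<close>

lemma TT_aK:
  assumes p: "p \<in> wspace 0 b" and i: "i \<in> idx n m" and j: "1 \<le> j" "j < n + m"
  shows "lookup (TT (aK j p) (e i)) k = qi (delta j i k) * lookup (TT p (e i)) k"
    and "lookup (TT (aKi j p) (e i)) k = qi (- delta j i k) * lookup (TT p (e i)) k"
proof -
  have word: "lookup (TT (aK j (mon w)) (e i)) k = qi (delta j i k) * lookup (TT (mon w) (e i)) k \<and>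
    lookup (TT (aKi j (mon w)) (e i)) k = qi (- delta j i k) * lookup (TT (mon w) (e i)) k"
    if "Word w \<in> keys p" for w
  proof -
    have w: "set w \<subseteq> G" "sum_list (map gw w) = 0" using that p carr_keys [of p G w] by (auto simp: wspace_def)
    have prod: "(\<Prod>g\<leftarrow>w. qi (K_weight j g)) = qi (sum_list (map (K_weight j) w))"
      "(\<Prod>g\<leftarrow>w. qi (- K_weight j g)) = qi (- sum_list (map (K_weight j) w))" for w
      by (induction w) (simp_all add: qi_add [symmetric] qi_diff [symmetric] algebra_simps)
    have wt: "sum_list (map (K_weight j) w) = delta j i k" if nz: "lookup (TT (mon w) (e i)) k \<noteq> 0"
    proof -
      obtain k' c where "TT (mon w) (e i) = single k' c" "\<forall>l\<in>{1..<n+m}. k' l = i l - cnt l w"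
        using TT_word [OF w(1) i] nz by auto
      then have kl: "\<forall>l\<in>{1..<n+m}. cnt l w = i l - k l" using nz by (auto simp: lookup_single when_def split: if_splits)
      then have "(\<Sum>l\<in>{1..<n+m}. cnt l w) = (\<Sum>l\<in>{1..<n+m}. i l - k l)" by (intro sum.cong) auto
      then have "cnt (n + m) w = - (\<Sum>l\<in>{1..<n+m}. i l - k l)" using gw_cnt [OF w(1)] w(2) by simp
      moreover have "cnt (j + 1) w = cnt (n + m) w" if "\<not> j + 1 < n + m"
      proof -
        have "j + 1 = n + m" using that j by simp
        then show ?thesis by (simp only:)
      qed
      ultimately show ?thesis using kl j by (auto simp: K_weight_cnt delta_def)
    qed
    show ?thesis
      by (cases "lookup (TT (mon w) (e i)) k = 0")
        (simp_all add: aK_dia aKi_dia dia_mon T_free_linear prod wt)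
  qed
  show "lookup (TT (aK j p) (e i)) k = qi (delta j i k) * lookup (TT p (e i)) k"
    by (rule free_linear_induct [where p = p and P = "\<lambda>p. lookup (TT (aK j p) (e i)) k =
          qi (delta j i k) * lookup (TT p (e i)) k"])
      (auto simp: act1_linear T_free_linear word lookup_add algebra_simps)
  show "lookup (TT (aKi j p) (e i)) k = qi (- delta j i k) * lookup (TT p (e i)) k"
    by (rule free_linear_induct [where p = p and P = "\<lambda>p. lookup (TT (aKi j p) (e i)) k =
          qi (- delta j i k) * lookup (TT p (e i)) k"])
      (auto simp: act1_linear T_free_linear word lookup_add algebra_simps)
qed

section \<open>Bounds for matrix elements\<close>

definition in_box :: "nat \<Rightarrow> (nat \<Rightarrow> int) \<Rightarrow> bool" where
  "in_box L i \<longleftrightarrow> (\<forall>j\<in>{1..n}. - int L \<le> i j)"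

lemma Ssum_ge: assumes "i \<in> idx n m" "in_box L i" "j \<le> n + m"
  shows "- (int n * int L) \<le> Ssum j i"
proof -
  have "- (int n * int L) = (\<Sum>k\<in>{1..n}. - int L)" by simp
  also have "\<dots> \<le> (\<Sum>k\<in>{1..n} \<inter> {1..<j}. - int L)"
  proof -
    have "(\<Sum>k\<in>{1..n}. - int L) = (\<Sum>k\<in>{1..n} \<inter> {1..<j}. - int L) + (\<Sum>k\<in>{1..n} - {1..<j}. - int L)"
      by (rule sum.Int_Diff) simp
    then show ?thesis by simp
  qed
  also have "\<dots> = (\<Sum>k\<in>{1..<j}. if k \<le> n then - int L else 0)"
    by (rule sum.mono_neutral_cong_left) auto
  also have "\<dots> \<le> (\<Sum>k\<in>{1..<j}. i k)"
  proof (rule sum_mono)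
    fix k assume "k \<in> {1..<j}"
    then show "(if k \<le> n then - int L else 0) \<le> i k"
      using assms idx_ge [OF assms(1), of k] by (auto simp: in_box_def)
  qed
  finally show ?thesis by (simp add: Ssum_def)
qed

lemma q_powi_mono: "a \<le> b \<Longrightarrow> q powi b \<le> q powi a"
  using power_int_decreasing [of a b q] q_pos q_less_1 by simp

lemma norm_qi: "norm (qi k) = q powi k"
  unfolding qi_def norm_of_real using q_pos by simp

lemma norm_sq_le: assumes "if j \<le> n then - int L \<le> k \<and> k \<le> 0 else 0 \<le> k"
  shows "norm (sq j k) \<le> q powi (- int L)"
proof (cases "j \<le> n")
  case True
  have "q powi (2 * k) = (q powi k) ^ 2"
    unfolding mult_2 by (subst power_int_add) (simp_all add: power2_eq_square)
  then have "sqrt (q powi (2 * k)) = q powi k" using q_pos by simp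
  moreover have "0 \<le> q powi (2 * k) - 1" using q_powi_ge_1 [of "2 * k"] True assms by simp
  then have "norm (sq j k) = sqrt (q powi (2 * k) - 1)" using True by (simp add: sq_def)
  moreover have "sqrt (q powi (2 * k) - 1) \<le> sqrt (q powi (2 * k))" by simp
  moreover have "q powi k \<le> q powi (- int L)" using True assms by (intro q_powi_mono) auto
  ultimately show ?thesis by simp
next
  case False
  have "0 \<le> q powi (2 * k)" "q powi (2 * k) \<le> 1"
    using q_pos q_powi_le_1 [of "2 * k"] False assms by auto
  then have "norm (sq j k) \<le> 1" using False by (simp add: sq_def)
  also have "\<dots> \<le> q powi (- int L)" by (intro q_powi_ge_1) simp
  finally show ?thesis .
qed

text \<open>The first factor bounds \<open>qi (Ssum j i)\<close> on the box, the second one the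
  square roots; it contains L + 1 because \<open>t j\<close> evaluates \<open>sq\<close> at i j -
  1.\<close>

definition lbound :: "nat \<Rightarrow> real" where
  "lbound L = q powi (- (int n * int L)) * q powi (- int (L + 1))"

lemma lbound_ge_1: "1 \<le> lbound L"
  unfolding lbound_def using q_powi_ge_1 [of "- (int n * int L)"] q_powi_ge_1 [of "- int (L + 1)"]
  by (metis mult_mono' mult_1 zero_le_one neg_le_0_iff_le of_nat_0_le_iff of_nat_mult)

lemma letter_bound: assumes "g \<in> G" "i \<in> idx n m" "in_box L i"
  shows "norm (lookup (TT (mon [g]) (e i)) k) \<le> lbound L"
proof -
  have S: "norm (qi (Ssum j i)) \<le> q powi (- (int n * int L))" if "j \<le> n + m" for j
    unfolding norm_qi by (rule q_powi_mono [OF Ssum_ge [OF assms(2,3) that]])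
  have both: "norm (qi (Ssum j i) * sq j k) \<le> lbound L"
    if "j \<le> n + m" "if j \<le> n then - int (L + 1) \<le> k \<and> k \<le> 0 else 0 \<le> k" for j k
    unfolding lbound_def norm_mult using S [OF that(1)] norm_sq_le [OF that(2)] q_pos
    by (intro mult_mono) auto
  have SN: "norm (qi (Ssum (n + m) i)) \<le> lbound L"
  proof -
    have "q powi (- (int n * int L)) * 1 \<le> lbound L"
      unfolding lbound_def using q_pos q_powi_ge_1 [of "- int (L + 1)"] by (intro mult_left_mono) auto
    then show ?thesis using S [of "n + m"] by simp
  qed
  have pos: "0 \<le> lbound L" using lbound_ge_1 [of L] by simp
  have box: "- int L \<le> i j" if "1 \<le> j" "j \<le> n" for j using assms(3) that by (simp add: in_box_def)
  show ?thesis
  proof (cases g)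
    case (Gen_t j)
    then have j: "1 \<le> j" "j \<le> n + m" using assms(1) by (auto simp: fgens_def)
    show ?thesis
    proof (cases "j = n + m")
      case False
      then have "norm (qi (Ssum j i) * sq j (i j - 1)) \<le> lbound L"
        using j box [of j] idx_le [OF assms(2), of j] idx_ge [OF assms(2), of j] by (intro both) auto
      then show ?thesis using Gen_t j False pos by (simp add: TT_t lookup_single when_def)
    qed (use Gen_t SN pos in \<open>auto simp: TT_tN lookup_single when_def\<close>)
  next
    case (Gen_ts j)
    then have j: "1 \<le> j" "j \<le> n + m" using assms(1) by (auto simp: fgens_def)
    show ?thesis
    proof (cases "j = n + m")
      case False
      then have "norm (qi (Ssum j i) * sq j (i j)) \<le> lbound L"
        using j box [of j] idx_le [OF assms(2), of j] idx_ge [OF assms(2), of j] by (intro both) auto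
      then show ?thesis using Gen_ts j False pos by (simp add: TT_ts lookup_single when_def)
    qed (use Gen_ts SN pos in \<open>auto simp: TT_tN lookup_single when_def\<close>)
  next
    case Gen_f0
    then show ?thesis using lbound_ge_1 [of L] by (auto simp: TT_f0 lookup_single when_def)
  qed
qed

lemma word_bound: assumes "set w \<subseteq> G"
  shows "\<exists>B\<ge>0. \<forall>i\<in>idx n m. in_box L i \<longrightarrow> (\<forall>k. norm (lookup (TT (mon w) (e i)) k) \<le> B)"
  using assms
proof (induction w)
  case Nil
  then show ?case by (intro exI [of _ 1]) (auto simp: lookup_single when_def)
next
  case (Cons g w)
  then obtain B where B: "0 \<le> B" "\<And>i k. i \<in> idx n m \<Longrightarrow> in_box L i \<Longrightarrow> norm (lookup (TT (mon w) (e i)) k) \<le> B"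
    by auto
  \<comment> \<open>When \<open>w\<close> has acted, the entries up to n may have fallen by
    \<open>length w\<close>, so \<open>g\<close> is estimated on the enlarged box.\<close>
  let ?b = "lbound (L + length w)"
  have "norm (lookup (TT (mon (g # w)) (e i)) k) \<le> B * ?b"
    if i: "i \<in> idx n m" "in_box L i" for i k
  proof -
    have step: "TT (mon (g # w)) (e i) = TT (mon [g]) (TT (mon w) (e i))"
      by (subst mon_Cons) (simp add: T_free_mult)
    have pos: "0 \<le> B * ?b" using B(1) lbound_ge_1 [of "L + length w"] by simp
    show ?thesis
    proof (cases "TT (mon w) (e i) = 0")
      case True
      then show ?thesis using pos by (simp add: step T_free_vec)
    next
      case False
      then obtain k' c where k': "k' \<in> idx n m" "TT (mon w) (e i) = single k' c"
        "\<forall>l\<in>{1..<n+m}. k' l = i l - cnt l w" using TT_word [of w i] Cons.prems i by auto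
      have "norm c \<le> B" using B(2) [OF i, of k'] k'(2) by simp
      moreover have "in_box (L + length w) k'"
        unfolding in_box_def
      proof
        fix j assume j: "j \<in> {1..n}"
        then have "k' j = i j - cnt j w" "- int L \<le> i j" using k'(3) m_ge i(2) by (auto simp: in_box_def)
        then show "- int (L + length w) \<le> k' j" using abs_cnt_le [of j w] by simp
      qed
      then have "norm (lookup (TT (mon [g]) (e k')) k) \<le> ?b"
        using Cons.prems k'(1) by (intro letter_bound) auto
      ultimately have "norm c * norm (lookup (TT (mon [g]) (e k')) k) \<le> B * ?b"
        using B(1) by (intro mult_mono) auto
      moreover have "TT (mon (g # w)) (e i) = scl c (TT (mon [g]) (e k'))"
        using step k'(2) T_free_single [of q n m "mon [g]" k' c] by simp
      ultimately show ?thesis by (simp add: norm_mult)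
    qed
  qed
  moreover have "0 \<le> B * ?b" using B(1) lbound_ge_1 [of "L + length w"] by simp
  ultimately show ?case by blast
qed

text \<open>The letters to the right of \<open>f0\<close> have to bring the first n entries to 0,
  and each letter changes an entry by at most 1.\<close>

lemma word_box: assumes "set w \<subseteq> G" "Gen_f0 \<in> set w" "i \<in> idx n m" "TT (mon w) (e i) \<noteq> 0"
  shows "in_box (length w) i"
proof -
  obtain u v where w: "w = u @ Gen_f0 # v" using assms(2) by (auto simp: in_set_conv_decomp)
  have "TT (mon w) (e i) = TT (mon u) (TT f0 (TT (mon v) (e i)))"
    unfolding w mon_append by (subst mon_Cons) (simp add: T_free_mult)
  then have nz: "TT f0 (TT (mon v) (e i)) \<noteq> 0" using assms(4) by (auto simp: T_free_vec)
  then have "TT (mon v) (e i) \<noteq> 0" by (auto simp: T_free_vec)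
  then obtain k c where k: "TT (mon v) (e i) = single k c" "\<forall>l\<in>{1..<n+m}. k l = i l - cnt l v"
    using TT_word [of v i] assms w by auto
  then have "\<forall>j\<in>{1..n}. k j = 0" using nz by (auto simp: TT_f0 split: if_splits)
  then have zero: "k j = 0" if "j \<in> {1..n}" for j using that by blast
  show ?thesis
    unfolding in_box_def
  proof
    fix j assume j: "j \<in> {1..n}"
    then have "k j = i j - cnt j v" using k(2) m_ge by simp
    then have "i j = cnt j v" using zero [OF j] by simp
    then show "- int (length w) \<le> i j" using abs_cnt_le [of j v] w by simp
  qed
qed

text \<open>The letters with index at most n act by unbounded operators, but every word is bounded
  on each box, and a word containing \<open>f0\<close> vanishes outside some box.\<close>

lemma wspace_bound: assumes "p \<in> wspace d True"
  shows "\<exists>B\<ge>0. \<exists>L. \<forall>i\<in>idx n m. (\<forall>k. norm (lookup (TT p (e i)) k) \<le> B)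
    \<and> (TT p (e i) \<noteq> 0 \<longrightarrow> in_box L i)"
proof (rule free_linear_induct [where p = p and P = "\<lambda>p. \<exists>B\<ge>0. \<exists>L. \<forall>i\<in>idx n m.
    (\<forall>k. norm (lookup (TT p (e i)) k) \<le> B) \<and> (TT p (e i) \<noteq> 0 \<longrightarrow> in_box L i)"])
  show "\<exists>B\<ge>0. \<exists>L. \<forall>i\<in>idx n m. (\<forall>k. norm (lookup (TT 0 (e i)) k) \<le> B) \<and> (TT 0 (e i) \<noteq> 0 \<longrightarrow> in_box L i)"
    by (auto simp: T_free_linear)
next
  fix w assume "Word w \<in> keys p"
  then have w: "set w \<subseteq> G" "Gen_f0 \<in> set w" using assms carr_keys [of p G w] by (auto simp: wspace_def)
  obtain B where B: "0 \<le> B" "\<forall>i\<in>idx n m. in_box (length w) i \<longrightarrow> (\<forall>k. norm (lookup (TT (mon w) (e i)) k) \<le> B)"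
    using word_bound [OF w(1)] by blast
  have "(\<forall>k. norm (lookup (TT (mon w) (e i)) k) \<le> B) \<and> (TT (mon w) (e i) \<noteq> 0 \<longrightarrow> in_box (length w) i)"
    if "i \<in> idx n m" for i
    using B word_box [OF w that] that by (cases "TT (mon w) (e i) = 0") auto
  then show "\<exists>B\<ge>0. \<exists>L. \<forall>i\<in>idx n m. (\<forall>k. norm (lookup (TT (mon w) (e i)) k) \<le> B)
      \<and> (TT (mon w) (e i) \<noteq> 0 \<longrightarrow> in_box L i)" using B(1) by blast
next
  fix x y
  assume "\<exists>B\<ge>0. \<exists>L. \<forall>i\<in>idx n m. (\<forall>k. norm (lookup (TT x (e i)) k) \<le> B) \<and> (TT x (e i) \<noteq> 0 \<longrightarrow> in_box L i)"
    "\<exists>B\<ge>0. \<exists>L. \<forall>i\<in>idx n m. (\<forall>k. norm (lookup (TT y (e i)) k) \<le> B) \<and> (TT y (e i) \<noteq> 0 \<longrightarrow> in_box L i)"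
  then obtain B L B' L' where
    x: "0 \<le> B" "\<And>i k. i \<in> idx n m \<Longrightarrow> norm (lookup (TT x (e i)) k) \<le> B"
      "\<And>i. i \<in> idx n m \<Longrightarrow> TT x (e i) \<noteq> 0 \<Longrightarrow> in_box L i"
    and y: "0 \<le> B'" "\<And>i k. i \<in> idx n m \<Longrightarrow> norm (lookup (TT y (e i)) k) \<le> B'"
      "\<And>i. i \<in> idx n m \<Longrightarrow> TT y (e i) \<noteq> 0 \<Longrightarrow> in_box L' i" by metis
  have mono: "in_box L i \<Longrightarrow> in_box (L + L') i" "in_box L' i \<Longrightarrow> in_box (L + L') i" for i
    by (force simp: in_box_def)+
  have "norm (lookup (TT (x + y) (e i)) k) \<le> B + B'" if "i \<in> idx n m" for i k
    using norm_triangle_mono [OF x(2) [OF that] y(2) [OF that], of k k] by (simp add: T_free_linear lookup_add)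
  moreover have "in_box (L + L') i" if "i \<in> idx n m" "TT (x + y) (e i) \<noteq> 0" for i
    using that mono x(3) y(3) by (cases "TT x (e i) = 0") (auto simp: T_free_linear)
  ultimately show "\<exists>B\<ge>0. \<exists>L. \<forall>i\<in>idx n m. (\<forall>k. norm (lookup (TT (x + y) (e i)) k) \<le> B)
      \<and> (TT (x + y) (e i) \<noteq> 0 \<longrightarrow> in_box L i)"
    using x(1) y(1) by (intro exI [of _ "B + B'"] conjI exI [of _ "L + L'"]) auto
next
  fix c x
  assume "\<exists>B\<ge>0. \<exists>L. \<forall>i\<in>idx n m. (\<forall>k. norm (lookup (TT x (e i)) k) \<le> B) \<and> (TT x (e i) \<noteq> 0 \<longrightarrow> in_box L i)"
  then obtain B L where
    x: "0 \<le> B" "\<And>i k. i \<in> idx n m \<Longrightarrow> norm (lookup (TT x (e i)) k) \<le> B"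
      "\<And>i. i \<in> idx n m \<Longrightarrow> TT x (e i) \<noteq> 0 \<Longrightarrow> in_box L i" by metis
  then show "\<exists>B\<ge>0. \<exists>L. \<forall>i\<in>idx n m. (\<forall>k. norm (lookup (TT (scl c x) (e i)) k) \<le> B)
      \<and> (TT (scl c x) (e i) \<noteq> 0 \<longrightarrow> in_box L i)"
    by (intro exI [of _ "norm c * B"] conjI exI [of _ L])
      (auto simp: T_free_linear norm_mult intro: mult_left_mono)
qed


section \<open>The intertwining operators\<close>

text \<open>The index shift of \<open>t j * ts (j + 1)\<close>; for j + 1 = n + m the second letter
  acts diagonally.\<close>

definition low :: "nat \<Rightarrow> (nat \<Rightarrow> int) \<Rightarrow> (nat \<Rightarrow> int)" where
  "low j i = (if j + 1 < n + m then (i(j := i j - 1))(j + 1 := i (j + 1) + 1) else i(j := i j - 1))"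

definition up :: "nat \<Rightarrow> (nat \<Rightarrow> int) \<Rightarrow> (nat \<Rightarrow> int)" where
  "up j i = (if j + 1 < n + m then (i(j := i j + 1))(j + 1 := i (j + 1) - 1) else i(j := i j + 1))"

lemma low_up [simp]: "low j (up j i) = i" and up_low [simp]: "up j (low j i) = i"
  by (auto simp: low_def up_def fun_eq_iff)

lemma low_eq_iff: "low j i = k \<longleftrightarrow> i = up j k"
  by (metis low_up up_low)

text \<open>Up to a scalar, \<open>EE j (e i)\<close> is \<open>T(t j * ts (j + 1)) e i\<close> divided by \<open>q ^ (2 * Ssum (j + 1) i)\<close>.\<close>

definition ea :: "nat \<Rightarrow> (nat \<Rightarrow> int) \<Rightarrow> complex" where
  "ea j i = eps (j + 1) * C * qi (- i j) * sq j (i j - 1) * (if j + 1 < n + m then sq (j + 1) (i (j + 1)) else 1)"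

definition EE :: "nat \<Rightarrow> vec \<Rightarrow> vec" where
  "EE j = lin_ext (\<lambda>i. single (low j i) (ea j i))"

lemma EE_lin: "lin (EE j)"
  by (simp add: EE_def lin_ext_lin)

lemma EE_single: "EE j (single i c) = single (low j i) (c * ea j i)"
  by (simp add: EE_def)

lemma lookup_EE: "lookup (EE j v) i = ea j (up j i) * lookup v (up j i)"
proof -
  have "lookup (EE j v) i = (\<Sum>a\<in>keys v. if a = up j i then ea j (up j i) * lookup v (up j i) else 0)"
    unfolding EE_def lookup_lin_ext [OF subset_refl finite_keys]
    by (rule sum.cong) (auto simp: lookup_single when_def low_eq_iff)
  then show ?thesis by (auto simp: sum.delta in_keys_iff)
qed

context
  fixes j :: nat
  assumes j: "1 \<le> j" "j < n + m"
begin

lemma Ssum_low: "l \<le> n + m \<Longrightarrow> Ssum l (low j i) = Ssum l i - (if l = j + 1 then 1 else 0)"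
  using j by (auto simp: low_def Ssum_upd)

lemma low_idx: assumes "i \<in> idx n m" "ea j i \<noteq> 0" shows "low j i \<in> idx n m"
proof -
  have nz: "i j - 1 \<noteq> 0" "j + 1 < n + m \<Longrightarrow> i (j + 1) \<noteq> 0"
    using assms(2) sq_0 [of j] sq_0 [of "j + 1"] by (auto simp: ea_def split: if_splits)
  have 1: "i(j := i j - 1) \<in> idx n m"
    using nz(1) j idx_le [OF assms(1), of j] idx_ge [OF assms(1), of j] by (intro idx_upd assms(1)) auto
  show ?thesis
  proof (cases "j + 1 < n + m")
    case True
    then show ?thesis
      unfolding low_def using 1 nz(2) idx_le [OF assms(1), of "j + 1"] idx_ge [OF assms(1), of "j + 1"]
      by (simp, intro idx_upd 1) auto
  qed (use 1 in \<open>simp add: low_def\<close>)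
qed

text \<open>\<open>E j\<close> is nonzero on \<open>t (j + 1)\<close>, on \<open>ts j\<close>, and
  on \<open>f0\<close> if j = n. For the first two, the scalar identities come down to
  \<open>sq_sq\<close> and \<open>C_eq\<close>. On all other letters the two compositions on the
  right agree.\<close>

lemma EE_letter: assumes g: "g \<in> G" and i: "i \<in> idx n m"
  shows "TT (aE j (mon [g])) (e i) = EE j (TT (mon [g]) (e i)) - TT (aK j (mon [g])) (EE j (e i))"
proof -
  have sqj: "sq l (i l) * sq l (i l) = eps l * (1 - qi (i l) * qi (i l))"
    "sq l (i l - 1) * sq l (i l - 1) = eps l * (1 - qi (i l) * qi (i l) / qc\<^sup>2)" if "1 \<le> l" "l < n + m" for l
    using that idx_le [OF i, of l] idx_ge [OF i, of l] sq_sq [of l "i l"] sq_sq [of l "i l - 1"]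
    by (cases "l \<le> n"; simp add: qi_diff qi_1 power2_eq_square)+
  have hC: "1 / h = C - C / qc\<^sup>2" using C_eq by simp
  have aEt: "aE j (t (Suc j)) = scl (C - C / qc\<^sup>2) (t j)" by (simp only: aE_t hC) simp
  have "- (eps j * eps (Suc j)) / (h * qc) = - (eps j * eps (Suc j)) * (1 / h) / qc" by simp
  then have aEts: "aE j (ts j) = scl (- (eps j * eps (Suc j)) * (C - C / qc\<^sup>2) / qc) (ts (Suc j))"
    by (simp only: aE_ts hC) simp
  have SSuc: "Ssum (Suc j) i = Ssum j i + i j" using j by (intro Ssum_Suc) simp
  have diff: "A = B - B' \<Longrightarrow> single k A = single k B - single k B'" for A B B' k
    by (simp add: single_diff)
  let ?s = "sq j (i j - 1)" and ?S = "qi (Ssum j i)" and ?x = "qi (i j)"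
  let ?v = "if j + 1 < n + m then sq (j + 1) (i (j + 1)) else 1"
  show ?thesis
  proof (cases g)
    case (Gen_t l)
    then have l: "1 \<le> l" "l \<le> n + m" using g by (auto simp: fgens_def)
    consider "l = n + m" "j + 1 = n + m" | "l = n + m" "j + 1 < n + m" | "l < n + m" "l = j + 1" | "l < n + m" "l = j"
      | "l < n + m" "l \<noteq> j" "l \<noteq> j + 1" using l j by linarith
    then show ?thesis
    proof cases
      case 1
      let ?k = "i(j := i j - 1)"
      have low: "low j i = ?k" using 1 by (simp add: low_def)
      have epsN: "eps (n + m) = 1" using m_ge by (simp add: eps_def)
      have SN: "qi (Ssum (n + m) i) = ?S * ?x" using SSuc 1 by (simp add: qi_add)
      have ea: "ea j i = C / ?x * ?s" using 1 epsN by (simp add: ea_def qi_minus)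
      have "TT (aE j (t l)) (e i) = single ?k ((C - C / qc\<^sup>2) * (?S * ?s))"
        using 1 j aEt by (simp add: T_free_linear TT_t)
      moreover have "EE j (TT (t l) (e i)) = single ?k (?S * ?x * (C / ?x * ?s))"
        using 1 SN by (simp add: TT_tN EE_single low ea)
      moreover have "TT (aK j (t l)) (EE j (e i)) = single ?k (1 / qc * (C / ?x * ?s * (?S * ?x / qc)))"
        using 1 SN Ssum_low [of "n + m" i] by (simp add: aK_t T_free_linear EE_single low ea TT_tN qi_diff qi_1)
      moreover have "(C - C / qc\<^sup>2) * (?S * ?s) = ?S * ?x * (C / ?x * ?s) - 1 / qc * (C / ?x * ?s * (?S * ?x / qc))"
        by (simp add: power2_eq_square left_diff_distrib)
      ultimately show ?thesis unfolding Gen_t by (metis diff)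
    next
      case 2
      then show ?thesis unfolding Gen_t using j Ssum_low [of "n + m" i]
        by (simp add: aE_t aK_t T_free_linear TT_tN EE_single mult.commute)
    next
      case 3
      let ?k = "i(j := i j - 1)"
      let ?u = "sq (j + 1) (i (j + 1) - 1)" and ?w = "sq (j + 1) (i (j + 1))" and ?e = "eps (j + 1)"
      have k: "low j (i(j + 1 := i (j + 1) - 1)) = ?k" "(low j i)(j + 1 := i (j + 1)) = ?k" "low j i (j + 1) = i (j + 1) + 1"
        using 3 by (auto simp: low_def fun_eq_iff)
      have S: "qi (Ssum (j + 1) i) = ?S * ?x" "qi (Ssum (j + 1) (low j i)) = ?S * ?x / qc"
        using SSuc Ssum_low [of "j + 1" i] j by (simp_all add: qi_add qi_diff qi_1)
      have ea: "ea j i = ?e * C / ?x * ?s * ?w" "ea j (i(j + 1 := i (j + 1) - 1)) = ?e * C / ?x * ?s * ?u"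
        using 3 by (simp_all add: ea_def qi_minus)
      have "TT (aE j (t l)) (e i) = single ?k ((C - C / qc\<^sup>2) * (?S * ?s))"
        using 3 j aEt by (simp add: T_free_linear TT_t)
      moreover have "EE j (TT (t l) (e i)) = single ?k (?S * ?x * ?u * (?e * C / ?x * ?s * ?u))"
        unfolding 3(2) using 3 TT_t [of "j + 1" i 1] by (simp only: EE_single k ea S mult_1)
      moreover have "TT (aK j (t l)) (EE j (e i)) = single ?k (1 / qc * (?e * C / ?x * ?s * ?w * (?S * ?x / qc) * ?w))"
      proof -
        have "TT (aK j (t l)) (EE j (e i)) = scl (1 / qc) (TT (t (j + 1)) (single (low j i) (ea j i)))"
          using 3 by (simp add: aK_t T_free_linear EE_single)
        also have "TT (t (j + 1)) (single (low j i) (ea j i)) =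
           single ((low j i)(j + 1 := low j i (j + 1) - 1)) (ea j i * qi (Ssum (j + 1) (low j i)) * sq (j + 1) (low j i (j + 1) - 1))"
          using 3 by (intro TT_t) simp
        finally show ?thesis by (simp only: k S ea add_diff_cancel_right' scl_single)
      qed
      moreover have "(C - C / qc\<^sup>2) * (?S * ?s) = ?S * ?x * ?u * (?e * C / ?x * ?s * ?u)
          - 1 / qc * (?e * C / ?x * ?s * ?w * (?S * ?x / qc) * ?w)"
      proof -
        \<comment> \<open>The roots occur only as squares; the powers of q depending on i (j + 1)
          drop out, and the factor 1 - 1 / q^2 remains.\<close>
        have u: "?u * ?u = ?e * (1 - qi (i (j+1)) * qi (i (j+1)) / qc\<^sup>2)" "?w * ?w = ?e * (1 - qi (i (j+1)) * qi (i (j+1)))"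
          using sqj [of "j + 1"] 3 j by auto
        let ?K = "?S * C * ?s * ?e" and ?z = "qi (i (j+1)) * qi (i (j+1))"
        have "?S * ?x * ?u * (?e * C / ?x * ?s * ?u) = ?K * (?u * ?u)"
          "1 / qc * (?e * C / ?x * ?s * ?w * (?S * ?x / qc) * ?w) = ?K / qc\<^sup>2 * (?w * ?w)"
          by (simp_all add: power2_eq_square)
        moreover have "a * (b * (1 - z / qc\<^sup>2)) - a / qc\<^sup>2 * (b * (1 - z)) = a * b * (1 - 1 / qc\<^sup>2)" for a b z
          by (simp add: field_simps)
        then have "?K * (?e * (1 - ?z / qc\<^sup>2)) - ?K / qc\<^sup>2 * (?e * (1 - ?z)) = ?K * ?e * (1 - 1 / qc\<^sup>2)" .
        moreover have "?K * ?e = ?S * C * ?s" by (simp add: mult.assoc)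
        ultimately show ?thesis by (simp only: u) (simp add: algebra_simps)
      qed
      ultimately show ?thesis unfolding Gen_t by (metis diff)
    next
      case 4
      have "Ssum j (low j i) = Ssum j i" using Ssum_low [of j i] j by simp
      moreover have "low j (i(j := i j - 1)) = (low j i)(j := low j i j - 1)" by (auto simp: low_def fun_eq_iff)
      moreover have coef: "qc * (ea j i * (?S * sq j (low j i j - 1))) = ?S * (?s * ea j (i(j := i j - 1)))"
        by (simp add: ea_def low_def qi_minus qi_diff qi_1)
      ultimately show ?thesis unfolding Gen_t using 4
        by (simp add: aE_t aK_t T_free_linear TT_t EE_single mult.assoc coef)
    next
      case 5
      have "Ssum l (low j i) = Ssum l i" using Ssum_low [of l i] 5 by simp
      moreover have "low j (i(l := i l - 1)) = (low j i)(l := low j i l - 1)" using 5 by (auto simp: low_def fun_eq_iff)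
      moreover have "ea j (i(l := i l - 1)) = ea j i" "low j i l = i l" using 5 by (auto simp: ea_def low_def)
      ultimately show ?thesis unfolding Gen_t using 5
        by (simp add: aE_t aK_t T_free_linear TT_t EE_single mult_ac)
    qed
  next
    case (Gen_ts l)
    then have l: "1 \<le> l" "l \<le> n + m" using g by (auto simp: fgens_def)
    consider "l = n + m" "j + 1 = n + m" | "l = n + m" "j + 1 < n + m" | "l < n + m" "l = j + 1" | "l < n + m" "l = j"
      | "l < n + m" "l \<noteq> j" "l \<noteq> j + 1" using l j by linarith
    then show ?thesis
    proof cases
      case 1
      then show ?thesis unfolding Gen_ts using j Ssum_low [of "n + m" i]
        by (simp add: aE_ts aK_ts T_free_linear TT_tN EE_single qi_diff qi_1 mult_ac)
    next
      case 2
      then show ?thesis unfolding Gen_ts using j Ssum_low [of "n + m" i]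
        by (simp add: aE_ts aK_ts T_free_linear TT_tN EE_single mult.commute)
    next
      case 3
      have "qi (Ssum (j + 1) (low j i)) = qi (Ssum (j + 1) i) / qc"
        using Ssum_low [of "j + 1" i] j by (simp add: qi_diff qi_1)
      moreover have "low j (i(j + 1 := i (j + 1) + 1)) = (low j i)(j + 1 := low j i (j + 1) + 1)"
        by (auto simp: low_def fun_eq_iff)
      moreover have coef: "ea j i * (qi (Ssum (Suc j) i) * sq (Suc j) (low j i (Suc j))) =
          qi (Ssum (Suc j) i) * (sq (Suc j) (i (Suc j)) * ea j (i(Suc j := i (Suc j) + 1)))"
        using 3 by (simp add: ea_def low_def)
      ultimately show ?thesis unfolding Gen_ts using 3
        by (simp add: aE_ts aK_ts T_free_linear TT_ts EE_single mult.assoc coef)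
    next
      case 4
      let ?k = "if j + 1 < n + m then i(j + 1 := i (j + 1) + 1) else i"
      let ?w = "sq j (i j)" and ?e = "eps j" and ?e' = "eps (j + 1)"
      have "TT (ts (Suc j)) (e i) = single ?k (?S * ?x * ?v)"
      proof (cases "j + 1 < n + m")
        case True
        then show ?thesis using SSuc by (simp add: TT_ts qi_add)
      next
        case False
        then have "Suc j = n + m" using j by simp
        then show ?thesis using SSuc TT_tN(2) [of i 1] by (simp add: qi_add)
      qed
      then have "TT (aE j (ts l)) (e i) = single ?k (- (?e * ?e') * (C - C / qc\<^sup>2) / qc * (?S * ?x * ?v))"
        using 4 aEts by (simp add: T_free_linear single_uminus)
      moreover have "EE j (TT (ts l) (e i)) = single ?k (?S * ?w * (?e' * C / (?x * qc) * ?w * ?v))"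
      proof -
        have "low j (i(j := i j + 1)) = ?k" by (auto simp: low_def fun_eq_iff)
        moreover have "ea j (i(j := i j + 1)) = ?e' * C / (?x * qc) * ?w * ?v"
          using qi_add [of "i j" 1] qi_minus [of "i j + 1"] by (simp add: ea_def qi_1)
        ultimately show ?thesis using 4 by (simp only: TT_ts EE_single mult_1)
      qed
      moreover have "TT (aK j (ts l)) (EE j (e i)) = single ?k (1 / qc * (?e' * C / ?x * ?s * ?v * ?S * ?s))"
      proof -
        have "Ssum j (low j i) = Ssum j i" using Ssum_low [of j i] j by simp
        moreover have "(low j i)(j := low j i j + 1) = ?k" "low j i j = i j - 1" by (auto simp: low_def fun_eq_iff)
        moreover have "ea j i = ?e' * C / ?x * ?s * ?v" by (simp add: ea_def qi_minus)
        moreover have "TT (aK j (ts l)) (EE j (e i)) = scl (1 / qc) (TT (ts j) (single (low j i) (ea j i)))"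
          using 4 by (simp add: aK_ts T_free_linear EE_single)
        ultimately show ?thesis using j by (simp only: TT_ts scl_single)
      qed
      moreover have "- (?e * ?e') * (C - C / qc\<^sup>2) / qc * (?S * ?x * v) =
         ?S * ?w * (?e' * C / (?x * qc) * ?w * v) - 1 / qc * (?e' * C / ?x * ?s * v * ?S * ?s)" for v
      proof -
        have w: "?w * ?w = ?e * (1 - ?x * ?x)" "?s * ?s = ?e * (1 - ?x * ?x / qc\<^sup>2)"
          using sqj [of j] j by auto
        have "?S * ?w * (?e' * C / (?x * qc) * ?w * v) = ?S * ?e' * C * v / (?x * qc) * (?w * ?w)"
          "1 / qc * (?e' * C / ?x * ?s * v * ?S * ?s) = ?S * ?e' * C * v / (?x * qc) * (?s * ?s)"
          by (simp_all add: mult_ac)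
        moreover have "?S * ?e' * C * v / (?x * qc) * (?e * (1 - ?x * ?x)) - ?S * ?e' * C * v / (?x * qc) * (?e * (1 - ?x * ?x / qc\<^sup>2))
          = - (?e * ?e') * (C - C / qc\<^sup>2) / qc * (?S * ?x * v)"
          by (simp add: field_simps power2_eq_square)
        ultimately show ?thesis by (simp only: w)
      qed
      ultimately show ?thesis unfolding Gen_ts by (simp only: diff)
    next
      case 5
      have "Ssum l (low j i) = Ssum l i" using Ssum_low [of l i] 5 by simp
      moreover have "low j (i(l := i l + 1)) = (low j i)(l := low j i l + 1)" using 5 by (auto simp: low_def fun_eq_iff)
      moreover have "ea j (i(l := i l + 1)) = ea j i" "low j i l = i l" using 5 by (auto simp: ea_def low_def)
      ultimately show ?thesis unfolding Gen_ts using 5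
        by (simp add: aE_ts aK_ts T_free_linear TT_ts EE_single mult_ac)
    qed
  next
    case Gen_f0
    let ?Z = "\<lambda>i :: nat \<Rightarrow> int. \<forall>k\<in>{1..n}. i k = 0"
    have RHS: "EE j (TT f0 (e i)) - TT (aK j f0) (EE j (e i)) =
       (if ?Z i then single (low j i) (ea j i) else 0) - (if ?Z (low j i) then single (low j i) (ea j i) else 0)"
      by (simp add: aK_f0 TT_f0 EE_single lin_zero [OF EE_lin])
    consider "n < j" | "j < n" | "j = n" by linarith
    then show ?thesis
    proof cases
      case 1
      then have "?Z (low j i) \<longleftrightarrow> ?Z i" by (auto simp: low_def)
      then show ?thesis unfolding Gen_f0 RHS using 1 by (simp add: aE_f0 T_free_linear)
    next
      case 2
      \<comment> \<open>\<open>EE j\<close> never leads into the range of \<open>f0\<close>, as i j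
        would have to be 1. It also annihilates that range, where the factor
        \<open>sq (j + 1) (i (j + 1))\<close> is 0.\<close>
      have "\<not> ?Z (low j i)"
      proof
        assume "?Z (low j i)"
        then have "low j i j = 0" using 2 j by simp
        then show False using idx_le [OF i, of j] 2 j by (simp add: low_def split: if_splits)
      qed
      moreover have "ea j i = 0" if "?Z i" using that 2 m_ge by (simp add: ea_def)
      ultimately show ?thesis unfolding Gen_f0 RHS using 2 by (auto simp: aE_f0 T_free_linear)
    next
      case 3
      \<comment> \<open>\<open>EE n\<close> never leads into the range of \<open>f0\<close>, so only
        \<open>EE n\<close> after \<open>f0\<close> remains. On that range the sums
        \<open>Ssum\<close> vanish, and the coefficient of \<open>t n * f0 * ts (n + 1)\<close>
        times \<open>C\<close> is \<open>ea\<close>.\<close>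
      have nZ: "\<not> ?Z (low j i)"
      proof
        assume "?Z (low j i)"
        then have "low j i j = 0" using 3 j by simp
        then show False using idx_le [OF i, of j] 3 j by (simp add: low_def split: if_splits)
      qed
      have N: "n + 1 < n + m" using m_ge by simp
      let ?i = "i(n + 1 := i (n + 1) + 1)"
      have "TT (aE j f0) (e i) = scl C (TT (t n) (TT f0 (TT (ts (n + 1)) (e i))))"
        using 3 by (simp add: aE_f0 T_free_linear T_free_mult)
      also have "TT (ts (n + 1)) (e i) = single ?i (qi (Ssum (n + 1) i) * sq (n + 1) (i (n + 1)))"
        using N by (simp only: TT_ts mult_1)
      finally have LHS: "TT (aE j f0) (e i) = scl C (TT (t n) (TT f0 (single ?i (qi (Ssum (n + 1) i) * sq (n + 1) (i (n + 1))))))" .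
      show ?thesis
      proof (cases "?Z i")
        case True
        have "Ssum n i = 0" "Ssum (n + 1) i = 0" "Ssum n ?i = 0" unfolding Ssum_def
          by (rule sum.neutral, use True in auto)+
        moreover have "?Z ?i" using True by auto
        moreover have "low j i = ?i(n := ?i n - 1)" using 3 N by (auto simp: low_def fun_eq_iff)
        moreover have "i n = 0" using True n_ge by simp
        moreover have "ea j i = C * sq n (- 1) * sq (n + 1) (i (n + 1))"
          using 3 N \<open>i n = 0\<close> by (simp add: ea_def eps_def)
        ultimately show ?thesis
          unfolding Gen_f0 RHS LHS using True nZ n_ge N by (auto simp: TT_f0 TT_t mult_ac)
      next
        case False
        then have "\<not> ?Z ?i" by auto
        then have "TT f0 (single ?i z) = 0" for z by (simp only: TT_f0 if_False)
        then show ?thesis unfolding Gen_f0 RHS LHS using False nZ by (auto simp: T_free_vec)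
      qed
    qed
  qed
qed

text \<open>The twisted commutator obeys the same Leibniz rule as \<open>aE j\<close>: in the
  induction on words the inner terms, with \<open>EE j\<close> between the two factors,
  cancel.\<close>

lemma EE_intertwines: assumes p: "p \<in> carr G" and v: "v \<in> supp"
  shows "TT (aE j p) v = EE j (TT p v) - TT (aK j p) (EE j v)"
proof -
  have letter: "TT (aE j (mon [g])) v = EE j (TT (mon [g]) v) - TT (aK j (mon [g])) (EE j v)"
    if "g \<in> G" "v \<in> supp" for g v
    by (rule lin_eqI [OF T_free_lin_vec lin_minus' [OF lin_comp [OF EE_lin T_free_lin_vec]
            lin_comp [OF T_free_lin_vec EE_lin]]])
      (use that EE_letter in \<open>auto simp: supp_def\<close>)
  have word: "TT (aE j (mon w)) v = EE j (TT (mon w) v) - TT (aK j (mon w)) (EE j v)" if "set w \<subseteq> G" for w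
    using that
  proof (induction w)
    case Nil
    then show ?case by (simp add: T_free_linear)
  next
    case (Cons g w)
    have wv: "TT (mon w) v \<in> supp" using Cons.prems v by (intro TT_supp) auto
    have "TT (aE j (mon [g] * mon w)) v = TT (aE j (mon [g])) (TT (mon w) v) + TT (aK j (mon [g])) (TT (aE j (mon w)) v)"
      by (simp add: aE_mult T_free_linear T_free_mult)
    also have "\<dots> = EE j (TT (mon [g]) (TT (mon w) v)) - TT (aK j (mon [g])) (TT (aK j (mon w)) (EE j v))"
      using Cons letter [OF _ wv, of g] by (simp add: T_free_vec)
    finally show ?case
      by (subst (1 2 3) mon_Cons) (simp only: aK_mult T_free_mult)
  qed
  show ?thesis
    by (rule free_linear_induct [where p = p and P = "\<lambda>p. TT (aE j p) v = EE j (TT p v) - TT (aK j p) (EE j v)"])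
      (auto simp: act1_linear T_free_linear lin_zero [OF EE_lin] lin_add [OF EE_lin] lin_scl [OF EE_lin]
        word carr_keys [OF p] scl.scale_right_diff_distrib)
qed

end

end


section \<open>The trace\<close>

context hyperboloid
begin

definition wsum :: "(nat \<Rightarrow> int) \<Rightarrow> int" where
  "wsum i = (\<Sum>l\<in>{n<..<n+m}. i l)"

lemma wsum_ge: assumes "i \<in> idx n m" "n < j" "j < n + m" shows "i j \<le> wsum i"
  unfolding wsum_def by (rule member_le_sum) (use assms idx_ge [OF assms(1)] in force)+

lemma wsum_nonneg: "i \<in> idx n m \<Longrightarrow> 0 \<le> wsum i"
  unfolding wsum_def by (rule sum_nonneg) (use idx_ge [of i] in force)

lemma geometric_bound: assumes "finite B" "B \<subseteq> {0..}" shows "(\<Sum>y\<in>B. q powi y) \<le> 1 / (1 - q)"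
proof -
  have inj: "inj_on nat B"
    by (rule inj_on_inverseI [where g = int]) (use assms(2) in auto)
  have "(\<Sum>y\<in>B. q powi y) = (\<Sum>y\<in>B. q ^ nat y)"
    by (rule sum.cong) (use assms(2) in \<open>auto simp: power_int_def\<close>)
  also have "\<dots> = (\<Sum>k\<in>nat ` B. q ^ k)" by (simp add: sum.reindex [OF inj])
  also have "\<dots> \<le> suminf (power q)"
    using q_pos q_less_1 assms(1) by (intro sum_le_suminf summable_geometric) auto
  also have "\<dots> = 1 / (1 - q)" using q_pos q_less_1 by (intro suminf_geometric) auto
  finally show ?thesis .
qed

text \<open>Multi-indices vanish outside \<open>J\<close>, so \<open>A\<close> embeds into the
  product of its projections, over which the sum factorises. A coordinate up to n takes at most L +
  1 values, and every other one contributes a partial geometric series.\<close>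

lemma wsum_bound: assumes A: "finite A" "A \<subseteq> idx n m" "\<And>i. i \<in> A \<Longrightarrow> in_box L i"
  shows "(\<Sum>i\<in>A. q powi wsum i) \<le> (\<Prod>j\<in>{1..<n+m}. if j \<le> n then real (L + 1) else 1 / (1 - q))"
proof -
  define J where "J = {1..<n+m}"
  define w where "w j y = (if j \<le> n then 1 else q powi y)" for j :: nat and y
  define B where "B j = (\<lambda>i. i j) ` A" for j
  have q0: "q \<noteq> 0" using q_pos by simp
  have "q powi (\<Sum>j\<in>S. i j) = (\<Prod>j\<in>S. q powi i j)" for i and S :: "nat set"
    by (induction S rule: infinite_finite_induct) (simp_all add: power_int_add q0)
  then have "q powi wsum i = (\<Prod>j\<in>{n<..<n+m}. q powi i j)" for i
    by (simp only: wsum_def)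
  moreover have "(\<Prod>j\<in>{n<..<n+m}. q powi i j) = (\<Prod>j\<in>J. w j (i j))" for i
    unfolding w_def J_def by (rule prod.mono_neutral_cong_left) auto
  ultimately have wp: "q powi wsum i = (\<Prod>j\<in>J. w j (i j))" for i by simp
  have inj: "inj_on (\<lambda>i. restrict i J) A"
  proof (rule inj_onI, rule ext)
    fix i k j assume ik: "i \<in> A" "k \<in> A" "restrict i J = restrict k J"
    show "i j = k j"
    proof (cases "j \<in> J")
      case True
      then show ?thesis using fun_cong [OF ik(3), of j] by simp
    next
      case False
      then have "j \<notin> {1..n+m-1}" by (auto simp: J_def)
      then have "i j = 0 \<and> k j = 0" using ik(1,2) A(2) unfolding idx_def by blast
      then show ?thesis by simp
    qed
  qed
  have "(\<Sum>i\<in>A. q powi wsum i) = (\<Sum>i\<in>A. \<Prod>j\<in>J. w j (restrict i J j))"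
    by (simp add: wp)
  also have "\<dots> = (\<Sum>g\<in>(\<lambda>i. restrict i J) ` A. \<Prod>j\<in>J. w j (g j))"
    by (simp add: sum.reindex [OF inj])
  also have "\<dots> \<le> (\<Sum>g\<in>PiE J B. \<Prod>j\<in>J. w j (g j))"
    using q_pos A(1) by (intro sum_mono2 finite_PiE prod_nonneg) (auto simp: B_def J_def w_def)
  also have "\<dots> = (\<Prod>j\<in>J. \<Sum>y\<in>B j. w j y)"
    using A(1) by (intro prod_sum_PiE [symmetric]) (auto simp: B_def J_def)
  also have "\<dots> \<le> (\<Prod>j\<in>J. if j \<le> n then real (L + 1) else 1 / (1 - q))"
  proof (rule prod_mono, rule conjI)
    fix j assume j: "j \<in> J"
    show "0 \<le> (\<Sum>y\<in>B j. w j y)" using q_pos by (intro sum_nonneg) (simp add: w_def)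
    show "(\<Sum>y\<in>B j. w j y) \<le> (if j \<le> n then real (L + 1) else 1 / (1 - q))"
    proof (cases "j \<le> n")
      case True
      have "B j \<subseteq> {- int L..0}"
        using A(2,3) j True idx_le by (fastforce simp: B_def J_def in_box_def)
      then have "card (B j) \<le> card {- int L..0}" by (rule card_mono [rotated]) simp
      then show ?thesis using True by (simp add: w_def)
    next
      case False
      have "B j \<subseteq> {0..}"
      proof
        fix y assume "y \<in> B j"
        then obtain i where "i \<in> idx n m" "y = i j" using A(2) by (auto simp: B_def)
        then show "y \<in> {0..}" using idx_ge [of i j] j False by (simp add: J_def)
      qed
      then show ?thesis using False geometric_bound [of "B j"] A(1) by (simp add: w_def B_def)
    qed
  qed
  finally show ?thesis unfolding J_def .
qed

lemma box_summable: fixes f :: "(nat \<Rightarrow> int) \<Rightarrow> complex"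
  assumes "0 \<le> B" "\<And>i. i \<in> idx n m \<Longrightarrow> f i \<noteq> 0 \<Longrightarrow> in_box L i"
    "\<And>i. i \<in> idx n m \<Longrightarrow> f i \<noteq> 0 \<Longrightarrow> norm (f i) \<le> B * q powi wsum i"
  shows "f abs_summable_on idx n m"
proof (rule nonneg_bdd_above_summable_on)
  let ?M = "\<Prod>j\<in>{1..<n+m}. if j \<le> n then real (L + 1) else 1 / (1 - q)"
  show "bdd_above (sum (\<lambda>i. norm (f i)) ` {A. A \<subseteq> idx n m \<and> finite A})"
  proof (rule bdd_aboveI2)
    fix A assume A: "A \<in> {A. A \<subseteq> idx n m \<and> finite A}"
    let ?A = "{i \<in> A. f i \<noteq> 0}"
    have "sum (\<lambda>i. norm (f i)) A = sum (\<lambda>i. norm (f i)) ?A"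
      using A by (intro sum.mono_neutral_right) auto
    also have "\<dots> \<le> (\<Sum>i\<in>?A. B * q powi wsum i)"
      using A assms(3) by (intro sum_mono) auto
    also have "\<dots> \<le> B * ?M"
      unfolding sum_distrib_left [symmetric] using A assms(1,2)
      by (intro mult_left_mono wsum_bound) auto
    finally show "sum (\<lambda>i. norm (f i)) A \<le> B * ?M" .
  qed
qed simp

end

locale hyperboloid_trace = hyperboloid +
  fixes \<kappa> :: real
  assumes \<kappa>_pos: "0 < \<kappa>"
begin

section \<open>Eigenvalues of \<open>Q\<close> and the trace on representatives\<close>

definition Qw :: "(nat \<Rightarrow> int) \<Rightarrow> real" where
  "Qw i = \<kappa> * q powi (2 * (\<Sum>j\<in>{1..n+m-1}. (int (n + m) - int j) * i j))"

lemma Qw_pos: "0 < Qw i"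
  unfolding Qw_def using q_pos \<kappa>_pos by simp

text \<open>For n < j < n + m the coefficient n + m - j is at least 1, and on the box the entries up
  to n contribute a bounded factor. Two factors \<open>q powi wsum i\<close> are kept: one for
  convergence, the other to absorb the growth of \<open>ea\<close> in \<open>tr_aE\<close>.\<close>

lemma Qw_le: assumes i: "i \<in> idx n m" "in_box L i"
  shows "Qw i \<le> \<kappa> * q powi (- (2 * (int (n + m) * int n * int L))) * (q powi wsum i * q powi wsum i)"
proof -
  have 1: "- (int (n + m) * int L) \<le> (int (n + m) - int j) * i j" if "j \<in> {1..n}" for j
  proof -
    have "- int L \<le> i j" "i j \<le> 0" using i idx_le [OF i(1), of j] that by (auto simp: in_box_def)
    then have "(int (n + m) - int j) * (- i j) \<le> int (n + m) * int L"
      using that by (intro mult_mono) auto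
    then show ?thesis by simp
  qed
  have 2: "i j \<le> (int (n + m) - int j) * i j" if "j \<in> {n<..<n+m}" for j
  proof -
    have "1 * i j \<le> (int (n + m) - int j) * i j"
      using that idx_ge [OF i(1), of j] by (intro mult_right_mono) auto
    then show ?thesis by simp
  qed
  have "{1..n+m-1} = {1..n} \<union> {n<..<n+m}" using m_ge by auto
  then have "(\<Sum>j\<in>{1..n+m-1}. (int (n + m) - int j) * i j) =
     (\<Sum>j\<in>{1..n}. (int (n + m) - int j) * i j) + (\<Sum>j\<in>{n<..<n+m}. (int (n + m) - int j) * i j)"
    by (simp only:) (rule sum.union_disjoint; auto)
  moreover have "- (int (n + m) * int n * int L) \<le> (\<Sum>j\<in>{1..n}. (int (n + m) - int j) * i j)"
    using sum_mono [of "{1..n}" "\<lambda>_. - (int (n + m) * int L)", OF 1] by (simp add: mult_ac)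
  moreover have "wsum i \<le> (\<Sum>j\<in>{n<..<n+m}. (int (n + m) - int j) * i j)"
    unfolding wsum_def by (rule sum_mono [OF 2])
  ultimately have "- (2 * (int (n + m) * int n * int L)) + (wsum i + wsum i) \<le>
      2 * (\<Sum>j\<in>{1..n+m-1}. (int (n + m) - int j) * i j)" by linarith
  from q_powi_mono [OF this] have "q powi (2 * (\<Sum>j\<in>{1..n+m-1}. (int (n + m) - int j) * i j)) \<le>
      q powi (- (2 * (int (n + m) * int n * int L))) * (q powi wsum i * q powi wsum i)"
    using q_pos by (simp only: power_int_add less_imp_neq [THEN not_sym] simp_thms)
  then show ?thesis
    unfolding Qw_def mult.assoc using \<kappa>_pos by (intro mult_left_mono) simp_all
qed

definition tr :: "fgen free \<Rightarrow> complex" where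
  "tr p = infsum (\<lambda>i. of_real (Qw i) * lookup (TT p (e i)) i) (idx n m)"

lemma diag_summable: assumes "p \<in> wspace d True"
  shows "(\<lambda>i. of_real (Qw i) * lookup (TT p (e i)) i) abs_summable_on idx n m"
proof -
  obtain B L where B: "0 \<le> B" "\<And>i k. i \<in> idx n m \<Longrightarrow> norm (lookup (TT p (e i)) k) \<le> B"
    "\<And>i. i \<in> idx n m \<Longrightarrow> TT p (e i) \<noteq> 0 \<Longrightarrow> in_box L i"
    using wspace_bound [OF assms] by metis
  let ?K = "\<kappa> * q powi (- (2 * (int (n + m) * int n * int L)))"
  have Z: "0 \<le> ?K" using \<kappa>_pos q_pos by simp
  show ?thesis
  proof (rule box_summable)
    show "0 \<le> ?K * B" using Z B(1) by simp
  next
    fix i assume i: "i \<in> idx n m" "of_real (Qw i) * lookup (TT p (e i)) i \<noteq> 0"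
    then show box: "in_box L i" using B(3) [of i] by (cases "TT p (e i) = 0") auto
    \<comment> \<open>The matrix elements of p are bounded, so one of the two decaying factors can
      be given away.\<close>
    have "q powi wsum i * q powi wsum i \<le> q powi wsum i * 1"
      using q_powi_le_1 [OF wsum_nonneg [OF i(1)]] q_pos by (intro mult_left_mono) auto
    then have "?K * (q powi wsum i * q powi wsum i) \<le> ?K * q powi wsum i"
      using mult_left_mono [OF _ Z] by simp
    with Qw_le [OF i(1) box] have "Qw i \<le> ?K * q powi wsum i" by (rule order_trans)
    then have "Qw i * norm (lookup (TT p (e i)) i) \<le> ?K * q powi wsum i * B"
      using Z q_pos by (intro mult_mono B(2) i(1)) simp_all
    then show "norm (of_real (Qw i) * lookup (TT p (e i)) i) \<le> ?K * B * q powi wsum i"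
      using Qw_pos [of i] by (simp add: norm_mult mult_ac)
  qed
qed

lemma diag_TQ: assumes "p \<in> carr G" "i \<in> idx n m"
  shows "diag_elt (T q n m (cls p) \<circ> Q q n m \<kappa>) i = of_real (Qw i) * lookup (TT p (e i)) i"
proof -
  have "Q q n m \<kappa> (e i) = single i (of_real (Qw i))" by (simp add: Q_def Qw_def)
  moreover have "T q n m (cls p) (single i (of_real (Qw i))) = scl (of_real (Qw i)) (TT p (e i))"
    by (rule trans [OF T_cls [OF assms(1) supp_single [OF assms(2)]] T_free_single])
  ultimately show ?thesis by (simp add: diag_elt_def)
qed

lemma trace_converges_cls: assumes "p \<in> wspace d True"
  shows "trace_converges n m (T q n m (cls p) \<circ> Q q n m \<kappa>)"
proof -
  have p: "p \<in> carr G" using assms by (simp add: wspace_def)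
  have eq: "norm (diag_elt (T q n m (cls p) \<circ> Q q n m \<kappa>) i) =
      norm (of_real (Qw i) * lookup (TT p (e i)) i)" if "i \<in> idx n m" for i
    by (simp only: diag_TQ [OF p that])
  show ?thesis
    unfolding trace_converges_def
    by (rule summable_on_cong [THEN iffD2, of _ _ "\<lambda>i. norm (of_real (Qw i) * lookup (TT p (e i)) i)",
          OF eq diag_summable [OF assms]])
qed

lemma nu_cls: assumes "p \<in> carr G" shows "nu q n m \<kappa> (cls p) = tr p"
  unfolding nu_def Tr_def tr_def by (rule infsum_cong) (rule diag_TQ [OF assms])

lemma tr_add: assumes "x \<in> wspace d True" "y \<in> wspace d' True" shows "tr (x + y) = tr x + tr y"
  unfolding tr_def infsum_add [OF abs_summable_summable [OF diag_summable [OF assms(1)]]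
      abs_summable_summable [OF diag_summable [OF assms(2)]], symmetric]
  by (simp add: T_free_linear lookup_add distrib_left)

lemma tr_scl: "tr (scl c x) = c * tr x"
  unfolding tr_def infsum_cmult_right' [symmetric] by (simp add: T_free_linear mult.left_commute)

section \<open>Invariance of the trace\<close>

lemma tr_aK: assumes p: "p \<in> wspace 0 b" and j: "1 \<le> j" "j < n + m"
  shows "tr (aK j p) = tr p" and "tr (aKi j p) = tr p"
proof -
  \<comment> \<open>On elements of weight 0, \<open>K j\<close> leaves the diagonal matrix elements
    unchanged.\<close>
  have "delta j i i = 0" for i by (simp add: delta_def)
  then have "lookup (TT (aK j p) (e i)) i = lookup (TT p (e i)) i"
    "lookup (TT (aKi j p) (e i)) i = lookup (TT p (e i)) i" if "i \<in> idx n m" for i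
    using TT_aK [OF p that j, of i] by simp_all
  then show "tr (aK j p) = tr p" "tr (aKi j p) = tr p"
    unfolding tr_def by (simp_all cong: infsum_cong)
qed

text \<open>The factor \<open>qi (- (i j + 1))\<close> is the one that grows on the box, and it
  costs a single inverse power \<open>q powi wsum i\<close>; the 1 comes from \<open>up\<close>,
  which raises the entry j.\<close>

lemma norm_ea_up: assumes i: "i \<in> idx n m" "in_box L i" and j: "1 \<le> j" "j < n + m"
  shows "norm (ea j (up j i)) \<le> norm C * (q powi (- (wsum i + 1)) * (q powi (- int L) * q powi (- int (L + 1))))"
proof -
  let ?v = "if j + 1 < n + m then sq (j + 1) (i (j + 1) - 1) else 1"
  have "up j i j = i j + 1" by (simp add: up_def)
  moreover have "up j i (j + 1) = i (j + 1) - 1" if "j + 1 < n + m" using that by (simp add: up_def)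
  ultimately have ea: "ea j (up j i) = eps (j + 1) * C * qi (- (i j + 1)) * sq j (i j) * ?v"
    by (simp add: ea_def)
  have "norm (qi (- (i j + 1))) \<le> q powi (- (wsum i + 1))"
    unfolding norm_qi using wsum_ge [OF i(1), of j] idx_le [OF i(1), of j] wsum_nonneg [OF i(1)] j
    by (intro q_powi_mono) (cases "j \<le> n"; simp)
  moreover have "norm (sq j (i j)) \<le> q powi (- int L)"
    using i(2) idx_le [OF i(1), of j] idx_ge [OF i(1), of j] j by (intro norm_sq_le) (auto simp: in_box_def)
  moreover have "norm ?v \<le> q powi (- int (L + 1))"
  proof (cases "j + 1 < n + m")
    case True
    have "- int L \<le> i (j + 1)" if "j + 1 \<le> n" using i(2) that by (simp add: in_box_def)
    then have "norm (sq (j + 1) (i (j + 1) - 1)) \<le> q powi (- int (L + 1))"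
      using True idx_le [OF i(1), of "j + 1"] idx_ge [OF i(1), of "j + 1"] j
      by (intro norm_sq_le) auto
    then show ?thesis using True by simp
  next
    case False
    then show ?thesis using q_powi_ge_1 [of "- int (L + 1)"] by simp
  qed
  ultimately have "norm (qi (- (i j + 1))) * (norm (sq j (i j)) * norm ?v) \<le>
      q powi (- (wsum i + 1)) * (q powi (- int L) * q powi (- int (L + 1)))"
    using q_pos by (intro mult_mono) simp_all
  then have "norm C * (norm (qi (- (i j + 1))) * (norm (sq j (i j)) * norm ?v)) \<le>
      norm C * (q powi (- (wsum i + 1)) * (q powi (- int L) * q powi (- int (L + 1))))"
    by (rule mult_left_mono) simp
  moreover have "norm (eps (j + 1)) = 1" by (simp add: eps_def)
  ultimately show ?thesis by (simp only: ea norm_mult mult_1 mult.assoc)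
qed

text \<open>\<open>low\<close> moves one unit from entry j to entry j + 1, and neighbouring
  coefficients differ by 1. For j + 1 = n + m there is no second entry, in accordance with the
  coefficient 0 at n + m.\<close>

lemma Qw_low: assumes "1 \<le> j" "j < n + m" shows "Qw (low j i) = Qw i * q powi (- 2)"
proof -
  let ?c = "\<lambda>l. int (n + m) - int l" and ?J = "{1..n+m-1}"
  have "?c l * low j i l = ?c l * i l - (if l = j then ?c j else 0) + (if l = j + 1 then ?c (j + 1) else 0)"
    if "l \<in> ?J" for l
    using that assms by (auto simp: low_def algebra_simps)
  then have "(\<Sum>l\<in>?J. ?c l * low j i l) =
      (\<Sum>l\<in>?J. ?c l * i l - (if l = j then ?c j else 0) + (if l = j + 1 then ?c (j + 1) else 0))"
    by (intro sum.cong) auto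
  also have "\<dots> = (\<Sum>l\<in>?J. ?c l * i l) - ?c j + (if j + 1 \<in> ?J then ?c (j + 1) else 0)"
    using assms by (simp add: sum.distrib sum_subtractf sum.delta)
  also have "\<dots> = (\<Sum>l\<in>?J. ?c l * i l) - 1" using assms by auto
  finally have "2 * (\<Sum>l\<in>?J. ?c l * low j i l) = 2 * (\<Sum>l\<in>?J. ?c l * i l) + (- 2)" by simp
  then show ?thesis
    unfolding Qw_def using q_pos by (simp only: power_int_add less_imp_neq [THEN not_sym] simp_thms mult.assoc)
qed

lemma delta_low: assumes "1 \<le> j" "j < n + m" shows "delta j (low j i) i = - 2"
proof (cases "j + 1 < n + m")
  case True
  then show ?thesis by (simp add: delta_def low_def)
next
  case False
  then have low: "low j i l - i l = (if l = j then - 1 else 0)" for l by (simp add: low_def)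
  show ?thesis unfolding delta_def low using False assms by (simp add: sum.delta)
qed

text \<open>
  By \<open>EE_intertwines\<close> the diagonal of \<open>TT (aE j p)\<close>, weighted with \<open>Qw\<close>, is \<open>g i - g (low j i)\<close>:
  the weight \<open>Qw\<close> compensates exactly the factor with which \<open>aK j\<close> acts.
\<close>

lemma tr_aE: assumes p: "p \<in> wspace 0 True" and j: "1 \<le> j" "j < n + m" shows "tr (aE j p) = 0"
proof -
  have pG: "p \<in> carr G" using p by (simp add: wspace_def)
  define g where "g i = of_real (Qw i) * (ea j (up j i) * lookup (TT p (e i)) (up j i))" for i
  define d where "d i = of_real (Qw i) * lookup (TT (aE j p) (e i)) i" for i
  let ?I = "idx n m" and ?S = "{i \<in> idx n m. low j i \<in> idx n m}"
  have diag: "d i = g i - (if i \<in> ?S then g (low j i) else 0)" if i: "i \<in> ?I" for i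
  proof -
    have "TT (aK j p) (EE j (e i)) = scl (ea j i) (TT (aK j p) (e (low j i)))"
      unfolding EE_single by (rule trans [OF T_free_single]) simp
    then have look: "lookup (TT (aE j p) (e i)) i =
        ea j (up j i) * lookup (TT p (e i)) (up j i)
        - ea j i * lookup (TT (aK j p) (e (low j i))) i"
      using EE_intertwines [OF j pG supp_single [OF i, of 1]] by (simp add: lookup_minus lookup_EE)
    have "of_real (Qw i) * (ea j i * lookup (TT (aK j p) (e (low j i))) i) =
        (if i \<in> ?S then g (low j i) else 0)"
    proof (cases "low j i \<in> ?I")
      case True
      have "complex_of_real (Qw (low j i)) = of_real (Qw i) * qi (- 2)"
        unfolding Qw_low [OF j] qi_def by simp
      then show ?thesis
        using True i by (simp add: g_def TT_aK(1) [OF p True j] delta_low [OF j] mult_ac)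
    next
      case False
      then show ?thesis using low_idx [OF j i] by auto
    qed
    then show ?thesis unfolding d_def look g_def by (simp only: right_diff_distrib)
  qed
  \<comment> \<open>Telescoping needs \<open>g\<close> by itself to be summable: \<open>Qw\<close>
    supplies two decaying factors, of which \<open>ea\<close> consumes one.\<close>
  have "g abs_summable_on ?I"
  proof -
    obtain B L where B: "0 \<le> B" "\<And>i k. i \<in> ?I \<Longrightarrow> norm (lookup (TT p (e i)) k) \<le> B"
      "\<And>i. i \<in> ?I \<Longrightarrow> TT p (e i) \<noteq> 0 \<Longrightarrow> in_box L i"
      using wspace_bound [OF p] by metis
    let ?K = "\<kappa> * q powi (- (2 * (int (n + m) * int n * int L)))"
      and ?s = "q powi (- int L) * q powi (- int (L + 1))"
    have nonneg: "0 \<le> ?K" "0 \<le> ?s" using \<kappa>_pos q_pos by simp_all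
    show ?thesis
    proof (rule box_summable)
      show "0 \<le> ?K * norm C * ?s * B * q powi (- 1)" using nonneg q_pos B(1) \<kappa>_pos by (intro mult_nonneg_nonneg) simp_all
    next
      fix i assume i: "i \<in> ?I" "g i \<noteq> 0"
      then show box: "in_box L i" using B(3) [of i] by (cases "TT p (e i) = 0") (auto simp: g_def)
      have "norm (g i) = Qw i * (norm (ea j (up j i)) * norm (lookup (TT p (e i)) (up j i)))"
        using Qw_pos [of i] by (simp add: g_def norm_mult)
      also have "\<dots> \<le> ?K * (q powi wsum i * q powi wsum i) * ((norm C * (q powi (- (wsum i + 1)) * ?s)) * B)"
        using nonneg q_pos B(1) \<kappa>_pos
        by (intro mult_mono Qw_le norm_ea_up B(2) i(1) box j mult_nonneg_nonneg) simp_all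
      also have "\<dots> = ?K * norm C * ?s * B * (q powi wsum i * q powi (- (wsum i + 1))) * q powi wsum i"
        by (simp only: mult_ac)
      also have "q powi wsum i * q powi (- (wsum i + 1)) = q powi (- 1)"
        using q_pos by (simp flip: power_int_add)
      finally show "norm (g i) \<le> ?K * norm C * ?s * B * q powi (- 1) * q powi wsum i" .
    qed
  qed
  then have sg: "g summable_on ?I" by (rule abs_summable_summable)
  have "aE j p \<in> wspace 0 True" using act1_wspace [of "Gen_E j"] p j by (simp add: ugens_def)
  then have sd: "d summable_on ?I" unfolding d_def by (rule abs_summable_summable [OF diag_summable])
  \<comment> \<open>The indices of \<open>?I\<close> missed by the shift along \<open>low j\<close>
    are those with \<open>up j k\<close> outside \<open>?I\<close>. Since \<open>g\<close> vanishes
    there, the reindexing loses nothing.\<close>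
  have g0: "g k = 0" if k: "k \<in> ?I" "up j k \<notin> ?I" for k
  proof -
    have "TT p (e k) \<in> supp" using pG k by (intro TT_supp) auto
    then have "lookup (TT p (e k)) (up j k) = 0" using k by (auto simp: supp_def in_keys_iff)
    then show ?thesis by (simp add: g_def)
  qed
  have "infsum (\<lambda>i. if i \<in> ?S then g (low j i) else 0) ?I = infsum (g \<circ> low j) ?S"
    by (rule infsum_cong_neutral) auto
  also have "\<dots> = infsum g (low j ` ?S)"
    by (rule infsum_reindex [symmetric]) (rule inj_on_inverseI [where g = "up j"], simp)
  also have "\<dots> = infsum g ?I"
  proof (rule infsum_cong_neutral)
    fix k assume k: "k \<in> ?I - low j ` ?S"
    have "up j k \<notin> ?I"
    proof
      assume "up j k \<in> ?I"
      then have "low j (up j k) \<in> low j ` ?S" using k by (intro imageI) simp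
      then show False using k by simp
    qed
    then show "g k = 0" using g0 k by simp
  qed auto
  finally have h: "infsum (\<lambda>i. if i \<in> ?S then g (low j i) else 0) ?I = infsum g ?I" .
  \<comment> \<open>\<open>g\<close> and its shifted copy have the same sum, so their difference
    \<open>d\<close> sums to 0.\<close>
  have "infsum g ?I = infsum (\<lambda>i. if i \<in> ?S then g (low j i) else 0) ?I" by (rule h [symmetric])
  also have "\<dots> = infsum (\<lambda>i. g i + (- 1) * d i) ?I" by (rule infsum_cong) (simp add: diag)
  also have "\<dots> = infsum g ?I + (- 1) * infsum d ?I"
    unfolding infsum_cmult_right' [symmetric] by (rule infsum_add [OF sg summable_on_cmult_right [OF sd]])
  finally show ?thesis by (simp add: tr_def d_def [symmetric])
qed

lemma tr_star: assumes "p \<in> carr G" shows "tr (free_star p) = cnj (tr p)"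
  unfolding tr_def infsum_cnj [symmetric]
  by (rule infsum_cong) (simp add: TT_adjoint [OF assms])

lemma tr_aF: assumes p: "p \<in> wspace 0 True" and j: "1 \<le> j" "j < n + m" shows "tr (aF j p) = 0"
proof -
  have "aE j (free_star p) \<in> carr G" using p j by (intro aE_carr free_star_carr) (auto simp: wspace_def)
  then show ?thesis
    by (simp only: aF_star [of j p] tr_scl tr_star tr_aE [OF wspace_star [OF p] j]) simp
qed

lemma tr_act1: assumes u: "u \<in> U" and p: "p \<in> wspace 0 True" shows "tr (act1 u p) = counit_letter u * tr p"
  using u by (cases rule: ugens_cases) (use p in \<open>auto simp: tr_aE tr_aF tr_aK\<close>)

lemma tr_AF: assumes a: "a \<in> carr U" and p: "p \<in> wspace 0 True"
  shows "AF a p \<in> wspace 0 True" and "tr (AF a p) = counit_free a * tr p"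
proof -
  have word: "AF (mon us) p \<in> wspace 0 True \<and> tr (AF (mon us) p) = counit_free (mon us) * tr p" if "set us \<subseteq> U" for us
    using that
  proof (induction us)
    case Nil
    then show ?case using p counit_free_mon [of "[]"] by simp
  next
    case (Cons u us)
    have "AF (mon (u # us)) p = act1 u (AF (mon us) p)" by (subst mon_Cons) (simp add: AF_mult)
    then show ?case using Cons by (simp add: act1_wspace tr_act1 counit_free_mon)
  qed
  then have word': "AF (mon us) p \<in> wspace 0 True \<and> tr (AF (mon us) p) = counit_free (mon us) * tr p"
    if "Word us \<in> keys a" for us
    using carr_keys [OF a that] by blast
  have "tr 0 = 0" using tr_scl [of 0 0] by simp
  then have "AF a p \<in> wspace 0 True \<and> tr (AF a p) = counit_free a * tr p"
    by (intro free_linear_induct [where p = a and P = "\<lambda>a. AF a p \<in> wspace 0 True \<and> tr (AF a p) = counit_free a * tr p"])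
      (use word' in \<open>auto simp: AF_linear counit_free_linear tr_scl tr_add wspace_add wspace_scl distrib_right\<close>)
  then show "AF a p \<in> wspace 0 True" "tr (AF a p) = counit_free a * tr p" by auto
qed

section \<open>Positivity of the trace\<close>

lemma tr_star_mult: assumes p: "p \<in> wspace 0 True" and nz: "\<not> p \<approx> 0"
  shows "\<exists>r>0. tr (free_star p * p) = complex_of_real r"
proof -
  have pG: "p \<in> carr G" using p by (simp add: wspace_def)
  \<comment> \<open>The squared norm of \<open>TT p (e i)\<close>, which adjointness turns into the
    diagonal element of \<open>free_star p * p\<close>.\<close>
  define s where "s i = (\<Sum>k\<in>keys (TT p (e i)). (norm (lookup (TT p (e i)) k))\<^sup>2)" for i
  have look: "lookup (TT (free_star p * p) (e i)) i = of_real (s i)" if i: "i \<in> idx n m" for i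
  proof -
    have keys: "keys (TT p (e i)) \<subseteq> idx n m"
      using TT_supp [OF pG, of "e i"] i by (simp add: supp_def)
    have "lookup (TT (free_star p * p) (e i)) i =
       (\<Sum>k\<in>keys (TT p (e i)). lookup (TT p (e i)) k * lookup (TT (free_star p) (e k)) i)"
      unfolding T_free_mult by (rule lookup_lin [OF T_free_lin_vec subset_refl finite_keys])
    also have "\<dots> = (\<Sum>k\<in>keys (TT p (e i)). of_real ((norm (lookup (TT p (e i)) k))\<^sup>2))"
    proof (rule sum.cong [OF refl])
      fix k assume "k \<in> keys (TT p (e i))"
      then have "lookup (TT (free_star p) (e k)) i = cnj (lookup (TT p (e i)) k)"
        using TT_adjoint [OF pG i, of k] keys by auto
      then show "lookup (TT p (e i)) k * lookup (TT (free_star p) (e k)) i =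
          of_real ((norm (lookup (TT p (e i)) k))\<^sup>2)"
        by (simp only: complex_norm_square)
    qed
    finally show ?thesis by (simp add: s_def)
  qed
  have s0: "0 \<le> s i" for i by (simp add: s_def sum_nonneg)
  have "free_star p * p \<in> wspace 0 True" using wspace_mult [OF wspace_star [OF p] p] by simp
  from diag_summable [OF this]
  have "(\<lambda>i. norm (complex_of_real (Qw i) * of_real (s i))) summable_on idx n m"
    by (rule summable_on_cong [THEN iffD1, rotated]) (simp only: look)
  then have sum: "(\<lambda>i. Qw i * s i) summable_on idx n m"
    using s0 Qw_pos by (simp add: norm_mult abs_of_pos)
  obtain i where i: "i \<in> idx n m" "TT p (e i) \<noteq> 0" using wspace_faithful [OF p] nz by blast
  have "0 < s i"
    unfolding s_def using i(2) by (intro sum_pos) (auto simp: in_keys_iff)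
  then have "0 < (\<Sum>i\<in>{i}. Qw i * s i)" using Qw_pos by simp
  also have "\<dots> \<le> infsum (\<lambda>i. Qw i * s i) (idx n m)"
    using i s0 Qw_pos [THEN less_imp_le] by (intro finite_sum_le_infsum sum mult_nonneg_nonneg) auto
  finally have pos: "0 < infsum (\<lambda>i. Qw i * s i) (idx n m)" .
  have "tr (free_star p * p) = infsum (\<lambda>i. complex_of_real (Qw i * s i)) (idx n m)"
    unfolding tr_def by (rule infsum_cong) (simp only: look of_real_mult)
  also have "\<dots> = of_real (infsum (\<lambda>i. Qw i * s i) (idx n m))"
    by (rule infsumI, rule has_sum_of_real, rule has_sum_infsum, rule sum)
  finally show ?thesis using pos by blast
qed

end

theorem theorem5p1:
  fixes q \<kappa> :: real and n m :: nat
  assumes "0 < q" and "q < 1" and "1 \<le> n" and "2 \<le> m" and "0 < \<kappa>"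
  shows
    "(\<forall>f\<in>D_H q n m. trace_converges n m (T q n m f \<circ> Q q n m \<kappa>)) \<and>
     (\<forall>f\<in>D_H q n m. \<forall>g\<in>D_H q n m.
        nu q n m \<kappa> (f \<oplus>\<^bsub>Fun_tilde q n m\<^esub> g) = nu q n m \<kappa> f + nu q n m \<kappa> g) \<and>
     (\<forall>f\<in>D_H q n m. \<forall>z.
        nu q n m \<kappa> (fun_scale q n m z f) = z * nu q n m \<kappa> f) \<and>
     (\<forall>f\<in>D_H q n m. f \<noteq> \<zero>\<^bsub>Fun_tilde q n m\<^esub> \<longrightarrow>
        nu q n m \<kappa> (fun_star f \<otimes>\<^bsub>Fun_tilde q n m\<^esub> f) \<in> \<real> \<and>
        0 < Re (nu q n m \<kappa> (fun_star f \<otimes>\<^bsub>Fun_tilde q n m\<^esub> f))) \<and>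
     (\<forall>a\<in>carrier (Uq q (n + m)). \<forall>f\<in>D_H q n m.
        nu q n m \<kappa> (act q n m a f) = counit a * nu q n m \<kappa> f)"
proof -
  interpret hyperboloid_trace q n m \<kappa>
    by unfold_locales (use assms in auto)
  have carr: "p \<in> carr G" if "p \<in> wspace 0 True" for p using that by (simp add: wspace_def)
  have conv: "trace_converges n m (T q n m f \<circ> Q q n m \<kappa>)" if "f \<in> D_H q n m" for f
    using D_H_representative [OF that] trace_converges_cls by blast
  have add: "nu q n m \<kappa> (f \<oplus>\<^bsub>Fun_tilde q n m\<^esub> g) = nu q n m \<kappa> f + nu q n m \<kappa> g"
    if fg: "f \<in> D_H q n m" "g \<in> D_H q n m" for f g
  proof -
    obtain x y where "x \<in> wspace 0 True" "f = cls x" "y \<in> wspace 0 True" "g = cls y"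
      using fg D_H_representative by metis
    then show ?thesis by (simp add: cls_add nu_cls carr carr_add tr_add)
  qed
  have scale: "nu q n m \<kappa> (fun_scale q n m z f) = z * nu q n m \<kappa> f" if f: "f \<in> D_H q n m" for f z
  proof -
    obtain x where "x \<in> wspace 0 True" "f = cls x" using f D_H_representative by metis
    then show ?thesis by (simp add: cls_scale nu_cls carr carr_scl tr_scl)
  qed
  have pos: "nu q n m \<kappa> (fun_star f \<otimes>\<^bsub>Fun_tilde q n m\<^esub> f) \<in> \<real> \<and>
      0 < Re (nu q n m \<kappa> (fun_star f \<otimes>\<^bsub>Fun_tilde q n m\<^esub> f))"
    if f: "f \<in> D_H q n m" "f \<noteq> \<zero>\<^bsub>Fun_tilde q n m\<^esub>" for f
  proof -
    obtain x where x: "x \<in> wspace 0 True" "f = cls x" using f(1) D_H_representative by metis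
    then have "\<not> x \<approx> 0" using f(2) carr by (simp add: cls_zero cls_eq_iff)
    then obtain r where "0 < r" "tr (free_star x * x) = complex_of_real r"
      using tr_star_mult [OF x(1)] by blast
    then show ?thesis
      using x carr by (simp add: cls_star cls_mult nu_cls free_star_carr carr_mult)
  qed
  have inv: "nu q n m \<kappa> (act q n m a f) = counit a * nu q n m \<kappa> f"
    if a: "a \<in> carrier (Uq q (n + m))" and f: "f \<in> D_H q n m" for a f
  proof -
    obtain x where x: "x \<in> wspace 0 True" "f = cls x" using f D_H_representative by metis
    obtain b where b: "b \<in> carr U" "a = genideal (free_algebra U) (uq_rels q (n + m)) +>\<^bsub>free_algebra U\<^esub> b"
      using a by (auto simp: Uq_def FactRing_def A_RCOSETS_def' carrier_free_algebra)
    have "act q n m a f = cls (AF b x)" "counit a = counit_free b"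
      using act_class [OF b(1) carr [OF x(1)]] by (simp_all add: b(2) x(2))
    then show ?thesis
      using tr_AF [OF b(1) x(1)] x by (simp add: nu_cls carr)
  qed
  show ?thesis using conv add scale pos inv by blast
qed

end
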